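(* Assume that for every $t=0,1,\dots,T-1$ and every admissible attention allocation $\bm\lambda_t$ the conditional covariance matrix $\bm\Sigma_{\bm b,t+}(\bm\lambda_t)$ of $\bm b_{t+1}$ given $\mathcal F_{t+}$ is positive definite, and that $E_{(T-1)+}[\bm b_T]\ne\bm 0$. Define functions $h_t(\Lambda_t,\bm f_t)$ backward in time by $h_T(\Lambda_T,\bm f_T)=1$ and, for $t=T-1,\dots,0$, let $h_t(\Lambda_t,\bm f_t)$ be the optimal objective value of the optimization problem $$\min_{\bm\lambda_t\ge\bm 0,\ \bm\lambda_t^\prime\bm 1\le\Lambda_t} a_{t+1}^2\,E_t\Big[E_{t+}[h_{t+1}(\Lambda_{t+1},\bm f_{t+1})]-E_{t+}[h_{t+1}(\Lambda_{t+1},\bm f_{t+1})\bm b_{t+1}^\prime]\;E_{t+}[h_{t+1}(\Lambda_{t+1},\bm f_{t+1})\bm b_{t+1}\bm b_{t+1}^\prime]^{-1}\;E_{t+}[h_{t+1}(\Lambda_{t+1},\bm f_{t+1})\bm b_{t+1}]\Big],\qquad(\ast)$$ where $\Lambda_{t+1}=\Lambda_t-\bm\lambda_t^\prime\bm 1$ and the conditional expectations $E_{t+}$ are taken after the signal $\bm s_{t+}(\bm\lambda_t)$ has been observed. Then for the dynamic mean-variance problem $(MV)$ with limited attention allocation: (i) the optimal attention allocation policy $\bm\lambda_t^\star(\Lambda_t,\bm f_t)$ at period $t$ is the minimizer ($\arg\min$) of $(\ast)$; (ii) the optimal portfolio policy at period $t$ is $$\bm u_{t+}^\star(x_t,\Lambda_t,\bm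 f_t,\bm s_{t+}(\bm\lambda_t^\star))=-E_{t+}[h_{t+1}(\Lambda_{t+1},\bm f_{t+1})\bm b_{t+1}\bm b_{t+1}^\prime]^{-1}\,E_{t+}[h_{t+1}(\Lambda_{t+1},\bm f_{t+1})\bm b_{t+1}]\,a_{t+1}\,\big(x_t-\rho_t^{-1}(d-\mu^\star)\big),$$ where $\Lambda_{t+1}=\Lambda_t-(\bm\lambda_t^\star)^\prime\bm 1$, $E_{t+}$ is taken with the signal $\bm s_{t+}(\bm\lambda_t^\star)$, and the optimal multiplier is $$\mu^\star=\frac{h_0(\Lambda_0,\bm f_0)(\rho_0x_0-d)}{\rho_0^2-h_0(\Lambda_0,\bm f_0)};$$ (iii) the efficient frontier (the minimal variance of terminal wealth as a function of the expected terminal wealth $E_0[x_T]=d$, as $d$ varies) is $$\mathrm{Var}_0(x_T)=\frac{h_0(\Lambda_0,\bm f_0)\,(E_0[x_T]-\rho_0x_0)^2}{\rho_0^2-h_0(\Lambda_0,\bm f_0)},\qquad E_0[x_T]\ge\rho_0x_0.$$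
   Context: Problem $(MV)$: given $x_0\in\mathbb R$, $\Lambda_0\ge 0$ and a target $d\ge\rho_0x_0$, $$\min_{\{\bm\lambda_t,\bm u_{t+}\}_{t=0}^{T-1}}\mathrm{Var}_0(x_T)\quad\text{subject to}\quad E_0[x_T]=d$$ and, for $t=0,\dots,T-1$: $x_{t+1}=a_{t+1}x_t+\bm b_{t+1}^\prime\bm u_{t+}$, $\bm u_{t+}\in\mathbb R^n$; $\bm b_{t+1}=\bm c+\bm D\bm f_{t+1}+\bm\epsilon_{t+1}$; $\bm f_{t+1}=(\bm I-\bm\varPhi)\bm f_t+\bm\eta_{t+1}$; $\Lambda_{t+1}=\Lambda_t-\bm\lambda_t^\prime\bm 1$; $\bm s_{t+}(\bm\lambda_t)=\bm f_{t+1}+\bm v_{t+1}(\bm\lambda_t)$; $\bm\lambda_t\in\mathbb R_+^k$, $\bm\lambda_t^\prime\bm 1\le\Lambda_t$. Here $\mathrm{Var}_0$ is the variance conditional on $\mathcal F_0$, $x_t$ is scalar wealth, $a_{t+1}>1$ is the deterministic total return of the risk-free investment at period $t$, and $\rho_t=\prod_{s=t}^{T-1}a_{s+1}$ (so $\rho_T=1$). Multiplier. A Lagrange multiplier $2\mu$ is attached to the constraint $E_0[x_T]=d$. With $y_t=x_t-(d-\mu)\rho_t^{-1}$ this yields the auxiliary problem of minimizing $E_0[y_T^2]-\mu^2$ under the same dynamics and constraints (with $y_t$ in place of $x_t$). The optimal multiplier $\mu^\star$ is the maximizer over $\mu\in\mathbb R$ of the optimal value of this auxiliary problem. Data. $^\prime$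 is transpose; $\bm 1$ and $\bm 0$ are the all-ones and zero vectors; $\bm I$ is the identity matrix. $\bm c\in\mathbb R^n$, the $n\times k$ matrix $\bm D$ ($k<n$), and the $k\times k$ mean-reverting matrix $\bm\varPhi$ are deterministic. $\bm\epsilon_{t+1}\sim N(\bm 0,\bm\Sigma_{\bm\epsilon})$ in $\mathbb R^n$ and $\bm\eta_{t+1}\sim N(\bm 0,\bm\Sigma_{\bm\eta})$ in $\mathbb R^k$, where $\bm\Sigma_{\bm\eta}$ has diagonal entries $\sigma_{\eta_1}^2,\dots,\sigma_{\eta_k}^2$. $\bm v_{t+1}(\bm\lambda_t)$ is Gaussian white noise in $\mathbb R^k$ with mean zero and diagonal covariance $$\bm\Sigma_{\bm v}(\bm\lambda_t)=\mathrm{diag}\Big(\frac{\sigma_{\eta_1}^2}{e^{\lambda_{1,t}\theta_1}-1},\dots,\frac{\sigma_{\eta_k}^2}{e^{\lambda_{k,t}\theta_k}-1}\Big),$$ with deterministic efficiency parameters $\theta_j>0$; if $\lambda_{j,t}=0$ the $j$-th variance is infinite, meaning that the $j$-th signal component carries no information. The noises $\bm\epsilon_t,\bm\eta_t,\bm v_t$ are mutually independent, independent over time and independent of $\bm f_0$. Information. $\mathcal F_t=\sigma(\bm f_0,\bm\epsilon_1,\dots,\bm\epsilon_t,\bm\eta_1,\dots,\bm\eta_t,\bm s_{0+}(\bm\lambda_0),\dots,\bm s_{(t-1)+}(\bm\lambda_{t-1}))$ and $\mathcal F_{t+}=\sigma(\mathcal F_t,\bm s_{t+}(\bm\lambda_t))$.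 $E_t[\cdot]=E[\cdot|\mathcal F_t]$ and $E_{t+}[\cdot]=E[\cdot|\mathcal F_{t+}]$. At time $t$ the decision maker chooses $\bm\lambda_t$ based on $\mathcal F_t$, then observes the signal $\bm s_{t+}(\bm\lambda_t)$, and then chooses $\bm u_{t+}$ based on $\mathcal F_{t+}$. Conditional laws. Given $\mathcal F_t$, $\bm f_{t+1}\sim N((\bm I-\bm\varPhi)\bm f_t,\bm\Sigma_{\bm\eta})$. Given $\mathcal F_{t+}$, $\bm f_{t+1}$ and $\bm b_{t+1}$ are Gaussian: with $\bm K=\bm\Sigma_{\bm\eta}(\bm\Sigma_{\bm\eta}+\bm\Sigma_{\bm v}(\bm\lambda_t))^{-1}$, $\bm f_{t+1}$ has mean $(\bm I-\bm\varPhi)\bm f_t+\bm K(\bm s_{t+}(\bm\lambda_t)-(\bm I-\bm\varPhi)\bm f_t)$ and covariance $\bm\Sigma_{\bm\eta}-\bm K\bm\Sigma_{\bm\eta}$, while $\bm b_{t+1}$ has mean $\bm c+\bm D(\bm I-\bm\varPhi)\bm f_t+\bm D\bm K(\bm s_{t+}(\bm\lambda_t)-(\bm I-\bm\varPhi)\bm f_t)$ and covariance $\bm\Sigma_{\bm b,t+}(\bm\lambda_t)=\bm D[\bm\Sigma_{\bm\eta}-\bm K\bm\Sigma_{\bm\eta}]\bm D^\prime+\bm\Sigma_{\bm\epsilon}$. *)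

theory Defs
  imports "HOL-Probability.Probability"
begin

section \<open>Gaussian vectors and conditional moments\<close>

definition std_normal_vec :: "(real ^ 'm::finite) measure" where
  "std_normal_vec = density lborel (\<lambda>z. ennreal (\<Prod>i\<in>UNIV. std_normal_density (z $ i)))"

text \<open>Law of \<open>m + A Z\<close> with \<open>A A\<^sup>T = S\<close>: this makes \<open>S\<close> symmetric positive semidefinite
  and allows it to be singular.\<close>

definition gaussian_vec ::
  "'w measure \<Rightarrow> ('w \<Rightarrow> real ^ 'm::finite) \<Rightarrow> real ^ 'm \<Rightarrow> real ^ 'm ^ 'm \<Rightarrow> bool" where
  "gaussian_vec M X m S \<longleftrightarrow> X \<in> borel_measurable M \<and>
     (\<exists>A :: real ^ 'm ^ 'm. A ** transpose A = S \<and>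
        distr M borel X = distr std_normal_vec borel (\<lambda>z. m + A *v z))"

definition pos_def_matrix :: "real ^ 'm ^ 'm::finite \<Rightarrow> bool" where
  "pos_def_matrix A \<longleftrightarrow> transpose A = A \<and> (\<forall>z. z \<noteq> 0 \<longrightarrow> 0 < z \<bullet> (A *v z))"

definition events_of :: "'w measure \<Rightarrow> ('w \<Rightarrow> 'b::topological_space) \<Rightarrow> 'w set set" where
  "events_of M X = {X -` A \<inter> space M | A. A \<in> sets borel}"

definition cond_vec ::
  "'w measure \<Rightarrow> 'w measure \<Rightarrow> ('w \<Rightarrow> real ^ 'm::finite) \<Rightarrow> 'w \<Rightarrow> real ^ 'm" where
  "cond_vec M G Y \<omega> = (\<chi> i. real_cond_exp M G (\<lambda>\<omega>'. Y \<omega>' $ i) \<omega>)"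

definition cond_mat ::
  "'w measure \<Rightarrow> 'w measure \<Rightarrow> ('w \<Rightarrow> real ^ 'm ^ 'm::finite) \<Rightarrow> 'w \<Rightarrow> real ^ 'm ^ 'm" where
  "cond_mat M G Y \<omega> = (\<chi> i j. real_cond_exp M G (\<lambda>\<omega>'. Y \<omega>' $ i $ j) \<omega>)"

definition outer :: "real ^ 'm::finite \<Rightarrow> real ^ 'm ^ 'm" where
  "outer z = (\<chi> i j. z $ i * z $ j)"

definition cond_cov ::
  "'w measure \<Rightarrow> 'w measure \<Rightarrow> ('w \<Rightarrow> real ^ 'm::finite) \<Rightarrow> 'w \<Rightarrow> real ^ 'm ^ 'm" where
  "cond_cov M G Y = cond_mat M G (\<lambda>\<omega>. outer (Y \<omega> - cond_vec M G Y \<omega>))"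


section \<open>The market\<close>

text \<open>Time-indexed data follow the dynamics: \<open>ret P t\<close>, \<open>eps P t\<close>, \<open>eta P t\<close> and
  \<open>vnoise P t\<close> are \<open>a\<^sub>t\<close>, \<open>\<epsilon>\<^sub>t\<close>, \<open>\<eta>\<^sub>t\<close> and the field \<open>l \<mapsto> v\<^sub>t(l)\<close>, for \<open>t = 1, \<dots>, T\<close>.\<close>

record ('w, 'n, 'k) market =
  pspace :: "'w measure"
  horizon :: nat
  ret :: "nat \<Rightarrow> real"
  cvec :: "real ^ 'n::finite"
  Dmat :: "real ^ 'k::finite ^ 'n::finite"
  Phi :: "real ^ 'k::finite ^ 'k"
  Sigma_eps :: "real ^ 'n::finite ^ 'n"
  Sigma_eta :: "real ^ 'k::finite ^ 'k"
  theta :: "real ^ 'k::finite"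
  f0 :: "'w \<Rightarrow> real ^ 'k::finite"
  eps :: "nat \<Rightarrow> 'w \<Rightarrow> real ^ 'n::finite"
  eta :: "nat \<Rightarrow> 'w \<Rightarrow> real ^ 'k::finite"
  vnoise :: "nat \<Rightarrow> real ^ 'k::finite \<Rightarrow> 'w \<Rightarrow> real ^ 'k"
  x0 :: real
  Lambda0 :: real

text \<open>A component with \<open>l\<^sub>j = 0\<close> has infinite variance and carries no information. It is masked
  out: the observed value is the constant \<open>0\<close>, and nothing is assumed about
  \<open>vnoise P t l \<omega> $ j\<close>. The division \<open>\<sigma>\<^sub>j\<^sup>2 / 0 = 0\<close> in \<open>Sigma_v\<close> is then the variance of the
  masked component.\<close>

definition masked_noise ::
  "('w, 'n::finite, 'k::finite) market \<Rightarrow> nat \<Rightarrow> real ^ 'k \<Rightarrow> 'w \<Rightarrow> real ^ 'k" where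
  "masked_noise P t l \<omega> = (\<chi> j. if l $ j = 0 then 0 else vnoise P t l \<omega> $ j)"

definition Sigma_v ::
  "('w, 'n::finite, 'k::finite) market \<Rightarrow> real ^ 'k \<Rightarrow> real ^ 'k ^ 'k" where
  "Sigma_v P l =
     (\<chi> i j. if i = j then Sigma_eta P $ j $ j / (exp (l $ j * theta P $ j) - 1) else 0)"

definition nonneg_vecs :: "(real ^ 'k::finite) set" where
  "nonneg_vecs = {l. \<forall>j. 0 \<le> l $ j}"

definition noise_field_algebra ::
  "('w, 'n::finite, 'k::finite) market \<Rightarrow> nat \<Rightarrow> 'w measure" where
  "noise_field_algebra P t =
     sigma (space (pspace P)) (\<Union>l\<in>nonneg_vecs. events_of (pspace P) (masked_noise P t l))"

datatype noise_source = Initial | Eps nat | Eta nat | Vfield nat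

primrec source_events ::
  "('w, 'n::finite, 'k::finite) market \<Rightarrow> noise_source \<Rightarrow> 'w set set" where
  "source_events P Initial = events_of (pspace P) (f0 P)"
| "source_events P (Eps t) = events_of (pspace P) (eps P t)"
| "source_events P (Eta t) = events_of (pspace P) (eta P t)"
| "source_events P (Vfield t) = sets (noise_field_algebra P t)"

text \<open>Since \<open>l\<close> is chosen at random in \<open>v\<^sub>t(l)\<close>, the field has to be jointly measurable, and it is
  the whole field that is independent of the other sources.\<close>

definition mv_market :: "('w, 'n::finite, 'k::finite) market \<Rightarrow> bool" where
  "mv_market P \<longleftrightarrow>
     prob_space (pspace P) \<and> CARD('k) < CARD('n) \<and>
     1 \<le> horizon P \<and> 0 \<le> Lambda0 P \<and>
     (\<forall>j. 0 < theta P $ j) \<and>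
     (\<forall>t\<in>{1..horizon P}. 1 < ret P t) \<and>
     f0 P \<in> borel_measurable (pspace P) \<and>
     (\<forall>t\<in>{1..horizon P}.
        gaussian_vec (pspace P) (eps P t) 0 (Sigma_eps P) \<and>
        gaussian_vec (pspace P) (eta P t) 0 (Sigma_eta P) \<and>
        (\<forall>l\<in>nonneg_vecs. gaussian_vec (pspace P) (masked_noise P t l) 0 (Sigma_v P l)) \<and>
        (\<lambda>(l, \<omega>). masked_noise P t l \<omega>)
          \<in> borel_measurable (restrict_space borel nonneg_vecs \<Otimes>\<^sub>M noise_field_algebra P t)) \<and>
     prob_space.indep_sets (pspace P) (source_events P)
       ({Initial} \<union> Eps ` {1..horizon P} \<union> Eta ` {1..horizon P} \<union> Vfield ` {1..horizon P})"

definition rho :: "('w, 'n::finite, 'k::finite) market \<Rightarrow> nat \<Rightarrow> real" where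
  "rho P t = (\<Prod>s\<in>{t..<horizon P}. ret P (Suc s))"

definition next_factor ::
  "('w, 'n::finite, 'k::finite) market \<Rightarrow> nat \<Rightarrow> real ^ 'k \<Rightarrow> 'w \<Rightarrow> real ^ 'k" where
  "next_factor P t f \<omega> = (mat 1 - Phi P) *v f + eta P (Suc t) \<omega>"

definition payoff_at ::
  "('w, 'n::finite, 'k::finite) market \<Rightarrow> nat \<Rightarrow> real ^ 'k \<Rightarrow> 'w \<Rightarrow> real ^ 'n" where
  "payoff_at P t f \<omega> = cvec P + Dmat P *v f + eps P t \<omega>"

definition signal_at ::
  "('w, 'n::finite, 'k::finite) market \<Rightarrow> nat \<Rightarrow> real ^ 'k \<Rightarrow> real ^ 'k \<Rightarrow> 'w \<Rightarrow> real ^ 'k" where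
  "signal_at P t l f \<omega> =
     (\<chi> j. if l $ j = 0 then 0 else f $ j + masked_noise P t l \<omega> $ j)"

primrec factor ::
  "('w, 'n::finite, 'k::finite) market \<Rightarrow> nat \<Rightarrow> 'w \<Rightarrow> real ^ 'k" where
  "factor P 0 \<omega> = f0 P \<omega>"
| "factor P (Suc t) \<omega> = next_factor P t (factor P t \<omega>) \<omega>"

definition payoff ::
  "('w, 'n::finite, 'k::finite) market \<Rightarrow> nat \<Rightarrow> 'w \<Rightarrow> real ^ 'n" where
  "payoff P t \<omega> = payoff_at P t (factor P t \<omega>) \<omega>"


section \<open>Policies, information and the mean-variance problem\<close>

text \<open>\<open>lam t\<close> and \<open>u t\<close> are the random vectors \<open>\<lambda>\<^sub>t\<close> and \<open>u\<^sub>t\<^sub>+\<close>. The information generated up to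
  time \<open>t\<close> depends on the attention paid before \<open>t\<close>.\<close>

type_synonym ('w, 'm) process = "nat \<Rightarrow> 'w \<Rightarrow> real ^ 'm"

definition signal ::
  "('w, 'n::finite, 'k::finite) market \<Rightarrow> ('w, 'k) process \<Rightarrow> nat \<Rightarrow> 'w \<Rightarrow> real ^ 'k" where
  "signal P lam t \<omega> = signal_at P (Suc t) (lam t \<omega>) (factor P (Suc t) \<omega>) \<omega>"

definition info_events ::
  "('w, 'n::finite, 'k::finite) market \<Rightarrow> ('w, 'k) process \<Rightarrow> nat \<Rightarrow> 'w set set" where
  "info_events P lam t =
     events_of (pspace P) (f0 P) \<union>
     (\<Union>s\<in>{1..t}. events_of (pspace P) (eps P s) \<union> events_of (pspace P) (eta P s)) \<union>
     (\<Union>s\<in>{..<t}. events_of (pspace P) (signal P lam s))"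

definition info ::
  "('w, 'n::finite, 'k::finite) market \<Rightarrow> ('w, 'k) process \<Rightarrow> nat \<Rightarrow> 'w measure" where
  "info P lam t = sigma (space (pspace P)) (info_events P lam t)"

definition info_plus ::
  "('w, 'n::finite, 'k::finite) market \<Rightarrow> ('w, 'k) process \<Rightarrow> nat \<Rightarrow> 'w measure" where
  "info_plus P lam t =
     sigma (space (pspace P)) (info_events P lam t \<union> events_of (pspace P) (signal P lam t))"

definition info0 :: "('w, 'n::finite, 'k::finite) market \<Rightarrow> 'w measure" where
  "info0 P = sigma (space (pspace P)) (events_of (pspace P) (f0 P))"

lemma info_0: "info P lam 0 = info0 P"
  by (simp add: info_def info0_def info_events_def)

primrec budget ::
  "('w, 'n::finite, 'k::finite) market \<Rightarrow> ('w, 'k) process \<Rightarrow> nat \<Rightarrow> 'w \<Rightarrow> real" where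
  "budget P lam 0 \<omega> = Lambda0 P"
| "budget P lam (Suc t) \<omega> = budget P lam t \<omega> - (\<Sum>j\<in>UNIV. lam t \<omega> $ j)"

primrec wealth ::
  "('w, 'n::finite, 'k::finite) market \<Rightarrow> ('w, 'n) process \<Rightarrow> nat \<Rightarrow> 'w \<Rightarrow> real" where
  "wealth P u 0 \<omega> = x0 P"
| "wealth P u (Suc t) \<omega> = ret P (Suc t) * wealth P u t \<omega> + payoff P (Suc t) \<omega> \<bullet> u t \<omega>"

definition attn_set :: "real \<Rightarrow> (real ^ 'k::finite) set" where
  "attn_set L = {l \<in> nonneg_vecs. (\<Sum>j\<in>UNIV. l $ j) \<le> L}"

definition admissible_attention ::
  "('w, 'n::finite, 'k::finite) market \<Rightarrow> ('w, 'k) process \<Rightarrow> bool" where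
  "admissible_attention P lam \<longleftrightarrow>
     (\<forall>t<horizon P. lam t \<in> borel_measurable (info P lam t) \<and>
        (\<forall>\<omega>\<in>space (pspace P). lam t \<omega> \<in> attn_set (budget P lam t \<omega>)))"

text \<open>The moments in the problem are conditional on the factor at time 0, whose law is arbitrary.
  Accordingly, terminal wealth needs a finite second moment conditionally on that information
  only, not unconditionally.\<close>

definition admissible ::
  "('w, 'n::finite, 'k::finite) market \<Rightarrow> (('w, 'k) process \<times> ('w, 'n) process) set" where
  "admissible P = {(lam, u). admissible_attention P lam \<and>
     (\<forall>t<horizon P. u t \<in> borel_measurable (info_plus P lam t)) \<and>
     (AE \<omega> in pspace P.
        nn_cond_exp (pspace P) (info0 P) (\<lambda>\<omega>'. ennreal ((wealth P u (horizon P) \<omega>')\<^sup>2)) \<omega> < \<infinity>)}"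

definition E0 ::
  "('w, 'n::finite, 'k::finite) market \<Rightarrow> ('w \<Rightarrow> real) \<Rightarrow> 'w \<Rightarrow> real" where
  "E0 P = real_cond_exp (pspace P) (info0 P)"

definition Var0 ::
  "('w, 'n::finite, 'k::finite) market \<Rightarrow> ('w \<Rightarrow> real) \<Rightarrow> 'w \<Rightarrow> real" where
  "Var0 P X = E0 P (\<lambda>\<omega>. (X \<omega> - E0 P X \<omega>)\<^sup>2)"

definition mv_feasible ::
  "('w, 'n::finite, 'k::finite) market \<Rightarrow> real \<Rightarrow> (('w, 'k) process \<times> ('w, 'n) process) set" where
  "mv_feasible P d = {(lam, u) \<in> admissible P.
     AE \<omega> in pspace P. E0 P (wealth P u (horizon P)) \<omega> = d}"

text \<open>An objective conditional on the initial information is itself a random variable; \<open>V\<close> is its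
  minimum over \<open>S\<close>, up to null sets.\<close>

definition is_cond_min ::
  "('w, 'n::finite, 'k::finite) market \<Rightarrow> 'p set \<Rightarrow> ('p \<Rightarrow> 'w \<Rightarrow> real) \<Rightarrow> ('w \<Rightarrow> real) \<Rightarrow> bool" where
  "is_cond_min P S cost V \<longleftrightarrow> V \<in> borel_measurable (info0 P) \<and>
     (\<exists>p\<in>S. AE \<omega> in pspace P. cost p \<omega> = V \<omega>) \<and>
     (\<forall>p\<in>S. AE \<omega> in pspace P. V \<omega> \<le> cost p \<omega>)"

definition mv_cost ::
  "('w, 'n::finite, 'k::finite) market \<Rightarrow> ('w, 'k) process \<times> ('w, 'n) process \<Rightarrow> 'w \<Rightarrow> real" where
  "mv_cost P p = Var0 P (wealth P (snd p) (horizon P))"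

definition mv_optimal ::
  "('w, 'n::finite, 'k::finite) market \<Rightarrow> real \<Rightarrow> ('w, 'k) process \<times> ('w, 'n) process \<Rightarrow> bool" where
  "mv_optimal P d p \<longleftrightarrow> p \<in> mv_feasible P d \<and>
     (\<forall>q\<in>mv_feasible P d. AE \<omega> in pspace P. mv_cost P p \<omega> \<le> mv_cost P q \<omega>)"

text \<open>The multiplier is chosen knowing the initial information, so \<open>\<mu>\<close> may depend on \<open>\<omega>\<close>.\<close>

definition shifted_wealth ::
  "('w, 'n::finite, 'k::finite) market \<Rightarrow> real \<Rightarrow> ('w \<Rightarrow> real) \<Rightarrow> ('w, 'n) process
     \<Rightarrow> nat \<Rightarrow> 'w \<Rightarrow> real" where
  "shifted_wealth P d \<mu> u t \<omega> = wealth P u t \<omega> - (d - \<mu> \<omega>) / rho P t"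

definition aux_cost ::
  "('w, 'n::finite, 'k::finite) market \<Rightarrow> real \<Rightarrow> ('w \<Rightarrow> real)
     \<Rightarrow> ('w, 'k) process \<times> ('w, 'n) process \<Rightarrow> 'w \<Rightarrow> real" where
  "aux_cost P d \<mu> p \<omega> =
     E0 P (\<lambda>\<omega>'. (shifted_wealth P d \<mu> (snd p) (horizon P) \<omega>')\<^sup>2) \<omega> - (\<mu> \<omega>)\<^sup>2"

text \<open>\<open>V m \<omega>\<close> is the optimal value of the auxiliary problem at multiplier \<open>m\<close>. Asking for this
  along every measurable \<open>\<mu>\<close>, constants included, fixes \<open>V\<close> up to one null set common to all \<open>m\<close>, so
  that maximizing over \<open>m\<close> for fixed \<open>\<omega>\<close> makes sense.\<close>

definition optimal_multiplier ::
  "('w, 'n::finite, 'k::finite) market \<Rightarrow> real \<Rightarrow> ('w \<Rightarrow> real) \<Rightarrow> bool" where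
  "optimal_multiplier P d \<mu>s \<longleftrightarrow> \<mu>s \<in> borel_measurable (info0 P) \<and>
     (\<exists>V :: real \<Rightarrow> 'w \<Rightarrow> real.
        (\<lambda>(m, \<omega>). V m \<omega>) \<in> borel_measurable (borel \<Otimes>\<^sub>M info0 P) \<and>
        (\<forall>\<mu>\<in>borel_measurable (info0 P).
           is_cond_min P (admissible P) (aux_cost P d \<mu>) (\<lambda>\<omega>. V (\<mu> \<omega>) \<omega>)) \<and>
        (AE \<omega> in pspace P. \<forall>m. m \<noteq> \<mu>s \<omega> \<longrightarrow> V m \<omega> < V (\<mu>s \<omega>) \<omega>))"


section \<open>The backward recursion\<close>

text \<open>One period started from the fixed state \<open>(L, f)\<close> at time \<open>t\<close> with attention \<open>l\<close>. The noises of
  period \<open>t + 1\<close> are independent of the information at time \<open>t\<close>, so conditioning on that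
  information amounts to freezing the state: \<open>E\<^sub>t\<close> becomes the expectation and \<open>E\<^sub>t\<^sub>+\<close> the conditional
  expectation given the signal alone. The argument \<open>g\<close> is the value function at \<open>t + 1\<close>.\<close>

definition step_info ::
  "('w, 'n::finite, 'k::finite) market \<Rightarrow> nat \<Rightarrow> real ^ 'k \<Rightarrow> real ^ 'k \<Rightarrow> 'w measure" where
  "step_info P t f l = sigma (space (pspace P))
     (events_of (pspace P) (\<lambda>\<omega>. signal_at P (Suc t) l (next_factor P t f \<omega>) \<omega>))"

definition step_weight ::
  "('w, 'n::finite, 'k::finite) market \<Rightarrow> nat \<Rightarrow> (real \<Rightarrow> real ^ 'k \<Rightarrow> real)
     \<Rightarrow> real \<Rightarrow> real ^ 'k \<Rightarrow> real ^ 'k \<Rightarrow> 'w \<Rightarrow> real" where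
  "step_weight P t g L f l \<omega> = g (L - (\<Sum>j\<in>UNIV. l $ j)) (next_factor P t f \<omega>)"

definition step_payoff ::
  "('w, 'n::finite, 'k::finite) market \<Rightarrow> nat \<Rightarrow> real ^ 'k \<Rightarrow> 'w \<Rightarrow> real ^ 'n" where
  "step_payoff P t f \<omega> = payoff_at P (Suc t) (next_factor P t f \<omega>) \<omega>"

definition step_vec ::
  "('w, 'n::finite, 'k::finite) market \<Rightarrow> nat \<Rightarrow> (real \<Rightarrow> real ^ 'k \<Rightarrow> real)
     \<Rightarrow> real \<Rightarrow> real ^ 'k \<Rightarrow> real ^ 'k \<Rightarrow> 'w \<Rightarrow> real ^ 'n" where
  "step_vec P t g L f l = cond_vec (pspace P) (step_info P t f l)
     (\<lambda>\<omega>. step_weight P t g L f l \<omega> *\<^sub>R step_payoff P t f \<omega>)"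

definition step_mat ::
  "('w, 'n::finite, 'k::finite) market \<Rightarrow> nat \<Rightarrow> (real \<Rightarrow> real ^ 'k \<Rightarrow> real)
     \<Rightarrow> real \<Rightarrow> real ^ 'k \<Rightarrow> real ^ 'k \<Rightarrow> 'w \<Rightarrow> real ^ 'n ^ 'n" where
  "step_mat P t g L f l = cond_mat (pspace P) (step_info P t f l)
     (\<lambda>\<omega>. step_weight P t g L f l \<omega> *\<^sub>R outer (step_payoff P t f \<omega>))"

definition step_objective ::
  "('w, 'n::finite, 'k::finite) market \<Rightarrow> nat \<Rightarrow> (real \<Rightarrow> real ^ 'k \<Rightarrow> real)
     \<Rightarrow> real \<Rightarrow> real ^ 'k \<Rightarrow> real ^ 'k \<Rightarrow> real" where
  "step_objective P t g L f l = (ret P (Suc t))\<^sup>2 *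
     (\<integral>\<omega>. real_cond_exp (pspace P) (step_info P t f l) (step_weight P t g L f l) \<omega>
         - step_vec P t g L f l \<omega> \<bullet>
             (matrix_inv (step_mat P t g L f l \<omega>) *v step_vec P t g L f l \<omega>) \<partial>pspace P)"

function h :: "('w, 'n::finite, 'k::finite) market \<Rightarrow> nat \<Rightarrow> real \<Rightarrow> real ^ 'k \<Rightarrow> real" where
  "h P t = (if t < horizon P
     then (\<lambda>L f. Inf (step_objective P t (h P (Suc t)) L f ` attn_set L))
     else (\<lambda>L f. 1))"
  by auto
termination
  by (relation "Wellfounded.measure (\<lambda>(P, t). horizon P - t)") auto

declare h.simps [simp del]

lemma h_terminal: "h P (horizon P) L f = 1"
  by (simp add: h.simps)

lemma h_backward:
  "t < horizon P \<Longrightarrow> h P t L f = Inf (step_objective P t (h P (Suc t)) L f ` attn_set L)"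
  by (simp add: h.simps)

definition attention_minimizer ::
  "('w, 'n::finite, 'k::finite) market \<Rightarrow> (nat \<Rightarrow> real \<Rightarrow> real ^ 'k \<Rightarrow> real ^ 'k) \<Rightarrow> bool" where
  "attention_minimizer P lstar \<longleftrightarrow>
     (\<forall>t<horizon P. (\<lambda>(L, f). lstar t L f) \<in> borel_measurable borel \<and>
        (\<forall>L\<in>{0..Lambda0 P}. \<forall>f.
           is_arg_min (step_objective P t (h P (Suc t)) L f) (\<lambda>l. l \<in> attn_set L) (lstar t L f)))"

definition mu_star ::
  "('w, 'n::finite, 'k::finite) market \<Rightarrow> real \<Rightarrow> 'w \<Rightarrow> real" where
  "mu_star P d \<omega> = h P 0 (Lambda0 P) (f0 P \<omega>) * (rho P 0 * x0 P - d)
     / ((rho P 0)\<^sup>2 - h P 0 (Lambda0 P) (f0 P \<omega>))"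

definition next_h ::
  "('w, 'n::finite, 'k::finite) market \<Rightarrow> ('w, 'k) process \<Rightarrow> nat \<Rightarrow> 'w \<Rightarrow> real" where
  "next_h P lam t \<omega> = h P (Suc t) (budget P lam (Suc t) \<omega>) (factor P (Suc t) \<omega>)"

definition weighted_vec ::
  "('w, 'n::finite, 'k::finite) market \<Rightarrow> ('w, 'k) process \<Rightarrow> nat \<Rightarrow> 'w \<Rightarrow> real ^ 'n" where
  "weighted_vec P lam t = cond_vec (pspace P) (info_plus P lam t)
     (\<lambda>\<omega>. next_h P lam t \<omega> *\<^sub>R payoff P (Suc t) \<omega>)"

definition weighted_mat ::
  "('w, 'n::finite, 'k::finite) market \<Rightarrow> ('w, 'k) process \<Rightarrow> nat \<Rightarrow> 'w \<Rightarrow> real ^ 'n ^ 'n" where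
  "weighted_mat P lam t = cond_mat (pspace P) (info_plus P lam t)
     (\<lambda>\<omega>. next_h P lam t \<omega> *\<^sub>R outer (payoff P (Suc t) \<omega>))"

definition follows_attention ::
  "('w, 'n::finite, 'k::finite) market \<Rightarrow> (nat \<Rightarrow> real \<Rightarrow> real ^ 'k \<Rightarrow> real ^ 'k)
     \<Rightarrow> ('w, 'k) process \<Rightarrow> bool" where
  "follows_attention P lstar lam \<longleftrightarrow>
     (\<forall>t<horizon P. \<forall>\<omega>\<in>space (pspace P).
        lam t \<omega> = lstar t (budget P lam t \<omega>) (factor P t \<omega>))"

definition follows_portfolio ::
  "('w, 'n::finite, 'k::finite) market \<Rightarrow> real \<Rightarrow> ('w, 'k) process \<Rightarrow> ('w, 'n) process \<Rightarrow> bool" where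
  "follows_portfolio P d lam u \<longleftrightarrow>
     (\<forall>t<horizon P. \<forall>\<omega>\<in>space (pspace P).
        u t \<omega> = - ((ret P (Suc t) * (wealth P u t \<omega> - (d - mu_star P d \<omega>) / rho P t)) *\<^sub>R
                    (matrix_inv (weighted_mat P lam t \<omega>) *v weighted_vec P lam t \<omega>)))"

end

theory Submission
  imports Defs
begin

text \<open>By Bayes' rule, the law of \<open>(\<eta>\<^sub>t\<^sub>+\<^sub>1, \<epsilon>\<^sub>t\<^sub>+\<^sub>1)\<close> given the signal is its prior law reweighted by a Gaussian
  likelihood. With \<open>y\<close> the shifted wealth, the cost \<open>h\<^sub>t\<^sub>+\<^sub>1 y\<^sub>t\<^sub>+\<^sub>1\<^sup>2\<close> conditional on the signal is a quadratic in the portfolio, and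
  minimizing it leaves \<open>y\<^sub>t\<^sup>2\<close> times the quantity averaged in the recursion for \<open>h\<^sub>t\<close>. After rescaling the
  signal by the square root of its precision, this average is continuous in the state and in the
  attention, including at zero attention; hence \<open>h\<^sub>t\<close> is continuous and positive and a measurable minimizer
  exists. Backward induction gives \<open>E\<^sub>0[y\<^sub>T\<^sup>2] \<ge> h\<^sub>0 y\<^sub>0\<^sup>2\<close> for every admissible policy, with equality for the
  candidate. Paying no attention and using the nonzero mean of the last payoff shows \<open>h\<^sub>0 < \<rho>\<^sub>0\<^sup>2\<close>, so that
  \<open>h\<^sub>0 y\<^sub>0\<^sup>2 - \<mu>\<^sup>2\<close> is a strictly concave quadratic in \<open>\<mu>\<close>. Its maximizer is \<open>\<mu>\<^sup>\<star>\<close> and its maximum the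
  frontier.\<close>


section \<open>Rotation invariance of the Gaussian law\<close>

text \<open>Two obstacles shape the argument. The initial factor has an arbitrary law, so neither
  payoffs nor wealth need be integrable. Comparisons are therefore made between nonnegative
  integrals over events known at time 0, and become almost sure statements about conditional
  expectations only at the end. The other obstacle is degeneracy: the covariance of the factor noise
  may be singular, and attention may vanish. What helps is that a positive definite conditional
  covariance makes the payoff of every nonzero portfolio, given the current factor, a nonconstant
  Gaussian variable, which hits no value with positive probability.\<close>

lemma nn_integral_lborel_shift:
  fixes f :: "'a::euclidean_space \<Rightarrow> ennreal"
  assumes [measurable]: "f \<in> borel_measurable borel"
  shows "(\<integral>\<^sup>+x. f (c + x) \<partial>lborel) = (\<integral>\<^sup>+x. f x \<partial>lborel)"
proof -
  have "(\<integral>\<^sup>+x. f x \<partial>lborel) = (\<integral>\<^sup>+x. f x \<partial>distr lborel borel ((+) c))"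
    by (simp add: lborel_distr_plus)
  also have "\<dots> = (\<integral>\<^sup>+x. f (c + x) \<partial>lborel)"
    by (subst nn_integral_distr) auto
  finally show ?thesis by simp
qed

lemma nn_integral_lborel_reflect:
  fixes f :: "'a::euclidean_space \<Rightarrow> ennreal"
  assumes [measurable]: "f \<in> borel_measurable borel"
  shows "(\<integral>\<^sup>+x. f (c - x) \<partial>lborel) = (\<integral>\<^sup>+x. f x \<partial>lborel)"
proof -
  have "(\<integral>\<^sup>+x. f x \<partial>lborel) = (\<integral>\<^sup>+x. f x \<partial>density (distr lborel borel (\<lambda>x. c + (-1) *\<^sub>R x)) (\<lambda>_. 1))"
    using lborel_affine[of "-1" c] by simp
  also have "\<dots> = (\<integral>\<^sup>+x. f (c - x) \<partial>lborel)"
    by (simp add: nn_integral_density nn_integral_distr)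
  finally show ?thesis by simp
qed

text \<open>A linear isometry carries Lebesgue measure to a translation invariant measure, hence (Fubini)
  to a multiple of it, and the unit ball shows that the factor is one.\<close>

lemma lborel_distr_orthogonal:
  fixes f :: "'a::euclidean_space \<Rightarrow> 'a"
  assumes f: "orthogonal_transformation f"
  shows "distr lborel borel f = lborel"
proof (rule measure_eqI)
  have lin: "linear f" using f by (simp add: orthogonal_transformation_linear)
  then have [measurable]: "f \<in> borel_measurable borel"
    by (intro borel_measurable_continuous_onI linear_continuous_on) (simp add: linear_linear)
  obtain g where g: "\<And>y. f (g y) = y"
    using orthogonal_transformation_surj[OF f] by (metis surjD)
  fix A assume "A \<in> sets (distr lborel borel f)"
  then have [measurable]: "A \<in> sets borel" by simp
  \<comment> \<open>Both sides evaluate the double integral of 1_A(f x) 1_B(f x + y). Integrating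
    over y first gives the left one; translating x by a preimage of \<open>- y\<close> and then
    reflecting y gives the right one.\<close>
  have main: "emeasure lborel (f -` A) * emeasure lborel B = emeasure lborel A * emeasure lborel (f -` B)"
    if [measurable]: "B \<in> sets borel" for B
  proof -
    have mA: "f -` A \<in> sets borel" "f -` B \<in> sets borel"
      using measurable_sets_borel[of f borel A] measurable_sets_borel[of f borel B] by auto
    have "emeasure lborel (f -` A) * emeasure lborel B
        = (\<integral>\<^sup>+x. indicator A (f x) * emeasure lborel B \<partial>lborel)"
      using mA by (subst nn_integral_multc) (auto simp: nn_integral_indicator[symmetric] indicator_def
            simp del: nn_integral_indicator intro!: nn_integral_cong arg_cong2[where f="(*)"])
    also have "\<dots> = (\<integral>\<^sup>+x. (\<integral>\<^sup>+y. indicator A (f x) * indicator B (f x + y) \<partial>lborel) \<partial>lborel)"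
      by (intro nn_integral_cong, subst nn_integral_lborel_shift[where f="\<lambda>y. indicator A (f _) * indicator B y"])
         (auto simp: nn_integral_cmult)
    also have "\<dots> = (\<integral>\<^sup>+y. (\<integral>\<^sup>+x. indicator A (f x) * indicator B (f x + y) \<partial>lborel) \<partial>lborel)"
      by (intro lborel_pair.Fubini') measurable
    also have "\<dots> = (\<integral>\<^sup>+y. (\<integral>\<^sup>+x. indicator A (f x - y) * indicator B (f x) \<partial>lborel) \<partial>lborel)"
    proof (rule nn_integral_cong)
      fix y :: 'a
      have *: "f (g (- y) + x) = f x - y" for x
        using linear_add[OF lin] g by simp
      show "(\<integral>\<^sup>+x. indicator A (f x) * indicator B (f x + y) \<partial>lborel)
         = (\<integral>\<^sup>+x. indicator A (f x - y) * indicator B (f x) \<partial>lborel)"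
        by (subst nn_integral_lborel_shift[where c="g (- y)", symmetric]) (auto simp: *)
    qed
    also have "\<dots> = (\<integral>\<^sup>+x. (\<integral>\<^sup>+y. indicator A (f x - y) * indicator B (f x) \<partial>lborel) \<partial>lborel)"
      by (intro lborel_pair.Fubini') measurable
    also have "\<dots> = (\<integral>\<^sup>+x. emeasure lborel A * indicator B (f x) \<partial>lborel)"
      by (intro nn_integral_cong, subst nn_integral_lborel_reflect[where f="\<lambda>y. indicator A y * indicator B (f _)"])
         (auto simp: nn_integral_multc)
    also have "\<dots> = emeasure lborel A * emeasure lborel (f -` B)"
      using mA by (subst nn_integral_cmult) (auto simp: nn_integral_indicator[symmetric] indicator_def
            simp del: nn_integral_indicator intro!: nn_integral_cong arg_cong2[where f="(*)"])
    finally show ?thesis .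
  qed
  have ball: "f -` ball 0 1 = ball 0 1"
    using f by (auto simp: orthogonal_transformation dist_norm)
  have "emeasure lborel (ball (0::'a) 1) \<noteq> 0" "emeasure lborel (ball (0::'a) 1) \<noteq> \<infinity>"
    using emeasure_lborel_ball_finite[of "0::'a" 1] open_not_negligible[of "ball (0::'a) 1"]
    by (auto simp: negligible_iff_emeasure0)
  with main[of "ball 0 1"] have "emeasure lborel (f -` A) = emeasure lborel A"
    by (simp add: ball ennreal_mult_cancel_left mult.commute[of _ "emeasure lborel (ball 0 1)"])
  then show "emeasure (distr lborel borel f) A = emeasure lborel A"
    by (subst emeasure_distr) auto
qed auto

section \<open>The standard normal vector: linear images, hyperplanes, second moments\<close>

lemma std_normal_vec_density_eq:
  "(\<Prod>i\<in>UNIV. std_normal_density (z $ i)) = (1 / sqrt (2 * pi)) ^ CARD('m) * exp (- (z \<bullet> z) / 2)"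
  for z :: "real ^ 'm::finite"
proof -
  have "(\<Prod>i\<in>UNIV. std_normal_density (z $ i)) = (1 / sqrt (2 * pi)) ^ CARD('m) * (\<Prod>i\<in>UNIV. exp (- ((z $ i)\<^sup>2) / 2))"
    by (simp add: std_normal_density_def prod.distrib power_divide prod_dividef)
  also have "(\<Prod>i\<in>UNIV. exp (- ((z $ i)\<^sup>2) / 2)) = exp (- (z \<bullet> z) / 2)"
    by (simp add: exp_sum[symmetric] inner_vec_def sum_divide_distrib[symmetric] sum_negf power2_eq_square)
  finally show ?thesis .
qed

lemma sets_std_normal_vec [simp, measurable_cong]: "sets std_normal_vec = sets borel"
  by (simp add: std_normal_vec_def)

lemma space_std_normal_vec [simp]: "space std_normal_vec = UNIV"
  by (simp add: std_normal_vec_def)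

lemma matrix_vector_mult_measurable [measurable]:
  "(\<lambda>x. A *v x) \<in> borel_measurable borel" for A :: "real^'m::finite^'n::finite"
  by (intro borel_measurable_continuous_onI linear_continuous_on)
     (simp add: linear_linear)

text \<open>The density depends on z only through \<open>z \<bullet> z\<close>, and Lebesgue measure
  is invariant under \<open>B\<close>.\<close>

lemma distr_std_normal_vec_orthogonal:
  assumes B: "orthogonal_matrix (B :: real^'m::finite^'m)"
  shows "distr std_normal_vec borel (\<lambda>z. B *v z) = std_normal_vec"
proof -
  have orth: "orthogonal_transformation (\<lambda>z. B *v z)"
    using B by (simp add: orthogonal_transformation_matrix)
  have *: "(B *v z) \<bullet> (B *v z) = z \<bullet> z" for z
    using orth by (simp add: orthogonal_transformation_def)
  have "std_normal_vec = density (distr lborel borel (\<lambda>z. B *v z))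
      (\<lambda>z. ennreal (\<Prod>i\<in>UNIV. std_normal_density (z $ i)))"
    unfolding lborel_distr_orthogonal[OF orth] by (simp add: std_normal_vec_def)
  also have "\<dots> = distr (density lborel (\<lambda>z. ennreal (\<Prod>i\<in>UNIV. std_normal_density ((B *v z) $ i)))) borel (\<lambda>z. B *v z)"
    by (subst density_distr) auto
  also have "\<dots> = distr std_normal_vec borel (\<lambda>z. B *v z)"
    by (simp add: std_normal_vec_density_eq * std_normal_vec_def)
  finally show ?thesis ..
qed

text \<open>As long as an index is missing, the family spans a proper subspace, and a unit normal
  vector is available for that index. The indexing matters: in \<open>diagonal_gram_factor\<close>
  the given vectors must stay in their rows.\<close>

lemma orthonormal_family_extend:
  fixes b :: "'m::finite \<Rightarrow> real^'m"
  assumes "\<And>i j. i \<in> J \<Longrightarrow> j \<in> J \<Longrightarrow> b i \<bullet> b j = (if i = j then 1 else 0)"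
  shows "\<exists>b'. (\<forall>j\<in>J. b' j = b j) \<and> (\<forall>i j. b' i \<bullet> b' j = (if i = j then 1 else 0))"
  using assms
proof (induction "card (- J)" arbitrary: J b)
  case 0
  then have "J = UNIV" by auto
  with 0 show ?case by auto
next
  case (Suc n)
  then obtain k where k: "k \<notin> J"
    by (metis ComplD card.empty equals0I nat.distinct(1))
  have "dim (b ` J) \<le> card J"
    by (meson card_image_le dim_le_card' finite finite_imageI le_trans)
  also have "card J < card (UNIV :: 'm set)"
    using k by (intro psubset_card_mono) auto
  finally have "dim (b ` J) < DIM(real^'m)" by simp
  then obtain x where x: "x \<noteq> 0" "\<And>y. y \<in> span (b ` J) \<Longrightarrow> orthogonal x y"
    using orthogonal_to_subspace_exists by blast
  define c where "c = b(k := x /\<^sub>R norm x)"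
  have orth: "x \<bullet> b j = 0" "b j \<bullet> x = 0" if "j \<in> J" for j
    using x(2)[of "b j"] that by (auto simp: orthogonal_def span_base inner_commute)
  have "(x /\<^sub>R norm x) \<bullet> (x /\<^sub>R norm x) = 1"
    using x(1) by (simp add: dot_square_norm power2_eq_square)
  then have "c i \<bullet> c j = (if i = j then 1 else 0)" if "i \<in> insert k J" "j \<in> insert k J" for i j
    using that k Suc.prems orth by (auto simp: c_def)
  moreover have "n = card (- insert k J)"
    using Suc.hyps(2) k by (simp add: Compl_insert)
  ultimately obtain b' where "\<forall>j\<in>insert k J. b' j = c j" "\<forall>i j. b' i \<bullet> b' j = (if i = j then 1 else 0)"
    using Suc.hyps(1) by blast
  with k show ?case by (intro exI[of _ b']) (auto simp: c_def)
qed

text \<open>The hypothesis says that the rows of \<open>A\<close> are orthogonal and that row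
  \<open>i\<close> has squared length \<open>(\<tau> i)\<^sup>2\<close>. Dividing by
  \<open>\<tau> i\<close> gives the rows of \<open>B\<close>; a row with \<open>\<tau> i = 0\<close>
  vanishes, so any completing unit vector may take its place.\<close>

lemma diagonal_gram_factor:
  fixes A :: "real^'m::finite^'m"
  assumes A: "A ** transpose A = (\<chi> i j. if i = j then (\<tau> j)\<^sup>2 else 0)"
  obtains B where "orthogonal_matrix B" "A = (\<chi> i j. \<tau> i * B $ i $ j)"
proof -
  have gram: "A $ i \<bullet> A $ j = (if i = j then (\<tau> j)\<^sup>2 else 0)" for i j
    using arg_cong[OF A, of "\<lambda>X. X $ i $ j"]
    by (simp add: matrix_matrix_mult_def transpose_def inner_vec_def)
  define b where "b i = A $ i /\<^sub>R \<tau> i" for i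
  have "b i \<bullet> b j = (if i = j then 1 else 0)" if "i \<in> {i. \<tau> i \<noteq> 0}" "j \<in> {i. \<tau> i \<noteq> 0}" for i j
    using that by (auto simp: b_def gram power2_eq_square field_simps)
  then obtain b' where b': "\<forall>j\<in>{i. \<tau> i \<noteq> 0}. b' j = b j" "\<forall>i j. b' i \<bullet> b' j = (if i = j then 1 else 0)"
    using orthonormal_family_extend[of "{i. \<tau> i \<noteq> 0}" b] by blast
  show ?thesis
  proof
    show "orthogonal_matrix (\<chi> i. b' i)"
      using b'(2) by (simp add: orthogonal_matrix_orthonormal_rows row_def vec_lambda_eta
        pairwise_def orthogonal_def rows_def norm_eq_1)
    have "A $ i = \<tau> i *\<^sub>R b' i" for i
    proof (cases "\<tau> i = 0")
      case True
      then have "A $ i \<bullet> A $ i = 0" by (simp add: gram)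
      then show ?thesis using True by simp
    next
      case False
      then show ?thesis using b'(1) by (simp add: b_def)
    qed
    then show "A = (\<chi> i j. \<tau> i * (\<chi> i. b' i) $ i $ j)"
      by (simp add: vec_eq_iff)
  qed
qed

text \<open>\<open>gaussian_vec\<close> only provides some square root \<open>A\<close> of the
  covariance. For a diagonal covariance the orthogonal factor is absorbed by the invariant law,
  which leaves explicitly scaled coordinates.\<close>

lemma distr_std_normal_vec_diagonal:
  fixes A :: "real^'m::finite^'m"
  assumes "A ** transpose A = (\<chi> i j. if i = j then (\<tau> j)\<^sup>2 else 0)"
  shows "distr std_normal_vec borel (\<lambda>z. A *v z) = distr std_normal_vec borel (\<lambda>z. \<chi> i. \<tau> i * z $ i)"
proof -
  obtain B where B: "orthogonal_matrix B" "A = (\<chi> i j. \<tau> i * B $ i $ j)"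
    using diagonal_gram_factor[OF assms] by blast
  have [measurable]: "(\<lambda>z::real^'m. \<chi> i. \<tau> i * z $ i) \<in> borel_measurable borel"
    by (intro borel_measurable_continuous_onI continuous_intros)
  have *: "A *v z = (\<chi> i. \<tau> i * (B *v z) $ i)" for z
    by (simp add: vec_eq_iff B(2) matrix_vector_mult_def sum_distrib_left mult.assoc)
  have "distr std_normal_vec borel (\<lambda>z. A *v z)
      = distr (distr std_normal_vec borel (\<lambda>z. B *v z)) borel (\<lambda>z. \<chi> i. \<tau> i * z $ i)"
    unfolding * by (subst distr_distr) (auto simp: comp_def)
  then show ?thesis by (simp add: distr_std_normal_vec_orthogonal[OF B(1)])
qed

lemma AE_std_normal_vec_hyperplane:
  fixes v :: "real^'m::finite"
  assumes "v \<noteq> 0"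
  shows "AE z in std_normal_vec. v \<bullet> z \<noteq> c"
proof -
  have "AE z in lborel. v \<bullet> z \<noteq> c"
    using negligible_hyperplane[of v c] assms
    by (intro AE_I[where N="{x. v \<bullet> x = c}"]) (auto simp: negligible_iff_emeasure0)
  then show ?thesis unfolding std_normal_vec_def by (subst AE_density) auto
qed

lemma Basis_vec_prod: "(\<Prod>b\<in>(Basis::(real^'m::finite) set). F b) = (\<Prod>i\<in>UNIV. F (axis i 1))"
proof -
  have "(Basis::(real^'m) set) = range (\<lambda>i. axis i 1)" by (auto simp: Basis_vec_def)
  then show ?thesis
    using prod.reindex[of "\<lambda>i::'m. axis i (1::real)" UNIV F] by (simp add: inj_on_def axis_eq_axis comp_def)
qed

lemma nn_integral_lborel_vec_prod:
  fixes F :: "'m::finite \<Rightarrow> real \<Rightarrow> ennreal"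
  assumes [measurable]: "\<And>i. F i \<in> borel_measurable borel"
  shows "(\<integral>\<^sup>+z. (\<Prod>i\<in>UNIV. F i ((z::real^'m) $ i)) \<partial>lborel) = (\<Prod>i\<in>UNIV. \<integral>\<^sup>+x. F i x \<partial>lborel)"
proof -
  \<comment> \<open>\<open>nn_integral_lborel_prod\<close> indexes the factors by basis vectors;
    \<open>ix\<close> recovers the coordinate of an axis vector.\<close>
  define ix where "ix b = (THE i. b = axis i (1::real))" for b :: "real^'m"
  have ix[simp]: "ix (axis i 1) = i" for i by (auto simp: ix_def axis_eq_axis)
  have "(\<integral>\<^sup>+z. (\<Prod>b\<in>Basis. F (ix b) ((z::real^'m) \<bullet> b)) \<partial>lborel) = (\<Prod>b\<in>(Basis::(real^'m) set). \<integral>\<^sup>+x. F (ix b) x \<partial>lborel)"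
    by (intro nn_integral_lborel_prod) auto
  then show ?thesis by (simp add: Basis_vec_prod inner_axis)
qed

lemma nn_integral_lborel_std_normal_shift:
  fixes y :: "real^'m::finite"
  shows "(\<integral>\<^sup>+r. ennreal (\<Prod>i\<in>UNIV. std_normal_density (r $ i - y $ i)) \<partial>lborel) = 1"
proof -
  have 1: "(\<integral>\<^sup>+x. ennreal (std_normal_density (x - c)) \<partial>lborel) = 1" for c
    using nn_integral_lborel_shift[of "\<lambda>x. ennreal (std_normal_density x)" "-c"]
      prob_space.emeasure_space_1[OF prob_space_normal_density[of 1 0]]
    by (simp add: emeasure_density)
  show ?thesis
    by (simp add: prod_ennreal[symmetric] nn_integral_lborel_vec_prod[where F="\<lambda>i x. ennreal (std_normal_density (x - y $ i))"] 1)
qed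

lemma prob_space_std_normal_vec: "prob_space (std_normal_vec :: (real^'m::finite) measure)"
  using nn_integral_lborel_std_normal_shift[of "0::real^'m"]
  by (intro prob_spaceI) (simp add: std_normal_vec_def emeasure_density)

lemma std_normal_vec_second_moment:
  "integrable std_normal_vec (\<lambda>z::real^'m::finite. (z $ j)\<^sup>2)"
proof (rule integrableI_nonneg)
  let ?F = "\<lambda>i x. ennreal (std_normal_density x) * (if i = j then ennreal (x\<^sup>2) else 1)"
  have eq: "ennreal (\<Prod>i\<in>UNIV. std_normal_density (z $ i)) * ennreal ((z $ j)\<^sup>2) = (\<Prod>i\<in>UNIV. ?F i (z $ i))" for z :: "real^'m"
    by (simp add: prod.distrib prod_ennreal prod.delta)
  have "(\<integral>\<^sup>+x. ?F i x \<partial>lborel) < \<infinity>" for i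
  proof -
    have "integrable lborel (\<lambda>x. std_normal_density x * x\<^sup>2)" "integrable lborel (\<lambda>x. std_normal_density x)"
      using integrable_std_normal_moment[of 2] integrable_std_normal_moment[of 0] by auto
    then show ?thesis
      by (cases "i = j") (auto simp: integrable_iff_bounded ennreal_mult abs_mult)
  qed
  then have "(\<integral>\<^sup>+z. (\<Prod>i\<in>UNIV. ?F i ((z::real^'m) $ i)) \<partial>lborel) < \<infinity>"
    by (subst nn_integral_lborel_vec_prod) (auto simp: less_top[symmetric] ennreal_prod_eq_top)
  then show "(\<integral>\<^sup>+z. ennreal ((z $ j)\<^sup>2) \<partial>(std_normal_vec :: (real^'m) measure)) < \<infinity>"
    by (simp add: std_normal_vec_def nn_integral_density eq[symmetric])
qed auto


section \<open>Matrices and measurable minimizers\<close>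

lemma measurable_vec_nth [measurable (raw)]:
  fixes f :: "'a \<Rightarrow> 'b::euclidean_space ^ 'm::finite"
  assumes "f \<in> borel_measurable M"
  shows "(\<lambda>x. f x $ i) \<in> borel_measurable M"
  by (rule borel_measurable_continuous_on[OF _ assms]) (intro continuous_intros)

text \<open>Joint continuity lets random states, attentions and signals be inserted together.
  Functions of fewer arguments simply repeat one of them.\<close>

lemma measurable_continuous4:
  fixes H :: "'a::euclidean_space \<Rightarrow> 'b::euclidean_space \<Rightarrow> 'c::euclidean_space \<Rightarrow> 'd::euclidean_space \<Rightarrow> 'e::topological_space"
  assumes "continuous_on UNIV (\<lambda>x. H (fst x) (fst (snd x)) (fst (snd (snd x))) (snd (snd (snd x))))"
    and "a \<in> borel_measurable N" "b \<in> borel_measurable N" "c \<in> borel_measurable N" "d \<in> borel_measurable N"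
  shows "(\<lambda>x. H (a x) (b x) (c x) (d x)) \<in> borel_measurable N"
  using borel_measurable_continuous_on[OF assms(1), of "\<lambda>x. (a x, b x, c x, d x)" N] assms(2-)
  by (simp add: borel_measurable_Pair)

lemma measurable_vec_lambda [measurable (raw)]:
  fixes f :: "'a \<Rightarrow> 'm::finite \<Rightarrow> 'b::euclidean_space"
  assumes "\<And>i. (\<lambda>x. f x i) \<in> borel_measurable M"
  shows "(\<lambda>x. \<chi> i. f x i) \<in> borel_measurable M"
  unfolding borel_measurable_euclidean_space[of "\<lambda>x. \<chi> i. f x i"]
  using assms by (auto simp: Basis_vec_def inner_axis)

lemma continuous_on_vec_lambda' [continuous_intros]:
  fixes f :: "'a::topological_space \<Rightarrow> 'm::finite \<Rightarrow> 'b::topological_space"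
  assumes "\<And>i. continuous_on S (\<lambda>x. f x i)"
  shows "continuous_on S (\<lambda>x. \<chi> i. f x i)"
  using assms by (auto simp: continuous_on_def intro!: vec_tendstoI)

lemma continuous_on_det [continuous_intros]:
  fixes f :: "'a::topological_space \<Rightarrow> real^'m::finite^'m"
  assumes "continuous_on S f"
  shows "continuous_on S (\<lambda>x. det (f x))"
  unfolding det_def using assms by (intro continuous_intros)

lemma measurable_det [measurable (raw)]:
  fixes f :: "'a \<Rightarrow> real^'m::finite^'m"
  assumes "f \<in> borel_measurable M"
  shows "(\<lambda>x. det (f x)) \<in> borel_measurable M"
  by (rule borel_measurable_continuous_on[OF _ assms]) (intro continuous_intros)

lemma continuous_on_matrix_vector_mult' [continuous_intros]:
  fixes f :: "'a::topological_space \<Rightarrow> real^'m::finite^'n::finite"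
  assumes "continuous_on S f" "continuous_on S g"
  shows "continuous_on S (\<lambda>x. f x *v g x)"
  unfolding matrix_vector_mult_def using assms by (intro continuous_intros)

text \<open>Cramer's rule. Unlike \<open>matrix_inv\<close>, which is a Hilbert choice, these are
  quotients of polynomials in the entries, from which measurability and continuity can be read
  off.\<close>

definition cramer_solution :: "real^'m::finite^'m \<Rightarrow> real^'m \<Rightarrow> real^'m" where
  "cramer_solution A b = (\<chi> k. det (\<chi> i j. if j = k then b $ i else A $ i $ j) / det A)"

lemma matrix_inv_solution_unique:
  fixes A :: "real^'m::finite^'m"
  assumes "invertible A" "A *v x = b"
  shows "matrix_inv A *v b = x"
proof -
  have "matrix_inv A ** A = mat 1"
    using assms(1) unfolding invertible_def matrix_inv_def by (metis (mono_tags, lifting) someI_ex)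
  then show ?thesis
    using assms(2) by (metis matrix_vector_mul_assoc matrix_vector_mul_lid)
qed

lemma matrix_inv_solution:
  fixes A :: "real^'m::finite^'m"
  assumes "invertible A"
  shows "A *v (matrix_inv A *v b) = b"
proof -
  have "A ** matrix_inv A = mat 1"
    using assms(1) unfolding invertible_def matrix_inv_def by (metis (mono_tags, lifting) someI_ex)
  then show ?thesis
    by (metis matrix_vector_mul_assoc matrix_vector_mul_lid)
qed

lemma matrix_inv_cramer:
  fixes A :: "real^'m::finite^'m"
  assumes "invertible A"
  shows "matrix_inv A *v b = cramer_solution A b"
  using assms cramer[of A "cramer_solution A b" b]
  by (intro matrix_inv_solution_unique) (auto simp: invertible_det_nz cramer_solution_def)

text \<open>A singular matrix gets a junk inverse from \<open>matrix_inv\<close>, but always the same one.\<close>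

lemma measurable_matrix_inv_mult [measurable (raw)]:
  fixes f :: "'a \<Rightarrow> real^'m::finite^'m"
  assumes [measurable]: "f \<in> borel_measurable M" "g \<in> borel_measurable M"
  shows "(\<lambda>x. matrix_inv (f x) *v g x) \<in> borel_measurable M"
proof -
  define J :: "real^'m^'m" where "J = (SOME A'. False)"
  have J: "matrix_inv A = J" if "\<not> invertible A" for A :: "real^'m^'m"
  proof -
    have "(\<lambda>A'. A ** A' = mat 1 \<and> A' ** A = mat 1) = (\<lambda>_. False)"
      using that by (auto simp: invertible_def fun_eq_iff)
    then show ?thesis by (simp add: matrix_inv_def J_def)
  qed
  have "matrix_inv (f x) *v g x = (if det (f x) = 0 then J *v g x else cramer_solution (f x) (g x))" for x
    by (simp add: matrix_inv_cramer J invertible_det_nz)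
  moreover have "(\<lambda>x. if det (f x) = 0 then J *v g x else cramer_solution (f x) (g x)) \<in> borel_measurable M"
    unfolding cramer_solution_def by measurable
  ultimately show ?thesis by simp
qed

lemma continuous_on_matrix_inv_mult:
  fixes f :: "'a::topological_space \<Rightarrow> real^'m::finite^'m"
  assumes "continuous_on S f" "continuous_on S g" "\<And>x. x \<in> S \<Longrightarrow> invertible (f x)"
  shows "continuous_on S (\<lambda>x. matrix_inv (f x) *v g x)"
proof -
  have "continuous_on S (\<lambda>x. cramer_solution (f x) (g x))"
    unfolding cramer_solution_def
  proof (intro continuous_intros ballI)
    show "continuous_on S (\<lambda>x. if j = k then g x $ i else f x $ i $ j)" for i j k
      using assms by (cases "j = k") (auto intro!: continuous_intros)
  qed (use assms in \<open>auto simp: invertible_det_nz\<close>)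
  then show ?thesis
    by (rule continuous_on_eq) (simp add: assms(3) matrix_inv_cramer)
qed

section \<open>Positive definite matrices and the minimization of quadratics\<close>

lemma pos_def_matrix_invertible:
  fixes C :: "real^'m::finite^'m"
  assumes "pos_def_matrix C"
  shows "invertible C"
proof -
  have "x = 0" if "C *v x = 0" for x
    using assms that by (force simp: pos_def_matrix_def)
  then show ?thesis
    by (simp add: invertible_left_inverse matrix_left_invertible_ker)
qed

lemma pos_def_inner_commute:
  assumes "pos_def_matrix C"
  shows "x \<bullet> (C *v y) = y \<bullet> (C *v x)"
  using assms by (metis dot_lmul_matrix inner_commute pos_def_matrix_def transpose_matrix_vector)

lemma pos_def_matrix_inv_pos:
  assumes C: "pos_def_matrix C" and "b \<noteq> 0"
  shows "0 < b \<bullet> (matrix_inv C *v b)"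
proof -
  define x where "x = matrix_inv C *v b"
  have b: "C *v x = b" unfolding x_def by (rule matrix_inv_solution[OF pos_def_matrix_invertible[OF C]])
  with \<open>b \<noteq> 0\<close> have "x \<noteq> 0" by auto
  then show ?thesis
    using C unfolding x_def[symmetric] by (subst b[symmetric]) (simp add: pos_def_matrix_def inner_commute)
qed

lemma pos_def_matrix_scaleR:
  assumes "pos_def_matrix C" "0 < c"
  shows "pos_def_matrix (c *\<^sub>R C)"
proof -
  have "(c *\<^sub>R C) *v z = c *\<^sub>R (C *v z)" for z
    by (simp add: vec_eq_iff matrix_vector_mult_def sum_distrib_left mult.assoc)
  moreover have "transpose (c *\<^sub>R C) = c *\<^sub>R transpose C"
    by (simp add: transpose_def vec_eq_iff)
  ultimately show ?thesis
    using assms by (simp add: pos_def_matrix_def)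
qed

lemma matrix_inv_scale_cancel:
  fixes C :: "real^'m::finite^'m"
  assumes "pos_def_matrix C" "0 < c"
  shows "matrix_inv (c *\<^sub>R C) *v (c *\<^sub>R b) = matrix_inv C *v b"
proof (rule matrix_inv_solution_unique)
  show "invertible (c *\<^sub>R C)"
    using assms by (intro pos_def_matrix_invertible pos_def_matrix_scaleR)
  have "(c *\<^sub>R C) *v (matrix_inv C *v b) = c *\<^sub>R (C *v (matrix_inv C *v b))"
    by (simp add: vec_eq_iff matrix_vector_mult_def[of "c *\<^sub>R C"] matrix_vector_mult_def[of C "matrix_inv C *v b"]
        sum_distrib_left mult.assoc)
  then show "(c *\<^sub>R C) *v (matrix_inv C *v b) = c *\<^sub>R b"
    by (simp add: matrix_inv_solution pos_def_matrix_invertible assms)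
qed

text \<open>In the application \<open>a\<close>, \<open>B\<close> and \<open>C\<close> are the
  weighted moments of 1, of the payoff and of its outer product, and \<open>\<alpha>\<close> is the
  riskless part of the next shifted wealth. Minimizing over the portfolio \<open>u\<close> leaves
  \<open>\<alpha>\<^sup>2\<close> times the Schur complement
  \<open>a - B \<bullet> v\<close>.\<close>

lemma quadratic_complete_square:
  fixes C :: "real^'m::finite^'m" and B u :: "real^'m" and a \<alpha> :: real
  assumes C: "pos_def_matrix C"
  defines "v \<equiv> matrix_inv C *v B"
  shows "\<alpha>\<^sup>2 * a + 2 * \<alpha> * (u \<bullet> B) + u \<bullet> (C *v u)
    = \<alpha>\<^sup>2 * (a - B \<bullet> v) + (u + \<alpha> *\<^sub>R v) \<bullet> (C *v (u + \<alpha> *\<^sub>R v))"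
proof -
  have B: "C *v v = B"
    unfolding v_def by (rule matrix_inv_solution[OF pos_def_matrix_invertible[OF C]])
  have "v \<bullet> (C *v u) = u \<bullet> B" using pos_def_inner_commute[OF C, of v u] B by simp
  then show ?thesis
    by (simp add: matrix_vector_right_distrib matrix_vector_mult_scaleR B inner_add_left inner_add_right algebra_simps power2_eq_square
        inner_commute[of B v])
qed

lemma quadratic_lower_bound:
  fixes C :: "real^'m::finite^'m"
  assumes C: "pos_def_matrix C"
  shows "\<alpha>\<^sup>2 * (a - B \<bullet> (matrix_inv C *v B)) \<le> \<alpha>\<^sup>2 * a + 2 * \<alpha> * (u \<bullet> B) + u \<bullet> (C *v u)"
  unfolding quadratic_complete_square[OF C]
  using C by (cases "u + \<alpha> *\<^sub>R (matrix_inv C *v B) = 0") (auto simp: pos_def_matrix_def less_imp_le)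

lemma quadratic_minimum:
  fixes C :: "real^'m::finite^'m"
  assumes C: "pos_def_matrix C" and u: "u = - (\<alpha> *\<^sub>R (matrix_inv C *v B))"
  shows "\<alpha>\<^sup>2 * a + 2 * \<alpha> * (u \<bullet> B) + u \<bullet> (C *v u) = \<alpha>\<^sup>2 * (a - B \<bullet> (matrix_inv C *v B))"
  unfolding quadratic_complete_square[OF C] by (simp add: u)

text \<open>A convergent sequence is bounded, so one integrable majorant per ball is enough for
  dominated convergence.\<close>

lemma continuous_integral_dominated:
  fixes F :: "'a::real_normed_vector \<Rightarrow> 'q \<Rightarrow> real"
  assumes cont: "\<And>q. q \<in> space Q \<Longrightarrow> continuous_on UNIV (\<lambda>y. F y q)"
    and [measurable]: "\<And>y. F y \<in> borel_measurable Q"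
    and dom: "\<And>R. \<exists>W. integrable Q W \<and> (\<forall>y q. norm y \<le> R \<longrightarrow> q \<in> space Q \<longrightarrow> \<bar>F y q\<bar> \<le> W q)"
  shows "continuous_on UNIV (\<lambda>y. \<integral>q. F y q \<partial>Q)"
proof (rule continuous_at_imp_continuous_on, intro ballI continuous_at_sequentiallyI)
  fix y :: 'a and s assume s: "s \<longlonglongrightarrow> y"
  then obtain R where R: "\<And>n. norm (s n) \<le> R"
    by (meson Bseq_def convergentI convergent_imp_Bseq)
  obtain W where W: "integrable Q W" "\<And>y q. norm y \<le> R \<Longrightarrow> q \<in> space Q \<Longrightarrow> \<bar>F y q\<bar> \<le> W q"
    using dom by blast
  show "(\<lambda>n. \<integral>q. F (s n) q \<partial>Q) \<longlonglongrightarrow> (\<integral>q. F y q \<partial>Q)"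
  proof (rule integral_dominated_convergence[where w=W])
    show "AE q in Q. (\<lambda>n. F (s n) q) \<longlonglongrightarrow> F y q"
    proof (rule AE_I2)
      fix q assume "q \<in> space Q"
      from cont[OF this] have "isCont (\<lambda>y. F y q) y" by (simp add: continuous_on_eq_continuous_at)
      then show "(\<lambda>n. F (s n) q) \<longlonglongrightarrow> F y q" by (rule isCont_tendsto_compose) (rule s)
    qed
  qed (use W R in auto)
qed

text \<open>Dominated convergence with a majorant that moves with the parameter. Scheffe's lemma
  turns convergence of the integrals of \<open>A\<close> into convergence in mean, and the part of
  \<open>F\<close> above the limiting majorant is at most the distance between the
  majorants.\<close>

lemma continuous_integral_squeeze:
  fixes F A :: "'a::real_normed_vector \<Rightarrow> 'q \<Rightarrow> real"
  assumes cF: "\<And>q. continuous_on UNIV (\<lambda>y. F y q)" and cA: "\<And>q. continuous_on UNIV (\<lambda>y. A y q)"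
    and [measurable]: "\<And>y. F y \<in> borel_measurable Q"
    and FA: "\<And>y q. 0 \<le> F y q" "\<And>y q. F y q \<le> A y q"
    and int: "\<And>y. integrable Q (A y)"
    and cI: "continuous_on UNIV (\<lambda>y. \<integral>q. A y q \<partial>Q)"
  shows "continuous_on UNIV (\<lambda>y. \<integral>q. F y q \<partial>Q)"
proof (rule continuous_at_imp_continuous_on, intro ballI continuous_at_sequentiallyI)
  fix y :: 'a and s assume s: "s \<longlonglongrightarrow> y"
  have lim: "(\<lambda>n. G (s n)) \<longlonglongrightarrow> G y" if "continuous_on UNIV G" for G :: "'a \<Rightarrow> real"
  proof -
    from that have "isCont G y" by (simp add: continuous_on_eq_continuous_at)
    then show ?thesis by (rule isCont_tendsto_compose) (rule s)
  qed
  have [measurable]: "A y \<in> borel_measurable Q" for y using int by auto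
  have A0: "0 \<le> A y q" for y q using FA order_trans by blast
  have intF: "integrable Q (F y)" for y
    by (rule Bochner_Integration.integrable_bound[OF int[of y]]) (use FA A0 in auto)
  have "(\<lambda>n. \<integral>\<^sup>+ q. norm (A (s n) q - A y q) \<partial>Q) \<longlonglongrightarrow> 0"
  proof (rule Scheffe_lemma1)
    show "AE q in Q. (\<lambda>n. A (s n) q) \<longlonglongrightarrow> A y q" using lim[OF cA] by auto
    have "(\<lambda>n. \<integral>\<^sup>+ q. norm (A (s n) q) \<partial>Q) = (\<lambda>n. ennreal (\<integral>q. A (s n) q \<partial>Q))"
      using int A0 by (auto simp: nn_integral_eq_integral)
    moreover have "(\<lambda>n. ennreal (\<integral>q. A (s n) q \<partial>Q)) \<longlonglongrightarrow> ennreal (\<integral>q. A y q \<partial>Q)"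
      using lim[OF cI] by (intro tendsto_ennrealI)
    moreover have "ennreal (\<integral>q. A y q \<partial>Q) = (\<integral>\<^sup>+ q. norm (A y q) \<partial>Q)"
      using int A0 by (auto simp: nn_integral_eq_integral)
    ultimately show "limsup (\<lambda>n. \<integral>\<^sup>+ q. norm (A (s n) q) \<partial>Q) \<le> (\<integral>\<^sup>+ q. norm (A y q) \<partial>Q)"
      by (simp add: lim_imp_Limsup)
  qed (use int in auto)
  then have sch: "(\<lambda>n. \<integral>q. \<bar>A (s n) q - A y q\<bar> \<partial>Q) \<longlonglongrightarrow> 0"
  proof -
    have eq: "(\<integral>\<^sup>+ q. norm (A (s n) q - A y q) \<partial>Q) = ennreal (\<integral>q. \<bar>A (s n) q - A y q\<bar> \<partial>Q)" for n
      using int by (subst nn_integral_eq_integral) auto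
    assume "(\<lambda>n. \<integral>\<^sup>+ q. norm (A (s n) q - A y q) \<partial>Q) \<longlonglongrightarrow> 0"
    then have "(\<lambda>n. ennreal (\<integral>q. \<bar>A (s n) q - A y q\<bar> \<partial>Q)) \<longlonglongrightarrow> ennreal 0"
      unfolding eq by simp
    then show ?thesis by (subst (asm) tendsto_ennreal_iff) auto
  qed
  have intm: "integrable Q (\<lambda>q. min (F (s n) q) (A y q))" for n
    by (rule Bochner_Integration.integrable_bound[OF int[of y]]) (use FA A0 in \<open>auto simp: min_def\<close>)
  have 1: "(\<lambda>n. \<integral>q. min (F (s n) q) (A y q) \<partial>Q) \<longlonglongrightarrow> (\<integral>q. F y q \<partial>Q)"
  proof (rule integral_dominated_convergence[where w="A y"])
    show "AE q in Q. (\<lambda>n. min (F (s n) q) (A y q)) \<longlonglongrightarrow> F y q"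
    proof (rule AE_I2)
      fix q
      have "(\<lambda>n. min (F (s n) q) (A y q)) \<longlonglongrightarrow> min (F y q) (A y q)"
        by (intro tendsto_min lim[OF cF] tendsto_const)
      then show "(\<lambda>n. min (F (s n) q) (A y q)) \<longlonglongrightarrow> F y q" using FA(2)[of y q] by (simp add: min_absorb1)
    qed
  qed (use int FA A0 in \<open>auto simp: min_def\<close>)
  have 2: "(\<lambda>n. \<integral>q. F (s n) q - min (F (s n) q) (A y q) \<partial>Q) \<longlonglongrightarrow> 0"
  proof (rule tendsto_sandwich[OF _ _ tendsto_const sch])
    show "\<forall>\<^sub>F n in sequentially. 0 \<le> (\<integral>q. F (s n) q - min (F (s n) q) (A y q) \<partial>Q)"
      by (intro always_eventually allI integral_nonneg_AE) auto
    show "\<forall>\<^sub>F n in sequentially. (\<integral>q. F (s n) q - min (F (s n) q) (A y q) \<partial>Q) \<le> (\<integral>q. \<bar>A (s n) q - A y q\<bar> \<partial>Q)"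
    proof (intro always_eventually allI integral_mono)
      fix n q show "F (s n) q - min (F (s n) q) (A y q) \<le> \<bar>A (s n) q - A y q\<bar>"
        using FA(2)[of "s n" q] by (auto simp: min_def)
    qed (use int intF intm in auto)
  qed
  have "(\<integral>q. F (s n) q \<partial>Q) = (\<integral>q. min (F (s n) q) (A y q) \<partial>Q) + (\<integral>q. F (s n) q - min (F (s n) q) (A y q) \<partial>Q)" for n
    using intm intF by (subst Bochner_Integration.integral_diff) auto
  then show "(\<lambda>n. \<integral>q. F (s n) q \<partial>Q) \<longlonglongrightarrow> (\<integral>q. F y q \<partial>Q)"
    using tendsto_add[OF 1 2] by simp
qed

section \<open>Minimization over a compact set\<close>

lemma Inf_attained_compact:
  fixes F :: "'b::topological_space \<Rightarrow> real"
  assumes "compact K" "K \<noteq> {}" "continuous_on K F"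
  shows "\<exists>q\<in>K. F q = Inf (F ` K) \<and> (\<forall>q'\<in>K. F q \<le> F q')"
proof -
  obtain q where q: "q \<in> K" "\<forall>q'\<in>K. F q \<le> F q'"
    using continuous_attains_inf[OF assms] by blast
  then have "Inf (F ` K) = F q"
    by (intro cInf_eq_minimum) auto
  with q show ?thesis by auto
qed

text \<open>At two nearby parameters both infima are attained, and uniform continuity on a compact
  neighbourhood compares each with the value at the minimizer of the other. For this the set
  \<open>K\<close> has to be the same for all parameters.\<close>

lemma continuous_on_Inf_compact:
  fixes F :: "'a::euclidean_space \<Rightarrow> 'b::metric_space \<Rightarrow> real"
  assumes K: "compact K" "K \<noteq> {}" and F: "continuous_on UNIV (\<lambda>(x, q). F x q)"
  shows "continuous_on UNIV (\<lambda>x. Inf (F x ` K))"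
proof (rule continuous_at_imp_continuous_on, intro ballI)
  fix x
  have c: "continuous_on K (F x)" for x
    by (rule continuous_on_compose2[OF F, of K "\<lambda>q. (x, q)", simplified]) (intro continuous_intros)
  have "uniformly_continuous_on (cball x 1 \<times> K) (\<lambda>(x, q). F x q)"
    using K by (intro compact_uniformly_continuous compact_Times continuous_on_subset[OF F]) auto
  note uc = this[unfolded uniformly_continuous_on_def, rule_format]
  show "isCont (\<lambda>x. Inf (F x ` K)) x"
    unfolding continuous_at_eps_delta
  proof (intro allI impI)
    fix e :: real assume "e > 0"
    then obtain d where d: "d > 0" "\<And>z w. z \<in> cball x 1 \<times> K \<Longrightarrow> w \<in> cball x 1 \<times> K \<Longrightarrow> dist w z < d \<Longrightarrow>
        dist ((\<lambda>(x, q). F x q) w) ((\<lambda>(x, q). F x q) z) < e"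
      using uc[of e] by blast
    show "\<exists>d>0. \<forall>x'. dist x' x < d \<longrightarrow> dist (Inf (F x' ` K)) (Inf (F x ` K)) < e"
    proof (intro exI[of _ "min d 1"] conjI allI impI)
      fix x' assume x': "dist x' x < min d 1"
      obtain q where q: "q \<in> K" "F x q = Inf (F x ` K)" "\<forall>q'\<in>K. F x q \<le> F x q'"
        using Inf_attained_compact[OF K c] by blast
      obtain r where r: "r \<in> K" "F x' r = Inf (F x' ` K)" "\<forall>q'\<in>K. F x' r \<le> F x' q'"
        using Inf_attained_compact[OF K c] by blast
      have D: "\<bar>F x' p - F x p\<bar> < e" if "p \<in> K" for p
        using d(2)[of "(x, p)" "(x', p)"] x' that by (auto simp: dist_Pair_Pair dist_real_def dist_commute)
      show "dist (Inf (F x' ` K)) (Inf (F x ` K)) < e"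
        using D[OF q(1)] D[OF r(1)] q(3)[rule_format, OF r(1)] r(3)[rule_format, OF q(1)]
        unfolding q(2)[symmetric] r(2)[symmetric] dist_real_def by linarith
    qed (use d in auto)
  qed
qed

text \<open>The lexicographically smallest minimizer: fixing one more coordinate at a time, its value is the
  minimum of a continuous function over a compact set, evaluated at the coordinates already found.\<close>

lemma measurable_argmin:
  fixes F :: "'a::euclidean_space \<Rightarrow> real^'k::finite \<Rightarrow> real"
  assumes K: "compact K" "K \<noteq> {}" and F: "continuous_on UNIV (\<lambda>(x, q). F x q)"
  shows "\<exists>s. s \<in> borel_measurable borel \<and> (\<forall>x. s x \<in> K \<and> (\<forall>q\<in>K. F x (s x) \<le> F x q))"
proof -
  define m0 where "m0 x = Inf (F x ` K)" for x
  have cm0: "continuous_on UNIV m0"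
    unfolding m0_def by (rule continuous_on_Inf_compact[OF K F])
  have c: "continuous_on S (F x)" for x S
    by (rule continuous_on_compose2[OF F, of S "\<lambda>q. (x, q)", simplified]) (intro continuous_intros)
  have "\<exists>m. m \<in> borel_measurable borel \<and> (\<forall>x. \<exists>q\<in>K. F x q = m0 x \<and> (\<forall>i\<in>S. q $ i = (m x :: real^'k) $ i))" for S :: "'k set"
  proof (induction S rule: finite_induct[OF finite])
    case 1
    have "\<exists>q\<in>K. F x q = m0 x" for x
      using Inf_attained_compact[OF K c, of x] by (auto simp: m0_def)
    then show ?case by (intro exI[of _ "\<lambda>_. 0"]) auto
  next
    case (2 j S)
    then obtain m where [measurable]: "m \<in> borel_measurable borel"
      and m: "\<And>x. \<exists>q\<in>K. F x q = m0 x \<and> (\<forall>i\<in>S. q $ i = m x $ i)" by blast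
    define Z where "Z x = {q\<in>K. F x q = m0 x \<and> (\<forall>i\<in>S. q $ i = m x $ i)}" for x
    have Zne: "Z x \<noteq> {}" for x using m[of x] by (auto simp: Z_def)
    have Zc: "compact (Z x)" for x
    proof -
      have "Z x = K \<inter> ({q. F x q = m0 x} \<inter> (\<Inter>i\<in>S. {q. q $ i = m x $ i}))" by (auto simp: Z_def)
      moreover have "closed ({q. F x q = m0 x} \<inter> (\<Inter>i\<in>S. {q. q $ i = m x $ i}))"
        by (intro closed_Int closed_INT ballI closed_Collect_eq c continuous_intros)
      ultimately show ?thesis using K(1) by (simp add: compact_Int_closed)
    qed
    define c where "c x = Inf ((\<lambda>q. q $ j) ` Z x)" for x
    have catt: "\<exists>q\<in>Z x. q $ j = c x \<and> (\<forall>q'\<in>Z x. c x \<le> q' $ j)" for x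
    proof -
      have "continuous_on (Z x) (\<lambda>q. q $ j)" by (intro continuous_intros)
      from Inf_attained_compact[OF Zc Zne this] show ?thesis unfolding c_def by metis
    qed
    \<comment> \<open>\<open>G (x, m x)\<close> is nonnegative and, on \<open>K\<close>, vanishes
      exactly at the points of \<open>Z x\<close>. Hence \<open>c x \<le> r\<close> says that its
      minimum over the part of \<open>K\<close> with \<open>q $ j \<le> r\<close> is zero. That
      minimum is continuous in the pair, into which the merely measurable \<open>m x\<close> is
      substituted.\<close>
    define G where "G = (\<lambda>(x, w :: real^'k) q. \<bar>F x q - m0 x\<bar> + (\<Sum>i\<in>S. \<bar>q $ i - w $ i\<bar>))"
    have Gc: "continuous_on UNIV (\<lambda>(z, q). G z q)"
    proof -
      have "continuous_on UNIV (\<lambda>y::('a \<times> (real^'k)) \<times> (real^'k). F (fst (fst y)) (snd y))"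
        by (rule continuous_on_compose2[OF F, of UNIV "\<lambda>y. (fst (fst y), snd y)", simplified])
           (intro continuous_intros)
      moreover have "continuous_on UNIV (\<lambda>y::('a \<times> (real^'k)) \<times> (real^'k). m0 (fst (fst y)))"
        by (rule continuous_on_compose2[OF cm0]) (auto intro!: continuous_intros)
      ultimately show ?thesis
        unfolding G_def case_prod_beta by (intro continuous_intros)
    qed
    have [measurable]: "c \<in> borel_measurable borel"
    proof (rule borel_measurableI_le)
      fix r
      let ?K = "K \<inter> {q. q $ j \<le> r}"
      have Kr: "compact ?K"
        using K(1) by (intro compact_Int_closed closed_Collect_le continuous_intros)
      show "{x \<in> space borel. c x \<le> r} \<in> sets borel"
      proof (cases "?K = {}")
        case True
        have "\<not> c x \<le> r" for x
        proof
          assume "c x \<le> r"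
          with catt[of x] True show False by (auto simp: Z_def)
        qed
        then have "{x. c x \<le> r} = {}" by auto
        then show ?thesis by simp
      next
        case False
        have cI: "continuous_on UNIV (\<lambda>z. Inf (G z ` ?K))"
          by (rule continuous_on_Inf_compact[OF Kr False Gc])
        have "c x \<le> r \<longleftrightarrow> Inf (G (x, m x) ` ?K) \<le> 0" for x
        proof
          assume "c x \<le> r"
          with catt[of x] obtain q where q: "q \<in> Z x" "q \<in> ?K" by (auto simp: Z_def)
          then have "G (x, m x) q = 0" by (auto simp: G_def Z_def)
          moreover have "bdd_below (G (x, m x) ` ?K)"
            by (rule bdd_belowI2[where m=0]) (auto simp: G_def intro!: add_nonneg_nonneg sum_nonneg)
          ultimately show "Inf (G (x, m x) ` ?K) \<le> 0"
            using q(2) by (metis cINF_lower)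
        next
          assume I: "Inf (G (x, m x) ` ?K) \<le> 0"
          have "continuous_on ?K (G (x, m x))"
            by (rule continuous_on_compose2[OF Gc, of _ "\<lambda>q. ((x, m x), q)", simplified]) (intro continuous_intros)
          from Inf_attained_compact[OF Kr False this] I obtain q where q: "q \<in> ?K" "G (x, m x) q \<le> 0" by auto
          have "0 \<le> (\<Sum>i\<in>S. \<bar>q $ i - m x $ i\<bar>)" by (intro sum_nonneg) auto
          moreover have "\<bar>F x q - m0 x\<bar> + (\<Sum>i\<in>S. \<bar>q $ i - m x $ i\<bar>) \<le> 0"
            using q(2) by (simp add: G_def)
          ultimately have "F x q = m0 x" "(\<Sum>i\<in>S. \<bar>q $ i - m x $ i\<bar>) = 0" by linarith+
          then have "q \<in> Z x" using q(1) by (auto simp: Z_def sum_nonneg_eq_0_iff)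
          then have "c x \<le> q $ j" using catt[of x] by blast
          then show "c x \<le> r" using q(1) by simp
        qed
        moreover have "{x \<in> space borel. Inf (G (x, m x) ` ?K) \<le> 0} \<in> sets borel"
        proof -
          have [measurable]: "(\<lambda>z. Inf (G z ` ?K)) \<in> borel_measurable borel"
            by (rule borel_measurable_continuous_onI[OF cI])
          have [measurable]: "(\<lambda>x. (x, m x)) \<in> borel_measurable borel"
            by (intro borel_measurable_Pair) measurable
          have "(\<lambda>x. Inf (G (x, m x) ` ?K)) \<in> borel_measurable borel"
            using measurable_compose[of "\<lambda>x. (x, m x)" borel borel "\<lambda>z. Inf (G z ` ?K)" borel] by simp
          then show ?thesis by measurable
        qed
        ultimately show ?thesis by simp
      qed
    qed
    have "\<exists>q\<in>K. F x q = m0 x \<and> (\<forall>i\<in>insert j S. q $ i = (\<chi> i. if i = j then c x else m x $ i) $ i)" for x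
    proof -
      obtain q where q: "q \<in> Z x" "q $ j = c x" using catt[of x] by blast
      then show ?thesis by (intro bexI[of _ q]) (auto simp: Z_def)
    qed
    moreover have "(\<lambda>x. \<chi> i. if i = j then c x else m x $ i) \<in> borel_measurable borel" by measurable
    ultimately show ?case by blast
  qed
  from this[of UNIV] obtain s where s: "s \<in> borel_measurable borel" "\<And>x. \<exists>q\<in>K. F x q = m0 x \<and> q = s x"
    by (auto simp: vec_eq_iff)
  have "F x (s x) \<le> F x q" if "q \<in> K" for x q
    using s(2)[of x] Inf_attained_compact[OF K c, of x] that by (auto simp: m0_def)
  with s show ?thesis by blast
qed

lemma (in prob_space) integral_pos_AE:
  fixes f :: "'a \<Rightarrow> real"
  assumes "integrable M f" "AE x in M. 0 < f x"
  shows "0 < (\<integral>x. f x \<partial>M)"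
proof -
  have nn: "AE x in M. 0 \<le> f x" using assms(2) by (auto elim: AE_mp)
  have "(\<integral>x. f x \<partial>M) \<noteq> 0"
  proof
    assume "(\<integral>x. f x \<partial>M) = 0"
    then have "AE x in M. f x = 0" using integral_nonneg_eq_0_iff_AE[OF assms(1) nn] by simp
    with assms(2) have "AE x in M. False" by eventually_elim simp
    then show False by simp
  qed
  with integral_nonneg_AE[OF nn] show ?thesis by simp
qed

lemma lborel_integral_pos:
  fixes f :: "'a::euclidean_space \<Rightarrow> real"
  assumes "integrable lborel f" "\<And>x. 0 < f x"
  shows "0 < (\<integral>x. f x \<partial>lborel)"
proof -
  have nn: "AE x in lborel. 0 \<le> f x" using assms(2) by (auto intro!: AE_I2 less_imp_le)
  have "(\<integral>x. f x \<partial>lborel) \<noteq> 0"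
  proof
    assume "(\<integral>x. f x \<partial>lborel) = 0"
    then have "AE x in lborel. f x = 0" using integral_nonneg_eq_0_iff_AE[OF assms(1) nn] by simp
    then have "AE x in (lborel :: 'a measure). False"
    proof eventually_elim
      case (elim x)
      then show ?case using assms(2)[of x] by simp
    qed
    then show False by (simp add: AE_iff_null null_sets_def)
  qed
  with integral_nonneg_AE[OF nn] show ?thesis by simp
qed

lemma continuous_on_std_normal_density [continuous_intros]:
  "continuous_on S f \<Longrightarrow> continuous_on S (\<lambda>x. std_normal_density (f x))"
  unfolding std_normal_density_def by (intro continuous_intros) auto

lemma std_normal_density_le_1: "std_normal_density x \<le> 1"
proof -
  have "1 \<le> sqrt (2 * pi)" using pi_gt3 by simp
  then have "1 / sqrt (2 * pi) \<le> 1" by simp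
  moreover have "exp (- x\<^sup>2 / 2) \<le> 1" by simp
  ultimately show ?thesis unfolding std_normal_density_def by (intro mult_le_one) auto
qed


section \<open>One period\<close>

text \<open>One period of the problem, with the signal rescaled to \<open>r = p x + Z\<close>, where \<open>Z\<close> is standard
  normal. A component without information has precision \<open>p\<^sub>j = 0\<close>, so that it
  becomes pure noise and everything is jointly continuous in the attention up to the boundary.
  The measure \<open>Q\<close> is the law of \<open>(\<eta>, \<epsilon>)\<close>.\<close>

locale signal_step =
  fixes Q :: "((real^'k::finite) \<times> (real^'n::finite)) measure"
    and F :: "real^'k^'k" and c :: "real^'n" and D :: "real^'k^'n" and p :: "real^'k \<Rightarrow> real^'k"
  assumes prob_Q: "prob_space Q" and sets_Q [simp, measurable_cong]: "sets Q = sets borel"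
    and moment: "integrable Q (\<lambda>q. (norm q)\<^sup>2)"
    and nondegenerate: "\<And>z e. z \<noteq> 0 \<Longrightarrow> AE q in Q. z \<bullet> (D *v fst q + snd q) \<noteq> e"
    and p_continuous: "continuous_on UNIV p"
begin

interpretation Q: prob_space Q by (rule prob_Q)

lemma space_Q [simp]: "space Q = UNIV"
  using sets_eq_imp_space_eq[OF sets_Q] by simp

section \<open>Weighted moments given the rescaled signal\<close>

definition fac :: "real^'k \<Rightarrow> (real^'k) \<times> (real^'n) \<Rightarrow> real^'k" where
  "fac f q = F *v f + fst q"

definition pay :: "real^'k \<Rightarrow> (real^'k) \<times> (real^'n) \<Rightarrow> real^'n" where
  "pay f q = c + D *v fac f q + snd q"

definition lik :: "real^'k \<Rightarrow> real^'k \<Rightarrow> real^'k \<Rightarrow> real" where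
  "lik l x r = (\<Prod>i\<in>UNIV. std_normal_density (r $ i - p l $ i * x $ i))"

definition wt :: "(real \<Rightarrow> real^'k \<Rightarrow> real) \<Rightarrow> real \<Rightarrow> real^'k \<Rightarrow> real^'k \<Rightarrow> real^'k \<Rightarrow> (real^'k) \<times> (real^'n) \<Rightarrow> real" where
  "wt g L f l r q = g L (fac f q) * lik l (fac f q) r"

text \<open>The moments \<open>mass\<close>, \<open>mvec\<close>, \<open>mmat\<close> are posterior
  moments multiplied by the density of \<open>r\<close>. Leaving them unnormalized is harmless: the
  factor cancels in \<open>hedge\<close>, and in \<open>residual\<close> it is exactly what averages
  over the signal by a Lebesgue integral.\<close>

definition mass :: "(real \<Rightarrow> real^'k \<Rightarrow> real) \<Rightarrow> real \<Rightarrow> real^'k \<Rightarrow> real^'k \<Rightarrow> real^'k \<Rightarrow> real" where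
  "mass g L f l r = (\<integral>q. wt g L f l r q \<partial>Q)"

definition mvec :: "(real \<Rightarrow> real^'k \<Rightarrow> real) \<Rightarrow> real \<Rightarrow> real^'k \<Rightarrow> real^'k \<Rightarrow> real^'k \<Rightarrow> real^'n" where
  "mvec g L f l r = (\<chi> i. \<integral>q. wt g L f l r q * pay f q $ i \<partial>Q)"

definition mmat :: "(real \<Rightarrow> real^'k \<Rightarrow> real) \<Rightarrow> real \<Rightarrow> real^'k \<Rightarrow> real^'k \<Rightarrow> real^'k \<Rightarrow> real^'n^'n" where
  "mmat g L f l r = (\<chi> i j. \<integral>q. wt g L f l r q * (pay f q $ i * pay f q $ j) \<partial>Q)"

definition hedge :: "(real \<Rightarrow> real^'k \<Rightarrow> real) \<Rightarrow> real \<Rightarrow> real^'k \<Rightarrow> real^'k \<Rightarrow> real^'k \<Rightarrow> real^'n" where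
  "hedge g L f l r = matrix_inv (mmat g L f l r) *v mvec g L f l r"

definition gain :: "(real \<Rightarrow> real^'k \<Rightarrow> real) \<Rightarrow> real \<Rightarrow> real^'k \<Rightarrow> real^'k \<Rightarrow> real^'k \<Rightarrow> real" where
  "gain g L f l r = mass g L f l r - mvec g L f l r \<bullet> hedge g L f l r"

definition residual :: "(real \<Rightarrow> real^'k \<Rightarrow> real) \<Rightarrow> real \<Rightarrow> real^'k \<Rightarrow> real^'k \<Rightarrow> real" where
  "residual g L f l = (\<integral>r. gain g L f l r \<partial>lborel)"

definition prior :: "(real \<Rightarrow> real^'k \<Rightarrow> real) \<Rightarrow> real \<Rightarrow> real^'k \<Rightarrow> real" where
  "prior g L f = (\<integral>q. g L (fac f q) \<partial>Q)"

text \<open>What the backward induction passes from one value function to the preceding one.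
  Continuity is asked for all real \<open>L\<close>, so a version of \<open>h\<close> extended to
  negative budgets will be used.\<close>

definition good :: "(real \<Rightarrow> real^'k \<Rightarrow> real) \<Rightarrow> bool" where
  "good g \<longleftrightarrow> continuous_on UNIV (\<lambda>(L, x). g L x) \<and> (\<exists>B. \<forall>L x. 0 < g L x \<and> g L x \<le> B)"

lemma continuous_on_fac [continuous_intros]:
  "continuous_on S f \<Longrightarrow> continuous_on S q \<Longrightarrow> continuous_on S (\<lambda>x. fac (f x) (q x))"
  unfolding fac_def by (intro continuous_intros)

lemma continuous_on_pay [continuous_intros]:
  "continuous_on S f \<Longrightarrow> continuous_on S q \<Longrightarrow> continuous_on S (\<lambda>x. pay (f x) (q x))"
  unfolding pay_def by (intro continuous_intros)

lemma continuous_on_lik [continuous_intros]: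
  assumes "continuous_on S l" "continuous_on S y" "continuous_on S r"
  shows "continuous_on S (\<lambda>x. lik (l x) (y x) (r x))"
proof -
  have "continuous_on S (\<lambda>x. p (l x))"
    by (rule continuous_on_compose2[OF p_continuous assms(1)]) auto
  with assms show ?thesis unfolding lik_def by (intro continuous_intros)
qed

lemma good_one: "good (\<lambda>_ _. 1)"
  by (auto simp: good_def)

lemma lik_pos: "0 < lik l x r"
  unfolding lik_def by (intro prod_pos) (simp add: normal_density_pos)

lemma lik_le_1: "lik l x r \<le> 1"
  unfolding lik_def by (intro prod_le_1) (auto simp: std_normal_density_le_1)

lemma continuous_on_good:
  assumes "good g" "continuous_on S L" "continuous_on S y"
  shows "continuous_on S (\<lambda>x. g (L x) (y x))"
proof -
  have "continuous_on UNIV (\<lambda>(L, x). g L x)" using assms(1) by (simp add: good_def)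
  from continuous_on_compose2[OF this continuous_on_Pair[OF assms(2,3)]]
  show ?thesis by simp
qed

lemma continuous_on_wt:
  assumes "good g" "continuous_on S L" "continuous_on S f" "continuous_on S l" "continuous_on S r" "continuous_on S q"
  shows "continuous_on S (\<lambda>x. wt g (L x) (f x) (l x) (r x) (q x))"
  unfolding wt_def
  by (rule continuous_on_mult[OF continuous_on_good[OF assms(1,2) continuous_on_fac[OF assms(3,6)]]
        continuous_on_lik[OF assms(4) continuous_on_fac[OF assms(3,6)] assms(5)]])

lemma wt_pos: "good g \<Longrightarrow> 0 < wt g L f l r q"
  unfolding wt_def by (intro mult_pos_pos lik_pos) (auto simp: good_def)

lemma wt_bounded: "good g \<Longrightarrow> \<exists>B. 0 < B \<and> (\<forall>L f l r q. wt g L f l r q \<le> B)"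
proof -
  assume "good g"
  then obtain B where B: "\<And>L x. 0 < g L x" "\<And>L x. g L x \<le> B" by (auto simp: good_def)
  have "0 < B" using B less_le_trans by blast
  moreover have "wt g L f l r q \<le> B * 1" for L f l r q
    unfolding wt_def using B lik_le_1 lik_pos \<open>0 < B\<close> by (intro mult_mono) (auto intro: less_imp_le)
  ultimately show ?thesis by auto
qed

lemma pay_bound: "\<exists>C\<ge>1. \<forall>f q. norm (pay f q) \<le> C * (1 + norm f + norm q)"
proof -
  obtain B1 where B1: "B1 > 0" "\<And>x. norm (F *v x) \<le> B1 * norm x"
    using linear_bounded_pos[OF matrix_vector_mul_linear[of F]] by blast
  obtain B2 where B2: "B2 > 0" "\<And>x. norm (D *v x) \<le> B2 * norm x"
    using linear_bounded_pos[OF matrix_vector_mul_linear[of D]] by blast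
  define C where "C = 1 + norm c + B2 * B1 + B2 + 1"
  have "norm (pay f q) \<le> C * (1 + norm f + norm q)" for f q
  proof -
    have q: "norm (fst q) \<le> norm q" "norm (snd q) \<le> norm q"
      using norm_fst_le[of "fst q" "snd q"] norm_snd_le[of "snd q" "fst q"] by simp_all
    have "norm (D *v fac f q) \<le> B2 * norm (fac f q)" by (rule B2)
    also have "\<dots> \<le> B2 * (B1 * norm f + norm q)"
      unfolding fac_def using B2(1) B1(2)[of f] q norm_triangle_ineq[of "F *v f" "fst q"]
      by (intro mult_left_mono) auto
    finally have "norm (D *v fac f q) \<le> B2 * B1 * norm f + B2 * norm q" by (simp add: algebra_simps)
    moreover have "norm (pay f q) \<le> norm c + norm (D *v fac f q) + norm (snd q)"
      unfolding pay_def using norm_triangle_ineq[of "c + D *v fac f q" "snd q"] norm_triangle_ineq[of c "D *v fac f q"]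
      by linarith
    ultimately have "norm (pay f q) \<le> norm c + B2 * B1 * norm f + (B2 + 1) * norm q"
      using q by (simp add: algebra_simps)
    also have "\<dots> \<le> C + C * norm f + C * norm q"
      unfolding C_def using B1(1) B2(1) by (intro add_mono mult_right_mono) auto
    finally show ?thesis by (simp add: algebra_simps)
  qed
  moreover have "C \<ge> 1" unfolding C_def using B1(1) B2(1) by simp
  ultimately show ?thesis by blast
qed

text \<open>A growth class that contains 1, the payoff coordinates and their products, so that
  \<open>mass\<close>, \<open>mvec\<close> and \<open>mmat\<close> share one domination
  argument.\<close>

definition moderate :: "(real^'k \<Rightarrow> (real^'k) \<times> (real^'n) \<Rightarrow> real) \<Rightarrow> bool" where
  "moderate \<phi> \<longleftrightarrow> continuous_on UNIV (\<lambda>(f, q). \<phi> f q) \<and>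
     (\<exists>C. \<forall>f q. \<bar>\<phi> f q\<bar> \<le> (C * (1 + norm f + norm q))\<^sup>2)"

lemma moderate_1: "moderate (\<lambda>f q. 1)"
proof -
  have "\<bar>1\<bar> \<le> (1 * (1 + norm f + norm q))\<^sup>2" for f :: "real^'k" and q :: "(real^'k) \<times> (real^'n)"
    using self_le_power[of "1 + norm f + norm q" 2] norm_ge_zero[of f] norm_ge_zero[of q] by simp
  then show ?thesis unfolding moderate_def by (auto intro!: exI[of _ 1] simp: case_prod_beta)
qed

lemma moderate_pay: "moderate (\<lambda>f q. pay f q $ i)"
proof -
  obtain C where C: "C \<ge> 1" "\<And>f q. norm (pay f q) \<le> C * (1 + norm f + norm q)" using pay_bound by auto
  have "\<bar>pay f q $ i\<bar> \<le> (C * (1 + norm f + norm q))\<^sup>2" for f q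
  proof -
    have "1 * 1 \<le> C * (1 + norm f + norm q)" using C(1) by (intro mult_mono) auto
    moreover have "\<bar>pay f q $ i\<bar> \<le> C * (1 + norm f + norm q)"
      using C(2)[of f q] component_le_norm_cart[of "pay f q" i] by simp
    ultimately show ?thesis using self_le_power[of "C * (1 + norm f + norm q)" 2] by linarith
  qed
  then show ?thesis unfolding moderate_def by (auto intro!: exI[of _ C] continuous_intros simp: case_prod_beta)
qed

lemma moderate_pay2: "moderate (\<lambda>f q. pay f q $ i * pay f q $ j)"
proof -
  obtain C where C: "C \<ge> 1" "\<And>f q. norm (pay f q) \<le> C * (1 + norm f + norm q)" using pay_bound by auto
  have "\<bar>pay f q $ i * pay f q $ j\<bar> \<le> (C * (1 + norm f + norm q))\<^sup>2" for f q
  proof -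
    have "\<bar>pay f q $ k\<bar> \<le> C * (1 + norm f + norm q)" for k
      using C(2)[of f q] component_le_norm_cart[of "pay f q" k] by linarith
    then show ?thesis
      unfolding power2_eq_square abs_mult by (intro mult_mono) (auto intro: order_trans[OF abs_ge_zero])
  qed
  then show ?thesis unfolding moderate_def by (auto intro!: exI[of _ C] continuous_intros simp: case_prod_beta)
qed

text \<open>The weight is bounded uniformly in budget, attention and signal, because the likelihood
  is at most 1. The majorant only has to follow quadratic growth in \<open>q\<close>, which the
  second moment of \<open>Q\<close> integrates.\<close>

lemma moderate_dominated:
  assumes g: "good g" and \<phi>: "moderate \<phi>"
  shows "\<exists>W. integrable Q W \<and> (\<forall>L f l r q. norm f \<le> R \<longrightarrow> \<bar>wt g L f l r q * \<phi> f q\<bar> \<le> W q)"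
proof -
  obtain B where B: "0 < B" "\<And>L f l r q. wt g L f l r q \<le> B" using wt_bounded[OF g] by auto
  obtain C where C: "\<And>f q. \<bar>\<phi> f q\<bar> \<le> (C * (1 + norm f + norm q))\<^sup>2" using \<phi> by (auto simp: moderate_def)
  define W where "W q = B * (C\<^sup>2 * (2 * (1 + R)\<^sup>2 + 2 * (norm q)\<^sup>2))" for q :: "(real^'k) \<times> (real^'n)"
  have "integrable Q W" unfolding W_def using moment by auto
  moreover have "\<bar>wt g L f l r q * \<phi> f q\<bar> \<le> W q" if "norm f \<le> R" for L f l r q
  proof -
    have "(1 + norm f + norm q)\<^sup>2 \<le> (1 + R + norm q)\<^sup>2" using that by (intro power_mono) auto
    also have "\<dots> \<le> 2 * (1 + R)\<^sup>2 + 2 * (norm q)\<^sup>2"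
      using sum_squares_bound[of "1 + R" "norm q"] by (simp add: power2_sum)
    finally have "\<bar>\<phi> f q\<bar> \<le> C\<^sup>2 * (2 * (1 + R)\<^sup>2 + 2 * (norm q)\<^sup>2)"
      using C[of f q] mult_left_mono[of "(1 + norm f + norm q)\<^sup>2" _ "C\<^sup>2"] unfolding power_mult_distrib
      by (meson order_trans zero_le_power2)
    then show ?thesis
      unfolding abs_mult W_def using B wt_pos[OF g] by (intro mult_mono) (auto simp: less_imp_le abs_of_pos)
  qed
  ultimately show ?thesis by blast
qed

lemma measurable_moderate:
  assumes "good g" "moderate \<phi>"
  shows "(\<lambda>q. wt g L f l r q * \<phi> f q) \<in> borel_measurable Q"
proof -
  have "continuous_on UNIV (\<lambda>q. \<phi> f q)"
    using assms(2) unfolding moderate_def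
    by (auto intro!: continuous_on_compose2[of UNIV "\<lambda>(f, q). \<phi> f q" UNIV "\<lambda>q. (f, q)", simplified] continuous_intros)
  then have "continuous_on UNIV (\<lambda>q. wt g L f l r q * \<phi> f q)"
    by (intro continuous_intros continuous_on_wt assms)
  then show ?thesis by (simp add: borel_measurable_continuous_onI cong: measurable_cong_sets)
qed

lemma integrable_moderate:
  assumes "good g" "moderate \<phi>"
  shows "integrable Q (\<lambda>q. wt g L f l r q * \<phi> f q)"
proof -
  obtain W where W: "integrable Q W" "\<And>q. \<bar>wt g L f l r q * \<phi> f q\<bar> \<le> W q"
    using moderate_dominated[OF assms, of "norm f"] by blast
  show ?thesis
    by (rule Bochner_Integration.integrable_bound[OF W(1) measurable_moderate[OF assms]])
       (use W(2) in \<open>auto intro!: AE_I2 simp: order_trans[OF _ abs_ge_self]\<close>)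
qed

lemma continuous_moderate:
  assumes "good g" "moderate \<phi>"
  shows "continuous_on UNIV (\<lambda>(L, f, l, r). \<integral>q. wt g L f l r q * \<phi> f q \<partial>Q)"
  unfolding case_prod_beta
proof (rule continuous_integral_dominated)
  fix q
  have "continuous_on UNIV (\<lambda>y::real \<times> (real^'k) \<times> (real^'k) \<times> (real^'k). \<phi> (fst (snd y)) q)"
    using assms(2) unfolding moderate_def
    by (auto intro!: continuous_on_compose2[of UNIV "\<lambda>(f, q). \<phi> f q" UNIV "\<lambda>y. (fst (snd y), q)", simplified] continuous_intros)
  then show "continuous_on UNIV (\<lambda>y. wt g (fst y) (fst (snd y)) (fst (snd (snd y))) (snd (snd (snd y))) q * \<phi> (fst (snd y)) q)"
    by (intro continuous_intros continuous_on_wt assms)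
next
  fix R :: real
  have "norm (fst (snd y)) \<le> norm y" for y :: "real \<times> (real^'k) \<times> (real^'k) \<times> (real^'k)"
    using norm_snd_le[of "snd y" "fst y"] norm_fst_le[of "fst (snd y)" "snd (snd y)"] by simp
  with moderate_dominated[OF assms, of R]
  show "\<exists>W. integrable Q W \<and> (\<forall>y q. norm y \<le> R \<longrightarrow> q \<in> space Q \<longrightarrow>
      \<bar>wt g (fst y) (fst (snd y)) (fst (snd (snd y))) (snd (snd (snd y))) q * \<phi> (fst (snd y)) q\<bar> \<le> W q)"
    by (meson order_trans)
qed (use measurable_moderate[OF assms] in auto)

lemma continuous_moderate_comp:
  assumes "good g" "moderate \<phi>"
    "continuous_on S L" "continuous_on S f" "continuous_on S l" "continuous_on S r"
  shows "continuous_on S (\<lambda>x. \<integral>q. wt g (L x) (f x) (l x) (r x) q * \<phi> (f x) q \<partial>Q)"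
  using continuous_on_compose2[OF continuous_moderate[OF assms(1,2)]
      continuous_on_Pair[OF assms(3) continuous_on_Pair[OF assms(4) continuous_on_Pair[OF assms(5,6)]]]]
  by simp

lemma mass_eq: "mass g L f l r = (\<integral>q. wt g L f l r q * 1 \<partial>Q)"
  by (simp add: mass_def)

lemma continuous_on_mass:
  assumes "good g" "continuous_on S L" "continuous_on S f" "continuous_on S l" "continuous_on S r"
  shows "continuous_on S (\<lambda>x. mass g (L x) (f x) (l x) (r x))"
  unfolding mass_eq by (intro continuous_moderate_comp moderate_1 assms)

lemma continuous_on_mvec:
  assumes "good g" "continuous_on S L" "continuous_on S f" "continuous_on S l" "continuous_on S r"
  shows "continuous_on S (\<lambda>x. mvec g (L x) (f x) (l x) (r x))"
  unfolding mvec_def by (intro continuous_intros continuous_moderate_comp moderate_pay assms)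

lemma continuous_on_mmat:
  assumes "good g" "continuous_on S L" "continuous_on S f" "continuous_on S l" "continuous_on S r"
  shows "continuous_on S (\<lambda>x. mmat g (L x) (f x) (l x) (r x))"
  unfolding mmat_def by (intro continuous_on_vec_lambda' continuous_moderate_comp moderate_pay2 assms)

lemma integrable_wt [simp]:
  assumes "good g"
  shows "integrable Q (wt g L f l r)"
    "integrable Q (\<lambda>q. wt g L f l r q * pay f q $ i)"
    "integrable Q (\<lambda>q. wt g L f l r q * (pay f q $ i * pay f q $ j))"
  using integrable_moderate[OF assms moderate_1] integrable_moderate[OF assms moderate_pay]
    integrable_moderate[OF assms moderate_pay2] by simp_all

lemma wt_square_expand:
  "wt g L f l r q * (\<alpha> + u \<bullet> pay f q)\<^sup>2 = \<alpha>\<^sup>2 * wt g L f l r q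
    + 2 * \<alpha> * (\<Sum>i\<in>UNIV. u $ i * (wt g L f l r q * pay f q $ i))
    + (\<Sum>i\<in>UNIV. \<Sum>j\<in>UNIV. u $ i * (u $ j * (wt g L f l r q * (pay f q $ i * pay f q $ j))))"
proof -
  have 1: "(\<Sum>i\<in>UNIV. u $ i * (wt g L f l r q * pay f q $ i)) = wt g L f l r q * (u \<bullet> pay f q)"
    by (simp add: inner_vec_def sum_distrib_left mult_ac)
  have 2: "(\<Sum>i\<in>UNIV. \<Sum>j\<in>UNIV. u $ i * (u $ j * (wt g L f l r q * (pay f q $ i * pay f q $ j))))
      = wt g L f l r q * ((u \<bullet> pay f q) * (u \<bullet> pay f q))"
    unfolding inner_vec_def sum_product by (simp add: sum_distrib_left mult_ac)
  show ?thesis unfolding 1 2 by (simp add: power2_eq_square algebra_simps)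
qed

lemma integrable_wt_square [simp]:
  assumes "good g" shows "integrable Q (\<lambda>q. wt g L f l r q * (\<alpha> + u \<bullet> pay f q)\<^sup>2)"
  unfolding wt_square_expand using assms by simp

lemma integral_wt_square:
  assumes "good g"
  shows "(\<integral>q. wt g L f l r q * (\<alpha> + u \<bullet> pay f q)\<^sup>2 \<partial>Q)
    = \<alpha>\<^sup>2 * mass g L f l r + 2 * \<alpha> * (u \<bullet> mvec g L f l r) + u \<bullet> (mmat g L f l r *v u)"
proof -
  have "(\<integral>q. wt g L f l r q * (\<alpha> + u \<bullet> pay f q)\<^sup>2 \<partial>Q) = \<alpha>\<^sup>2 * mass g L f l r
      + 2 * \<alpha> * (\<Sum>i\<in>UNIV. u $ i * mvec g L f l r $ i)
      + (\<Sum>i\<in>UNIV. \<Sum>j\<in>UNIV. u $ i * (u $ j * mmat g L f l r $ i $ j))"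
    unfolding wt_square_expand using assms by (simp add: mass_def mvec_def mmat_def)
  moreover have "(\<Sum>i\<in>UNIV. \<Sum>j\<in>UNIV. u $ i * (u $ j * mmat g L f l r $ i $ j)) = u \<bullet> (mmat g L f l r *v u)"
    by (simp add: inner_vec_def matrix_vector_mult_def sum_distrib_left mult_ac)
  ultimately show ?thesis by (simp add: inner_vec_def)
qed

lemma AE_payoff_ne:
  assumes "u \<noteq> 0"
  shows "AE q in Q. u \<bullet> pay f q \<noteq> e"
proof -
  have "u \<bullet> pay f q = u \<bullet> (c + D *v (F *v f)) + u \<bullet> (D *v fst q + snd q)" for q
    by (simp add: pay_def fac_def matrix_vector_right_distrib inner_add_right)
  then show ?thesis
    using nondegenerate[OF assms, of "e - u \<bullet> (c + D *v (F *v f))"] by (auto elim!: AE_mp)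
qed

text \<open>The quadratic form at \<open>z\<close> integrates a positive weight against
  \<open>(z \<bullet> pay f q)\<^sup>2\<close>, and this square vanishes only on a null set.\<close>

lemma pos_def_mmat:
  assumes "good g" shows "pos_def_matrix (mmat g L f l r)"
  unfolding pos_def_matrix_def
proof (intro conjI allI impI)
  show "transpose (mmat g L f l r) = mmat g L f l r"
    by (simp add: mmat_def transpose_def vec_eq_iff mult_ac)
  fix z :: "real^'n" assume z: "z \<noteq> 0"
  have "0 < (\<integral>q. wt g L f l r q * (0 + z \<bullet> pay f q)\<^sup>2 \<partial>Q)"
  proof (rule Q.integral_pos_AE)
    show "AE q in Q. 0 < wt g L f l r q * (0 + z \<bullet> pay f q)\<^sup>2"
      using AE_payoff_ne[OF z, of f 0] by eventually_elim (simp add: wt_pos assms)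
  qed (use assms in \<open>simp del: add_0\<close>)
  then show "0 < z \<bullet> (mmat g L f l r *v z)"
    unfolding integral_wt_square[OF assms] by simp
qed

lemma continuous_on_hedge:
  assumes "good g" "continuous_on S L" "continuous_on S f" "continuous_on S l" "continuous_on S r"
  shows "continuous_on S (\<lambda>x. hedge g (L x) (f x) (l x) (r x))"
  unfolding hedge_def
  by (intro continuous_on_matrix_inv_mult continuous_on_mmat continuous_on_mvec assms
      pos_def_matrix_invertible pos_def_mmat)

lemma continuous_on_gain:
  assumes "good g" "continuous_on S L" "continuous_on S f" "continuous_on S l" "continuous_on S r"
  shows "continuous_on S (\<lambda>x. gain g (L x) (f x) (l x) (r x))"
  unfolding gain_def
  by (intro continuous_intros continuous_on_mass continuous_on_mvec continuous_on_hedge assms)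

lemma gain_lower_bound:
  assumes "good g"
  shows "\<alpha>\<^sup>2 * gain g L f l r \<le> (\<integral>q. wt g L f l r q * (\<alpha> + u \<bullet> pay f q)\<^sup>2 \<partial>Q)"
  unfolding integral_wt_square[OF assms] gain_def hedge_def
  by (rule quadratic_lower_bound[OF pos_def_mmat[OF assms]])

lemma gain_attained:
  assumes "good g" "u = - (\<alpha> *\<^sub>R hedge g L f l r)"
  shows "(\<integral>q. wt g L f l r q * (\<alpha> + u \<bullet> pay f q)\<^sup>2 \<partial>Q) = \<alpha>\<^sup>2 * gain g L f l r"
  unfolding integral_wt_square[OF assms(1)] gain_def hedge_def
  by (rule quadratic_minimum[OF pos_def_mmat[OF assms(1)]]) (simp add: assms(2) hedge_def)

text \<open>At riskless part 1 and the optimal portfolio, \<open>gain\<close> is the integral of a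
  positive weight times \<open>(1 + u \<bullet> pay f q)\<^sup>2\<close>. A perfect hedge would
  confine the payoff to a hyperplane.\<close>

lemma gain_pos:
  assumes "good g" shows "0 < gain g L f l r"
proof -
  define u where "u = - hedge g L f l r"
  have "0 < (\<integral>q. wt g L f l r q * (1 + u \<bullet> pay f q)\<^sup>2 \<partial>Q)"
  proof (rule Q.integral_pos_AE)
    have "AE q in Q. u \<bullet> pay f q \<noteq> - 1"
      using AE_payoff_ne[of u f "- 1"] by (cases "u = 0") auto
    then show "AE q in Q. 0 < wt g L f l r q * (1 + u \<bullet> pay f q)\<^sup>2"
      by eventually_elim (simp add: wt_pos assms add_eq_0_iff)
  qed (use assms in simp)
  then show ?thesis
    using gain_attained[OF assms, of u 1 L f l r] by (simp add: u_def)
qed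

lemma gain_le_mass:
  assumes "good g" shows "gain g L f l r \<le> mass g L f l r"
  using pos_def_matrix_inv_pos[OF pos_def_mmat[OF assms], of "mvec g L f l r" L f l r]
  by (cases "mvec g L f l r = 0") (auto simp: gain_def hedge_def)

lemma gain_less_mass:
  assumes "good g" "mvec g L f l r \<noteq> 0" shows "gain g L f l r < mass g L f l r"
  using pos_def_matrix_inv_pos[OF pos_def_mmat[OF assms(1)] assms(2)] by (auto simp: gain_def hedge_def)

lemma mass_pos:
  assumes "good g" shows "0 < mass g L f l r"
  using gain_pos[OF assms] gain_le_mass[OF assms] less_le_trans by blast

section \<open>Integration over the signal\<close>

lemma nn_integral_lik: "(\<integral>\<^sup>+r. ennreal (lik l x r) \<partial>lborel) = 1"
  using nn_integral_lborel_std_normal_shift[of "\<chi> i. p l $ i * x $ i"] by (simp add: lik_def)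

lemma nn_integral_wt:
  assumes "good g" shows "(\<integral>\<^sup>+q. ennreal (wt g L f l r q) \<partial>Q) = ennreal (mass g L f l r)"
  unfolding mass_def using assms by (intro nn_integral_eq_integral) (auto simp: less_imp_le wt_pos)

lemma integrable_good:
  assumes "good g" shows "integrable Q (\<lambda>q. g L (fac f q))"
proof -
  obtain B where B: "\<And>L x. 0 < g L x" "\<And>L x. g L x \<le> B" using assms by (auto simp: good_def)
  have "continuous_on UNIV (\<lambda>q. g L (fac f q))"
    by (rule continuous_on_good[OF assms]) (intro continuous_intros)+
  then have "(\<lambda>q. g L (fac f q)) \<in> borel_measurable Q"
    by (simp add: borel_measurable_continuous_onI cong: measurable_cong_sets)
  then show ?thesis using B by (intro Q.integrable_const_bound[where B=B]) (auto simp: less_imp_le abs_of_pos)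
qed

text \<open>By Fubini, since the likelihood has total mass 1 in \<open>r\<close>. That the value
  does not depend on the attention \<open>l\<close> is what makes \<open>mass\<close> a convenient
  majorant in \<open>continuous_residual\<close>.\<close>

lemma has_integral_mass:
  assumes g: "good g"
  shows "integrable lborel (mass g L f l)" "(\<integral>r. mass g L f l r \<partial>lborel) = prior g L f"
proof -
  interpret lQ: pair_sigma_finite "lborel :: (real^'k) measure" Q ..
  have "continuous_on UNIV (\<lambda>x::(real^'k) \<times> (real^'k) \<times> (real^'n). wt g L f l (fst x) (snd x))"
    by (intro continuous_on_wt g continuous_intros)
  then have "(\<lambda>x::(real^'k) \<times> (real^'k) \<times> (real^'n). wt g L f l (fst x) (snd x)) \<in> borel_measurable borel"
    by (rule borel_measurable_continuous_onI)
  then have [measurable]: "(\<lambda>(r, q). wt g L f l r q) \<in> borel_measurable (lborel \<Otimes>\<^sub>M Q)"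
    unfolding case_prod_beta by (simp add: borel_prod[symmetric] cong: measurable_cong_sets)
  have gpos: "0 \<le> g L x" for L x using g by (auto simp: good_def less_imp_le)
  have [measurable]: "(\<lambda>r. lik l x r) \<in> borel_measurable borel" for x
    by (intro borel_measurable_continuous_onI continuous_intros)
  have "(\<integral>\<^sup>+r. ennreal (mass g L f l r) \<partial>lborel) = (\<integral>\<^sup>+r. \<integral>\<^sup>+q. ennreal (wt g L f l r q) \<partial>Q \<partial>lborel)"
    by (simp add: nn_integral_wt g)
  also have "\<dots> = (\<integral>\<^sup>+q. \<integral>\<^sup>+r. ennreal (wt g L f l r q) \<partial>lborel \<partial>Q)"
    by (intro lQ.Fubini'[symmetric]) measurable
  also have "\<dots> = (\<integral>\<^sup>+q. ennreal (g L (fac f q)) \<partial>Q)"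
    unfolding wt_def by (simp add: ennreal_mult gpos less_imp_le[OF lik_pos] nn_integral_cmult nn_integral_lik)
  also have "\<dots> = ennreal (prior g L f)"
    unfolding prior_def by (intro nn_integral_eq_integral integrable_good g) (auto simp: gpos)
  finally have *: "(\<integral>\<^sup>+r. ennreal (mass g L f l r) \<partial>lborel) = ennreal (prior g L f)" .
  have [measurable]: "mass g L f l \<in> borel_measurable borel"
    by (intro borel_measurable_continuous_onI continuous_on_mass g continuous_intros)
  show I: "integrable lborel (mass g L f l)"
    by (rule integrableI_nonneg) (auto simp: * less_imp_le mass_pos g)
  have "0 \<le> prior g L f" unfolding prior_def by (intro integral_nonneg_AE) (auto simp: gpos)
  then show "(\<integral>r. mass g L f l r \<partial>lborel) = prior g L f"
    using * by (subst integral_eq_nn_integral) (auto simp: less_imp_le mass_pos g)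
qed

lemma integrable_gain:
  assumes "good g" shows "integrable lborel (gain g L f l)"
proof (rule Bochner_Integration.integrable_bound[OF has_integral_mass(1)[OF assms]])
  show "gain g L f l \<in> borel_measurable lborel"
    by (simp, intro borel_measurable_continuous_onI continuous_on_gain assms continuous_intros)
  show "AE r in lborel. norm (gain g L f l r) \<le> norm (mass g L f l r)"
    using gain_pos[OF assms] gain_le_mass[OF assms] mass_pos[OF assms] by (auto simp: abs_of_pos)
qed

lemma nn_integral_gain:
  assumes "good g" shows "(\<integral>\<^sup>+r. ennreal (gain g L f l r) \<partial>lborel) = ennreal (residual g L f l)"
  unfolding residual_def using assms
  by (intro nn_integral_eq_integral integrable_gain) (auto simp: gain_pos less_imp_le)

lemma residual_pos: "good g \<Longrightarrow> 0 < residual g L f l"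
  unfolding residual_def by (intro lborel_integral_pos integrable_gain gain_pos)

lemma residual_le_prior: "good g \<Longrightarrow> residual g L f l \<le> prior g L f"
  unfolding residual_def has_integral_mass(2)[symmetric, where l=l]
  by (intro integral_mono integrable_gain has_integral_mass gain_le_mass)

lemma residual_less_prior:
  assumes "good g" "\<And>r. mvec g L f l r \<noteq> 0"
  shows "residual g L f l < prior g L f"
proof -
  have "0 < (\<integral>r. mass g L f l r - gain g L f l r \<partial>lborel)"
    using assms by (intro lborel_integral_pos Bochner_Integration.integrable_diff integrable_gain has_integral_mass)
      (auto simp: gain_less_mass)
  then show ?thesis
    unfolding residual_def using assms by (simp add: integrable_gain has_integral_mass)
qed

lemma prior_le: "good g \<Longrightarrow> (\<And>x. g L x \<le> B) \<Longrightarrow> prior g L f \<le> B"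
  unfolding prior_def using Q.integral_le_const[OF integrable_good, of g L f B] by auto

lemma continuous_on_prior:
  assumes g: "good g" shows "continuous_on UNIV (\<lambda>(L, f). prior g L f)"
  unfolding case_prod_beta prior_def
proof (rule continuous_integral_dominated)
  obtain B where B: "\<And>L x. 0 < g L x" "\<And>L x. g L x \<le> B" using assms by (auto simp: good_def)
  show "continuous_on UNIV (\<lambda>y. g (fst y) (fac (snd y) q))" for q
    by (rule continuous_on_good[OF g]) (intro continuous_intros)+
  show "\<exists>W. integrable Q W \<and> (\<forall>y q. norm y \<le> R \<longrightarrow> q \<in> space Q \<longrightarrow> \<bar>g (fst y) (fac (snd y) q)\<bar> \<le> W q)" for R
    using B by (intro exI[of _ "\<lambda>_. B"]) (auto simp: abs_of_pos)
qed (use integrable_good[OF g] in auto)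

text \<open>No fixed Lebesgue integrable majorant in \<open>r\<close> is sought: \<open>gain\<close>
  lies between 0 and \<open>mass\<close>, which moves with the state and the attention but has the
  continuous integral \<open>prior\<close>.\<close>

lemma continuous_residual:
  assumes g: "good g" shows "continuous_on UNIV (\<lambda>(L, f, l). residual g L f l)"
  unfolding case_prod_beta residual_def
proof (rule continuous_integral_squeeze[where A="\<lambda>y r. mass g (fst y) (fst (snd y)) (snd (snd y)) r"])
  show "continuous_on UNIV (\<lambda>y. gain g (fst y) (fst (snd y)) (snd (snd y)) r)"
    and "continuous_on UNIV (\<lambda>y. mass g (fst y) (fst (snd y)) (snd (snd y)) r)" for r
    by (intro continuous_on_gain continuous_on_mass g continuous_intros)+
  show "continuous_on UNIV (\<lambda>y. \<integral>r. mass g (fst y) (fst (snd y)) (snd (snd y)) r \<partial>lborel)"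
    unfolding has_integral_mass(2)[OF g]
    using continuous_on_compose2[OF continuous_on_prior[OF g]
        continuous_on_Pair[OF continuous_on_fst[OF continuous_on_id]
          continuous_on_fst[OF continuous_on_snd[OF continuous_on_id]]]]
    by simp
qed (use integrable_gain[OF g] in \<open>auto simp: gain_pos g less_imp_le gain_le_mass has_integral_mass(1)\<close>)

lemma continuous_on_residual:
  assumes "good g" "continuous_on S L" "continuous_on S f" "continuous_on S l"
  shows "continuous_on S (\<lambda>x. residual g (L x) (f x) (l x))"
  using continuous_on_compose2[OF continuous_residual[OF assms(1)]
      continuous_on_Pair[OF assms(2) continuous_on_Pair[OF assms(3,4)]]]
  by simp

text \<open>Zero precision makes the likelihood constant in the factor, so it comes out of the
  integral.\<close>

lemma mvec_uninformative:
  assumes "p l = 0"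
  shows "mvec g L f l r = (\<Prod>i\<in>UNIV. std_normal_density (r $ i)) *\<^sub>R (\<chi> i. \<integral>q. g L (fac f q) * pay f q $ i \<partial>Q)"
proof -
  have *: "wt g L f l r q * pay f q $ i = (\<Prod>i\<in>UNIV. std_normal_density (r $ i)) * (g L (fac f q) * pay f q $ i)" for q i
    by (simp add: wt_def lik_def assms)
  show ?thesis by (simp add: mvec_def vec_eq_iff *)
qed

text \<open>The observed signal determines \<open>r\<close> only up to the components of precision \<open>0\<close>; these change
  the likelihood by a factor that does not depend on the factor.\<close>

definition visible :: "real^'k \<Rightarrow> real^'k \<Rightarrow> real^'k" where
  "visible l r = (\<chi> i. if p l $ i = 0 then 0 else r $ i)"

text \<open>Passing to \<open>visible\<close> replaces the pure noise coordinates of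
  \<open>r\<close> by 0, hence the division by the density at 0.\<close>

definition noise_scale :: "real^'k \<Rightarrow> real^'k \<Rightarrow> real" where
  "noise_scale l r = (\<Prod>i\<in>UNIV. if p l $ i = 0 then std_normal_density (r $ i) / std_normal_density 0 else 1)"

lemma noise_scale_pos: "0 < noise_scale l r"
  unfolding noise_scale_def by (intro prod_pos) (auto simp: normal_density_pos intro!: divide_pos_pos)

lemma lik_visible: "lik l x r = noise_scale l r * lik l x (visible l r)"
proof -
  have "std_normal_density (0::real) \<noteq> 0" using normal_density_pos[of 1 0 0] by linarith
  then show ?thesis
    unfolding lik_def noise_scale_def visible_def prod.distrib[symmetric]
    by (intro prod.cong) auto
qed

lemma wt_visible: "wt g L f l r q = noise_scale l r * wt g L f l (visible l r) q"
  unfolding wt_def by (subst lik_visible) simp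

lemma mass_visible: "mass g L f l r = noise_scale l r * mass g L f l (visible l r)"
  unfolding mass_eq by (subst wt_visible) (simp add: mult.assoc)

lemma mvec_visible: "mvec g L f l r = noise_scale l r *\<^sub>R mvec g L f l (visible l r)"
  unfolding mvec_def by (subst wt_visible) (simp add: vec_eq_iff mult.assoc)

lemma mmat_visible: "mmat g L f l r = noise_scale l r *\<^sub>R mmat g L f l (visible l r)"
  unfolding mmat_def by (subst wt_visible) (simp add: vec_eq_iff mult.assoc)

text \<open>The common scale of matrix and vector cancels, so the portfolio depends only on what is
  observed.\<close>

lemma hedge_visible: "good g \<Longrightarrow> hedge g L f l r = hedge g L f l (visible l r)"
  unfolding hedge_def mmat_visible[of g L f l r] mvec_visible[of g L f l r]
  by (intro matrix_inv_scale_cancel pos_def_mmat noise_scale_pos)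

lemma gain_visible: "good g \<Longrightarrow> gain g L f l r = noise_scale l r * gain g L f l (visible l r)"
  unfolding gain_def by (subst mass_visible, subst mvec_visible, subst hedge_visible) (simp_all add: algebra_simps)

definition evidence :: "real^'k \<Rightarrow> real^'k \<Rightarrow> real^'k \<Rightarrow> real" where
  "evidence f l r = (\<integral>q. lik l (fac f q) r \<partial>Q)"

text \<open>The Bayes density of the period noises given \<open>r\<close>, relative to their prior
  law \<open>Q\<close>.\<close>

definition posterior :: "real^'k \<Rightarrow> real^'k \<Rightarrow> real^'k \<Rightarrow> (real^'k) \<times> (real^'n) \<Rightarrow> real" where
  "posterior f l r q = lik l (fac f q) r / evidence f l r"

lemma evidence_eq_mass: "evidence f l r = mass (\<lambda>_ _. 1) L f l r"
  by (simp add: evidence_def mass_def wt_def)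

lemma evidence_pos: "0 < evidence f l r"
  using mass_pos[OF good_one] by (simp add: evidence_eq_mass[of _ _ _ 0])

lemma posterior_pos: "0 < posterior f l r q"
  by (simp add: posterior_def evidence_pos lik_pos)

text \<open>The scale of the pure noise coordinates enters likelihood and evidence alike. Thus the
  posterior can be computed from the observed signal, although \<open>r\<close> itself cannot be
  recovered.\<close>

lemma posterior_visible: "posterior f l (visible l r) q = posterior f l r q"
  unfolding posterior_def evidence_eq_mass[of _ _ _ 0] mass_visible[of _ _ f l r] lik_visible[of l _ r]
  using noise_scale_pos[of l r] by simp

lemma continuous_on_evidence:
  assumes "continuous_on S f" "continuous_on S l" "continuous_on S r"
  shows "continuous_on S (\<lambda>x. evidence (f x) (l x) (r x))"
  unfolding evidence_eq_mass[of _ _ _ 0] by (intro continuous_on_mass good_one assms continuous_intros)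

lemma continuous_on_posterior:
  assumes "continuous_on S f" "continuous_on S l" "continuous_on S r" "continuous_on S q"
  shows "continuous_on S (\<lambda>x. posterior (f x) (l x) (r x) (q x))"
proof -
  have "evidence a b e \<noteq> 0" for a b e using evidence_pos[of a b e] by simp
  then show ?thesis
    unfolding posterior_def by (intro continuous_intros continuous_on_evidence assms ballI) auto
qed

lemma wt_posterior: "g L (fac f q) * posterior f l r q = wt g L f l r q / evidence f l r"
  by (simp add: posterior_def wt_def)

end


section \<open>Independence and conditioning in the market\<close>

lemma events_of_subset:
  assumes "X \<in> borel_measurable G" "space G = space M"
  shows "events_of M X \<subseteq> sets G"
  using assms measurable_sets[OF assms(1)] by (auto simp: events_of_def)

lemma events_of_Pow: "events_of M X \<subseteq> Pow (space M)"
  by (auto simp: events_of_def)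

lemma measurable_sigma_events:
  assumes "events_of M X \<subseteq> E" "E \<subseteq> Pow (space M)"
  shows "X \<in> borel_measurable (sigma (space M) E)"
proof (rule measurableI)
  fix A :: "'b set" assume "A \<in> sets borel"
  then have "X -` A \<inter> space M \<in> E" using assms(1) by (auto simp: events_of_def)
  then show "X -` A \<inter> space (sigma (space M) E) \<in> sets (sigma (space M) E)"
    using assms(2) by (simp add: space_measure_of_conv)
qed auto

lemma sets_sigma_subset:
  assumes "E \<subseteq> sets N" "space N = S"
  shows "sets (sigma S E) \<subseteq> sets N"
proof -
  have "E \<subseteq> Pow S" using assms(1) sets.space_closed[of N] unfolding assms(2) by (rule order_trans)
  with assms show ?thesis using sets.sigma_sets_subset[of E N] by simp
qed

lemma Int_stable_events_of: "Int_stable (events_of M X)"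
proof (rule Int_stableI)
  fix a b assume "a \<in> events_of M X" "b \<in> events_of M X"
  then obtain A B where "a = X -` A \<inter> space M" "b = X -` B \<inter> space M" "A \<in> sets borel" "B \<in> sets borel"
    by (auto simp: events_of_def)
  then show "a \<inter> b \<in> events_of M X"
    unfolding events_of_def by (intro CollectI exI[of _ "A \<inter> B"]) auto
qed

text \<open>On the \<open>G\<close>-event where \<open>X \<omega> < Y \<omega>\<close> and
  \<open>Y \<omega> \<le> of_nat n\<close>, the integrals are finite and can be subtracted. As the
  values of \<open>Y\<close> are finite, letting \<open>n\<close> grow exhausts the exceptional set.
  This stands in for integrability of \<open>Y\<close>, which may fail.\<close>

lemma subalgebra_AE_le:
  assumes "finite_measure M" "subalgebra M G"
    and [measurable]: "X \<in> borel_measurable G" "Y \<in> borel_measurable G"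
    and fin: "\<And>\<omega>. \<omega> \<in> space M \<Longrightarrow> Y \<omega> < (\<infinity>::ennreal)"
    and le: "\<And>A. A \<in> sets G \<Longrightarrow> (\<integral>\<^sup>+\<omega>. Y \<omega> * indicator A \<omega> \<partial>M) \<le> (\<integral>\<^sup>+\<omega>. X \<omega> * indicator A \<omega> \<partial>M)"
  shows "AE \<omega> in M. Y \<omega> \<le> X \<omega>"
proof -
  interpret finite_measure M by fact
  have sp: "space G = space M" and sub: "sets G \<subseteq> sets M" using assms(2) by (auto simp: subalgebra_def)
  have XM[measurable]: "X \<in> borel_measurable M" "Y \<in> borel_measurable M"
    by (rule measurable_from_subalg[OF assms(2)], fact)+
  have "AE \<omega> in M. \<not> (X \<omega> < Y \<omega> \<and> Y \<omega> \<le> of_nat n)" for n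
  proof -
    define A where "A = {\<omega>\<in>space G. X \<omega> < Y \<omega> \<and> Y \<omega> \<le> of_nat n}"
    have AG: "A \<in> sets G" unfolding A_def by measurable
    then have [measurable]: "A \<in> sets M" using sub by auto
    have fin: "(\<integral>\<^sup>+\<omega>. X \<omega> * indicator A \<omega> \<partial>M) \<noteq> \<infinity>"
    proof -
      have "(\<integral>\<^sup>+\<omega>. X \<omega> * indicator A \<omega> \<partial>M) \<le> (\<integral>\<^sup>+\<omega>. of_nat n \<partial>M)"
        by (intro nn_integral_mono) (auto simp: A_def split: split_indicator intro: order_trans less_imp_le)
      also have "\<dots> < \<infinity>"
      proof -
        have "emeasure M (space M) < top" using emeasure_finite[of "space M"] by (simp add: less_top[symmetric])
        then show ?thesis by (simp add: ennreal_mult_less_top of_nat_less_top)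
      qed
      finally show ?thesis by simp
    qed
    have "(\<integral>\<^sup>+\<omega>. Y \<omega> * indicator A \<omega> - X \<omega> * indicator A \<omega> \<partial>M)
        = (\<integral>\<^sup>+\<omega>. Y \<omega> * indicator A \<omega> \<partial>M) - (\<integral>\<^sup>+\<omega>. X \<omega> * indicator A \<omega> \<partial>M)"
    proof (rule nn_integral_diff)
      show "AE \<omega> in M. X \<omega> * indicator A \<omega> \<le> Y \<omega> * indicator A \<omega>"
        by (auto simp: A_def split: split_indicator intro!: AE_I2 intro: less_imp_le)
    qed (use fin in auto)
    also have "\<dots> = 0" 
    proof (rule diff_eq_0_ennreal)
      show "(\<integral>\<^sup>+\<omega>. Y \<omega> * indicator A \<omega> \<partial>M) < top"
        using order_le_less_trans[OF le[OF AG], of top] fin by (simp add: less_top[symmetric])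
    qed (rule le[OF AG])
    finally have "AE \<omega> in M. Y \<omega> * indicator A \<omega> - X \<omega> * indicator A \<omega> = 0"
      by (subst (asm) nn_integral_0_iff_AE) auto
    then show ?thesis using AE_space
    proof eventually_elim
      case (elim \<omega>)
      show ?case
      proof
        assume *: "X \<omega> < Y \<omega> \<and> Y \<omega> \<le> of_nat n"
        then have "\<omega> \<in> A" using elim(2) by (simp add: A_def sp)
        with elim(1) have "Y \<omega> - X \<omega> = 0" by simp
        moreover have "X \<omega> < top" using * by (meson less_le_trans top_greatest)
        ultimately have "Y \<omega> \<le> X \<omega>" by (simp add: ennreal_minus_eq_0)
        with * show False using leD by blast
      qed
    qed
  qed
  then have "AE \<omega> in M. \<forall>n::nat. \<not> (X \<omega> < Y \<omega> \<and> Y \<omega> \<le> of_nat n)"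
    unfolding AE_all_countable by blast
  with AE_space show ?thesis
  proof eventually_elim
    case (elim \<omega>)
    then obtain y where y: "Y \<omega> = ennreal y" "0 \<le> y" using fin[of \<omega>] by (cases "Y \<omega>") auto
    obtain n :: nat where "y \<le> real n" using real_arch_simple by blast
    then have "Y \<omega> \<le> of_nat n" unfolding y ennreal_of_nat_eq_real_of_nat by (rule ennreal_leI)
    then show ?case using elim(2)[rule_format, of n] by (meson not_less)
  qed
qed

text \<open>If conditioning on \<open>G\<close> reweights the law \<open>Q\<close> of \<open>Y\<close> by a density \<open>k\<close>, this computes conditional
  expectations without any integrability over \<open>M\<close>, as the initial factor has an arbitrary law.\<close>

locale cond_kernel = prob_space M for M :: "'w measure" +
  fixes G :: "'w measure" and Q :: "'q measure" and Y :: "'w \<Rightarrow> 'q" and k :: "'w \<Rightarrow> 'q \<Rightarrow> real"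
  assumes sub: "subalgebra M G" and Q: "prob_space Q" and Y[measurable]: "Y \<in> measurable M Q"
    and k[measurable]: "(\<lambda>(\<omega>, q). k \<omega> q) \<in> borel_measurable (G \<Otimes>\<^sub>M Q)"
    and k0: "\<And>\<omega> q. 0 \<le> k \<omega> q"
    and kernel: "\<And>\<Phi>. case_prod \<Phi> \<in> borel_measurable (G \<Otimes>\<^sub>M Q) \<Longrightarrow>
        (\<integral>\<^sup>+\<omega>. \<Phi> \<omega> (Y \<omega>) \<partial>M) = (\<integral>\<^sup>+\<omega>. \<integral>\<^sup>+q. \<Phi> \<omega> q * ennreal (k \<omega> q) \<partial>Q \<partial>M)"
begin

interpretation Q: prob_space Q by (rule Q)

sublocale sub: sigma_finite_subalgebra M G
  using sub by (intro finite_measure_subalgebra_is_sigma_finite finite_measure_subalgebra.intro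
      finite_measure_subalgebra_axioms.intro) unfold_locales

lemma measurable_id_G [measurable]: "(\<lambda>\<omega>. \<omega>) \<in> measurable M G"
  by (rule measurable_from_subalg[OF sub]) simp

lemma measurable_at_Y:
  assumes "case_prod \<Phi> \<in> borel_measurable (G \<Otimes>\<^sub>M Q)"
  shows "(\<lambda>\<omega>. \<Phi> \<omega> (Y \<omega>)) \<in> borel_measurable M"
proof -
  have "(\<lambda>\<omega>. (\<omega>, Y \<omega>)) \<in> measurable M (G \<Otimes>\<^sub>M Q)" by measurable
  from measurable_compose[OF this assms] show ?thesis by simp
qed

lemma nn_cond_exp_kernel:
  fixes \<Phi> :: "'w \<Rightarrow> 'q \<Rightarrow> ennreal"
  assumes \<Phi>[measurable]: "case_prod \<Phi> \<in> borel_measurable (G \<Otimes>\<^sub>M Q)"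
  shows "AE \<omega> in M. nn_cond_exp M G (\<lambda>\<omega>. \<Phi> \<omega> (Y \<omega>)) \<omega> = (\<integral>\<^sup>+q. \<Phi> \<omega> q * ennreal (k \<omega> q) \<partial>Q)"
proof -
  have "AE \<omega> in M. (\<integral>\<^sup>+q. \<Phi> \<omega> q * ennreal (k \<omega> q) \<partial>Q) = nn_cond_exp M G (\<lambda>\<omega>. \<Phi> \<omega> (Y \<omega>)) \<omega>"
  proof (rule sub.nn_cond_exp_charact)
    show "(\<lambda>\<omega>. \<Phi> \<omega> (Y \<omega>)) \<in> borel_measurable M" by (rule measurable_at_Y[OF \<Phi>])
    show "(\<lambda>\<omega>. \<integral>\<^sup>+q. \<Phi> \<omega> q * ennreal (k \<omega> q) \<partial>Q) \<in> borel_measurable G"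
      by measurable
    fix A assume A[measurable]: "A \<in> sets G"
    have "(\<integral>\<^sup>+\<omega>. \<Phi> \<omega> (Y \<omega>) * indicator A \<omega> \<partial>M) = (\<integral>\<^sup>+\<omega>. \<integral>\<^sup>+q. \<Phi> \<omega> q * indicator A \<omega> * ennreal (k \<omega> q) \<partial>Q \<partial>M)"
      by (rule kernel[of "\<lambda>\<omega> q. \<Phi> \<omega> q * indicator A \<omega>"]) measurable
    also have "\<dots> = (\<integral>\<^sup>+\<omega>. (\<integral>\<^sup>+q. \<Phi> \<omega> q * ennreal (k \<omega> q) \<partial>Q) * indicator A \<omega> \<partial>M)"
      by (intro nn_integral_cong) (auto split: split_indicator)
    finally show "(\<integral>\<^sup>+\<omega>\<in>A. \<Phi> \<omega> (Y \<omega>) \<partial>M) = (\<integral>\<^sup>+\<omega>\<in>A. (\<integral>\<^sup>+q. \<Phi> \<omega> q * ennreal (k \<omega> q) \<partial>Q) \<partial>M)" .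
  qed
  then show ?thesis by eventually_elim simp
qed

text \<open>\<open>real_cond_exp\<close> is by definition the difference of the conditional
  expectations of positive and negative part, so integrability against the kernel at each
  \<open>\<omega>\<close> suffices.\<close>

lemma real_cond_exp_kernel:
  fixes \<Phi> :: "'w \<Rightarrow> 'q \<Rightarrow> real"
  assumes \<Phi>[measurable]: "case_prod \<Phi> \<in> borel_measurable (G \<Otimes>\<^sub>M Q)"
    and int: "\<And>\<omega>. \<omega> \<in> space M \<Longrightarrow> integrable Q (\<lambda>q. \<Phi> \<omega> q * k \<omega> q)"
  shows "AE \<omega> in M. real_cond_exp M G (\<lambda>\<omega>. \<Phi> \<omega> (Y \<omega>)) \<omega> = (\<integral>q. \<Phi> \<omega> q * k \<omega> q \<partial>Q)"
proof -
  have "AE \<omega> in M. nn_cond_exp M G (\<lambda>\<omega>. ennreal (\<Phi> \<omega> (Y \<omega>))) \<omega> = (\<integral>\<^sup>+q. ennreal (\<Phi> \<omega> q) * ennreal (k \<omega> q) \<partial>Q)"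
    by (rule nn_cond_exp_kernel) measurable
  moreover have "AE \<omega> in M. nn_cond_exp M G (\<lambda>\<omega>. ennreal (- \<Phi> \<omega> (Y \<omega>))) \<omega> = (\<integral>\<^sup>+q. ennreal (- \<Phi> \<omega> q) * ennreal (k \<omega> q) \<partial>Q)"
    by (rule nn_cond_exp_kernel) measurable
  ultimately show ?thesis using AE_space
  proof eventually_elim
    case (elim \<omega>)
    have "(\<integral>q. \<Phi> \<omega> q * k \<omega> q \<partial>Q) = enn2real (\<integral>\<^sup>+q. ennreal (\<Phi> \<omega> q * k \<omega> q) \<partial>Q) - enn2real (\<integral>\<^sup>+q. ennreal (- (\<Phi> \<omega> q * k \<omega> q)) \<partial>Q)"
      by (rule real_lebesgue_integral_def[OF int[OF elim(3)]])
    also have "\<dots> = enn2real (\<integral>\<^sup>+q. ennreal (\<Phi> \<omega> q) * ennreal (k \<omega> q) \<partial>Q) - enn2real (\<integral>\<^sup>+q. ennreal (- \<Phi> \<omega> q) * ennreal (k \<omega> q) \<partial>Q)"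
      by (simp add: ennreal_mult''[OF k0, symmetric])
    finally show ?case using elim by (simp add: real_cond_exp_def)
  qed
qed

end

section \<open>The noise sources and their independence\<close>

locale mv_base =
  fixes P :: "('w, 'n::finite, 'k::finite) market"
  assumes market: "mv_market P"
begin

abbreviation M where "M \<equiv> pspace P"
abbreviation T where "T \<equiv> horizon P"

lemma prob_M: "prob_space M" using market by (simp add: mv_market_def)

sublocale prob_space M by (rule prob_M)

lemma T_pos: "0 < T" and Lambda0_nonneg: "0 \<le> Lambda0 P" and theta_pos: "0 < theta P $ j"
  and ret_gt_1: "t < T \<Longrightarrow> 1 < ret P (Suc t)"
  using market by (auto simp: mv_market_def)

lemma f0_measurable [measurable]: "f0 P \<in> borel_measurable M"
  using market by (auto simp: mv_market_def)

lemma gaussian_noises: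
  assumes "t \<in> {1..T}"
  shows "gaussian_vec M (eps P t) 0 (Sigma_eps P)" "gaussian_vec M (eta P t) 0 (Sigma_eta P)"
    "l \<in> nonneg_vecs \<Longrightarrow> gaussian_vec M (masked_noise P t l) 0 (Sigma_v P l)"
    "(\<lambda>(l, \<omega>). masked_noise P t l \<omega>) \<in> borel_measurable (restrict_space borel nonneg_vecs \<Otimes>\<^sub>M noise_field_algebra P t)"
  using market assms by (auto simp: mv_market_def)

lemma noise_measurable:
  assumes "t \<in> {1..T}"
  shows "eps P t \<in> borel_measurable M" "eta P t \<in> borel_measurable M"
    "l \<in> nonneg_vecs \<Longrightarrow> masked_noise P t l \<in> borel_measurable M"
  using gaussian_noises[OF assms] by (auto simp: gaussian_vec_def)

text \<open>The signal of period s reads the noise field with index \<open>Suc s\<close>, so the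
  information at time t involves only field indices up to t.\<close>

definition sources :: "nat \<Rightarrow> noise_source set" where
  "sources t = {Initial} \<union> Eps ` {1..t} \<union> Eta ` {1..t} \<union> Vfield ` {1..t}"

definition source_algebra :: "noise_source set \<Rightarrow> 'w measure" where
  "source_algebra I = sigma (space M) (\<Union>i\<in>I. source_events P i)"

lemma space_noise_field [simp]: "space (noise_field_algebra P t) = space M"
  by (simp add: noise_field_algebra_def space_measure_of_conv)

lemma source_events_subset:
  assumes "i \<in> sources T" shows "source_events P i \<subseteq> sets M"
proof -
  have "sets (noise_field_algebra P t) \<subseteq> sets M" if "t \<in> {1..T}" for t
    unfolding noise_field_algebra_def using noise_measurable(3)[OF that]
    by (intro sets_sigma_subset UN_least events_of_subset) auto
  note nf = this
  show ?thesis
  proof (cases i)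
    case Initial
    then show ?thesis using events_of_subset[OF f0_measurable refl] by simp
  next
    case (Eps t)
    then have "t \<in> {1..T}" using assms by (auto simp: sources_def)
    then show ?thesis using events_of_subset[OF noise_measurable(1) refl] Eps by simp
  next
    case (Eta t)
    then have "t \<in> {1..T}" using assms by (auto simp: sources_def)
    then show ?thesis using events_of_subset[OF noise_measurable(2) refl] Eta by simp
  next
    case (Vfield t)
    then have "t \<in> {1..T}" using assms by (auto simp: sources_def)
    then show ?thesis using nf Vfield by simp
  qed
qed

lemma source_events_Pow: "source_events P i \<subseteq> Pow (space M)"
proof (cases i)
  case (Vfield t)
  then show ?thesis using sets.space_closed[of "noise_field_algebra P t"] by simp
qed (simp_all add: events_of_Pow)

lemma Int_stable_source_events: "Int_stable (source_events P i)"
proof (cases i)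
  case (Vfield t)
  then show ?thesis by (simp add: sets.Int_stable)
qed (simp_all add: Int_stable_events_of)

lemma space_source_algebra [simp]: "space (source_algebra I) = space M"
  by (simp add: source_algebra_def space_measure_of_conv)

lemma sets_source_algebra: "sets (source_algebra I) = sigma_sets (space M) (\<Union>i\<in>I. source_events P i)"
  unfolding source_algebra_def using source_events_Pow by (intro sets_measure_of) auto

lemma source_algebra_subset: "I \<subseteq> sources T \<Longrightarrow> sets (source_algebra I) \<subseteq> sets M"
  unfolding source_algebra_def using source_events_subset by (intro sets_sigma_subset) auto

lemma source_algebra_mono: "I \<subseteq> J \<Longrightarrow> sets (source_algebra I) \<subseteq> sets (source_algebra J)"
  unfolding sets_source_algebra by (intro sigma_sets_mono') auto

lemma source_events_in_algebra: "i \<in> I \<Longrightarrow> source_events P i \<subseteq> sets (source_algebra I)"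
  unfolding sets_source_algebra by (auto intro: sigma_sets.Basic)

lemma sources_mono: "s \<le> t \<Longrightarrow> sources s \<subseteq> sources t"
  by (auto simp: sources_def)

text \<open>The generating families are stable under intersection, so independence passes from the
  single sources to the sigma-algebras of disjoint groups.\<close>

lemma source_algebra_indep:
  assumes "I \<subseteq> sources T" "J \<subseteq> sources T" "I \<inter> J = {}"
    and A: "A \<in> sets (source_algebra I)" and B: "B \<in> sets (source_algebra J)"
  shows "emeasure M (A \<inter> B) = emeasure M A * emeasure M B"
proof -
  have "indep_sets (source_events P) (sources T)"
    using market by (simp add: mv_market_def sources_def)
  then have "indep_sets (source_events P) (\<Union>b\<in>UNIV. if b then I else J)"
    by (rule indep_sets_mono_index[rotated]) (use assms in \<open>auto split: if_splits\<close>)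
  then have "indep_sets (\<lambda>b. sigma_sets (space M) (\<Union>i\<in>(if b then I else J). source_events P i)) UNIV"
    using assms(3) by (intro indep_sets_collect_sigma Int_stable_source_events)
      (auto simp: disjoint_family_on_def split: if_splits)
  from indep_setsD[OF this, of UNIV "\<lambda>b. if b then A else B"]
  have "prob (A \<inter> B) = prob A * prob B"
    using A B by (simp add: UNIV_bool sets_source_algebra Int_commute mult.commute)
  moreover have "A \<in> sets M" "B \<in> sets M" using A B source_algebra_subset[OF assms(1)] source_algebra_subset[OF assms(2)] by auto
  ultimately show ?thesis
    by (simp add: emeasure_eq_measure ennreal_mult)
qed

lemma source_algebra_distr_pair:
  assumes IJ: "I \<subseteq> sources T" "J \<subseteq> sources T" "I \<inter> J = {}"
    and X: "X \<in> measurable (source_algebra I) N" and Y: "Y \<in> measurable (source_algebra J) N'"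
  shows "distr M (N \<Otimes>\<^sub>M N') (\<lambda>\<omega>. (X \<omega>, Y \<omega>)) = distr M N X \<Otimes>\<^sub>M distr M N' Y"
proof -
  have sI: "subalgebra M (source_algebra I)" and sJ: "subalgebra M (source_algebra J)"
    using source_algebra_subset IJ by (auto simp: subalgebra_def)
  have XM[measurable]: "X \<in> measurable M N" "Y \<in> measurable M N'"
    using measurable_from_subalg[OF sI X] measurable_from_subalg[OF sJ Y] by auto
  interpret X: prob_space "distr M N X" by (rule prob_space_distr) measurable
  interpret Y: prob_space "distr M N' Y" by (rule prob_space_distr) measurable
  show ?thesis
  proof (rule pair_measure_eqI[symmetric])
    fix A B assume "A \<in> sets (distr M N X)" "B \<in> sets (distr M N' Y)"
    then have [measurable]: "A \<in> sets N" "B \<in> sets N'" by auto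
    have "emeasure M ((X -` A \<inter> space M) \<inter> (Y -` B \<inter> space M)) = emeasure M (X -` A \<inter> space M) * emeasure M (Y -` B \<inter> space M)"
      using measurable_sets[OF X, of A] measurable_sets[OF Y, of B] by (intro source_algebra_indep[OF IJ]) auto
    moreover have "(X -` A \<inter> space M) \<inter> (Y -` B \<inter> space M) = (\<lambda>\<omega>. (X \<omega>, Y \<omega>)) -` (A \<times> B) \<inter> space M" by auto
    ultimately show "emeasure (distr M N X) A * emeasure (distr M N' Y) B
        = emeasure (distr M (N \<Otimes>\<^sub>M N') (\<lambda>\<omega>. (X \<omega>, Y \<omega>))) (A \<times> B)"
      by (simp add: emeasure_distr)
  next
    show "sets (distr M N X \<Otimes>\<^sub>M distr M N' Y) = sets (distr M (N \<Otimes>\<^sub>M N') (\<lambda>\<omega>. (X \<omega>, Y \<omega>)))"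
      by (simp cong: sets_pair_measure_cong)
  qed (rule X.sigma_finite_measure_axioms Y.sigma_finite_measure_axioms)+
qed

lemma measurable_source:
  assumes "i \<in> I"
  shows "i = Initial \<Longrightarrow> f0 P \<in> borel_measurable (source_algebra I)"
    "i = Eps t \<Longrightarrow> eps P t \<in> borel_measurable (source_algebra I)"
    "i = Eta t \<Longrightarrow> eta P t \<in> borel_measurable (source_algebra I)"
    "i = Vfield t \<Longrightarrow> (\<lambda>\<omega>. \<omega>) \<in> measurable (source_algebra I) (noise_field_algebra P t)"
proof -
  have *: "(\<Union>i\<in>I. source_events P i) \<subseteq> Pow (space M)" using source_events_Pow by auto
  show "i = Initial \<Longrightarrow> f0 P \<in> borel_measurable (source_algebra I)"
    "i = Eps t \<Longrightarrow> eps P t \<in> borel_measurable (source_algebra I)"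
    "i = Eta t \<Longrightarrow> eta P t \<in> borel_measurable (source_algebra I)"
  proof -
    have "events_of M (f0 P) \<subseteq> (\<Union>i\<in>I. source_events P i)" if "i = Initial" using that assms by force
    then show "i = Initial \<Longrightarrow> f0 P \<in> borel_measurable (source_algebra I)"
      unfolding source_algebra_def using * by (intro measurable_sigma_events) auto
    have "events_of M (eps P t) \<subseteq> (\<Union>i\<in>I. source_events P i)" if "i = Eps t" using that assms by force
    then show "i = Eps t \<Longrightarrow> eps P t \<in> borel_measurable (source_algebra I)"
      unfolding source_algebra_def using * by (intro measurable_sigma_events) auto
    have "events_of M (eta P t) \<subseteq> (\<Union>i\<in>I. source_events P i)" if "i = Eta t" using that assms by force
    then show "i = Eta t \<Longrightarrow> eta P t \<in> borel_measurable (source_algebra I)"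
      unfolding source_algebra_def using * by (intro measurable_sigma_events) auto
  qed
  assume "i = Vfield t"
  then have "sets (noise_field_algebra P t) \<subseteq> sets (source_algebra I)"
    using source_events_in_algebra[OF assms] by simp
  then show "(\<lambda>\<omega>. \<omega>) \<in> measurable (source_algebra I) (noise_field_algebra P t)"
    by (intro measurableI) (auto simp: sets.Int_space_eq2 dest: sets.sets_into_space)
qed

text \<open>The noise field is jointly measurable over nonnegative attention only, hence the detour
  through \<open>restrict_space\<close>.\<close>

lemma measurable_signal_at:
  assumes t: "t \<in> {1..T}"
    and [measurable]: "l \<in> borel_measurable N" "x \<in> borel_measurable N" "w \<in> measurable N (noise_field_algebra P t)"
    and l: "\<And>z. z \<in> space N \<Longrightarrow> l z \<in> nonneg_vecs"
  shows "(\<lambda>z. signal_at P t (l z) (x z) (w z)) \<in> borel_measurable N"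
proof -
  have "l \<in> measurable N (restrict_space borel nonneg_vecs)"
    using l by (intro measurable_restrict_space2) auto
  then have "(\<lambda>z. (l z, w z)) \<in> measurable N (restrict_space borel nonneg_vecs \<Otimes>\<^sub>M noise_field_algebra P t)"
    by measurable
  from measurable_compose[OF this gaussian_noises(4)[OF t]]
  have [measurable]: "(\<lambda>z. masked_noise P t (l z) (w z)) \<in> borel_measurable N" by simp
  show ?thesis unfolding signal_at_def by measurable
qed

section \<open>The law of the period noises and the precision of the signal\<close>

definition law :: "nat \<Rightarrow> ((real^'k) \<times> (real^'n)) measure" where
  "law t = distr M borel (\<lambda>\<omega>. (eta P t \<omega>, eps P t \<omega>))"

text \<open>The reciprocal standard deviation of the signal noise, so that zero attention
  corresponds to 0 instead of an infinite variance. A factor component of zero variance also gets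
  precision 0, because division by zero yields 0; \<open>observed\<close> treats it
  separately.\<close>

definition prec :: "real^'k \<Rightarrow> real^'k" where
  "prec l = (\<chi> j. sqrt ((exp (l $ j * theta P $ j) - 1) / Sigma_eta P $ j $ j))"

lemma sets_law [simp, measurable_cong]: "sets (law t) = sets borel" by (simp add: law_def)

lemma space_law [simp]: "space (law t) = UNIV" by (simp add: law_def)

lemma measurable_noise_pair:
  assumes "t \<in> {1..T}"
  shows "(\<lambda>\<omega>. (eta P t \<omega>, eps P t \<omega>)) \<in> borel_measurable M"
    "(\<lambda>\<omega>. (eta P t \<omega>, eps P t \<omega>)) \<in> measurable M (law t)"
proof -
  show *: "(\<lambda>\<omega>. (eta P t \<omega>, eps P t \<omega>)) \<in> borel_measurable M"
    using noise_measurable(1,2)[OF assms] by (intro borel_measurable_Pair)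
  then show "(\<lambda>\<omega>. (eta P t \<omega>, eps P t \<omega>)) \<in> measurable M (law t)"
    by (simp add: law_def)
qed

lemma prob_law:
  assumes "t \<in> {1..T}" shows "prob_space (law t)"
  unfolding law_def using measurable_noise_pair(1)[OF assms] by (intro prob_space_distr)

lemma gaussian_matrix:
  fixes X :: "'w \<Rightarrow> real^'m::finite"
  assumes "gaussian_vec M X 0 S"
  obtains A :: "real^'m^'m" where "A ** transpose A = S" "distr M borel X = distr std_normal_vec borel (\<lambda>z. A *v z)"
proof -
  from assms obtain A :: "real^'m^'m" where "A ** transpose A = S" "distr M borel X = distr std_normal_vec borel (\<lambda>z. 0 + A *v z)"
    unfolding gaussian_vec_def by blast
  with that[of A] show ?thesis by simp
qed

lemma law_product:
  assumes t: "t \<in> {1..T}"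
  shows "law t = distr M borel (eta P t) \<Otimes>\<^sub>M distr M borel (eps P t)"
proof -
  have "distr M (borel \<Otimes>\<^sub>M borel) (\<lambda>\<omega>. (eta P t \<omega>, eps P t \<omega>)) = distr M borel (eta P t) \<Otimes>\<^sub>M distr M borel (eps P t)"
    using t by (intro source_algebra_distr_pair[of "{Eta t}" "{Eps t}"] measurable_source[OF insertI1 refl] )
       (auto simp: sources_def)
  then show ?thesis by (simp add: law_def borel_prod)
qed

lemma Sigma_eta_nonneg: "0 \<le> Sigma_eta P $ j $ j"
proof -
  have "(1::nat) \<in> {1..T}" using T_pos by simp
  from gaussian_matrix[OF gaussian_noises(2)[OF this]]
  obtain A :: "real^'k^'k" where A: "A ** transpose A = Sigma_eta P" by metis
  show ?thesis
    unfolding A[symmetric] matrix_matrix_mult_def transpose_def by (simp add: sum_nonneg)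
qed

text \<open>A diagonal entry of \<open>A ** transpose A\<close> is the squared length of a row of
  \<open>A\<close>; if it vanishes, so does the row. A signal about such a component tells nothing
  beyond its conditional mean.\<close>

lemma eta_degenerate:
  assumes t: "t \<in> {1..T}"
  shows "AE q in law t. \<forall>j. Sigma_eta P $ j $ j = 0 \<longrightarrow> fst q $ j = 0"
proof -
  obtain A :: "real^'k^'k" where A: "A ** transpose A = Sigma_eta P" "distr M borel (eta P t) = distr std_normal_vec borel (\<lambda>z. A *v z)"
    using gaussian_matrix[OF gaussian_noises(2)[OF t]] by metis
  have row: "A $ j = 0" if "Sigma_eta P $ j $ j = 0" for j
  proof -
    have "Sigma_eta P $ j $ j = A $ j \<bullet> A $ j"
      unfolding A(1)[symmetric] by (simp add: matrix_matrix_mult_def transpose_def inner_vec_def)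
    with that show ?thesis by simp
  qed
  have "AE x in distr std_normal_vec borel (\<lambda>z. A *v z). \<forall>j. Sigma_eta P $ j $ j = 0 \<longrightarrow> x $ j = 0"
    by (subst AE_distr_iff) (auto simp: matrix_vector_mul_component row)
  then have "AE x in distr M borel (eta P t). \<forall>j. Sigma_eta P $ j $ j = 0 \<longrightarrow> x $ j = 0"
    unfolding A(2) .
  then have "AE \<omega> in M. \<forall>j. Sigma_eta P $ j $ j = 0 \<longrightarrow> eta P t \<omega> $ j = 0"
    using noise_measurable(2)[OF t] by (subst (asm) AE_distr_iff) auto
  then show ?thesis
    unfolding law_def using measurable_noise_pair(1)[OF t]
    by (subst AE_distr_iff) (auto simp: borel_prod[symmetric])
qed

lemma second_moment_gaussian:
  fixes X :: "'w \<Rightarrow> real^'m::finite"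
  assumes "gaussian_vec M X 0 S"
  shows "integrable M (\<lambda>\<omega>. (norm (X \<omega>))\<^sup>2)"
proof -
  obtain A :: "real^'m^'m" where A: "distr M borel X = distr std_normal_vec borel (\<lambda>z. A *v z)"
    using gaussian_matrix[OF assms] by metis
  have [measurable]: "X \<in> borel_measurable M" using assms by (simp add: gaussian_vec_def)
  obtain B where B: "B > 0" "\<And>x. norm (A *v x) \<le> B * norm x"
    using linear_bounded_pos[OF matrix_vector_mul_linear[of A]] by blast
  have "integrable std_normal_vec (\<lambda>z. B\<^sup>2 * (\<Sum>i\<in>UNIV. (z $ i)\<^sup>2))"
    by (intro integrable_mult_right Bochner_Integration.integrable_sum std_normal_vec_second_moment)
  then have "integrable std_normal_vec (\<lambda>z. (norm (A *v z))\<^sup>2)"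
  proof (rule Bochner_Integration.integrable_bound)
    have "(norm (A *v z))\<^sup>2 \<le> B\<^sup>2 * (\<Sum>i\<in>UNIV. (z $ i)\<^sup>2)" for z
    proof -
      have "(norm (A *v z))\<^sup>2 \<le> (B * norm z)\<^sup>2" using B by (intro power_mono) auto
      also have "\<dots> = B\<^sup>2 * (\<Sum>i\<in>UNIV. (z $ i)\<^sup>2)"
        by (simp add: power_mult_distrib norm_vec_def L2_set_def sum_nonneg)
      finally show ?thesis .
    qed
    then show "AE z in std_normal_vec. norm ((norm (A *v z))\<^sup>2) \<le> norm (B\<^sup>2 * (\<Sum>i\<in>UNIV. (z $ i)\<^sup>2))"
      by (auto intro!: AE_I2 order_trans[OF _ abs_ge_self])
  qed measurable
  then have "integrable (distr M borel X) (\<lambda>x. (norm x)\<^sup>2)"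
    unfolding A by (subst integrable_distr_eq) auto
  then show ?thesis by (subst (asm) integrable_distr_eq) auto
qed

lemma law_moment:
  assumes t: "t \<in> {1..T}" shows "integrable (law t) (\<lambda>q. (norm q)\<^sup>2)"
proof -
  have "integrable M (\<lambda>\<omega>. (norm (eta P t \<omega>, eps P t \<omega>))\<^sup>2)"
    using second_moment_gaussian[OF gaussian_noises(1)[OF t]] second_moment_gaussian[OF gaussian_noises(2)[OF t]]
    by (simp add: norm_Pair)
  then show ?thesis
    unfolding law_def using measurable_noise_pair(1)[OF t]
    by (subst integrable_distr_eq) auto
qed

lemma prec_continuous: "continuous_on UNIV prec"
proof -
  have "continuous_on UNIV (\<lambda>l::real^'k. (exp (l $ j * theta P $ j) - 1) / Sigma_eta P $ j $ j)" for j
    by (cases "Sigma_eta P $ j $ j = 0") (auto intro!: continuous_intros)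
  then show ?thesis
    unfolding prec_def by (intro continuous_on_vec_lambda' continuous_on_real_sqrt)
qed

lemma prec_eq_0_iff:
  assumes "l \<in> nonneg_vecs"
  shows "prec l $ j = 0 \<longleftrightarrow> l $ j = 0 \<or> Sigma_eta P $ j $ j = 0"
  using theta_pos[of j] by (auto simp: prec_def)

text \<open>With both noises written as linear images of independent standard normal vectors, the
  form becomes \<open>v1 \<bullet> x + v2 \<bullet> y\<close>. Positive variance excludes
  \<open>v1 = 0 \<and> v2 = 0\<close>, and otherwise Fubini reduces a level set to a null hyperplane
  in one of the variables.\<close>

lemma law_nondegenerate:
  fixes z :: "real^'n"
  assumes t: "t \<in> {1..T}" and pos: "0 < (\<integral>q. (z \<bullet> (Dmat P *v fst q + snd q) - e')\<^sup>2 \<partial>law t)"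
    and e': "e' = (\<integral>q. z \<bullet> (Dmat P *v fst q + snd q) \<partial>law t)"
  shows "AE q in law t. z \<bullet> (Dmat P *v fst q + snd q) \<noteq> e"
proof -
  obtain A :: "real^'k^'k" where A: "distr M borel (eta P t) = distr std_normal_vec borel (\<lambda>z. A *v z)"
    using gaussian_matrix[OF gaussian_noises(2)[OF t]] by metis
  obtain B :: "real^'n^'n" where B: "distr M borel (eps P t) = distr std_normal_vec borel (\<lambda>z. B *v z)"
    using gaussian_matrix[OF gaussian_noises(1)[OF t]] by metis
  interpret Z1: prob_space "std_normal_vec :: (real^'k) measure" by (rule prob_space_std_normal_vec)
  interpret Z2: prob_space "std_normal_vec :: (real^'n) measure" by (rule prob_space_std_normal_vec)
  interpret Z: pair_sigma_finite "std_normal_vec :: (real^'k) measure" "std_normal_vec :: (real^'n) measure" ..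
  interpret N: prob_space "distr std_normal_vec borel (\<lambda>z. B *v z)"
    by (intro Z2.prob_space_distr) measurable
  have law_eq: "law t = distr (std_normal_vec \<Otimes>\<^sub>M std_normal_vec) (borel \<Otimes>\<^sub>M borel) (\<lambda>(x, y). (A *v x, B *v y))"
    unfolding law_product[OF t] A B by (intro pair_measure_distr N.sigma_finite_measure_axioms) measurable
  define v1 where "v1 = transpose A *v (transpose (Dmat P) *v z)"
  define v2 where "v2 = transpose B *v z"
  have v1: "z \<bullet> (Dmat P *v (A *v x)) = v1 \<bullet> x" for x
    by (simp add: v1_def transpose_matrix_vector dot_lmul_matrix)
  have v2: "z \<bullet> (B *v x) = v2 \<bullet> x" for x
    by (simp add: v2_def transpose_matrix_vector dot_lmul_matrix)
  have pairI: "AE q in law t. R (fst q) (snd q)"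
    if "AE x in std_normal_vec. AE y in std_normal_vec. R (A *v x) (B *v y)"
      and [measurable]: "Measurable.pred borel (\<lambda>q. R (fst q) (snd q))" for R
  proof -
    have R[measurable]: "Measurable.pred (borel \<Otimes>\<^sub>M borel) (\<lambda>q. R (fst q) (snd q))"
      using that(2) by (simp add: borel_prod)
    have f[measurable]: "(\<lambda>(x, y). (A *v x, B *v y)) \<in> measurable (std_normal_vec \<Otimes>\<^sub>M std_normal_vec) (borel \<Otimes>\<^sub>M borel)"
      by measurable
    have "Measurable.pred (std_normal_vec \<Otimes>\<^sub>M std_normal_vec) (\<lambda>w. R (A *v fst w) (B *v snd w))"
      using measurable_compose[OF f R] by (simp add: case_prod_beta)
    then have "AE w in std_normal_vec \<Otimes>\<^sub>M std_normal_vec. R (A *v fst w) (B *v snd w)"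
      using that(1) by (intro Z.AE_pair_measure) (auto simp: space_pair_measure pred_def)
    then show ?thesis
      unfolding law_eq using R by (subst AE_distr_iff) (auto simp: pred_def case_prod_beta space_pair_measure)
  qed
  have pred_ne: "Measurable.pred borel (\<lambda>q::(real^'k) \<times> (real^'n). z \<bullet> (Dmat P *v fst q + snd q) \<noteq> e)"
    and pred_eq: "Measurable.pred borel (\<lambda>q::(real^'k) \<times> (real^'n). z \<bullet> (Dmat P *v fst q + snd q) = 0)"
    by (simp_all add: borel_prod[symmetric])
  consider "v1 = 0 \<and> v2 = 0" | "v2 \<noteq> 0" | "v1 \<noteq> 0" "v2 = 0" by blast
  then show ?thesis
  proof cases
    case 1
    have "AE q in law t. z \<bullet> (Dmat P *v fst q + snd q) = 0"
      by (rule pairI[OF _ pred_eq]) (simp add: inner_add_right v1 v2 1)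
    then have "AE q in law t. (z \<bullet> (Dmat P *v fst q + snd q) - e')\<^sup>2 = 0"
    proof -
      assume *: "AE q in law t. z \<bullet> (Dmat P *v fst q + snd q) = 0"
      then have "e' = 0" unfolding e' by (rule integral_eq_zero_AE)
      with * show ?thesis by (auto elim: AE_mp)
    qed
    then have "(\<integral>q. (z \<bullet> (Dmat P *v fst q + snd q) - e')\<^sup>2 \<partial>law t) = 0"
      by (rule integral_eq_zero_AE)
    with pos show ?thesis by simp
  next
    case 2
    have "AE y in std_normal_vec. v1 \<bullet> x + v2 \<bullet> y \<noteq> e" for x
      using AE_std_normal_vec_hyperplane[OF 2, of "e - v1 \<bullet> x"] by (auto elim!: AE_mp)
    then show ?thesis by (intro pairI[OF _ pred_ne]) (simp add: inner_add_right v1 v2)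
  next
    case 3
    have "AE x in std_normal_vec. v1 \<bullet> x \<noteq> e" by (rule AE_std_normal_vec_hyperplane[OF 3(1)])
    then show ?thesis by (intro pairI[OF _ pred_ne]) (auto simp add: inner_add_right v1 v2 3(2) elim!: AE_mp)
  qed
qed

end

locale mv_period = mv_base P for P :: "('w, 'n::finite, 'k::finite) market" +
  fixes t :: nat
  assumes t: "t < T"
    and nondegenerate_law: "\<And>z e. z \<noteq> 0 \<Longrightarrow> AE q in law (Suc t). z \<bullet> (Dmat P *v fst q + snd q) \<noteq> e"
begin

lemma Suc_t: "Suc t \<in> {1..T}" using t by simp

sublocale signal_step "law (Suc t)" "mat 1 - Phi P" "cvec P" "Dmat P" prec
  by (rule signal_step.intro) (simp_all add: prob_law[OF Suc_t] law_moment[OF Suc_t] prec_continuous nondegenerate_law)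

sublocale law: prob_space "law (Suc t)" by (rule prob_law[OF Suc_t])

text \<open>The signal recovered from \<open>r\<close>; \<open>m\<close> is the conditional mean of the factor, which a component
  with zero variance reveals for free.\<close>

definition observed :: "real^'k \<Rightarrow> real^'k \<Rightarrow> real^'k \<Rightarrow> real^'k" where
  "observed l m r = (\<chi> j. if prec l $ j \<noteq> 0 then r $ j / prec l $ j else if l $ j = 0 then 0 else m $ j)"

text \<open>Where the precision is nonzero, the noise is \<open>\<tau> j * z $ j\<close> with
  \<open>\<tau> j = 1 / prec l $ j\<close>, so multiplying the signal by the precision gives the
  coordinate of \<open>r = y + z\<close> with \<open>z\<close> standard normal. Translating Lebesgue
  measure by \<open>y\<close> turns the density of \<open>z\<close> into \<open>lik\<close>. Where
  the factor has variance zero, the hypothesis on \<open>m\<close> supplies the observed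
  value.\<close>

lemma signal_law:
  fixes \<psi> :: "real^'k \<Rightarrow> ennreal"
  assumes l: "l \<in> nonneg_vecs" and x: "\<And>j. Sigma_eta P $ j $ j = 0 \<Longrightarrow> x $ j = m $ j"
    and [measurable]: "\<psi> \<in> borel_measurable borel"
  shows "(\<integral>\<^sup>+\<omega>. \<psi> (signal_at P (Suc t) l x \<omega>) \<partial>M) = (\<integral>\<^sup>+r. \<psi> (observed l m r) * ennreal (lik l x r) \<partial>lborel)"
proof -
  have [measurable]: "masked_noise P (Suc t) l \<in> borel_measurable M"
    by (rule noise_measurable(3)[OF Suc_t l])
  define \<tau> where "\<tau> j = sqrt (Sigma_v P l $ j $ j)" for j
  have Sv: "Sigma_v P l = (\<chi> i j. if i = j then (\<tau> j)\<^sup>2 else 0)"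
  proof -
    have "0 \<le> Sigma_v P l $ j $ j" for j
      using l theta_pos[of j] Sigma_eta_nonneg[of j] by (simp add: Sigma_v_def nonneg_vecs_def)
    moreover have "Sigma_v P l $ i $ j = 0" if "i \<noteq> j" for i j using that by (simp add: Sigma_v_def)
    ultimately show ?thesis by (auto simp: vec_eq_iff \<tau>_def)
  qed
  obtain A :: "real^'k^'k" where A: "A ** transpose A = Sigma_v P l"
      "distr M borel (masked_noise P (Suc t) l) = distr std_normal_vec borel (\<lambda>z. A *v z)"
    using gaussian_matrix[OF gaussian_noises(3)[OF Suc_t l]] by metis
  have D: "distr M borel (masked_noise P (Suc t) l) = distr std_normal_vec borel (\<lambda>z. \<chi> i. \<tau> i * z $ i)"
    unfolding A(2) by (rule distr_std_normal_vec_diagonal) (simp add: A(1) Sv)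
  define B where "B v = (\<chi> j. if l $ j = 0 then 0 else x $ j + v $ j)" for v :: "real^'k"
  have [measurable]: "B \<in> borel_measurable borel" unfolding B_def by measurable
  have [measurable]: "observed l m \<in> borel_measurable borel" unfolding observed_def by measurable
  have [measurable]: "lik l x \<in> borel_measurable borel"
    by (intro borel_measurable_continuous_onI continuous_intros)
  define y where "y = (\<chi> j. prec l $ j * x $ j)"
  have eq: "B (\<chi> i. \<tau> i * z $ i) = observed l m (y + z)" for z
  proof -
    have "(if l $ j = 0 then 0 else x $ j + \<tau> j * z $ j)
        = (if prec l $ j \<noteq> 0 then (prec l $ j * x $ j + z $ j) / prec l $ j else if l $ j = 0 then 0 else m $ j)" for j
    proof (cases "prec l $ j = 0")
      case True
      then show ?thesis using x[of j] by (auto simp: prec_eq_0_iff[OF l] \<tau>_def Sigma_v_def)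
    next
      case False
      then have ne: "l $ j \<noteq> 0" "Sigma_eta P $ j $ j \<noteq> 0" by (auto simp: prec_eq_0_iff[OF l])
      have "\<tau> j = 1 / prec l $ j"
        by (simp add: \<tau>_def prec_def Sigma_v_def real_sqrt_divide)
      then show ?thesis using False ne by (simp add: add_divide_distrib)
    qed
    then show ?thesis unfolding B_def observed_def y_def vec_eq_iff vec_lambda_beta vector_add_component by blast
  qed
  have "(\<integral>\<^sup>+\<omega>. \<psi> (signal_at P (Suc t) l x \<omega>) \<partial>M) = (\<integral>\<^sup>+\<omega>. \<psi> (B (masked_noise P (Suc t) l \<omega>)) \<partial>M)"
    by (simp add: signal_at_def B_def)
  also have "\<dots> = (\<integral>\<^sup>+v. \<psi> (B v) \<partial>distr M borel (masked_noise P (Suc t) l))"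
    by (subst nn_integral_distr) auto
  also have "\<dots> = (\<integral>\<^sup>+z. \<psi> (observed l m (y + z)) \<partial>std_normal_vec)"
    unfolding D by (subst nn_integral_distr) (auto simp: eq)
  also have "\<dots> = (\<integral>\<^sup>+z. ennreal (\<Prod>i\<in>UNIV. std_normal_density (z $ i)) * \<psi> (observed l m (y + z)) \<partial>lborel)"
    unfolding std_normal_vec_def by (subst nn_integral_density) auto
  also have "\<dots> = (\<integral>\<^sup>+z. \<psi> (observed l m (y + z)) * ennreal (lik l x (y + z)) \<partial>lborel)"
    by (simp add: lik_def y_def mult.commute)
  also have "\<dots> = (\<integral>\<^sup>+r. \<psi> (observed l m r) * ennreal (lik l x r) \<partial>lborel)"
    by (rule nn_integral_lborel_shift) measurable
  finally show ?thesis .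
qed

lemma measurable_posterior [measurable (raw)]:
  assumes "f \<in> borel_measurable N" "l \<in> borel_measurable N" "r \<in> borel_measurable N" "q \<in> borel_measurable N"
  shows "(\<lambda>x. posterior (f x) (l x) (r x) (q x)) \<in> borel_measurable N"
  by (intro measurable_continuous4[of posterior, OF _ assms] continuous_on_posterior continuous_intros)

lemma measurable_lik [measurable (raw)]:
  assumes "l \<in> borel_measurable N" "y \<in> borel_measurable N" "r \<in> borel_measurable N"
  shows "(\<lambda>x. lik (l x) (y x) (r x)) \<in> borel_measurable N"
  by (intro measurable_continuous4[of "\<lambda>a b c d. lik a b c", OF _ assms assms(1)] continuous_intros)

lemma measurable_fac [measurable (raw)]:
  "f \<in> borel_measurable N \<Longrightarrow> q \<in> borel_measurable N \<Longrightarrow> (\<lambda>x. fac (f x) (q x)) \<in> borel_measurable N"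
  by (intro measurable_continuous4[of "\<lambda>a b c d. fac a b" f N q q q] continuous_intros)

lemma measurable_pay [measurable (raw)]:
  "f \<in> borel_measurable N \<Longrightarrow> q \<in> borel_measurable N \<Longrightarrow> (\<lambda>x. pay (f x) (q x)) \<in> borel_measurable N"
  by (intro measurable_continuous4[of "\<lambda>a b c d. pay a b" f N q q q] continuous_intros)

lemma measurable_prec [measurable (raw)]:
  "l \<in> borel_measurable N \<Longrightarrow> (\<lambda>x. prec (l x)) \<in> borel_measurable N"
  by (rule borel_measurable_continuous_on[OF prec_continuous])

lemma measurable_observed [measurable (raw)]:
  assumes [measurable]: "l \<in> borel_measurable N" "m \<in> borel_measurable N" "r \<in> borel_measurable N"
  shows "(\<lambda>x. observed (l x) (m x) (r x)) \<in> borel_measurable N"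
  unfolding observed_def by measurable

lemma nn_integral_lik_evidence:
  "(\<integral>\<^sup>+q. ennreal (lik l (fac f q) r) \<partial>law (Suc t)) = ennreal (evidence f l r)"
  using nn_integral_wt[OF good_one, of 0 f l r] by (simp add: evidence_eq_mass[of _ _ _ 0] wt_def)

lemma lik_eq_posterior: "lik l (fac f q) r = posterior f l r q * evidence f l r"
  using evidence_pos[of f l r] by (simp add: posterior_def)

end

text \<open>Bridges the recursion, which freezes the state, and the policies, which do not. For the
  former, \<open>G\<close> is trivial and attention and factor are constants; for the latter,
  \<open>G\<close> is the information generated by the policy.\<close>

locale mv_information = mv_period P t for P :: "('w, 'n::finite, 'k::finite) market" and t +
  fixes G :: "'w measure" and l :: "'w \<Rightarrow> real^'k" and f :: "'w \<Rightarrow> real^'k"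
  assumes space_G [simp]: "space G = space M"
    and past_G: "sets G \<subseteq> sets (source_algebra (sources t))"
    and l_G [measurable]: "l \<in> borel_measurable G" and f_G [measurable]: "f \<in> borel_measurable G"
    and l_nonneg: "\<And>\<omega>. \<omega> \<in> space M \<Longrightarrow> l \<omega> \<in> nonneg_vecs"
begin

definition sig :: "'w \<Rightarrow> real^'k" where
  "sig \<omega> = signal_at P (Suc t) (l \<omega>) (next_factor P t (f \<omega>) \<omega>) \<omega>"

definition Y :: "'w \<Rightarrow> (real^'k) \<times> (real^'n)" where
  "Y \<omega> = (eta P (Suc t) \<omega>, eps P (Suc t) \<omega>)"

definition Gplus :: "'w measure" where
  "Gplus = sigma (space M) (sets G \<union> events_of M sig)"

text \<open>The signal in the scale of \<open>r\<close>. From \<open>observed l m r\<close> it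
  recovers \<open>visible l r\<close>, which is all that the posterior uses.\<close>

definition score :: "'w \<Rightarrow> real^'k" where
  "score \<omega> = (\<chi> j. prec (l \<omega>) $ j * sig \<omega> $ j)"

lemma G_subset_M: "sets G \<subseteq> sets M"
  using past_G source_algebra_subset[OF sources_mono[of t T]] t by auto

lemma subalgebra_G: "subalgebra M G"
  using G_subset_M by (simp add: subalgebra_def)

lemma measurable_id_G [measurable]: "(\<lambda>\<omega>. \<omega>) \<in> measurable M G"
  by (rule measurable_from_subalg[OF subalgebra_G]) simp

lemma measurable_Y [measurable]: "Y \<in> measurable M (law (Suc t))" "Y \<in> borel_measurable M"
  unfolding Y_def using measurable_noise_pair[OF Suc_t] by auto

lemma measurable_id_field [measurable]: "(\<lambda>\<omega>. \<omega>) \<in> measurable M (noise_field_algebra P (Suc t))"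
proof -
  have "Vfield (Suc t) \<in> sources T" using Suc_t by (auto simp: sources_def)
  from source_events_subset[OF this]
  have "subalgebra M (noise_field_algebra P (Suc t))" by (simp add: subalgebra_def)
  then show ?thesis by (rule measurable_from_subalg) simp
qed

lemma next_factor_eq: "next_factor P t (f \<omega>) \<omega> = fac (f \<omega>) (Y \<omega>)"
  by (simp add: next_factor_def fac_def Y_def)

lemma payoff_eq: "payoff_at P (Suc t) (next_factor P t (f \<omega>) \<omega>) \<omega> = pay (f \<omega>) (Y \<omega>)"
  by (simp add: payoff_at_def next_factor_eq pay_def) (simp add: Y_def)

lemma measurable_sig [measurable]: "sig \<in> borel_measurable M"
proof -
  have [measurable]: "l \<in> borel_measurable M" "f \<in> borel_measurable M" by auto
  have "(\<lambda>\<omega>. signal_at P (Suc t) (l \<omega>) (fac (f \<omega>) (Y \<omega>)) \<omega>) \<in> borel_measurable M"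
    by (rule measurable_signal_at[OF Suc_t _ _ measurable_id_field l_nonneg]) measurable
  then show ?thesis by (simp add: sig_def[abs_def] next_factor_eq)
qed

text \<open>The past, the period noises and the noise field come from disjoint groups of sources.
  The identity maps keep all of \<open>\<omega>\<close>, once seen through \<open>G\<close> and once
  through the field algebra, because a random attention selects from the whole field.\<close>

lemma joint_distr:
  "distr M (G \<Otimes>\<^sub>M (law (Suc t) \<Otimes>\<^sub>M noise_field_algebra P (Suc t))) (\<lambda>\<omega>. (\<omega>, (Y \<omega>, \<omega>)))
    = distr M G (\<lambda>\<omega>. \<omega>) \<Otimes>\<^sub>M (law (Suc t) \<Otimes>\<^sub>M distr M (noise_field_algebra P (Suc t)) (\<lambda>\<omega>. \<omega>))"
proof -
  let ?E = "{Eta (Suc t), Eps (Suc t)}" and ?V = "{Vfield (Suc t)}"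
  have Y: "Y \<in> measurable (source_algebra I) (law (Suc t))" if "?E \<subseteq> I" for I
  proof -
    have "Y \<in> borel_measurable (source_algebra I)"
      unfolding Y_def using that
      by (intro borel_measurable_Pair measurable_source(3)[OF _ refl] measurable_source(2)[OF _ refl]) auto
    then show ?thesis by (simp cong: measurable_cong_sets)
  qed
  have V: "(\<lambda>\<omega>. \<omega>) \<in> measurable (source_algebra I) (noise_field_algebra P (Suc t))" if "?V \<subseteq> I" for I
    using that by (intro measurable_source(4)[OF _ refl]) auto
  have G: "(\<lambda>\<omega>. \<omega>) \<in> measurable (source_algebra (sources t)) G"
    by (rule measurable_from_subalg[of _ G]) (use past_G in \<open>auto simp: subalgebra_def\<close>)
  have lawY: "distr M (law (Suc t)) Y = law (Suc t)"
    unfolding law_def Y_def by (intro distr_cong) auto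
  have "distr M (G \<Otimes>\<^sub>M (law (Suc t) \<Otimes>\<^sub>M noise_field_algebra P (Suc t))) (\<lambda>\<omega>. (\<omega>, (Y \<omega>, \<omega>)))
    = distr M G (\<lambda>\<omega>. \<omega>) \<Otimes>\<^sub>M distr M (law (Suc t) \<Otimes>\<^sub>M noise_field_algebra P (Suc t)) (\<lambda>\<omega>. (Y \<omega>, \<omega>))"
    using Suc_t t Y[of "?E \<union> ?V"] V[of "?E \<union> ?V"] G
    by (intro source_algebra_distr_pair[of "sources t" "?E \<union> ?V"] measurable_Pair) (auto simp: sources_def)
  also have "distr M (law (Suc t) \<Otimes>\<^sub>M noise_field_algebra P (Suc t)) (\<lambda>\<omega>. (Y \<omega>, \<omega>))
    = distr M (law (Suc t)) Y \<Otimes>\<^sub>M distr M (noise_field_algebra P (Suc t)) (\<lambda>\<omega>. \<omega>)"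
    using Suc_t Y[of ?E] V[of ?V] by (intro source_algebra_distr_pair[of ?E ?V]) (auto simp: sources_def)
  finally show ?thesis unfolding lawY .
qed

text \<open>The noises of the next period are independent of \<open>G\<close>, so the state can be frozen.\<close>

lemma freeze:
  fixes \<Psi> :: "'w \<Rightarrow> real^'k \<Rightarrow> (real^'k) \<times> (real^'n) \<Rightarrow> ennreal"
  assumes \<Psi>: "(\<lambda>(\<omega>, \<sigma>, q). \<Psi> \<omega> \<sigma> q) \<in> borel_measurable (G \<Otimes>\<^sub>M (borel \<Otimes>\<^sub>M law (Suc t)))"
  shows "(\<integral>\<^sup>+\<omega>. \<Psi> \<omega> (sig \<omega>) (Y \<omega>) \<partial>M) =
    (\<integral>\<^sup>+\<omega>. \<integral>\<^sup>+q. \<integral>\<^sup>+r. \<Psi> \<omega> (observed (l \<omega>) ((mat 1 - Phi P) *v f \<omega>) r) q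
        * ennreal (lik (l \<omega>) (fac (f \<omega>) q) r) \<partial>lborel \<partial>law (Suc t) \<partial>M)"
proof -
  let ?N = "noise_field_algebra P (Suc t)"
  let ?N' = "distr M ?N (\<lambda>\<omega>. \<omega>)"
  interpret GG: prob_space "distr M G (\<lambda>\<omega>. \<omega>)" by (rule prob_space_distr) measurable
  interpret NN: prob_space ?N' by (rule prob_space_distr) measurable
  interpret LN: pair_prob_space "law (Suc t)" ?N' ..
  have \<Psi>'[measurable (raw)]: "(\<lambda>z. \<Psi> (a z) (b z) (c z)) \<in> borel_measurable N"
    if "a \<in> measurable N G" "b \<in> borel_measurable N" "c \<in> measurable N (law (Suc t))"
    for a b c and N :: "'z measure"
    using measurable_compose[OF measurable_Pair[OF that(1) measurable_Pair[OF that(2,3)]] \<Psi>] by simp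
  have sg[measurable]: "(\<lambda>z. signal_at P (Suc t) (l (a z)) (fac (f (a z)) (b z)) (c z)) \<in> borel_measurable N"
    if [measurable]: "a \<in> measurable N G" "b \<in> borel_measurable N" "c \<in> measurable N ?N" for a b c and N :: "'z measure"
  proof (rule measurable_signal_at[OF Suc_t])
    fix z assume "z \<in> space N"
    with measurable_space[OF that(1)] have "a z \<in> space G" by blast
    then show "l (a z) \<in> nonneg_vecs" by (simp add: l_nonneg)
  qed measurable
  \<comment> \<open>\<open>H\<close> separates the three roles of \<open>\<omega>\<close>: the past,
    the period noise \<open>q\<close> and the point \<open>w\<close> of the noise field, which
    \<open>joint_distr\<close> makes independent.\<close>
  define H where "H = (\<lambda>(\<omega>, q, w). \<Psi> \<omega> (signal_at P (Suc t) (l \<omega>) (fac (f \<omega>) q) w) q)"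
  have mb: "measurable N (law (Suc t)) = borel_measurable N" for N :: "'z measure"
    by (rule measurable_cong_sets) auto
  have H: "H \<in> borel_measurable (G \<Otimes>\<^sub>M (law (Suc t) \<Otimes>\<^sub>M ?N))"
    unfolding H_def case_prod_beta
    by (intro \<Psi>' sg) (auto simp: mb[symmetric])
  then have H'[measurable]: "H \<in> borel_measurable (distr M G (\<lambda>\<omega>. \<omega>) \<Otimes>\<^sub>M (law (Suc t) \<Otimes>\<^sub>M ?N'))"
    by (simp cong: measurable_cong_sets sets_pair_measure_cong)
  have "(\<integral>\<^sup>+\<omega>. \<Psi> \<omega> (sig \<omega>) (Y \<omega>) \<partial>M) = (\<integral>\<^sup>+\<omega>. H (\<omega>, (Y \<omega>, \<omega>)) \<partial>M)"
    by (simp add: H_def sig_def next_factor_eq)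
  also have "\<dots> = (\<integral>\<^sup>+z. H z \<partial>distr M (G \<Otimes>\<^sub>M (law (Suc t) \<Otimes>\<^sub>M ?N)) (\<lambda>\<omega>. (\<omega>, (Y \<omega>, \<omega>))))"
    using H by (subst nn_integral_distr) auto
  also have "\<dots> = (\<integral>\<^sup>+\<omega>. \<integral>\<^sup>+z. H (\<omega>, z) \<partial>(law (Suc t) \<Otimes>\<^sub>M ?N') \<partial>distr M G (\<lambda>\<omega>. \<omega>))"
    unfolding joint_distr by (rule LN.nn_integral_fst[symmetric]) measurable
  also have "\<dots> = (\<integral>\<^sup>+\<omega>. \<integral>\<^sup>+z. H (\<omega>, z) \<partial>(law (Suc t) \<Otimes>\<^sub>M ?N') \<partial>M)"
    by (rule nn_integral_distr) measurable
  also have "\<dots> = (\<integral>\<^sup>+\<omega>. \<integral>\<^sup>+q. \<integral>\<^sup>+r. \<Psi> \<omega> (observed (l \<omega>) ((mat 1 - Phi P) *v f \<omega>) r) q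
        * ennreal (lik (l \<omega>) (fac (f \<omega>) q) r) \<partial>lborel \<partial>law (Suc t) \<partial>M)"
  proof (rule nn_integral_cong)
    fix \<omega> assume \<omega>: "\<omega> \<in> space M"
    then have Hw[measurable]: "(\<lambda>z. H (\<omega>, z)) \<in> borel_measurable (law (Suc t) \<Otimes>\<^sub>M ?N')"
      by (intro measurable_compose[OF _ H'] measurable_Pair1') simp
    have Hw2: "(\<lambda>w. H (\<omega>, q, w)) \<in> borel_measurable ?N" for q
      using measurable_compose[OF measurable_Pair1'[of q "law (Suc t)" ?N'] Hw] by (simp cong: measurable_cong_sets)
    have "(\<integral>\<^sup>+z. H (\<omega>, z) \<partial>(law (Suc t) \<Otimes>\<^sub>M ?N')) = (\<integral>\<^sup>+q. \<integral>\<^sup>+w. H (\<omega>, q, w) \<partial>?N' \<partial>law (Suc t))"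
      by (rule NN.nn_integral_fst[symmetric]) measurable
    also have "\<dots> = (\<integral>\<^sup>+q. \<integral>\<^sup>+w. H (\<omega>, q, w) \<partial>M \<partial>law (Suc t))"
      using Hw2 by (intro nn_integral_cong nn_integral_distr) auto
    also have "\<dots> = (\<integral>\<^sup>+q. \<integral>\<^sup>+r. \<Psi> \<omega> (observed (l \<omega>) ((mat 1 - Phi P) *v f \<omega>) r) q
        * ennreal (lik (l \<omega>) (fac (f \<omega>) q) r) \<partial>lborel \<partial>law (Suc t))"
    \<comment> \<open>Only almost every \<open>q\<close>: for \<open>signal_law\<close> to apply,
      the components of zero variance must equal their conditional mean.\<close>
    proof (rule nn_integral_cong_AE)
      show "AE q in law (Suc t). (\<integral>\<^sup>+w. H (\<omega>, q, w) \<partial>M) =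
        (\<integral>\<^sup>+r. \<Psi> \<omega> (observed (l \<omega>) ((mat 1 - Phi P) *v f \<omega>) r) q * ennreal (lik (l \<omega>) (fac (f \<omega>) q) r) \<partial>lborel)"
        using eta_degenerate[OF Suc_t]
      proof eventually_elim
        case (elim q)
        have [measurable]: "(\<lambda>\<sigma>. \<Psi> \<omega> \<sigma> q) \<in> borel_measurable borel"
          using \<omega> by (intro \<Psi>') auto
        show ?case
          unfolding H_def prod.case using elim
          by (intro signal_law[where \<psi>="\<lambda>\<sigma>. \<Psi> \<omega> \<sigma> q"] l_nonneg \<omega>) (auto simp: fac_def)
      qed
    qed
    finally show "(\<integral>\<^sup>+z. H (\<omega>, z) \<partial>(law (Suc t) \<Otimes>\<^sub>M ?N')) = (\<integral>\<^sup>+q. \<integral>\<^sup>+r. \<Psi> \<omega> (observed (l \<omega>) ((mat 1 - Phi P) *v f \<omega>) r) q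
        * ennreal (lik (l \<omega>) (fac (f \<omega>) q) r) \<partial>lborel \<partial>law (Suc t))" .
  qed
  finally show ?thesis .
qed

text \<open>Integrating the period noise out of the likelihood leaves \<open>evidence\<close>, which
  acts as the density of \<open>r\<close> given the state.\<close>

lemma freeze_signal:
  fixes \<Theta> :: "'w \<Rightarrow> real^'k \<Rightarrow> ennreal"
  assumes \<Theta>: "(\<lambda>(\<omega>, \<sigma>). \<Theta> \<omega> \<sigma>) \<in> borel_measurable (G \<Otimes>\<^sub>M borel)"
  shows "(\<integral>\<^sup>+\<omega>. \<Theta> \<omega> (sig \<omega>) \<partial>M) =
    (\<integral>\<^sup>+\<omega>. \<integral>\<^sup>+r. \<Theta> \<omega> (observed (l \<omega>) ((mat 1 - Phi P) *v f \<omega>) r) * ennreal (evidence (f \<omega>) (l \<omega>) r) \<partial>lborel \<partial>M)"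
proof -
  interpret lQ: pair_sigma_finite "lborel :: (real^'k) measure" "law (Suc t)" ..
  have \<Theta>'[measurable (raw)]: "(\<lambda>z. \<Theta> (a z) (b z)) \<in> borel_measurable N"
    if "a \<in> measurable N G" "b \<in> borel_measurable N" for a b and N :: "'z measure"
    using measurable_compose[OF measurable_Pair[OF that] \<Theta>] by simp
  have "(\<integral>\<^sup>+\<omega>. \<Theta> \<omega> (sig \<omega>) \<partial>M) = (\<integral>\<^sup>+\<omega>. \<integral>\<^sup>+q. \<integral>\<^sup>+r. \<Theta> \<omega> (observed (l \<omega>) ((mat 1 - Phi P) *v f \<omega>) r)
        * ennreal (lik (l \<omega>) (fac (f \<omega>) q) r) \<partial>lborel \<partial>law (Suc t) \<partial>M)"
    by (rule freeze[where \<Psi>="\<lambda>\<omega> \<sigma> q. \<Theta> \<omega> \<sigma>"]) measurable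
  also have "\<dots> = (\<integral>\<^sup>+\<omega>. \<integral>\<^sup>+r. \<Theta> \<omega> (observed (l \<omega>) ((mat 1 - Phi P) *v f \<omega>) r) * ennreal (evidence (f \<omega>) (l \<omega>) r) \<partial>lborel \<partial>M)"
  proof (rule nn_integral_cong)
    fix \<omega> assume \<omega>: "\<omega> \<in> space M"
    have [measurable]: "(\<lambda>r. \<Theta> \<omega> (observed (l \<omega>) ((mat 1 - Phi P) *v f \<omega>) r)) \<in> borel_measurable N"
      if [measurable]: "(\<lambda>r. r) \<in> borel_measurable N" for N
      using \<omega> by (intro \<Theta>') (auto intro!: measurable_observed)
    have [measurable]: "(\<lambda>r. \<Theta> \<omega> (observed (l \<omega>) ((mat 1 - Phi P) *v f \<omega>) r)) \<in> borel_measurable borel"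
      using \<omega> by (intro \<Theta>') (auto intro!: measurable_observed)
    have [measurable]: "(\<lambda>q. q) \<in> borel_measurable (law (Suc t))" by (simp cong: measurable_cong_sets)
    have "(\<integral>\<^sup>+q. \<integral>\<^sup>+r. \<Theta> \<omega> (observed (l \<omega>) ((mat 1 - Phi P) *v f \<omega>) r)
        * ennreal (lik (l \<omega>) (fac (f \<omega>) q) r) \<partial>lborel \<partial>law (Suc t)) =
       (\<integral>\<^sup>+r. \<integral>\<^sup>+q. \<Theta> \<omega> (observed (l \<omega>) ((mat 1 - Phi P) *v f \<omega>) r)
        * ennreal (lik (l \<omega>) (fac (f \<omega>) q) r) \<partial>law (Suc t) \<partial>lborel)"
      by (intro lQ.Fubini') measurable
    also have "\<dots> = (\<integral>\<^sup>+r. \<Theta> \<omega> (observed (l \<omega>) ((mat 1 - Phi P) *v f \<omega>) r) * ennreal (evidence (f \<omega>) (l \<omega>) r) \<partial>lborel)"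
      by (intro nn_integral_cong, subst nn_integral_cmult) (auto simp: nn_integral_lik_evidence)
    finally show "(\<integral>\<^sup>+q. \<integral>\<^sup>+r. \<Theta> \<omega> (observed (l \<omega>) ((mat 1 - Phi P) *v f \<omega>) r)
        * ennreal (lik (l \<omega>) (fac (f \<omega>) q) r) \<partial>lborel \<partial>law (Suc t)) =
       (\<integral>\<^sup>+r. \<Theta> \<omega> (observed (l \<omega>) ((mat 1 - Phi P) *v f \<omega>) r) * ennreal (evidence (f \<omega>) (l \<omega>) r) \<partial>lborel)" .
  qed
  finally show ?thesis .
qed

section \<open>Bayes' rule given the signal\<close>

lemma sets_Gplus: "sets Gplus = sigma_sets (space M) (sets G \<union> events_of M sig)"
  unfolding Gplus_def using sets.space_closed[of G] events_of_Pow[of M sig] by (intro sets_measure_of) auto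

lemma space_Gplus [simp]: "space Gplus = space M"
  by (simp add: Gplus_def space_measure_of_conv)

lemma G_subset_Gplus: "sets G \<subseteq> sets Gplus"
  unfolding sets_Gplus by (auto intro: sigma_sets.Basic)

lemma subalgebra_Gplus: "subalgebra M Gplus"
proof -
  have "sets Gplus \<subseteq> sets M"
    unfolding Gplus_def using G_subset_M events_of_subset[OF measurable_sig refl] by (intro sets_sigma_subset) auto
  then show ?thesis by (simp add: subalgebra_def)
qed

lemma measurable_G_Gplus: "g \<in> measurable G N \<Longrightarrow> g \<in> measurable Gplus N"
  by (rule measurable_from_subalg) (use G_subset_Gplus in \<open>auto simp: subalgebra_def\<close>)

lemma measurable_Gplus_M: "g \<in> measurable Gplus N \<Longrightarrow> g \<in> measurable M N"
  by (rule measurable_from_subalg[OF subalgebra_Gplus])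

lemma measurable_id_Gplus [measurable]: "(\<lambda>\<omega>. \<omega>) \<in> measurable M Gplus"
  by (rule measurable_Gplus_M) simp

lemma sig_Gplus [measurable]: "sig \<in> borel_measurable Gplus"
  unfolding Gplus_def using sets.space_closed[of G] events_of_Pow[of M sig]
  by (intro measurable_sigma_events) auto

lemma l_f_Gplus [measurable]: "l \<in> borel_measurable Gplus" "f \<in> borel_measurable Gplus"
  by (auto intro: measurable_G_Gplus)

lemma score_Gplus [measurable]: "score \<in> borel_measurable Gplus"
  unfolding score_def by measurable

text \<open>The preimages under \<open>\<lambda>\<omega>. (\<omega>, sig \<omega>)\<close> form a
  sigma-algebra that contains both generating families. This brings the events of
  \<open>Gplus\<close> into the form on which \<open>freeze\<close> operates.\<close>

lemma Gplus_factor: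
  assumes "A \<in> sets Gplus"
  shows "\<exists>A'\<in>sets (G \<Otimes>\<^sub>M borel). A = {\<omega>\<in>space M. (\<omega>, sig \<omega>) \<in> A'}"
proof -
  let ?V = "vimage_algebra (space M) (\<lambda>\<omega>. (\<omega>, sig \<omega>)) (G \<Otimes>\<^sub>M borel)"
  have sp: "(\<lambda>\<omega>. (\<omega>, sig \<omega>)) \<in> space M \<rightarrow> space (G \<Otimes>\<^sub>M (borel :: (real^'k) measure))"
    by (auto simp: space_pair_measure)
  have "sets G \<union> events_of M sig \<subseteq> sets ?V"
  proof (intro Un_least subsetI)
    fix B assume B: "B \<in> sets G"
    have "B = (\<lambda>\<omega>. (\<omega>, sig \<omega>)) -` (B \<times> UNIV) \<inter> space M"
      using sets.sets_into_space[OF B] by auto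
    moreover have "B \<times> UNIV \<in> sets (G \<Otimes>\<^sub>M (borel :: (real^'k) measure))"
      using B by (intro pair_measureI) auto
    ultimately show "B \<in> sets ?V"
      unfolding sets_vimage_algebra2[OF sp] by (intro CollectI exI[of _ "B \<times> UNIV"] conjI)
  next
    fix B assume "B \<in> events_of M sig"
    then obtain C where C: "C \<in> sets borel" "B = sig -` C \<inter> space M" by (auto simp: events_of_def)
    have "B = (\<lambda>\<omega>. (\<omega>, sig \<omega>)) -` (space G \<times> C) \<inter> space M" by (auto simp: C)
    moreover have "space G \<times> C \<in> sets (G \<Otimes>\<^sub>M (borel :: (real^'k) measure))"
      using C sets.top[of G] by (intro pair_measureI)
    ultimately show "B \<in> sets ?V"
      unfolding sets_vimage_algebra2[OF sp] by (intro CollectI exI[of _ "space G \<times> C"] conjI)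
  qed
  then have "sets Gplus \<subseteq> sets ?V"
    unfolding Gplus_def by (intro sets_sigma_subset) simp_all
  with assms have "A \<in> sets ?V" by auto
  then show ?thesis unfolding sets_vimage_algebra2[OF sp] by auto
qed

lemma visible_observed: "(\<chi> j. prec l' $ j * observed l' m r $ j) = visible l' r"
  by (simp add: observed_def visible_def vec_eq_iff)

definition kern :: "'w \<Rightarrow> (real^'k) \<times> (real^'n) \<Rightarrow> real" where
  "kern \<omega> q = posterior (f \<omega>) (l \<omega>) (score \<omega>) q"

lemma measurable_kern: "(\<lambda>(\<omega>, q). kern \<omega> q) \<in> borel_measurable (Gplus \<Otimes>\<^sub>M law (Suc t))"
  unfolding kern_def by measurable

text \<open>Freezing the state turns the left side into an integral against the likelihood, which
  factors into posterior and evidence. Freezing in the opposite direction restores the actual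
  signal.\<close>

lemma bayes_rectangle:
  assumes A: "A \<in> sets Gplus" and B[measurable]: "B \<in> sets (law (Suc t))"
  shows "(\<integral>\<^sup>+\<omega>. indicator A \<omega> * indicator B (Y \<omega>) \<partial>M)
    = (\<integral>\<^sup>+\<omega>. indicator A \<omega> * (\<integral>\<^sup>+q. indicator B q * ennreal (kern \<omega> q) \<partial>law (Suc t)) \<partial>M)"
proof -
  interpret lQ: pair_sigma_finite "lborel :: (real^'k) measure" "law (Suc t)" ..
  obtain A' where A'[measurable]: "A' \<in> sets (G \<Otimes>\<^sub>M borel)" and AA: "A = {\<omega>\<in>space M. (\<omega>, sig \<omega>) \<in> A'}"
    using Gplus_factor[OF A] by blast
  let ?ob = "\<lambda>\<omega> r. observed (l \<omega>) ((mat 1 - Phi P) *v f \<omega>) r"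
  let ?K = "\<lambda>\<omega> r. \<integral>\<^sup>+q. indicator B q * ennreal (posterior (f \<omega>) (l \<omega>) r q) \<partial>law (Suc t)"
  have "(\<integral>\<^sup>+\<omega>. indicator A \<omega> * indicator B (Y \<omega>) \<partial>M)
      = (\<integral>\<^sup>+\<omega>. indicator A' (\<omega>, sig \<omega>) * indicator B (Y \<omega>) \<partial>M)"
    by (intro nn_integral_cong) (auto simp: AA split: split_indicator)
  also have "\<dots> = (\<integral>\<^sup>+\<omega>. \<integral>\<^sup>+q. \<integral>\<^sup>+r. indicator A' (\<omega>, ?ob \<omega> r) * indicator B q
        * ennreal (lik (l \<omega>) (fac (f \<omega>) q) r) \<partial>lborel \<partial>law (Suc t) \<partial>M)"
    by (rule freeze[where \<Psi>="\<lambda>\<omega> \<sigma> q. indicator A' (\<omega>, \<sigma>) * indicator B q"]) measurable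
  also have "\<dots> = (\<integral>\<^sup>+\<omega>. \<integral>\<^sup>+r. indicator A' (\<omega>, ?ob \<omega> r) * ?K \<omega> r * ennreal (evidence (f \<omega>) (l \<omega>) r) \<partial>lborel \<partial>M)"
  proof (rule nn_integral_cong)
    fix \<omega> assume \<omega>: "\<omega> \<in> space M"
    then have [measurable]: "Pair \<omega> \<in> measurable borel (G \<Otimes>\<^sub>M (borel :: (real^'k) measure))" by simp
    have "{\<sigma>. (\<omega>, \<sigma>) \<in> A'} \<in> sets borel"
      using sets_Pair1[OF A', of \<omega>] by (simp add: vimage_def)
    then have [measurable]: "Measurable.pred borel (\<lambda>\<sigma>. (\<omega>, \<sigma>) \<in> A')" by (simp add: pred_def)
    have "(\<integral>\<^sup>+q. \<integral>\<^sup>+r. indicator A' (\<omega>, ?ob \<omega> r) * indicator B q * ennreal (lik (l \<omega>) (fac (f \<omega>) q) r) \<partial>lborel \<partial>law (Suc t))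
      = (\<integral>\<^sup>+r. \<integral>\<^sup>+q. indicator A' (\<omega>, ?ob \<omega> r) * indicator B q * ennreal (lik (l \<omega>) (fac (f \<omega>) q) r) \<partial>law (Suc t) \<partial>lborel)"
      unfolding indicator_def[of A'] by (intro lQ.Fubini') measurable
    also have "\<dots> = (\<integral>\<^sup>+r. indicator A' (\<omega>, ?ob \<omega> r) * ?K \<omega> r * ennreal (evidence (f \<omega>) (l \<omega>) r) \<partial>lborel)"
    proof (rule nn_integral_cong)
      fix r
      have "(\<integral>\<^sup>+q. indicator A' (\<omega>, ?ob \<omega> r) * indicator B q * ennreal (lik (l \<omega>) (fac (f \<omega>) q) r) \<partial>law (Suc t))
        = (\<integral>\<^sup>+q. (indicator A' (\<omega>, ?ob \<omega> r) * ennreal (evidence (f \<omega>) (l \<omega>) r)) * (indicator B q * ennreal (posterior (f \<omega>) (l \<omega>) r q)) \<partial>law (Suc t))"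
        by (intro nn_integral_cong) (simp add: lik_eq_posterior ennreal_mult less_imp_le[OF posterior_pos] less_imp_le[OF evidence_pos] mult_ac)
      also have "\<dots> = (indicator A' (\<omega>, ?ob \<omega> r) * ennreal (evidence (f \<omega>) (l \<omega>) r)) * ?K \<omega> r"
        by (rule nn_integral_cmult) measurable
      finally show "(\<integral>\<^sup>+q. indicator A' (\<omega>, ?ob \<omega> r) * indicator B q * ennreal (lik (l \<omega>) (fac (f \<omega>) q) r) \<partial>law (Suc t))
        = indicator A' (\<omega>, ?ob \<omega> r) * ?K \<omega> r * ennreal (evidence (f \<omega>) (l \<omega>) r)"
        by (simp add: mult_ac)
    qed
    finally show "(\<integral>\<^sup>+q. \<integral>\<^sup>+r. indicator A' (\<omega>, ?ob \<omega> r) * indicator B q * ennreal (lik (l \<omega>) (fac (f \<omega>) q) r) \<partial>lborel \<partial>law (Suc t))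
      = (\<integral>\<^sup>+r. indicator A' (\<omega>, ?ob \<omega> r) * ?K \<omega> r * ennreal (evidence (f \<omega>) (l \<omega>) r) \<partial>lborel)" .
  qed
  also have "\<dots> = (\<integral>\<^sup>+\<omega>. indicator A' (\<omega>, sig \<omega>) * ?K \<omega> (score \<omega>) \<partial>M)"
  proof -
    \<comment> \<open>At \<open>observed\<close>, the score equals \<open>visible\<close>, and by
      \<open>posterior_visible\<close> the posterior there is the one at \<open>r\<close>.\<close>
    have "(\<integral>\<^sup>+\<omega>. indicator A' (\<omega>, sig \<omega>) * ?K \<omega> (\<chi> j. prec (l \<omega>) $ j * sig \<omega> $ j) \<partial>M)
      = (\<integral>\<^sup>+\<omega>. \<integral>\<^sup>+r. indicator A' (\<omega>, ?ob \<omega> r) * ?K \<omega> (\<chi> j. prec (l \<omega>) $ j * ?ob \<omega> r $ j)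
          * ennreal (evidence (f \<omega>) (l \<omega>) r) \<partial>lborel \<partial>M)"
      by (rule freeze_signal[where \<Theta>="\<lambda>\<omega> \<sigma>. indicator A' (\<omega>, \<sigma>) * ?K \<omega> (\<chi> j. prec (l \<omega>) $ j * \<sigma> $ j)"]) measurable
    then show ?thesis by (simp add: visible_observed posterior_visible score_def)
  qed
  also have "\<dots> = (\<integral>\<^sup>+\<omega>. indicator A \<omega> * ?K \<omega> (score \<omega>) \<partial>M)"
    by (intro nn_integral_cong) (auto simp: AA split: split_indicator)
  finally show ?thesis by (simp add: kern_def)
qed

text \<open>The joint law \<open>m1\<close> of past, signal and period noise and the reweighted
  product \<open>m2\<close> agree on rectangles, an intersection stable generator, and are finite.
  Hence they coincide and integrate every nonnegative measurable function alike.\<close>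

lemma bayes:
  assumes \<Phi>: "case_prod \<Phi> \<in> borel_measurable (Gplus \<Otimes>\<^sub>M law (Suc t))"
  shows "(\<integral>\<^sup>+\<omega>. \<Phi> \<omega> (Y \<omega>) \<partial>M) = (\<integral>\<^sup>+\<omega>. \<integral>\<^sup>+q. \<Phi> \<omega> q * ennreal (kern \<omega> q) \<partial>law (Suc t) \<partial>M)"
proof -
  let ?G = "distr M Gplus (\<lambda>\<omega>. \<omega>)"
  let ?N = "Gplus \<Otimes>\<^sub>M law (Suc t)"
  define m1 where "m1 = distr M ?N (\<lambda>\<omega>. (\<omega>, Y \<omega>))"
  define m2 where "m2 = density (?G \<Otimes>\<^sub>M law (Suc t)) (\<lambda>(\<omega>, q). ennreal (kern \<omega> q))"
  have sN: "sets (?G \<Otimes>\<^sub>M law (Suc t)) = sets ?N" by (rule sets_pair_measure_cong) simp_all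
  note [measurable] = measurable_kern
  have kG[measurable]: "(\<lambda>(\<omega>, q). ennreal (kern \<omega> q)) \<in> borel_measurable (?G \<Otimes>\<^sub>M law (Suc t))"
    using measurable_compose[OF measurable_kern, of ennreal borel]
    by (simp add: case_prod_beta measurable_cong_sets[OF sN refl])
  have rect: "emeasure m1 (A \<times> B) = emeasure m2 (A \<times> B)" if A[measurable]: "A \<in> sets Gplus" and B[measurable]: "B \<in> sets (law (Suc t))" for A B
  proof -
    have AM[measurable]: "A \<in> sets M" using A subalgebra_Gplus by (auto simp: subalgebra_def)
    have "emeasure m1 (A \<times> B) = (\<integral>\<^sup>+z. indicator (A \<times> B) z \<partial>m1)"
      by (rule nn_integral_indicator[symmetric]) (unfold m1_def sets_distr, rule pair_measureI[OF A B])
    also have "\<dots> = (\<integral>\<^sup>+\<omega>. indicator A \<omega> * indicator B (Y \<omega>) \<partial>M)"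
      unfolding m1_def by (subst nn_integral_distr) (auto simp: indicator_times)
    also have "\<dots> = (\<integral>\<^sup>+\<omega>. indicator A \<omega> * (\<integral>\<^sup>+q. indicator B q * ennreal (kern \<omega> q) \<partial>law (Suc t)) \<partial>M)"
      by (rule bayes_rectangle[OF A B])
    also have "\<dots> = (\<integral>\<^sup>+\<omega>. indicator A \<omega> * (\<integral>\<^sup>+q. indicator B q * ennreal (kern \<omega> q) \<partial>law (Suc t)) \<partial>?G)"
      by (subst nn_integral_distr) auto
    also have "\<dots> = (\<integral>\<^sup>+\<omega>. (\<integral>\<^sup>+q. ennreal (kern \<omega> q) * indicator (A \<times> B) (\<omega>, q) \<partial>law (Suc t)) \<partial>?G)"
      by (intro nn_integral_cong) (auto split: split_indicator simp: mult.commute intro!: nn_integral_cong)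
    also have "\<dots> = (\<integral>\<^sup>+z. (\<lambda>(\<omega>, q). ennreal (kern \<omega> q)) z * indicator (A \<times> B) z \<partial>(?G \<Otimes>\<^sub>M law (Suc t)))"
      by (subst law.nn_integral_fst[symmetric]) (auto simp: case_prod_beta)
    also have "\<dots> = emeasure m2 (A \<times> B)"
      unfolding m2_def by (rule emeasure_density[symmetric, OF kG]) (unfold sN, rule pair_measureI[OF A B])
    finally show ?thesis .
  qed
  have "m1 = m2"
  proof (rule measure_eqI_generator_eq[OF Int_stable_pair_measure_generator[of Gplus "law (Suc t)"], where A="\<lambda>_. space Gplus \<times> space (law (Suc t))"])
    show "{a \<times> b | a b. a \<in> sets Gplus \<and> b \<in> sets (law (Suc t))} \<subseteq> Pow (space Gplus \<times> space (law (Suc t)))"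
      by (rule pair_measure_closed)
    show "range (\<lambda>_::nat. space Gplus \<times> space (law (Suc t))) \<subseteq> {a \<times> b | a b. a \<in> sets Gplus \<and> b \<in> sets (law (Suc t))}"
      by (rule image_subsetI, rule CollectI, intro exI conjI, rule refl) (rule sets.top)+
    show "(\<Union>i::nat. space Gplus \<times> space (law (Suc t))) = space Gplus \<times> space (law (Suc t))" by simp
    show "emeasure m1 X = emeasure m2 X" if "X \<in> {a \<times> b | a b. a \<in> sets Gplus \<and> b \<in> sets (law (Suc t))}" for X
      using that rect by auto
    show "sets m1 = sigma_sets (space Gplus \<times> space (law (Suc t))) {a \<times> b | a b. a \<in> sets Gplus \<and> b \<in> sets (law (Suc t))}"
      by (simp add: m1_def sets_pair_measure)
    show "sets m2 = sigma_sets (space Gplus \<times> space (law (Suc t))) {a \<times> b | a b. a \<in> sets Gplus \<and> b \<in> sets (law (Suc t))}"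
      unfolding m2_def sets_density sN by (simp add: sets_pair_measure)
    interpret m1: prob_space m1 unfolding m1_def by (rule prob_space_distr) measurable
    show "emeasure m1 (space Gplus \<times> space (law (Suc t))) \<noteq> \<infinity>" by simp
  qed
  have \<Phi>'[measurable]: "case_prod \<Phi> \<in> borel_measurable (?G \<Otimes>\<^sub>M law (Suc t))"
    using \<Phi> by (simp add: measurable_cong_sets[OF sN refl])
  have [measurable]: "(\<lambda>\<omega>. \<integral>\<^sup>+q. \<Phi> \<omega> q * ennreal (kern \<omega> q) \<partial>law (Suc t)) \<in> borel_measurable Gplus"
    using \<Phi> by measurable
  have "(\<integral>\<^sup>+\<omega>. \<Phi> \<omega> (Y \<omega>) \<partial>M) = (\<integral>\<^sup>+z. case_prod \<Phi> z \<partial>m1)"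
    unfolding m1_def using \<Phi> by (subst nn_integral_distr) auto
  also have "\<dots> = (\<integral>\<^sup>+z. (\<lambda>(\<omega>, q). ennreal (kern \<omega> q)) z * case_prod \<Phi> z \<partial>(?G \<Otimes>\<^sub>M law (Suc t)))"
    unfolding \<open>m1 = m2\<close> m2_def by (rule nn_integral_density) measurable
  also have "\<dots> = (\<integral>\<^sup>+\<omega>. \<integral>\<^sup>+q. \<Phi> \<omega> q * ennreal (kern \<omega> q) \<partial>law (Suc t) \<partial>?G)"
    by (subst law.nn_integral_fst[symmetric]) (auto simp: case_prod_beta mult.commute)
  also have "\<dots> = (\<integral>\<^sup>+\<omega>. \<integral>\<^sup>+q. \<Phi> \<omega> q * ennreal (kern \<omega> q) \<partial>law (Suc t) \<partial>M)"
    by (rule nn_integral_distr) measurable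
  finally show ?thesis .
qed

sublocale bayes: cond_kernel M Gplus "law (Suc t)" Y kern
proof
  show "subalgebra M Gplus" by (rule subalgebra_Gplus)
  show "0 \<le> kern \<omega> q" for \<omega> q by (simp add: kern_def less_imp_le posterior_pos)
qed (use measurable_kern bayes law.prob_space_axioms in auto)

section \<open>Conditional moments and the one-step inequality\<close>

definition ev :: "'w \<Rightarrow> real" where
  "ev \<omega> = evidence (f \<omega>) (l \<omega>) (score \<omega>)"

lemma ev_pos: "0 < ev \<omega>" by (simp add: ev_def evidence_pos)

lemma kern_wt: "g L (fac (f \<omega>) q) * kern \<omega> q = wt g L (f \<omega>) (l \<omega>) (score \<omega>) q / ev \<omega>"
  unfolding kern_def ev_def by (rule wt_posterior)

lemma measurable_good:
  assumes "good g" "L \<in> borel_measurable N" "y \<in> borel_measurable N"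
  shows "(\<lambda>x. g (L x) (y x)) \<in> borel_measurable N"
proof -
  have "continuous_on UNIV (\<lambda>(L, x). g L x)" using assms(1) by (simp add: good_def)
  from borel_measurable_continuous_on[OF this, of "\<lambda>x. (L x, y x)" N] assms(2,3)
  show ?thesis by (simp add: borel_measurable_Pair)
qed

text \<open>Multiplying the kernel by the next value function gives \<open>wt\<close> divided by
  \<open>ev\<close>, so each conditional moment is an unnormalized one divided by the same
  evidence.\<close>

lemma cond_moderate:
  assumes g: "good g" and \<phi>: "moderate \<phi>" and [measurable]: "L \<in> borel_measurable Gplus"
  shows "AE \<omega> in M. real_cond_exp M Gplus (\<lambda>\<omega>. g (L \<omega>) (fac (f \<omega>) (Y \<omega>)) * \<phi> (f \<omega>) (Y \<omega>)) \<omega>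
    = (\<integral>q. wt g (L \<omega>) (f \<omega>) (l \<omega>) (score \<omega>) q * \<phi> (f \<omega>) q \<partial>law (Suc t)) / ev \<omega>"
proof -
  have \<phi>m: "(\<lambda>x. \<phi> (a x) (b x)) \<in> borel_measurable N" if "a \<in> borel_measurable N" "b \<in> borel_measurable N" for a b N
  proof -
    have "continuous_on UNIV (\<lambda>(f, q). \<phi> f q)" using \<phi> by (simp add: moderate_def)
    from borel_measurable_continuous_on[OF this, of "\<lambda>x. (a x, b x)" N] that
    show ?thesis by (simp add: borel_measurable_Pair)
  qed
  have eq: "g (L \<omega>) (fac (f \<omega>) q) * \<phi> (f \<omega>) q * kern \<omega> q
      = wt g (L \<omega>) (f \<omega>) (l \<omega>) (score \<omega>) q * \<phi> (f \<omega>) q / ev \<omega>" for \<omega> q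
    using kern_wt[of g "L \<omega>" \<omega> q] by (simp add: mult_ac)
  have "AE \<omega> in M. real_cond_exp M Gplus (\<lambda>\<omega>. g (L \<omega>) (fac (f \<omega>) (Y \<omega>)) * \<phi> (f \<omega>) (Y \<omega>)) \<omega>
    = (\<integral>q. g (L \<omega>) (fac (f \<omega>) q) * \<phi> (f \<omega>) q * kern \<omega> q \<partial>law (Suc t))"
  proof (rule bayes.real_cond_exp_kernel[of "\<lambda>\<omega> q. g (L \<omega>) (fac (f \<omega>) q) * \<phi> (f \<omega>) q"])
    have [measurable]: "(\<lambda>z. g (L (fst z)) (fac (f (fst z)) (snd z))) \<in> borel_measurable (Gplus \<Otimes>\<^sub>M law (Suc t))"
      by (rule measurable_good[OF g]) measurable
    have [measurable]: "(\<lambda>z. \<phi> (f (fst z)) (snd z)) \<in> borel_measurable (Gplus \<Otimes>\<^sub>M law (Suc t))"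
      by (rule \<phi>m) measurable
    show "(\<lambda>(\<omega>, q). g (L \<omega>) (fac (f \<omega>) q) * \<phi> (f \<omega>) q) \<in> borel_measurable (Gplus \<Otimes>\<^sub>M law (Suc t))"
      unfolding case_prod_beta by measurable
    show "integrable (law (Suc t)) (\<lambda>q. g (L \<omega>) (fac (f \<omega>) q) * \<phi> (f \<omega>) q * kern \<omega> q)" for \<omega>
      unfolding eq by (intro integrable_divide_zero integrable_moderate g \<phi>)
  qed
  then show ?thesis unfolding eq by simp
qed

lemma cond_weight:
  assumes "good g" "L \<in> borel_measurable Gplus"
  shows "AE \<omega> in M. real_cond_exp M Gplus (\<lambda>\<omega>. g (L \<omega>) (fac (f \<omega>) (Y \<omega>))) \<omega>
    = mass g (L \<omega>) (f \<omega>) (l \<omega>) (score \<omega>) / ev \<omega>"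
  using cond_moderate[OF assms(1) moderate_1 assms(2)] by (simp add: mass_def)

lemma cond_vec_weighted:
  assumes "good g" "L \<in> borel_measurable Gplus"
  shows "AE \<omega> in M. cond_vec M Gplus (\<lambda>\<omega>. g (L \<omega>) (fac (f \<omega>) (Y \<omega>)) *\<^sub>R pay (f \<omega>) (Y \<omega>)) \<omega>
    = (1 / ev \<omega>) *\<^sub>R mvec g (L \<omega>) (f \<omega>) (l \<omega>) (score \<omega>)"
proof -
  have "AE \<omega> in M. \<forall>i\<in>UNIV. real_cond_exp M Gplus (\<lambda>\<omega>. g (L \<omega>) (fac (f \<omega>) (Y \<omega>)) * pay (f \<omega>) (Y \<omega>) $ i) \<omega>
    = (\<integral>q. wt g (L \<omega>) (f \<omega>) (l \<omega>) (score \<omega>) q * pay (f \<omega>) q $ i \<partial>law (Suc t)) / ev \<omega>"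
    by (intro AE_finite_allI finite cond_moderate moderate_pay assms)
  then show ?thesis
    by eventually_elim (simp add: cond_vec_def mvec_def vec_eq_iff)
qed

lemma cond_mat_weighted:
  assumes "good g" "L \<in> borel_measurable Gplus"
  shows "AE \<omega> in M. cond_mat M Gplus (\<lambda>\<omega>. g (L \<omega>) (fac (f \<omega>) (Y \<omega>)) *\<^sub>R outer (pay (f \<omega>) (Y \<omega>))) \<omega>
    = (1 / ev \<omega>) *\<^sub>R mmat g (L \<omega>) (f \<omega>) (l \<omega>) (score \<omega>)"
proof -
  have "AE \<omega> in M. \<forall>i\<in>UNIV. \<forall>j\<in>UNIV. real_cond_exp M Gplus (\<lambda>\<omega>. g (L \<omega>) (fac (f \<omega>) (Y \<omega>)) * (pay (f \<omega>) (Y \<omega>) $ i * pay (f \<omega>) (Y \<omega>) $ j)) \<omega>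
    = (\<integral>q. wt g (L \<omega>) (f \<omega>) (l \<omega>) (score \<omega>) q * (pay (f \<omega>) q $ i * pay (f \<omega>) q $ j) \<partial>law (Suc t)) / ev \<omega>"
    by (intro AE_finite_allI finite cond_moderate moderate_pay2 assms)
  then show ?thesis
    by eventually_elim (simp add: cond_mat_def mmat_def outer_def vec_eq_iff)
qed

lemma weighted_hedge:
  assumes "good g"
  shows "invertible ((1 / ev \<omega>) *\<^sub>R mmat g L (f \<omega>) (l \<omega>) (score \<omega>))"
    "matrix_inv ((1 / ev \<omega>) *\<^sub>R mmat g L (f \<omega>) (l \<omega>) (score \<omega>)) *v ((1 / ev \<omega>) *\<^sub>R mvec g L (f \<omega>) (l \<omega>) (score \<omega>))
      = hedge g L (f \<omega>) (l \<omega>) (score \<omega>)"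
  unfolding hedge_def using ev_pos[of \<omega>]
  by (auto intro!: pos_def_matrix_invertible pos_def_matrix_scaleR pos_def_mmat matrix_inv_scale_cancel assms
      simp del: scaleR_conv_of_real)

lemma measurable_gain_residual:
  assumes "good g"
  shows "L \<in> borel_measurable N \<Longrightarrow> a \<in> borel_measurable N \<Longrightarrow> b \<in> borel_measurable N \<Longrightarrow> r \<in> borel_measurable N \<Longrightarrow>
      (\<lambda>x. gain g (L x) (a x) (b x) (r x)) \<in> borel_measurable N"
    "L \<in> borel_measurable N \<Longrightarrow> a \<in> borel_measurable N \<Longrightarrow> b \<in> borel_measurable N \<Longrightarrow>
      (\<lambda>x. residual g (L x) (a x) (b x)) \<in> borel_measurable N"
    "L \<in> borel_measurable N \<Longrightarrow> a \<in> borel_measurable N \<Longrightarrow> b \<in> borel_measurable N \<Longrightarrow> r \<in> borel_measurable N \<Longrightarrow>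
      (\<lambda>x. hedge g (L x) (a x) (b x) (r x)) \<in> borel_measurable N"
proof -
  show "L \<in> borel_measurable N \<Longrightarrow> a \<in> borel_measurable N \<Longrightarrow> b \<in> borel_measurable N \<Longrightarrow> r \<in> borel_measurable N \<Longrightarrow>
      (\<lambda>x. gain g (L x) (a x) (b x) (r x)) \<in> borel_measurable N"
    by (rule measurable_continuous4[of "gain g"], intro continuous_on_gain assms continuous_intros)
  show "L \<in> borel_measurable N \<Longrightarrow> a \<in> borel_measurable N \<Longrightarrow> b \<in> borel_measurable N \<Longrightarrow> r \<in> borel_measurable N \<Longrightarrow>
      (\<lambda>x. hedge g (L x) (a x) (b x) (r x)) \<in> borel_measurable N"
    by (rule measurable_continuous4[of "hedge g"], intro continuous_on_hedge assms continuous_intros)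
  show "L \<in> borel_measurable N \<Longrightarrow> a \<in> borel_measurable N \<Longrightarrow> b \<in> borel_measurable N \<Longrightarrow>
      (\<lambda>x. residual g (L x) (a x) (b x)) \<in> borel_measurable N"
    by (rule measurable_continuous4[of "\<lambda>a b c d. residual g a b c" L N a b b], intro continuous_on_residual assms continuous_intros)
qed

text \<open>Averaging over the signal multiplies \<open>gain / ev\<close> by the density
  \<open>evidence\<close>. The two evidences differ by the scale of the pure noise coordinates, and
  by \<open>gain_visible\<close> this is just the scale that \<open>gain\<close> lacks. The factor
  \<open>W\<close> later is the indicator of an event known at time 0.\<close>

lemma expected_gain:
  assumes g: "good g" and [measurable]: "L \<in> borel_measurable G" "W \<in> borel_measurable G"
  shows "(\<integral>\<^sup>+\<omega>. W \<omega> * ennreal (gain g (L \<omega>) (f \<omega>) (l \<omega>) (score \<omega>) / ev \<omega>) \<partial>M)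
    = (\<integral>\<^sup>+\<omega>. W \<omega> * ennreal (residual g (L \<omega>) (f \<omega>) (l \<omega>)) \<partial>M)"
proof -
  note [measurable (raw)] = measurable_gain_residual[OF g]
  have [measurable (raw)]: "(\<lambda>x. evidence (a x) (b x) (r x)) \<in> borel_measurable N"
    if "a \<in> borel_measurable N" "b \<in> borel_measurable N" "r \<in> borel_measurable N" for a b r and N :: "'z measure"
    by (rule measurable_continuous4[of "\<lambda>a b c d. evidence a b c" a N b r r, OF _ that that(3)])
       (intro continuous_on_evidence continuous_intros)
  let ?ob = "\<lambda>\<omega> r. observed (l \<omega>) ((mat 1 - Phi P) *v f \<omega>) r"
  let ?S = "\<lambda>\<omega> \<sigma>. (\<chi> j. prec (l \<omega>) $ j * \<sigma> $ j)"
  have "(\<integral>\<^sup>+\<omega>. W \<omega> * ennreal (gain g (L \<omega>) (f \<omega>) (l \<omega>) (?S \<omega> (sig \<omega>)) / evidence (f \<omega>) (l \<omega>) (?S \<omega> (sig \<omega>))) \<partial>M)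
    = (\<integral>\<^sup>+\<omega>. \<integral>\<^sup>+r. W \<omega> * ennreal (gain g (L \<omega>) (f \<omega>) (l \<omega>) (?S \<omega> (?ob \<omega> r)) / evidence (f \<omega>) (l \<omega>) (?S \<omega> (?ob \<omega> r)))
        * ennreal (evidence (f \<omega>) (l \<omega>) r) \<partial>lborel \<partial>M)"
    by (rule freeze_signal[where \<Theta>="\<lambda>\<omega> \<sigma>. W \<omega> * ennreal (gain g (L \<omega>) (f \<omega>) (l \<omega>) (?S \<omega> \<sigma>) / evidence (f \<omega>) (l \<omega>) (?S \<omega> \<sigma>))"])
       measurable
  also have "\<dots> = (\<integral>\<^sup>+\<omega>. \<integral>\<^sup>+r. W \<omega> * ennreal (gain g (L \<omega>) (f \<omega>) (l \<omega>) r) \<partial>lborel \<partial>M)"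
  proof (intro nn_integral_cong)
    fix \<omega> r
    have e: "evidence (f \<omega>) (l \<omega>) r = noise_scale (l \<omega>) r * evidence (f \<omega>) (l \<omega>) (visible (l \<omega>) r)"
      unfolding evidence_eq_mass[of _ _ _ 0] by (rule mass_visible)
    have "gain g (L \<omega>) (f \<omega>) (l \<omega>) (visible (l \<omega>) r) / evidence (f \<omega>) (l \<omega>) (visible (l \<omega>) r) * evidence (f \<omega>) (l \<omega>) r
       = gain g (L \<omega>) (f \<omega>) (l \<omega>) r"
      unfolding gain_visible[OF g, of _ _ _ r] e using evidence_pos[of "f \<omega>" "l \<omega>" "visible (l \<omega>) r"] by simp
    then show "W \<omega> * ennreal (gain g (L \<omega>) (f \<omega>) (l \<omega>) (?S \<omega> (?ob \<omega> r)) / evidence (f \<omega>) (l \<omega>) (?S \<omega> (?ob \<omega> r)))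
        * ennreal (evidence (f \<omega>) (l \<omega>) r) = W \<omega> * ennreal (gain g (L \<omega>) (f \<omega>) (l \<omega>) r)"
      unfolding visible_observed using gain_pos[OF g] evidence_pos
      by (simp add: mult.assoc ennreal_mult''[symmetric] less_imp_le)
  qed
  also have "\<dots> = (\<integral>\<^sup>+\<omega>. W \<omega> * ennreal (residual g (L \<omega>) (f \<omega>) (l \<omega>)) \<partial>M)"
    by (intro nn_integral_cong, subst nn_integral_cmult) (auto simp: nn_integral_gain[OF g])
  finally show ?thesis by (simp add: score_def ev_def)
qed

text \<open>Riskless part and portfolio are known once the signal is seen, so Bayes' rule replaces
  \<open>Y\<close> by an integration over \<open>q\<close>. What results is the quadratic of
  \<open>integral_wt_square\<close>.\<close>

lemma posterior_square:
  assumes g: "good g" and [measurable]: "L \<in> borel_measurable Gplus" "W \<in> borel_measurable Gplus"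
    "\<alpha> \<in> borel_measurable Gplus" "u \<in> borel_measurable Gplus"
  shows "(\<integral>\<^sup>+\<omega>. W \<omega> * ennreal (g (L \<omega>) (fac (f \<omega>) (Y \<omega>)) * (\<alpha> \<omega> + u \<omega> \<bullet> pay (f \<omega>) (Y \<omega>))\<^sup>2) \<partial>M)
    = (\<integral>\<^sup>+\<omega>. W \<omega> * ennreal ((\<integral>q. wt g (L \<omega>) (f \<omega>) (l \<omega>) (score \<omega>) q * (\<alpha> \<omega> + u \<omega> \<bullet> pay (f \<omega>) q)\<^sup>2 \<partial>law (Suc t)) / ev \<omega>) \<partial>M)"
proof -
  have gpos: "0 < g L x" for L x using g by (auto simp: good_def)
  have [measurable]: "(\<lambda>z. g (L (fst z)) (fac (f (fst z)) (snd z))) \<in> borel_measurable (Gplus \<Otimes>\<^sub>M law (Suc t))"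
    by (rule measurable_good[OF g]) measurable
  have "(\<integral>\<^sup>+\<omega>. W \<omega> * ennreal (g (L \<omega>) (fac (f \<omega>) (Y \<omega>)) * (\<alpha> \<omega> + u \<omega> \<bullet> pay (f \<omega>) (Y \<omega>))\<^sup>2) \<partial>M)
    = (\<integral>\<^sup>+\<omega>. \<integral>\<^sup>+q. W \<omega> * ennreal (g (L \<omega>) (fac (f \<omega>) q) * (\<alpha> \<omega> + u \<omega> \<bullet> pay (f \<omega>) q)\<^sup>2) * ennreal (kern \<omega> q) \<partial>law (Suc t) \<partial>M)"
    by (rule bayes[where \<Phi>="\<lambda>\<omega> q. W \<omega> * ennreal (g (L \<omega>) (fac (f \<omega>) q) * (\<alpha> \<omega> + u \<omega> \<bullet> pay (f \<omega>) q)\<^sup>2)"])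
       (unfold case_prod_beta, measurable)
  also have "\<dots> = (\<integral>\<^sup>+\<omega>. W \<omega> * ennreal ((\<integral>q. wt g (L \<omega>) (f \<omega>) (l \<omega>) (score \<omega>) q * (\<alpha> \<omega> + u \<omega> \<bullet> pay (f \<omega>) q)\<^sup>2 \<partial>law (Suc t)) / ev \<omega>) \<partial>M)"
  proof (rule nn_integral_cong)
    fix \<omega>
    let ?w = "\<lambda>q. wt g (L \<omega>) (f \<omega>) (l \<omega>) (score \<omega>) q * (\<alpha> \<omega> + u \<omega> \<bullet> pay (f \<omega>) q)\<^sup>2"
    have "(\<integral>\<^sup>+q. W \<omega> * ennreal (g (L \<omega>) (fac (f \<omega>) q) * (\<alpha> \<omega> + u \<omega> \<bullet> pay (f \<omega>) q)\<^sup>2) * ennreal (kern \<omega> q) \<partial>law (Suc t))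
       = (\<integral>\<^sup>+q. W \<omega> * ennreal (?w q / ev \<omega>) \<partial>law (Suc t))"
    proof (rule nn_integral_cong)
      fix q
      have "g (L \<omega>) (fac (f \<omega>) q) * (\<alpha> \<omega> + u \<omega> \<bullet> pay (f \<omega>) q)\<^sup>2 * kern \<omega> q = ?w q / ev \<omega>"
      proof -
        have "g (L \<omega>) (fac (f \<omega>) q) * (\<alpha> \<omega> + u \<omega> \<bullet> pay (f \<omega>) q)\<^sup>2 * kern \<omega> q
          = g (L \<omega>) (fac (f \<omega>) q) * kern \<omega> q * (\<alpha> \<omega> + u \<omega> \<bullet> pay (f \<omega>) q)\<^sup>2" by (simp only: mult_ac)
        then show ?thesis unfolding kern_wt by simp
      qed
      then show "W \<omega> * ennreal (g (L \<omega>) (fac (f \<omega>) q) * (\<alpha> \<omega> + u \<omega> \<bullet> pay (f \<omega>) q)\<^sup>2) * ennreal (kern \<omega> q) = W \<omega> * ennreal (?w q / ev \<omega>)"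
        by (simp add: mult.assoc ennreal_mult''[OF bayes.k0, symmetric])
    qed
    also have "\<dots> = W \<omega> * (\<integral>\<^sup>+q. ennreal (?w q / ev \<omega>) \<partial>law (Suc t))"
      using integrable_wt_square[OF g] by (intro nn_integral_cmult) auto
    also have "(\<integral>\<^sup>+q. ennreal (?w q / ev \<omega>) \<partial>law (Suc t)) = ennreal (\<integral>q. ?w q / ev \<omega> \<partial>law (Suc t))"
      using integrable_wt_square[OF g] wt_pos[OF g] ev_pos[of \<omega>] by (intro nn_integral_eq_integral) (auto simp: less_imp_le)
    also have "(\<integral>q. ?w q / ev \<omega> \<partial>law (Suc t)) = (\<integral>q. ?w q \<partial>law (Suc t)) / ev \<omega>" by simp
    finally show "(\<integral>\<^sup>+q. W \<omega> * ennreal (g (L \<omega>) (fac (f \<omega>) q) * (\<alpha> \<omega> + u \<omega> \<bullet> pay (f \<omega>) q)\<^sup>2) * ennreal (kern \<omega> q) \<partial>law (Suc t))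
      = W \<omega> * ennreal ((\<integral>q. ?w q \<partial>law (Suc t)) / ev \<omega>)" .
  qed
  finally show ?thesis .
qed

lemma expected_gain_scaled:
  assumes g: "good g" and [measurable]: "L \<in> borel_measurable G" "W \<in> borel_measurable G" "\<alpha> \<in> borel_measurable G"
  shows "(\<integral>\<^sup>+\<omega>. W \<omega> * ennreal ((\<alpha> \<omega>)\<^sup>2 * gain g (L \<omega>) (f \<omega>) (l \<omega>) (score \<omega>) / ev \<omega>) \<partial>M)
    = (\<integral>\<^sup>+\<omega>. W \<omega> * ennreal ((\<alpha> \<omega>)\<^sup>2 * residual g (L \<omega>) (f \<omega>) (l \<omega>)) \<partial>M)"
  using expected_gain[OF g, of L "\<lambda>\<omega>. W \<omega> * ennreal ((\<alpha> \<omega>)\<^sup>2)"]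
  by (simp add: ennreal_mult' mult.assoc flip: times_divide_eq_right)

text \<open>The quadratic is minimized for each signal and then averaged. Accordingly
  \<open>W\<close>, the budget and \<open>\<alpha>\<close> are measurable before the signal, the
  portfolio only after it.\<close>

lemma one_step_lower:
  assumes g: "good g" and [measurable]: "L \<in> borel_measurable G" "W \<in> borel_measurable G" "\<alpha> \<in> borel_measurable G" "u \<in> borel_measurable Gplus"
  shows "(\<integral>\<^sup>+\<omega>. W \<omega> * ennreal ((\<alpha> \<omega>)\<^sup>2 * residual g (L \<omega>) (f \<omega>) (l \<omega>)) \<partial>M)
    \<le> (\<integral>\<^sup>+\<omega>. W \<omega> * ennreal (g (L \<omega>) (fac (f \<omega>) (Y \<omega>)) * (\<alpha> \<omega> + u \<omega> \<bullet> pay (f \<omega>) (Y \<omega>))\<^sup>2) \<partial>M)"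
  unfolding posterior_square[OF g measurable_G_Gplus[OF assms(2)] measurable_G_Gplus[OF assms(3)] measurable_G_Gplus[OF assms(4)] assms(5)]
    expected_gain_scaled[OF g assms(2-4), symmetric]
  using ev_pos by (intro nn_integral_mono mult_left_mono ennreal_leI divide_right_mono gain_lower_bound[OF g]) (auto simp: less_imp_le)

lemma one_step_attained:
  assumes g: "good g" and [measurable]: "L \<in> borel_measurable G" "W \<in> borel_measurable G" "\<alpha> \<in> borel_measurable G" "u \<in> borel_measurable Gplus"
    and u: "AE \<omega> in M. u \<omega> = - (\<alpha> \<omega> *\<^sub>R hedge g (L \<omega>) (f \<omega>) (l \<omega>) (score \<omega>))"
  shows "(\<integral>\<^sup>+\<omega>. W \<omega> * ennreal (g (L \<omega>) (fac (f \<omega>) (Y \<omega>)) * (\<alpha> \<omega> + u \<omega> \<bullet> pay (f \<omega>) (Y \<omega>))\<^sup>2) \<partial>M)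
    = (\<integral>\<^sup>+\<omega>. W \<omega> * ennreal ((\<alpha> \<omega>)\<^sup>2 * residual g (L \<omega>) (f \<omega>) (l \<omega>)) \<partial>M)"
  unfolding posterior_square[OF g measurable_G_Gplus[OF assms(2)] measurable_G_Gplus[OF assms(3)] measurable_G_Gplus[OF assms(4)] assms(5)]
    expected_gain_scaled[OF g assms(2-4), symmetric]
proof (rule nn_integral_cong_AE)
  show "AE \<omega> in M. W \<omega> * ennreal ((\<integral>q. wt g (L \<omega>) (f \<omega>) (l \<omega>) (score \<omega>) q * (\<alpha> \<omega> + u \<omega> \<bullet> pay (f \<omega>) q)\<^sup>2 \<partial>law (Suc t)) / ev \<omega>)
      = W \<omega> * ennreal ((\<alpha> \<omega>)\<^sup>2 * gain g (L \<omega>) (f \<omega>) (l \<omega>) (score \<omega>) / ev \<omega>)"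
    using u by eventually_elim (simp only: gain_attained[OF g])
qed

end


section \<open>Information and absence of attention\<close>

lemma sigma_union_sigma:
  assumes "E \<subseteq> Pow \<Omega>" "F \<subseteq> Pow \<Omega>"
  shows "sigma \<Omega> (sets (sigma \<Omega> E) \<union> F) = sigma \<Omega> (E \<union> F)"
proof (rule sigma_eqI)
  have s: "sets (sigma \<Omega> E) = sigma_sets \<Omega> E" using assms by (intro sets_measure_of)
  show "sets (sigma \<Omega> E) \<union> F \<subseteq> Pow \<Omega>" "E \<union> F \<subseteq> Pow \<Omega>"
    using assms sigma_sets_into_sp[OF assms(1)] by (auto simp: s)
  show "sigma_sets \<Omega> (sets (sigma \<Omega> E) \<union> F) = sigma_sets \<Omega> (E \<union> F)"
    unfolding s
  proof (rule antisym)
    show "sigma_sets \<Omega> (sigma_sets \<Omega> E \<union> F) \<subseteq> sigma_sets \<Omega> (E \<union> F)"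
    proof (rule sigma_sets_mono, rule Un_least)
      show "sigma_sets \<Omega> E \<subseteq> sigma_sets \<Omega> (E \<union> F)" by (rule sigma_sets_mono') auto
      show "F \<subseteq> sigma_sets \<Omega> (E \<union> F)" by (auto intro: sigma_sets.Basic)
    qed
    show "sigma_sets \<Omega> (E \<union> F) \<subseteq> sigma_sets \<Omega> (sigma_sets \<Omega> E \<union> F)"
      by (rule sigma_sets_mono') (auto intro: sigma_sets.Basic)
  qed
qed

context mv_information
begin

lemma Gplus_sigma:
  assumes "G = sigma (space M) E" "E \<subseteq> Pow (space M)" "s = sig"
  shows "Gplus = sigma (space M) (E \<union> events_of M s)"
proof -
  have "Gplus = sigma (space M) (sets (sigma (space M) E) \<union> events_of M sig)"
    unfolding Gplus_def by (simp only: assms(1))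
  then show ?thesis
    by (simp only: sigma_union_sigma[OF assms(2) events_of_Pow] assms(3))
qed

end

section \<open>The information generated by a policy\<close>

lemma zero_in_attn_set: "0 \<le> L \<Longrightarrow> 0 \<in> attn_set L"
  by (simp add: attn_set_def nonneg_vecs_def)

lemma info_events_Pow: "info_events P lam t \<subseteq> Pow (space (pspace P))"
  unfolding info_events_def by (intro Un_least UN_least events_of_Pow)

lemma space_info [simp]: "space (info P lam t) = space (pspace P)"
  by (simp add: info_def space_measure_of_conv)

lemma space_info_plus [simp]: "space (info_plus P lam t) = space (pspace P)"
  by (simp add: info_plus_def space_measure_of_conv)

lemma events_of_measurable:
  assumes "events_of (pspace P) X \<subseteq> sets N" "space N = space (pspace P)"
  shows "X \<in> borel_measurable N"
proof (rule measurableI)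
  fix A :: "'b set" assume "A \<in> sets borel"
  then show "X -` A \<inter> space N \<in> sets N" using assms by (auto simp: events_of_def)
qed auto

lemma info_events_info: "info_events P lam t \<subseteq> sets (info P lam t)"
  unfolding info_def sets_measure_of[OF info_events_Pow] by (auto intro: sigma_sets.Basic)

lemma measurable_factor:
  assumes "f0 P \<in> borel_measurable N" "\<And>s. s \<in> {1..t} \<Longrightarrow> eta P s \<in> borel_measurable N"
  shows "factor P t \<in> borel_measurable N"
  using assms(2)
proof (induction t)
  case 0
  then show ?case using assms(1) by (simp cong: measurable_cong)
next
  case (Suc t)
  then have [measurable]: "factor P t \<in> borel_measurable N" "eta P (Suc t) \<in> borel_measurable N" by auto
  show ?case by (simp add: next_factor_def[abs_def] cong: measurable_cong) measurable
qed

lemma info_measurable: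
  shows "f0 P \<in> borel_measurable (info P lam t)"
    "s \<in> {1..t} \<Longrightarrow> eta P s \<in> borel_measurable (info P lam t)"
    "s \<in> {1..t} \<Longrightarrow> eps P s \<in> borel_measurable (info P lam t)"
    "s < t \<Longrightarrow> signal P lam s \<in> borel_measurable (info P lam t)"
proof -
  note sub = info_events_info[of P lam t, unfolded info_events_def]
  show "f0 P \<in> borel_measurable (info P lam t)"
    by (rule events_of_measurable) (use sub in \<open>blast, simp\<close>)
  show "eta P s \<in> borel_measurable (info P lam t)" if "s \<in> {1..t}"
    by (rule events_of_measurable) (use sub that in \<open>blast, simp\<close>)
  show "eps P s \<in> borel_measurable (info P lam t)" if "s \<in> {1..t}"
    by (rule events_of_measurable) (use sub that in \<open>blast, simp\<close>)
  show "signal P lam s \<in> borel_measurable (info P lam t)" if "s < t"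
    by (rule events_of_measurable) (use sub that in \<open>blast, simp\<close>)
qed

lemma factor_info: "factor P t \<in> borel_measurable (info P lam t)"
  by (intro measurable_factor info_measurable)

lemma info_mono:
  assumes "s \<le> t" shows "sets (info P lam s) \<subseteq> sets (info P lam t)"
  unfolding info_def[of P lam s]
proof (rule sets_sigma_subset)
  have "info_events P lam s \<subseteq> info_events P lam t"
    using assms unfolding info_events_def by (intro Un_mono UN_mono) auto
  then show "info_events P lam s \<subseteq> sets (info P lam t)"
    using info_events_info by blast
qed simp

lemma info_info_plus: "sets (info P lam t) \<subseteq> sets (info_plus P lam t)"
  unfolding info_def info_plus_def using info_events_Pow[of P lam t] events_of_Pow[of "pspace P" "signal P lam t"]
  by (simp add: sets_measure_of sigma_sets_mono')

lemma info_plus_info_Suc: "sets (info_plus P lam t) \<subseteq> sets (info P lam (Suc t))"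
  unfolding info_plus_def
proof (rule sets_sigma_subset)
  have "info_events P lam t \<union> events_of (pspace P) (signal P lam t) \<subseteq> info_events P lam (Suc t)"
    unfolding info_events_def by fastforce
  then show "info_events P lam t \<union> events_of (pspace P) (signal P lam t) \<subseteq> sets (info P lam (Suc t))"
    using info_events_info by blast
qed simp

lemma measurable_sub:
  assumes "g \<in> measurable N' L" "sets N' \<subseteq> sets N" "space N = space N'"
  shows "g \<in> measurable N L"
  by (rule measurable_from_subalg[of N N']) (use assms in \<open>auto simp: subalgebra_def\<close>)

lemma payoff_info: "payoff P (Suc t) \<in> borel_measurable (info P lam (Suc t))"
proof -
  have [measurable]: "eps P (Suc t) \<in> borel_measurable (info P lam (Suc t))" by (rule info_measurable) simp
  have [measurable]: "factor P (Suc t) \<in> borel_measurable (info P lam (Suc t))" by (rule factor_info)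
  show ?thesis unfolding payoff_def[abs_def] payoff_at_def by measurable
qed

context mv_base
begin

lemma source_measurable_sources:
  assumes "s \<in> {1..t}"
  shows "eta P s \<in> borel_measurable (source_algebra (sources t))"
    "eps P s \<in> borel_measurable (source_algebra (sources t))"
    "(\<lambda>\<omega>. \<omega>) \<in> measurable (source_algebra (sources t)) (noise_field_algebra P s)"
  using assms
  by (auto intro!: measurable_source(2)[OF _ refl] measurable_source(3)[OF _ refl] measurable_source(4)[OF _ refl] simp: sources_def)

lemma f0_sources: "f0 P \<in> borel_measurable (source_algebra (sources t))"
  by (intro measurable_source(1)[OF _ refl]) (simp add: sources_def)

lemma factor_sources: "factor P t \<in> borel_measurable (source_algebra (sources t))"
  by (intro measurable_factor f0_sources source_measurable_sources)

lemma attention_nonneg: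
  assumes "admissible_attention P lam" "t < T" "\<omega> \<in> space M"
  shows "lam t \<omega> \<in> nonneg_vecs"
  using assms by (auto simp: admissible_attention_def attn_set_def)

lemma signal_sources:
  assumes lam: "admissible_attention P lam" and s: "s < T"
    and sub: "sets (info P lam s) \<subseteq> sets (source_algebra (sources s))"
  shows "signal P lam s \<in> borel_measurable (source_algebra (sources (Suc s)))"
proof -
  have "lam s \<in> borel_measurable (info P lam s)" using lam s by (simp add: admissible_attention_def)
  then have "lam s \<in> borel_measurable (source_algebra (sources (Suc s)))"
    by (rule measurable_sub) (use sub source_algebra_mono[OF sources_mono[of s "Suc s"]] in auto)
  then have "(\<lambda>\<omega>. signal_at P (Suc s) (lam s \<omega>) (factor P (Suc s) \<omega>) \<omega>) \<in> borel_measurable (source_algebra (sources (Suc s)))"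
    using s attention_nonneg[OF lam s]
    by (intro measurable_signal_at factor_sources source_measurable_sources) auto
  then show ?thesis by (simp add: signal_def[abs_def])
qed

text \<open>Attention at an earlier time is measurable for the information of that time, which by
  strong induction comes from the sources; so does then the signal that it selects from the noise
  field.\<close>

lemma info_sources:
  assumes lam: "admissible_attention P lam"
  shows "t \<le> T \<Longrightarrow> sets (info P lam t) \<subseteq> sets (source_algebra (sources t))"
proof (induction t rule: less_induct)
  case (less t)
  have "events_of M (f0 P) \<subseteq> sets (source_algebra (sources t))"
    by (intro events_of_subset f0_sources) simp
  moreover have "events_of M (eps P s) \<union> events_of M (eta P s) \<subseteq> sets (source_algebra (sources t))" if "s \<in> {1..t}" for s
    using that by (intro Un_least events_of_subset source_measurable_sources) simp_all
  moreover have "events_of M (signal P lam s) \<subseteq> sets (source_algebra (sources t))" if "s \<in> {..<t}" for s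
  proof -
    have s: "s < t" "s < T" using that less.prems by auto
    then have "signal P lam s \<in> borel_measurable (source_algebra (sources (Suc s)))"
      by (intro signal_sources lam less.IH) auto
    then have "events_of M (signal P lam s) \<subseteq> sets (source_algebra (sources (Suc s)))"
      by (rule events_of_subset) simp
    also have "\<dots> \<subseteq> sets (source_algebra (sources t))"
      using s by (intro source_algebra_mono sources_mono) simp
    finally show ?thesis .
  qed
  ultimately have "info_events P lam t \<subseteq> sets (source_algebra (sources t))"
    unfolding info_events_def by blast
  then show ?case unfolding info_def by (rule sets_sigma_subset) simp
qed

lemma budget_nonneg:
  assumes lam: "admissible_attention P lam" and \<omega>: "\<omega> \<in> space M"
  shows "t \<le> T \<Longrightarrow> 0 \<le> budget P lam t \<omega> \<and> budget P lam t \<omega> \<le> Lambda0 P"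
proof (induction t)
  case 0
  then show ?case by (simp add: Lambda0_nonneg)
next
  case (Suc t)
  then have a: "lam t \<omega> \<in> attn_set (budget P lam t \<omega>)" using lam \<omega> by (auto simp: admissible_attention_def)
  then have "0 \<le> (\<Sum>j\<in>UNIV. lam t \<omega> $ j)" by (auto simp: attn_set_def nonneg_vecs_def intro: sum_nonneg)
  with a Suc show ?case by (simp add: attn_set_def)
qed

lemma budget_info:
  assumes lam: "\<And>s. s < t \<Longrightarrow> lam s \<in> borel_measurable (info P lam s)"
  shows "budget P lam t \<in> borel_measurable (info P lam t)"
  using lam
proof (induction t)
  case 0
  have "budget P lam 0 = (\<lambda>_. Lambda0 P)" by (rule ext) simp
  then show ?case by simp
next
  case (Suc t)
  have [measurable]: "budget P lam t \<in> borel_measurable (info P lam (Suc t))" "lam t \<in> borel_measurable (info P lam (Suc t))"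
    using Suc by (auto intro: measurable_sub[OF _ info_mono[of t "Suc t"]])
  have "budget P lam (Suc t) = (\<lambda>\<omega>. budget P lam t \<omega> - (\<Sum>j\<in>UNIV. lam t \<omega> $ j))" by (rule ext) simp
  then show ?case by simp
qed

text \<open>The signal of this policy is constantly 0, so the information after it still comes from
  past sources. Conditional moments of the next payoff are then plain integrals over the law of the
  next noise, which makes assumptions on them accessible.\<close>

definition no_attention :: "nat \<Rightarrow> 'w \<Rightarrow> real^'k" where
  "no_attention = (\<lambda>_ _. 0)"

lemma budget_no_attention: "budget P no_attention t \<omega> = Lambda0 P"
  by (induction t) (simp_all add: no_attention_def)

lemma admissible_no_attention: "admissible_attention P no_attention"
  unfolding admissible_attention_def budget_no_attention
  by (auto simp: no_attention_def zero_in_attn_set Lambda0_nonneg)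

lemma no_attention_info_plus:
  assumes "t \<le> T"
  shows "sets (info_plus P no_attention t) \<subseteq> sets (source_algebra (sources t))"
  unfolding info_plus_def
proof (rule sets_sigma_subset)
  have "signal P no_attention t = (\<lambda>\<omega>. 0)"
    by (rule ext) (simp add: signal_def signal_at_def no_attention_def vec_eq_iff)
  then have "events_of M (signal P no_attention t) \<subseteq> sets (source_algebra (sources t))"
    by (intro events_of_subset) auto
  moreover have "info_events P no_attention t \<subseteq> sets (source_algebra (sources t))"
    using info_events_info info_sources[OF admissible_no_attention assms] by blast
  ultimately show "info_events P no_attention t \<union> events_of M (signal P no_attention t) \<subseteq> sets (source_algebra (sources t))"
    by auto
qed simp

section \<open>Nondegeneracy of the payoff law\<close>

definition noise :: "nat \<Rightarrow> 'w \<Rightarrow> (real^'k) \<times> (real^'n)" where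
  "noise t \<omega> = (eta P t \<omega>, eps P t \<omega>)"

lemma measurable_noise: "t \<in> {1..T} \<Longrightarrow> noise t \<in> measurable M (law t)"
  using measurable_noise_pair(2)[of t] by (simp add: noise_def[abs_def])

lemma past_noise_distr:
  assumes t: "t < T" and G: "sets G \<subseteq> sets (source_algebra (sources t))" "space G = space M"
  shows "distr M (G \<Otimes>\<^sub>M law (Suc t)) (\<lambda>\<omega>. (\<omega>, noise (Suc t) \<omega>)) = distr M G (\<lambda>\<omega>. \<omega>) \<Otimes>\<^sub>M law (Suc t)"
proof -
  let ?E = "{Eta (Suc t), Eps (Suc t)}"
  have "noise (Suc t) \<in> borel_measurable (source_algebra ?E)"
    unfolding noise_def
    by (intro borel_measurable_Pair measurable_source(3)[OF _ refl] measurable_source(2)[OF _ refl]) auto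
  then have N: "noise (Suc t) \<in> measurable (source_algebra ?E) (law (Suc t))"
    by (simp cong: measurable_cong_sets)
  have id: "(\<lambda>\<omega>. \<omega>) \<in> measurable (source_algebra (sources t)) G"
    by (rule measurable_from_subalg[of _ G]) (use G in \<open>auto simp: subalgebra_def\<close>)
  have "distr M (law (Suc t)) (noise (Suc t)) = law (Suc t)"
    unfolding law_def noise_def by (intro distr_cong) auto
  moreover have "distr M (G \<Otimes>\<^sub>M law (Suc t)) (\<lambda>\<omega>. (\<omega>, noise (Suc t) \<omega>))
      = distr M G (\<lambda>\<omega>. \<omega>) \<Otimes>\<^sub>M distr M (law (Suc t)) (noise (Suc t))"
    using t by (intro source_algebra_distr_pair[OF _ _ _ id N]) (auto simp: sources_def)
  ultimately show ?thesis by simp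
qed

text \<open>Conditioning on the past leaves the law of the next noise as it is, hence the constant
  density 1.\<close>

lemma past_kernel:
  assumes t: "t < T" and G: "sets G \<subseteq> sets (source_algebra (sources t))" "space G = space M"
  shows "cond_kernel M G (law (Suc t)) (noise (Suc t)) (\<lambda>_ _. 1)"
proof -
  have St: "Suc t \<in> {1..T}" using t by simp
  have sub: "subalgebra M G"
    using G source_algebra_subset[OF sources_mono[of t T]] t by (auto simp: subalgebra_def)
  have id[measurable]: "(\<lambda>\<omega>. \<omega>) \<in> measurable M G" by (rule measurable_from_subalg[OF sub]) simp
  interpret law: prob_space "law (Suc t)" by (rule prob_law[OF St])
  note [measurable] = measurable_noise[OF St]
  show ?thesis
  proof
    fix \<Phi> :: "'w \<Rightarrow> (real^'k) \<times> (real^'n) \<Rightarrow> ennreal" assume \<Phi>: "case_prod \<Phi> \<in> borel_measurable (G \<Otimes>\<^sub>M law (Suc t))"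
    have sN: "sets (distr M G (\<lambda>\<omega>. \<omega>) \<Otimes>\<^sub>M law (Suc t)) = sets (G \<Otimes>\<^sub>M law (Suc t))"
      by (rule sets_pair_measure_cong) simp_all
    have \<Phi>': "case_prod \<Phi> \<in> borel_measurable (distr M G (\<lambda>\<omega>. \<omega>) \<Otimes>\<^sub>M law (Suc t))"
      using \<Phi> by (simp add: measurable_cong_sets[OF sN refl])
    have im: "(\<lambda>\<omega>. \<integral>\<^sup>+q. \<Phi> \<omega> q \<partial>law (Suc t)) \<in> borel_measurable G"
      by (rule law.borel_measurable_nn_integral[OF \<Phi>])
    have "(\<integral>\<^sup>+\<omega>. \<Phi> \<omega> (noise (Suc t) \<omega>) \<partial>M) = (\<integral>\<^sup>+z. case_prod \<Phi> z \<partial>distr M (G \<Otimes>\<^sub>M law (Suc t)) (\<lambda>\<omega>. (\<omega>, noise (Suc t) \<omega>)))"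
    proof -
      have "(\<lambda>\<omega>. (\<omega>, noise (Suc t) \<omega>)) \<in> measurable M (G \<Otimes>\<^sub>M law (Suc t))" by measurable
      from nn_integral_distr[OF this, of "case_prod \<Phi>"] \<Phi> show ?thesis by (simp only: measurable_distr_eq1 prod.case)
    qed
    also have "\<dots> = (\<integral>\<^sup>+\<omega>. \<integral>\<^sup>+q. \<Phi> \<omega> q \<partial>law (Suc t) \<partial>distr M G (\<lambda>\<omega>. \<omega>))"
      unfolding past_noise_distr[OF assms] law.nn_integral_fst[OF \<Phi>', symmetric] by simp
    also have "\<dots> = (\<integral>\<^sup>+\<omega>. \<integral>\<^sup>+q. \<Phi> \<omega> q \<partial>law (Suc t) \<partial>M)"
      by (rule nn_integral_distr[OF id]) (simp only: measurable_distr_eq1 im)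
    finally show "(\<integral>\<^sup>+\<omega>. \<Phi> \<omega> (noise (Suc t) \<omega>) \<partial>M) = (\<integral>\<^sup>+\<omega>. \<integral>\<^sup>+q. \<Phi> \<omega> q * ennreal 1 \<partial>law (Suc t) \<partial>M)" by simp
  qed (use sub measurable_noise[OF St] law.prob_space_axioms in auto)
qed

text \<open>Agrees with \<open>pay\<close>, whose locale presupposes the nondegeneracy that is still
  to be derived.\<close>

definition raw_pay :: "real^'k \<Rightarrow> (real^'k) \<times> (real^'n) \<Rightarrow> real^'n" where
  "raw_pay f q = cvec P + Dmat P *v ((mat 1 - Phi P) *v f + fst q) + snd q"

lemma measurable_raw_pay [measurable (raw)]:
  assumes "a \<in> borel_measurable N" "b \<in> borel_measurable N"
  shows "(\<lambda>x. raw_pay (a x) (b x)) \<in> borel_measurable N"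
proof -
  have "continuous_on UNIV (\<lambda>z. raw_pay (fst z) (snd z))"
    unfolding raw_pay_def by (intro continuous_intros)
  from borel_measurable_continuous_on[OF this, of "\<lambda>x. (a x, b x)" N] assms
  show ?thesis by (simp add: borel_measurable_Pair)
qed

lemma payoff_raw: "payoff P (Suc t) \<omega> = raw_pay (factor P t \<omega>) (noise (Suc t) \<omega>)"
  by (simp add: payoff_def payoff_at_def next_factor_def raw_pay_def noise_def)

text \<open>The part of the payoff that does not involve the current factor; it alone determines the
  conditional covariance.\<close>

definition residue :: "(real^'k) \<times> (real^'n) \<Rightarrow> real^'n" where
  "residue q = Dmat P *v fst q + snd q"

lemma raw_pay_residue: "raw_pay f q = cvec P + Dmat P *v ((mat 1 - Phi P) *v f) + residue q"
  by (simp add: raw_pay_def residue_def matrix_vector_right_distrib algebra_simps)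

lemma residue_moments:
  assumes t: "t \<in> {1..T}"
  shows "integrable (law t) (\<lambda>q. residue q $ i)" "integrable (law t) (\<lambda>q. (residue q $ i - a) * (residue q $ j - b))"
proof -
  interpret law: prob_space "law t" by (rule prob_law[OF t])
  have [measurable]: "(\<lambda>q. residue q $ i) \<in> borel_measurable (law t)" for i
  proof -
    have "(\<lambda>q. residue q $ i) \<in> borel_measurable borel"
      unfolding residue_def by (intro borel_measurable_continuous_onI continuous_intros)
    then show ?thesis by (simp cong: measurable_cong_sets)
  qed
  obtain B where B: "B > 0" "\<And>x. norm (Dmat P *v x) \<le> B * norm x"
    using linear_bounded_pos[OF matrix_vector_mul_linear[of "Dmat P"]] by blast
  have bound: "\<bar>residue q $ i\<bar> \<le> (B + 1) * norm q" for q i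
  proof -
    have "\<bar>residue q $ i\<bar> \<le> norm (residue q)" by (rule component_le_norm_cart)
    also have "\<dots> \<le> norm (Dmat P *v fst q) + norm (snd q)" unfolding residue_def by (rule norm_triangle_ineq)
    also have "\<dots> \<le> B * norm q + norm q"
      using B(1) order_trans[OF B(2)[of "fst q"] mult_left_mono[of "norm (fst q)" "norm q" B]]
        norm_fst_le[of "fst q" "snd q"] norm_snd_le[of "snd q" "fst q"] by (intro add_mono) auto
    finally show ?thesis by (simp add: algebra_simps)
  qed
  have sq: "integrable (law t) (\<lambda>q. (residue q $ i)\<^sup>2)" for i
  proof (rule Bochner_Integration.integrable_bound)
    show "integrable (law t) (\<lambda>q. (B + 1)\<^sup>2 * (norm q)\<^sup>2)" using law_moment[OF t] by simp
    have "\<bar>(residue q $ i)\<^sup>2\<bar> \<le> (B + 1)\<^sup>2 * (norm q)\<^sup>2" for q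
      using power_mono[OF bound[of q i] abs_ge_zero, of 2] by (simp add: power_mult_distrib)
    then show "AE q in law t. norm ((residue q $ i)\<^sup>2) \<le> norm ((B + 1)\<^sup>2 * (norm q)\<^sup>2)" by simp
  qed measurable
  show 1: "integrable (law t) (\<lambda>q. residue q $ i)" for i
    by (rule law.square_integrable_imp_integrable[OF _ sq]) measurable
  have 2: "integrable (law t) (\<lambda>q. residue q $ i * residue q $ j)"
  proof (rule Bochner_Integration.integrable_bound)
    show "integrable (law t) (\<lambda>q. (residue q $ i)\<^sup>2 + (residue q $ j)\<^sup>2)" using sq by simp
    have "\<bar>x * y\<bar> \<le> x\<^sup>2 + y\<^sup>2" for x y :: real
    proof -
      have "0 \<le> \<bar>x\<bar> * \<bar>y\<bar>" by simp
      then show ?thesis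
        using sum_squares_bound[of "\<bar>x\<bar>" "\<bar>y\<bar>"] unfolding abs_mult power2_abs by linarith
    qed
    then show "AE q in law t. norm (residue q $ i * residue q $ j) \<le> norm ((residue q $ i)\<^sup>2 + (residue q $ j)\<^sup>2)" by simp
  qed measurable
  have "(residue q $ i - a) * (residue q $ j - b) = residue q $ i * residue q $ j - b * residue q $ i - a * residue q $ j + a * b" for q
    by (simp add: algebra_simps)
  then show "integrable (law t) (\<lambda>q. (residue q $ i - a) * (residue q $ j - b))" using 1 2 by simp
qed

definition mean_pay :: "nat \<Rightarrow> real^'k \<Rightarrow> real^'n" where
  "mean_pay t f = (\<chi> i. \<integral>q. raw_pay f q $ i \<partial>law (Suc t))"

lemma cond_mean_payoff:
  assumes t: "t < T" and G: "sets G \<subseteq> sets (source_algebra (sources t))" "space G = space M"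
    and [measurable]: "factor P t \<in> borel_measurable G"
  shows "AE \<omega> in M. cond_vec M G (payoff P (Suc t)) \<omega> = mean_pay t (factor P t \<omega>)"
proof -
  interpret K: cond_kernel M G "law (Suc t)" "noise (Suc t)" "\<lambda>_ _. 1" by (rule past_kernel[OF t G])
  interpret law: prob_space "law (Suc t)" by (rule K.Q)
  have "AE \<omega> in M. \<forall>i\<in>UNIV. real_cond_exp M G (\<lambda>\<omega>. raw_pay (factor P t \<omega>) (noise (Suc t) \<omega>) $ i) \<omega>
      = (\<integral>q. raw_pay (factor P t \<omega>) q $ i * 1 \<partial>law (Suc t))"
  proof (intro AE_finite_allI finite K.real_cond_exp_kernel[of "\<lambda>\<omega> q. raw_pay (factor P t \<omega>) q $ _"])
    show "(\<lambda>(\<omega>, q). raw_pay (factor P t \<omega>) q $ i) \<in> borel_measurable (G \<Otimes>\<^sub>M law (Suc t))" for i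
      unfolding case_prod_beta by measurable
    show "integrable (law (Suc t)) (\<lambda>q. raw_pay (factor P t \<omega>) q $ i * 1)" for \<omega> i
      using t by (simp add: raw_pay_residue residue_moments)
  qed
  then show ?thesis
    by eventually_elim (simp add: cond_vec_def mean_pay_def vec_eq_iff payoff_raw)
qed

text \<open>Without attention, the conditional covariance is almost surely the covariance matrix of
  \<open>residue\<close>. Its positive definiteness gives \<open>z \<bullet> residue q\<close>
  positive variance, so that \<open>law_nondegenerate\<close> applies.\<close>

lemma nondegenerate_from_cov:
  assumes t: "t < T" and pd: "AE \<omega> in M. pos_def_matrix (cond_cov M (info_plus P no_attention t) (payoff P (Suc t)) \<omega>)"
    and z: "z \<noteq> 0"
  shows "AE q in law (Suc t). z \<bullet> (Dmat P *v fst q + snd q) \<noteq> e"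
proof -
  let ?G = "info_plus P no_attention t"
  have St: "Suc t \<in> {1..T}" using t by simp
  have G: "sets ?G \<subseteq> sets (source_algebra (sources t))" "space ?G = space M"
    using no_attention_info_plus[of t] t by auto
  have [measurable]: "factor P t \<in> borel_measurable ?G"
    by (rule measurable_sub[OF factor_info info_info_plus]) simp
  interpret K: cond_kernel M ?G "law (Suc t)" "noise (Suc t)" "\<lambda>_ _. 1" by (rule past_kernel[OF t G])
  interpret law: prob_space "law (Suc t)" by (rule K.Q)
  define CV where "CV = cond_vec M ?G (payoff P (Suc t))"
  have [measurable]: "CV \<in> borel_measurable ?G" unfolding CV_def cond_vec_def by measurable
  have "AE \<omega> in M. \<forall>i\<in>UNIV. \<forall>j\<in>UNIV. real_cond_exp M ?G (\<lambda>\<omega>. (raw_pay (factor P t \<omega>) (noise (Suc t) \<omega>) $ i - CV \<omega> $ i) * (raw_pay (factor P t \<omega>) (noise (Suc t) \<omega>) $ j - CV \<omega> $ j)) \<omega>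
      = (\<integral>q. (raw_pay (factor P t \<omega>) q $ i - CV \<omega> $ i) * (raw_pay (factor P t \<omega>) q $ j - CV \<omega> $ j) * 1 \<partial>law (Suc t))"
  proof (intro AE_finite_allI finite K.real_cond_exp_kernel[of "\<lambda>\<omega> q. (raw_pay (factor P t \<omega>) q $ _ - CV \<omega> $ _) * (raw_pay (factor P t \<omega>) q $ _ - CV \<omega> $ _)"])
    show "(\<lambda>(\<omega>, q). (raw_pay (factor P t \<omega>) q $ i - CV \<omega> $ i) * (raw_pay (factor P t \<omega>) q $ j - CV \<omega> $ j)) \<in> borel_measurable (?G \<Otimes>\<^sub>M law (Suc t))" for i j
      unfolding case_prod_beta by measurable
    have eq: "(raw_pay f q $ i - a) * (raw_pay f q $ j - b) * 1
       = (residue q $ i - (a - (cvec P + Dmat P *v ((mat 1 - Phi P) *v f)) $ i)) * (residue q $ j - (b - (cvec P + Dmat P *v ((mat 1 - Phi P) *v f)) $ j))" for f q i j a b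
      by (simp add: raw_pay_residue algebra_simps)
    show "integrable (law (Suc t)) (\<lambda>q. (raw_pay (factor P t \<omega>) q $ i - CV \<omega> $ i) * (raw_pay (factor P t \<omega>) q $ j - CV \<omega> $ j) * 1)" for \<omega> i j
      unfolding eq by (rule residue_moments(2)[OF St])
  qed
  moreover have "AE \<omega> in M. CV \<omega> = mean_pay t (factor P t \<omega>)"
    unfolding CV_def by (rule cond_mean_payoff[OF t G]) measurable
  ultimately have "AE \<omega> in M. \<exists>S. pos_def_matrix S \<and> (\<forall>i j. S $ i $ j =
     (\<integral>q. (residue q $ i - (\<integral>q. residue q $ i \<partial>law (Suc t))) * (residue q $ j - (\<integral>q. residue q $ j \<partial>law (Suc t))) \<partial>law (Suc t)))"
    using pd
  proof eventually_elim
    case (elim \<omega>)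
    have d: "raw_pay (factor P t \<omega>) q $ i - CV \<omega> $ i = residue q $ i - (\<integral>q. residue q $ i \<partial>law (Suc t))" for q i
      unfolding elim(2) mean_pay_def raw_pay_residue using residue_moments(1)[OF St, of i] law.prob_space by simp
    show ?case
    proof (intro exI[of _ "cond_cov M ?G (payoff P (Suc t)) \<omega>"] conjI allI elim(3))
      fix i j
      have "cond_cov M ?G (payoff P (Suc t)) \<omega> $ i $ j
         = real_cond_exp M ?G (\<lambda>\<omega>. (raw_pay (factor P t \<omega>) (noise (Suc t) \<omega>) $ i - CV \<omega> $ i) * (raw_pay (factor P t \<omega>) (noise (Suc t) \<omega>) $ j - CV \<omega> $ j)) \<omega>"
        by (simp add: cond_cov_def cond_mat_def outer_def payoff_raw CV_def)
      also have "\<dots> = (\<integral>q. (residue q $ i - (\<integral>q. residue q $ i \<partial>law (Suc t))) * (residue q $ j - (\<integral>q. residue q $ j \<partial>law (Suc t))) \<partial>law (Suc t))"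
        using elim(1) unfolding d by simp
      finally show "cond_cov M ?G (payoff P (Suc t)) \<omega> $ i $ j = \<dots>" .
    qed
  qed
  \<comment> \<open>The existence statement does not mention \<open>\<omega>\<close>; holding almost
    surely, it holds outright.\<close>
  then obtain S where S: "pos_def_matrix S" "\<And>i j. S $ i $ j =
     (\<integral>q. (residue q $ i - (\<integral>q. residue q $ i \<partial>law (Suc t))) * (residue q $ j - (\<integral>q. residue q $ j \<partial>law (Suc t))) \<partial>law (Suc t))"
    unfolding AE_const by blast
  define m where "m i = (\<integral>q. residue q $ i \<partial>law (Suc t))" for i
  define e' where "e' = (\<Sum>i\<in>UNIV. z $ i * m i)"
  have e': "e' = (\<integral>q. z \<bullet> (Dmat P *v fst q + snd q) \<partial>law (Suc t))"
    unfolding residue_def[symmetric] inner_vec_def e'_def m_def using residue_moments(1)[OF St] by simp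
  have "0 < z \<bullet> (S *v z)" using S(1) z by (simp add: pos_def_matrix_def)
  also have "z \<bullet> (S *v z) = (\<Sum>i\<in>UNIV. \<Sum>j\<in>UNIV. z $ i * z $ j * S $ i $ j)"
    by (simp add: inner_vec_def matrix_vector_mult_def sum_distrib_left mult_ac)
  also have "\<dots> = (\<Sum>i\<in>UNIV. \<Sum>j\<in>UNIV. \<integral>q. z $ i * z $ j * ((residue q $ i - m i) * (residue q $ j - m j)) \<partial>law (Suc t))"
    by (simp add: S(2) m_def)
  also have "\<dots> = (\<integral>q. (\<Sum>i\<in>UNIV. \<Sum>j\<in>UNIV. z $ i * z $ j * ((residue q $ i - m i) * (residue q $ j - m j))) \<partial>law (Suc t))"
    using residue_moments(2)[OF St] by simp
  also have "\<dots> = (\<integral>q. (z \<bullet> (Dmat P *v fst q + snd q) - e')\<^sup>2 \<partial>law (Suc t))"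
  proof (rule Bochner_Integration.integral_cong[OF refl])
    fix q
    have "z \<bullet> (Dmat P *v fst q + snd q) - e' = (\<Sum>i\<in>UNIV. z $ i * (residue q $ i - m i))"
      unfolding residue_def[symmetric] inner_vec_def e'_def by (simp add: sum_subtractf algebra_simps)
    then show "(\<Sum>i\<in>UNIV. \<Sum>j\<in>UNIV. z $ i * z $ j * ((residue q $ i - m i) * (residue q $ j - m j))) = (z \<bullet> (Dmat P *v fst q + snd q) - e')\<^sup>2"
      unfolding power2_eq_square by (simp add: sum_product mult_ac)
  qed
  finally show ?thesis by (rule law_nondegenerate[OF St _ e'])
qed

end

text \<open>Scaling makes the compact set independent of the budget, as continuity of the infimum
  and measurable selection require. At \<open>L = 0\<close> both sides are
  \<open>{0}\<close>.\<close>

lemma attn_set_scale: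
  assumes "0 \<le> L" shows "attn_set L = (\<lambda>q. L *\<^sub>R q) ` (attn_set 1 :: (real^'k::finite) set)"
proof (intro equalityI subsetI)
  fix l :: "real^'k" assume l: "l \<in> attn_set L"
  show "l \<in> (\<lambda>q. L *\<^sub>R q) ` attn_set 1"
  proof (cases "L = 0")
    case True
    have nn: "0 \<le> l $ j" for j using l by (simp add: attn_set_def nonneg_vecs_def)
    have "(\<Sum>j\<in>UNIV. l $ j) = 0"
      using l True sum_nonneg[of UNIV "($) l", OF nn] by (simp add: attn_set_def)
    then have "\<forall>j\<in>UNIV. l $ j = 0" by (subst (asm) sum_nonneg_eq_0_iff) (simp_all add: nn)
    then have "l = L *\<^sub>R 0" by (simp add: vec_eq_iff)
    then show ?thesis by (rule image_eqI[OF _ zero_in_attn_set]) simp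
  next
    case False
    with assms have "0 < L" by simp
    have "(\<Sum>j\<in>UNIV. ((1 / L) *\<^sub>R l) $ j) = (\<Sum>j\<in>UNIV. l $ j) / L"
      by (simp add: sum_divide_distrib)
    also have "\<dots> \<le> 1" using l \<open>0 < L\<close> by (simp add: attn_set_def)
    finally have "(1 / L) *\<^sub>R l \<in> attn_set 1"
      using l \<open>0 < L\<close> by (simp add: attn_set_def nonneg_vecs_def)
    with \<open>0 < L\<close> show ?thesis by (intro image_eqI[of _ _ "(1 / L) *\<^sub>R l"]) simp_all
  qed
next
  fix l :: "real^'k" assume "l \<in> (\<lambda>q. L *\<^sub>R q) ` attn_set 1"
  then obtain q where q: "q \<in> attn_set 1" "l = L *\<^sub>R q" by (rule imageE)
  have "(\<Sum>j\<in>UNIV. l $ j) = L * (\<Sum>j\<in>UNIV. q $ j)" by (simp add: q(2) sum_distrib_left)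
  also have "\<dots> \<le> L * 1" using assms q(1) by (intro mult_left_mono) (simp_all add: attn_set_def)
  finally show "l \<in> attn_set L"
    using q assms by (simp add: attn_set_def nonneg_vecs_def)
qed

lemma compact_attn_set: "compact (attn_set L :: (real^'k::finite) set)"
proof (rule compact_eq_bounded_closed[THEN iffD2], intro conjI)
  have "norm l \<le> L" if "l \<in> attn_set L" for l :: "real^'k"
  proof -
    have "norm l \<le> (\<Sum>j\<in>UNIV. \<bar>l $ j\<bar>)" by (rule norm_le_l1_cart)
    also have "\<dots> = (\<Sum>j\<in>UNIV. l $ j)" using that by (intro sum.cong) (auto simp: attn_set_def nonneg_vecs_def)
    also have "\<dots> \<le> L" using that by (simp add: attn_set_def)
    finally show ?thesis .
  qed
  then show "bounded (attn_set L :: (real^'k) set)" by (rule boundedI)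
  have "attn_set L = (\<Inter>j. {l :: real^'k. 0 \<le> l $ j}) \<inter> {l. (\<Sum>j\<in>UNIV. l $ j) \<le> L}"
    by (auto simp: attn_set_def nonneg_vecs_def)
  moreover have "closed \<dots>"
    by (intro closed_Int closed_INT ballI closed_Collect_le continuous_intros)
  ultimately show "closed (attn_set L :: (real^'k) set)" by simp
qed

section \<open>The objective of the recursion\<close>

context mv_period
begin

lemma trivial_information:
  assumes "l \<in> nonneg_vecs"
  shows "mv_information P t (sigma (space M) {}) (\<lambda>_. l) (\<lambda>_. f)"
proof unfold_locales
  show "sets (sigma (space M) {}) \<subseteq> sets (source_algebra (sources t))"
    by (rule sets_sigma_subset) auto
qed (use assms in \<open>auto simp: space_measure_of_conv\<close>)

text \<open>At a frozen state the signal is the only information, so the integrand is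
  \<open>gain / ev\<close>, whose mean is \<open>residual\<close>. Two functions occur because
  \<open>h\<close> is shown to be \<open>good\<close> only after clamping; they have to agree just
  at the remaining budget.\<close>

lemma step_objective_eq:
  assumes l: "l \<in> nonneg_vecs" and g: "good g"
    and gg: "\<And>x. g' (L - (\<Sum>j\<in>UNIV. l $ j)) x = g (L - (\<Sum>j\<in>UNIV. l $ j)) x"
  shows "step_objective P t g' L f l = (ret P (Suc t))\<^sup>2 * residual g (L - (\<Sum>j\<in>UNIV. l $ j)) f l"
    "AE \<omega> in M. invertible (step_mat P t g' L f l \<omega>)"
proof -
  interpret S: mv_information P t "sigma (space M) {}" "\<lambda>_. l" "\<lambda>_. f"
    by (rule trivial_information[OF l])
  let ?L = "L - (\<Sum>j\<in>UNIV. l $ j)"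
  have info: "step_info P t f l = S.Gplus"
    unfolding step_info_def by (subst S.Gplus_sigma[of "{}" S.sig]) (simp_all add: S.sig_def[abs_def])
  have w: "step_weight P t g' L f l = (\<lambda>\<omega>. g ?L (fac f (S.Y \<omega>)))"
    by (rule ext) (simp add: step_weight_def gg S.next_factor_eq)
  have p: "step_payoff P t f = (\<lambda>\<omega>. pay f (S.Y \<omega>))"
    by (rule ext) (simp add: step_payoff_def S.payoff_eq)
  have m: "AE \<omega> in M. step_mat P t g' L f l \<omega> = (1 / S.ev \<omega>) *\<^sub>R mmat g ?L f l (S.score \<omega>)"
    using S.cond_mat_weighted[OF g, of "\<lambda>_. ?L"] by (simp add: step_mat_def info w p)
  have v: "AE \<omega> in M. step_vec P t g' L f l \<omega> = (1 / S.ev \<omega>) *\<^sub>R mvec g ?L f l (S.score \<omega>)"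
    using S.cond_vec_weighted[OF g, of "\<lambda>_. ?L"] by (simp add: step_vec_def info w p)
  have a: "AE \<omega> in M. real_cond_exp M (step_info P t f l) (step_weight P t g' L f l) \<omega> = mass g ?L f l (S.score \<omega>) / S.ev \<omega>"
    using S.cond_weight[OF g, of "\<lambda>_. ?L"] by (simp add: info w)
  show "AE \<omega> in M. invertible (step_mat P t g' L f l \<omega>)"
    using m by eventually_elim (simp only: S.weighted_hedge(1)[OF g])
  have [measurable]: "S.score \<in> borel_measurable M" by (rule S.measurable_Gplus_M[OF S.score_Gplus])
  have gm[measurable]: "(\<lambda>\<omega>. gain g ?L f l (S.score \<omega>) / S.ev \<omega>) \<in> borel_measurable M"
  proof -
    have "continuous_on UNIV (\<lambda>r. gain g ?L f l r / evidence f l r)"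
    proof (intro continuous_on_divide continuous_on_gain continuous_on_evidence g continuous_intros ballI)
      show "evidence f l x \<noteq> 0" for x using evidence_pos[of f l x] by simp
    qed
    from borel_measurable_continuous_on[OF this, of S.score M] show ?thesis by (simp add: S.ev_def)
  qed
  have nn: "0 \<le> gain g ?L f l (S.score \<omega>) / S.ev \<omega>" for \<omega>
    using gain_pos[OF g] S.ev_pos by (intro divide_nonneg_nonneg) (auto simp: less_imp_le)
  have "(\<integral>\<omega>. real_cond_exp M (step_info P t f l) (step_weight P t g' L f l) \<omega>
         - step_vec P t g' L f l \<omega> \<bullet> (matrix_inv (step_mat P t g' L f l \<omega>) *v step_vec P t g' L f l \<omega>) \<partial>M)
      = (\<integral>\<omega>. gain g ?L f l (S.score \<omega>) / S.ev \<omega> \<partial>M)"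
  proof (rule integral_cong_AE)
    show "(\<lambda>\<omega>. real_cond_exp M (step_info P t f l) (step_weight P t g' L f l) \<omega>
         - step_vec P t g' L f l \<omega> \<bullet> (matrix_inv (step_mat P t g' L f l \<omega>) *v step_vec P t g' L f l \<omega>)) \<in> borel_measurable M"
      unfolding step_vec_def step_mat_def cond_vec_def cond_mat_def by measurable
    show "AE \<omega> in M. real_cond_exp M (step_info P t f l) (step_weight P t g' L f l) \<omega>
         - step_vec P t g' L f l \<omega> \<bullet> (matrix_inv (step_mat P t g' L f l \<omega>) *v step_vec P t g' L f l \<omega>)
        = gain g ?L f l (S.score \<omega>) / S.ev \<omega>"
      using m v a
    proof eventually_elim
      case (elim \<omega>)
      show ?case unfolding elim S.weighted_hedge(2)[OF g] by (simp add: gain_def diff_divide_distrib)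
    qed
  qed measurable
  also have "\<dots> = enn2real (\<integral>\<^sup>+\<omega>. 1 * ennreal (gain g ?L f l (S.score \<omega>) / S.ev \<omega>) \<partial>M)"
    using nn by (subst integral_eq_nn_integral) auto
  also have "(\<integral>\<^sup>+\<omega>. 1 * ennreal (gain g ?L f l (S.score \<omega>) / S.ev \<omega>) \<partial>M) = (\<integral>\<^sup>+\<omega>. 1 * ennreal (residual g ?L f l) \<partial>M)"
    by (rule S.expected_gain[OF g]) auto
  also have "\<dots> = ennreal (residual g ?L f l)" by (simp add: emeasure_space_1)
  finally show "step_objective P t g' L f l = (ret P (Suc t))\<^sup>2 * residual g ?L f l"
    unfolding step_objective_def using residual_pos[OF g, of ?L f l] by simp
qed

text \<open>The objective in the scaled attention, with the budget clamped at 0 to be continuous on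
  the whole space.\<close>

definition scaled_objective :: "(real \<Rightarrow> real^'k \<Rightarrow> real) \<Rightarrow> real \<times> (real^'k) \<Rightarrow> real^'k \<Rightarrow> real" where
  "scaled_objective g x q = (ret P (Suc t))\<^sup>2 *
     residual g (max (fst x) 0 - (\<Sum>j\<in>UNIV. (max (fst x) 0 *\<^sub>R q) $ j)) (snd x) (max (fst x) 0 *\<^sub>R q)"

lemma continuous_scaled_objective:
  assumes "good g" shows "continuous_on UNIV (\<lambda>(x, q). scaled_objective g x q)"
  unfolding scaled_objective_def case_prod_beta
  by (intro continuous_on_mult continuous_on_const continuous_on_residual assms continuous_intros)

end


section \<open>The value function\<close>

text \<open>The infimum defining \<open>h\<close> is meaningful for \<open>L \<ge> 0\<close> only.\<close>

definition clamped_h :: "('w, 'n::finite, 'k::finite) market \<Rightarrow> nat \<Rightarrow> real \<Rightarrow> real^'k \<Rightarrow> real" where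
  "clamped_h P t L f = h P t (max L 0) f"

locale mv_problem = mv_base P for P :: "('w, 'n::finite, 'k::finite) market" +
  assumes cov_pos_def: "\<And>t. t < T \<Longrightarrow>
      AE \<omega> in M. pos_def_matrix (cond_cov M (info_plus P no_attention t) (payoff P (Suc t)) \<omega>)"
    and mean_nonzero: "AE \<omega> in M. cond_vec M (info_plus P no_attention (T - 1)) (payoff P T) \<omega> \<noteq> 0"
begin

abbreviation hc where "hc \<equiv> clamped_h P"

lemma period: "t < T \<Longrightarrow> mv_period P t"
  by unfold_locales (auto intro: nondegenerate_from_cov cov_pos_def)

abbreviation Res where
  "Res t \<equiv> signal_step.residual (law (Suc t)) (mat 1 - Phi P) (cvec P) (Dmat P) prec"

lemma rho_Suc: "t < T \<Longrightarrow> rho P t = ret P (Suc t) * rho P (Suc t)"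
  by (simp add: rho_def prod.atLeast_Suc_lessThan)

lemma rho_T: "rho P T = 1"
  by (simp add: rho_def)

lemma rho_pos: "0 < rho P t"
  unfolding rho_def by (intro prod_pos) (use ret_gt_1 in \<open>force intro: less_trans[of 0 1]\<close>)

text \<open>The bound \<open>(rho P t)\<^sup>2\<close> is the cost, per unit of squared shifted
  wealth, of holding no risky asset until the horizon.\<close>

definition h_regular :: "nat \<Rightarrow> bool" where
  "h_regular t \<longleftrightarrow> continuous_on UNIV (\<lambda>(L, x). hc t L x) \<and> (\<forall>L x. 0 < hc t L x \<and> hc t L x \<le> (rho P t)\<^sup>2)"

lemma h_regular_good:
  assumes "t < T" "h_regular s" shows "signal_step.good (hc s)"
proof -
  interpret mv_period P t by (rule period[OF assms(1)])
  show ?thesis using assms(2) by (auto simp: good_def h_regular_def)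
qed

lemma step_objective_residual:
  assumes t: "t < T" and h: "h_regular (Suc t)" and l: "l \<in> attn_set L"
  shows "step_objective P t (h P (Suc t)) L f l = (ret P (Suc t))\<^sup>2 * Res t (hc (Suc t)) (L - (\<Sum>j\<in>UNIV. l $ j)) f l"
    "AE \<omega> in M. invertible (step_mat P t (h P (Suc t)) L f l \<omega>)"
proof -
  interpret mv_period P t by (rule period[OF t])
  have l': "0 \<le> L - (\<Sum>j\<in>UNIV. l $ j)" "l \<in> nonneg_vecs" using l by (auto simp: attn_set_def)
  have eq: "h P (Suc t) (L - (\<Sum>j\<in>UNIV. l $ j)) x = hc (Suc t) (L - (\<Sum>j\<in>UNIV. l $ j)) x" for x
    using l'(1) by (simp only: clamped_h_def max_absorb1)
  show "step_objective P t (h P (Suc t)) L f l = (ret P (Suc t))\<^sup>2 * Res t (hc (Suc t)) (L - (\<Sum>j\<in>UNIV. l $ j)) f l"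
    "AE \<omega> in M. invertible (step_mat P t (h P (Suc t)) L f l \<omega>)"
    by (rule step_objective_eq[where g'="h P (Suc t)" and L=L, OF l'(2) h_regular_good[OF t h] eq])+
qed

text \<open>In scaled form the infimum runs over the fixed compact set \<open>attn_set 1\<close>,
  which yields continuity and a measurable minimizer. Positivity survives because the infimum is
  attained, and the upper bound comes from attention 0, where \<open>residual\<close> is at most
  \<open>prior\<close>.\<close>

lemma h_regular_step:
  assumes t: "t < T" and h: "h_regular (Suc t)"
  shows "h_regular t"
    "\<exists>s. (\<lambda>(L, f). s L f) \<in> borel_measurable borel \<and> (\<forall>L\<ge>0. \<forall>f. s L f \<in> attn_set L \<and>
        (\<forall>l\<in>attn_set L. step_objective P t (h P (Suc t)) L f (s L f) \<le> step_objective P t (h P (Suc t)) L f l))"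
proof -
  interpret mv_period P t by (rule period[OF t])
  let ?K = "attn_set 1 :: (real^'k) set"
  have g: "good (hc (Suc t))" by (rule h_regular_good[OF t h])
  have K: "compact ?K" "?K \<noteq> {}" using compact_attn_set zero_in_attn_set[of 1] by auto
  have cont: "continuous_on UNIV (\<lambda>(x, q). scaled_objective (hc (Suc t)) x q)"
    by (rule continuous_scaled_objective[OF g])
  have obj: "scaled_objective (hc (Suc t)) (L, f) q = step_objective P t (h P (Suc t)) (max L 0) f (max L 0 *\<^sub>R q)" if "q \<in> ?K" for L f q
  proof -
    have "max L 0 *\<^sub>R q \<in> attn_set (max L 0)" using attn_set_scale[of "max L 0"] that by auto
    from step_objective_residual(1)[OF t h this] show ?thesis by (simp add: scaled_objective_def)
  qed
  have hI: "hc t L f = Inf (scaled_objective (hc (Suc t)) (L, f) ` ?K)" for L f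
  proof -
    have "step_objective P t (h P (Suc t)) (max L 0) f ` attn_set (max L 0) = scaled_objective (hc (Suc t)) (L, f) ` ?K"
      unfolding attn_set_scale[OF max.cobounded2] image_image using obj by (intro image_cong) auto
    then show ?thesis by (simp add: clamped_h_def h_backward[OF t])
  qed
  have c1: "continuous_on UNIV (\<lambda>x. Inf (scaled_objective (hc (Suc t)) x ` ?K))"
    by (rule continuous_on_Inf_compact[OF K cont])
  have c: "continuous_on ?K (scaled_objective (hc (Suc t)) x)" for x
    by (rule continuous_on_compose2[OF cont, of _ "\<lambda>q. (x, q)", simplified]) (intro continuous_intros)
  have r0: "ret P (Suc t) > 0" using ret_gt_1[OF t] by simp
  show "h_regular t"
    unfolding h_regular_def
  proof (intro conjI allI)
    show "continuous_on UNIV (\<lambda>(L, x). hc t L x)" unfolding hI case_prod_beta using c1 by simp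
    fix L f
    obtain q where q: "q \<in> ?K" "scaled_objective (hc (Suc t)) (L, f) q = hc t L f"
      "\<forall>q'\<in>?K. scaled_objective (hc (Suc t)) (L, f) q \<le> scaled_objective (hc (Suc t)) (L, f) q'"
      using Inf_attained_compact[OF K c] unfolding hI by blast
    show "0 < hc t L f" unfolding q(2)[symmetric] scaled_objective_def
      using residual_pos[OF g] r0 by simp
    have "(0 :: real^'k) \<in> ?K" by (rule zero_in_attn_set) simp
    with q have "hc t L f \<le> scaled_objective (hc (Suc t)) (L, f) 0" by simp
    also have "\<dots> = (ret P (Suc t))\<^sup>2 * residual (hc (Suc t)) (max L 0) f 0" by (simp add: scaled_objective_def)
    also have "\<dots> \<le> (ret P (Suc t))\<^sup>2 * (rho P (Suc t))\<^sup>2"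
      using h order_trans[OF residual_le_prior[OF g] prior_le[OF g, of "max L 0" "(rho P (Suc t))\<^sup>2" f]]
      by (intro mult_left_mono) (auto simp: h_regular_def)
    also have "\<dots> = (rho P t)\<^sup>2" by (simp add: rho_Suc[OF t] power_mult_distrib)
    finally show "hc t L f \<le> (rho P t)\<^sup>2" .
  qed
  obtain s where s: "s \<in> borel_measurable borel"
      "\<And>x. s x \<in> ?K" "\<And>x q. q \<in> ?K \<Longrightarrow> scaled_objective (hc (Suc t)) x (s x) \<le> scaled_objective (hc (Suc t)) x q"
    using measurable_argmin[OF K cont] by blast
  show "\<exists>s. (\<lambda>(L, f). s L f) \<in> borel_measurable borel \<and> (\<forall>L\<ge>0. \<forall>f. s L f \<in> attn_set L \<and>
        (\<forall>l\<in>attn_set L. step_objective P t (h P (Suc t)) L f (s L f) \<le> step_objective P t (h P (Suc t)) L f l))"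
  proof (intro exI[of _ "\<lambda>L f. max L 0 *\<^sub>R s (L, f)"] conjI allI impI ballI)
    have [measurable]: "(\<lambda>x::real \<times> (real^'k). fst x) \<in> borel_measurable borel"
      by (intro borel_measurable_continuous_onI continuous_intros)
    show "(\<lambda>(L, f). max L 0 *\<^sub>R s (L, f)) \<in> borel_measurable borel"
      unfolding case_prod_beta using s(1) by simp
    fix L :: real and f assume L: "0 \<le> L"
    show "max L 0 *\<^sub>R s (L, f) \<in> attn_set L" using s(2) L attn_set_scale[OF L] by (auto simp: max_def)
    fix l :: "real^'k" assume "l \<in> attn_set L"
    then obtain q where q: "q \<in> ?K" "l = L *\<^sub>R q" unfolding attn_set_scale[OF L] by blast
    show "step_objective P t (h P (Suc t)) L f (max L 0 *\<^sub>R s (L, f)) \<le> step_objective P t (h P (Suc t)) L f l"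
      using s(3)[OF q(1), of "(L, f)"] obj[OF s(2), of L f "(L, f)"] obj[OF q(1), of L f] L q(2) by (simp add: max_absorb1)
  qed
qed

lemma h_regular: "t \<le> T \<Longrightarrow> h_regular t"
proof (induction t rule: inc_induct)
  case base
  show ?case by (auto simp: h_regular_def clamped_h_def h_terminal rho_T)
next
  case (step n)
  show ?case by (rule h_regular_step(1)[OF step.hyps(2) step.IH])
qed

lemma good_hc: "t < T \<Longrightarrow> signal_step.good (hc (Suc t))"
  by (rule h_regular_good) (auto intro: h_regular)

lemma minimizer_exists: "\<exists>lstar. attention_minimizer P lstar"
proof -
  define R where "R t s \<longleftrightarrow> (\<lambda>(L, f). s L f) \<in> borel_measurable borel \<and> (\<forall>L\<ge>0. \<forall>f. s L f \<in> attn_set L \<and>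
        (\<forall>l\<in>attn_set L. step_objective P t (h P (Suc t)) L f (s L f) \<le> step_objective P t (h P (Suc t)) L f l))"
    for t and s :: "real \<Rightarrow> real^'k \<Rightarrow> real^'k"
  have "\<exists>s. t < T \<longrightarrow> R t s" for t
    using h_regular_step(2)[of t] h_regular[of "Suc t"] by (cases "t < T") (simp_all add: R_def)
  then have "\<exists>s. \<forall>t. t < T \<longrightarrow> R t (s t)" by (intro choice allI)
  then obtain s where s: "\<And>t. t < T \<Longrightarrow> R t (s t)" by blast
  have "attention_minimizer P s"
    unfolding attention_minimizer_def
  proof (intro allI impI conjI ballI)
    fix t assume t: "t < T"
    show "(\<lambda>(L, f). s t L f) \<in> borel_measurable borel" using s[OF t] unfolding R_def by (rule conjunct1)
    fix L f assume "L \<in> {0..Lambda0 P}"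
    then have "0 \<le> L" by simp
    then show "is_arg_min (step_objective P t (h P (Suc t)) L f) (\<lambda>l. l \<in> attn_set L) (s t L f)"
      using s[OF t] unfolding R_def is_arg_min_def by (simp add: not_less)
  qed
  then show ?thesis by blast
qed

lemma h_le_residual:
  assumes t: "t < T" and L: "0 \<le> L" and l: "l \<in> attn_set L"
  shows "hc t L f \<le> (ret P (Suc t))\<^sup>2 * Res t (hc (Suc t)) (L - (\<Sum>j\<in>UNIV. l $ j)) f l"
proof -
  obtain s where s: "s \<in> attn_set L" "\<And>l. l \<in> attn_set L \<Longrightarrow> step_objective P t (h P (Suc t)) L f s \<le> step_objective P t (h P (Suc t)) L f l"
  proof -
    from h_regular_step(2)[OF t h_regular[of "Suc t"]] t obtain s' where
      "\<forall>L\<ge>0. \<forall>f. s' L f \<in> attn_set L \<and>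
        (\<forall>l\<in>attn_set L. step_objective P t (h P (Suc t)) L f (s' L f) \<le> step_objective P t (h P (Suc t)) L f l)"
      by auto
    with L that[of "s' L f"] show ?thesis by simp
  qed
  have "hc t L f = step_objective P t (h P (Suc t)) L f s"
    unfolding clamped_h_def h_backward[OF t] max_absorb1[OF L] using s by (intro cInf_eq_minimum) auto
  with s(2)[OF l] show ?thesis
    using step_objective_residual(1)[OF t h_regular l] t by simp
qed

lemma minimizer_attains:
  assumes lstar: "attention_minimizer P lstar" and t: "t < T" and L: "L \<in> {0..Lambda0 P}"
  shows "lstar t L f \<in> attn_set L"
    "hc t L f = (ret P (Suc t))\<^sup>2 * Res t (hc (Suc t)) (L - (\<Sum>j\<in>UNIV. lstar t L f $ j)) f (lstar t L f)"
proof -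
  have am: "is_arg_min (step_objective P t (h P (Suc t)) L f) (\<lambda>l. l \<in> attn_set L) (lstar t L f)"
    using lstar t L by (auto simp: attention_minimizer_def)
  then show l: "lstar t L f \<in> attn_set L" by (simp add: is_arg_min_def)
  have "hc t L f = step_objective P t (h P (Suc t)) L f (lstar t L f)"
    unfolding clamped_h_def h_backward[OF t] max_absorb1[of 0 L, OF atLeastAtMost_iff[THEN iffD1, OF L, THEN conjunct1]]
    using am by (intro cInf_eq_minimum) (auto simp: is_arg_min_def not_less)
  then show "hc t L f = (ret P (Suc t))\<^sup>2 * Res t (hc (Suc t)) (L - (\<Sum>j\<in>UNIV. lstar t L f $ j)) f (lstar t L f)"
    using step_objective_residual(1)[OF t h_regular l] t by simp
qed

text \<open>The last weight is 1, so at zero attention \<open>mvec\<close> is a positive multiple of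
  the mean payoff; if that is nonzero, hedging strictly improves on holding nothing.\<close>

lemma h_strict_last:
  assumes "mean_pay (T - 1) f \<noteq> 0"
  shows "hc (T - 1) (Lambda0 P) f < (rho P (T - 1))\<^sup>2"
proof -
  define t where "t = T - 1"
  have tT: "t < T" "Suc t = T" using T_pos by (auto simp: t_def)
  interpret mv_period P t by (rule period[OF tT(1)])
  have one: "hc (Suc t) = (\<lambda>_ _. 1)" unfolding tT(2) by (intro ext) (simp only: clamped_h_def h_terminal)
  have "mvec (hc (Suc t)) (Lambda0 P) f 0 r \<noteq> 0" for r
  proof -
    have "prec 0 = 0" by (simp add: prec_def vec_eq_iff)
    moreover have "(\<chi> i. \<integral>q. hc (Suc t) (Lambda0 P) (fac f q) * pay f q $ i \<partial>law (Suc t)) = mean_pay t f"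
      by (simp add: one mean_pay_def raw_pay_def pay_def fac_def)
    moreover have "std_normal_density (r $ i) \<noteq> 0" for i
      using normal_density_pos[of 1 0 "r $ i"] by simp
    moreover have "mean_pay t f \<noteq> 0" using assms by (simp add: t_def)
    ultimately show ?thesis by (simp add: mvec_uninformative)
  qed
  then have "residual (hc (Suc t)) (Lambda0 P) f 0 < prior (hc (Suc t)) (Lambda0 P) f"
    by (intro residual_less_prior good_hc tT)
  also have "\<dots> = 1" using law.prob_space by (simp add: one prior_def)
  finally have "(ret P (Suc t))\<^sup>2 * residual (hc (Suc t)) (Lambda0 P) f 0 < (ret P (Suc t))\<^sup>2"
    using ret_gt_1[OF tT(1)] by simp
  moreover have "hc t (Lambda0 P) f \<le> (ret P (Suc t))\<^sup>2 * residual (hc (Suc t)) (Lambda0 P) f 0"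
    using h_le_residual[OF tT(1) Lambda0_nonneg zero_in_attn_set[OF Lambda0_nonneg], of f] by simp
  moreover have "rho P t = ret P (Suc t)" using rho_Suc[OF tT(1)] by (simp add: tT(2) rho_T)
  ultimately show ?thesis by (simp add: t_def)
qed

text \<open>The mean payoff is known to be nonzero only along the factor process, so strictness is
  an almost sure statement. The product law of past and next noise transfers it to almost every next
  noise from a frozen factor, and integration keeps it strict. With zero attention the budget stays
  at \<open>Lambda0 P\<close>.\<close>

lemma h_strict: "t \<le> T - 1 \<Longrightarrow> AE \<omega> in M. hc t (Lambda0 P) (factor P t \<omega>) < (rho P t)\<^sup>2"
proof (induction t rule: inc_induct)
  case base
  have t: "T - 1 < T" using T_pos by simp
  have "AE \<omega> in M. cond_vec M (info_plus P no_attention (T - 1)) (payoff P (Suc (T - 1))) \<omega> = mean_pay (T - 1) (factor P (T - 1) \<omega>)"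
    using no_attention_info_plus[of "T - 1"]
    by (intro cond_mean_payoff t measurable_sub[OF factor_info info_info_plus]) auto
  with mean_nonzero show ?case
  proof eventually_elim
    case (elim \<omega>)
    then show ?case using T_pos by (intro h_strict_last) auto
  qed
next
  case (step t)
  have t: "t < T" using step by simp
  interpret mv_period P t by (rule period[OF t])
  let ?G = "source_algebra (sources t)"
  have g: "good (hc (Suc t))" by (rule good_hc[OF t])
  have sub: "subalgebra M ?G" using source_algebra_subset[OF sources_mono[of t T]] t by (auto simp: subalgebra_def)
  have id[measurable]: "(\<lambda>\<omega>. \<omega>) \<in> measurable M ?G" by (rule measurable_from_subalg[OF sub]) simp
  note [measurable] = measurable_noise[OF Suc_t] factor_sources
  have gm: "(\<lambda>x. hc (Suc t) (Lambda0 P) (y x)) \<in> borel_measurable N" if "y \<in> borel_measurable N" for y and N :: "'z measure"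
  proof -
    have "continuous_on UNIV (\<lambda>x. hc (Suc t) (Lambda0 P) x)"
      by (rule continuous_on_good[OF g]) (intro continuous_intros)+
    from borel_measurable_continuous_on[OF this that] show ?thesis .
  qed
  have [measurable]: "(\<lambda>z. hc (Suc t) (Lambda0 P) (fac (factor P t (fst z)) (snd z))) \<in> borel_measurable (?G \<Otimes>\<^sub>M law (Suc t))"
    by (rule gm) measurable
  interpret GG: prob_space "distr M ?G (\<lambda>\<omega>. \<omega>)" by (rule prob_space_distr) measurable
  interpret GL: pair_sigma_finite "distr M ?G (\<lambda>\<omega>. \<omega>)" "law (Suc t)" ..
  let ?P = "\<lambda>z. hc (Suc t) (Lambda0 P) (fac (factor P t (fst z)) (snd z)) < (rho P (Suc t))\<^sup>2"
  have fe: "factor P (Suc t) \<omega> = fac (factor P t \<omega>) (noise (Suc t) \<omega>)" for \<omega>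
    by (simp add: next_factor_def fac_def noise_def)
  have "AE \<omega> in M. ?P (\<omega>, noise (Suc t) \<omega>)"
    using step.IH unfolding fe fst_conv snd_conv .
  moreover have "(\<lambda>\<omega>. (\<omega>, noise (Suc t) \<omega>)) \<in> measurable M (?G \<Otimes>\<^sub>M law (Suc t))" by measurable
  moreover have "Measurable.pred (?G \<Otimes>\<^sub>M law (Suc t)) ?P" by measurable
  ultimately have "AE z in distr M (?G \<Otimes>\<^sub>M law (Suc t)) (\<lambda>\<omega>. (\<omega>, noise (Suc t) \<omega>)). ?P z"
    by (simp only: AE_distr_iff predE)
  then have "AE \<omega> in distr M ?G (\<lambda>\<omega>. \<omega>). AE q in law (Suc t). ?P (\<omega>, q)"
    unfolding past_noise_distr[OF t order_refl space_source_algebra] by (rule GL.AE_pair)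
  then have "AE \<omega> in M. AE q in law (Suc t). ?P (\<omega>, q)"
    by (rule AE_distrD[OF id])
  then show ?case
  proof eventually_elim
    case (elim \<omega>)
    let ?f = "factor P t \<omega>"
    have i: "integrable (law (Suc t)) (\<lambda>q. hc (Suc t) (Lambda0 P) (fac ?f q))" by (rule integrable_good[OF g])
    have "0 < (\<integral>q. (rho P (Suc t))\<^sup>2 - hc (Suc t) (Lambda0 P) (fac ?f q) \<partial>law (Suc t))"
      by (rule law.integral_pos_AE) (use i elim in auto)
    then have "prior (hc (Suc t)) (Lambda0 P) ?f < (rho P (Suc t))\<^sup>2"
      using i law.prob_space by (simp add: prior_def)
    with residual_le_prior[OF g, of "Lambda0 P" ?f 0]
    have "residual (hc (Suc t)) (Lambda0 P) ?f 0 < (rho P (Suc t))\<^sup>2" by linarith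
    then have "(ret P (Suc t))\<^sup>2 * residual (hc (Suc t)) (Lambda0 P) ?f 0 < (rho P t)\<^sup>2"
      using ret_gt_1[OF t] by (simp add: rho_Suc[OF t] power_mult_distrib)
    then show ?case
      using h_le_residual[OF t Lambda0_nonneg zero_in_attn_set[OF Lambda0_nonneg], of ?f] by simp
  qed
qed

lemma h0_strict: "AE \<omega> in M. h P 0 (Lambda0 P) (f0 P \<omega>) < (rho P 0)\<^sup>2"
  using h_strict[of 0] Lambda0_nonneg by (simp add: clamped_h_def max_absorb1)

end


section \<open>Conditional second moments\<close>

text \<open>Meant for \<open>h\<close> and its clamped version, which agree along a policy only on
  the space, where budgets are nonnegative. The conclusion is an identity of functions, without
  exceptional null sets.\<close>

lemma nn_cond_exp_space_cong:
  assumes "\<And>\<omega>. \<omega> \<in> space M \<Longrightarrow> f \<omega> = g \<omega>"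
  shows "nn_cond_exp M F f = nn_cond_exp M F g"
proof -
  have m: "f \<in> borel_measurable M \<longleftrightarrow> g \<in> borel_measurable M" by (rule measurable_cong) (rule assms)
  have "density M f = density M g" if "f \<in> borel_measurable M"
    using that m assms by (intro density_cong) auto
  then show ?thesis unfolding nn_cond_exp_def by (simp only: m cong: if_cong conj_cong)
qed

lemma real_cond_exp_space_cong:
  assumes "\<And>\<omega>. \<omega> \<in> space M \<Longrightarrow> f \<omega> = g \<omega>"
  shows "real_cond_exp M F f = real_cond_exp M F g"
proof -
  have "nn_cond_exp M F (\<lambda>\<omega>. ennreal (f \<omega>)) = nn_cond_exp M F (\<lambda>\<omega>. ennreal (g \<omega>))"
    "nn_cond_exp M F (\<lambda>\<omega>. ennreal (- f \<omega>)) = nn_cond_exp M F (\<lambda>\<omega>. ennreal (- g \<omega>))"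
    by (intro nn_cond_exp_space_cong; simp add: assms)+
  then show ?thesis by (intro ext) (simp add: real_cond_exp_def)
qed

lemma cond_vec_space_cong:
  assumes "\<And>\<omega>. \<omega> \<in> space M \<Longrightarrow> X \<omega> = X' \<omega>"
  shows "cond_vec M F X = cond_vec M F X'"
proof -
  have "real_cond_exp M F (\<lambda>\<omega>. X \<omega> $ i) = real_cond_exp M F (\<lambda>\<omega>. X' \<omega> $ i)" for i
    by (rule real_cond_exp_space_cong) (simp add: assms)
  then show ?thesis by (intro ext) (simp add: cond_vec_def)
qed

lemma cond_mat_space_cong:
  assumes "\<And>\<omega>. \<omega> \<in> space M \<Longrightarrow> X \<omega> = X' \<omega>"
  shows "cond_mat M F X = cond_mat M F X'"
proof -
  have "real_cond_exp M F (\<lambda>\<omega>. X \<omega> $ i $ j) = real_cond_exp M F (\<lambda>\<omega>. X' \<omega> $ i $ j)" for i j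
    by (rule real_cond_exp_space_cong) (simp add: assms)
  then show ?thesis by (intro ext) (simp add: cond_mat_def)
qed

text \<open>A random variable whose conditional second moment is finite need not be integrable. It is
  square integrable on the events \<open>E[X\<^sup>2 | F] \<le> n\<close>, which exhaust the space.\<close>

context finite_measure_subalgebra
begin

lemma measurable_F_M: "g \<in> borel_measurable F \<Longrightarrow> g \<in> borel_measurable M"
  by (rule measurable_from_subalg[OF subalg])

text \<open>The positive and the negative part are restricted separately, so this is valid for a
  non-integrable \<open>X\<close> as well.\<close>

lemma real_cond_exp_restrict:
  assumes A[measurable]: "A \<in> sets F" and [measurable]: "X \<in> borel_measurable M"
  shows "AE \<omega> in M. real_cond_exp M F (\<lambda>\<omega>. indicator A \<omega> * X \<omega>) \<omega> = indicator A \<omega> * real_cond_exp M F X \<omega>"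
proof -
  have 1: "AE \<omega> in M. indicator A \<omega> * nn_cond_exp M F (\<lambda>\<omega>. ennreal (X \<omega>)) \<omega> = nn_cond_exp M F (\<lambda>\<omega>. indicator A \<omega> * ennreal (X \<omega>)) \<omega>"
    by (rule nn_cond_exp_prod) measurable
  have 2: "AE \<omega> in M. indicator A \<omega> * nn_cond_exp M F (\<lambda>\<omega>. ennreal (- X \<omega>)) \<omega> = nn_cond_exp M F (\<lambda>\<omega>. indicator A \<omega> * ennreal (- X \<omega>)) \<omega>"
    by (rule nn_cond_exp_prod) measurable
  have e: "(\<lambda>\<omega>. ennreal (indicator A \<omega> * X \<omega>)) = (\<lambda>\<omega>. indicator A \<omega> * ennreal (X \<omega>))"
    "(\<lambda>\<omega>. ennreal (- (indicator A \<omega> * X \<omega>))) = (\<lambda>\<omega>. indicator A \<omega> * ennreal (- X \<omega>))"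
    by (auto simp: fun_eq_iff split: split_indicator)
  show ?thesis
    using 1 2
  proof eventually_elim
    case (elim \<omega>)
    then show ?case unfolding real_cond_exp_def e by (cases "\<omega> \<in> A") auto
  qed
qed

lemma real_cond_exp_eq_enn2real:
  assumes [measurable]: "X \<in> borel_measurable M" and "\<And>\<omega>. 0 \<le> X \<omega>"
  shows "AE \<omega> in M. real_cond_exp M F X \<omega> = enn2real (nn_cond_exp M F (\<lambda>\<omega>. ennreal (X \<omega>)) \<omega>)"
proof -
  have "(\<lambda>\<omega>. ennreal (- X \<omega>)) = (\<lambda>\<omega>. 0)" using assms(2) by (auto simp: fun_eq_iff ennreal_neg)
  moreover have "AE \<omega> in M. 0 = nn_cond_exp M F (\<lambda>\<omega>. 0) \<omega>"
    by (rule nn_cond_exp_charact) auto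
  ultimately show ?thesis by (auto simp: real_cond_exp_def elim: AE_mp)
qed

lemma cond_second_moment_shift:
  assumes [measurable]: "X \<in> borel_measurable M" "c \<in> borel_measurable F"
    and fin: "AE \<omega> in M. nn_cond_exp M F (\<lambda>\<omega>. ennreal ((X \<omega>)\<^sup>2)) \<omega> < \<infinity>"
  shows "AE \<omega> in M. nn_cond_exp M F (\<lambda>\<omega>. ennreal ((X \<omega> + c \<omega>)\<^sup>2)) \<omega> < \<infinity>"
proof -
  have [measurable]: "c \<in> borel_measurable M" by (rule measurable_F_M) measurable
  have "(X \<omega> + c \<omega>)\<^sup>2 \<le> 2 * (X \<omega>)\<^sup>2 + 2 * (c \<omega>)\<^sup>2" for \<omega>
    using sum_squares_bound[of "X \<omega>" "c \<omega>"] by (simp add: power2_sum)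
  then have le: "ennreal ((X \<omega> + c \<omega>)\<^sup>2) \<le> 2 * ennreal ((X \<omega>)\<^sup>2) + ennreal (2 * (c \<omega>)\<^sup>2)" for \<omega>
    using ennreal_leI[of "(X \<omega> + c \<omega>)\<^sup>2" "2 * (X \<omega>)\<^sup>2 + 2 * (c \<omega>)\<^sup>2"] by (simp add: ennreal_plus ennreal_mult)
  have 1: "AE \<omega> in M. nn_cond_exp M F (\<lambda>\<omega>. ennreal ((X \<omega> + c \<omega>)\<^sup>2)) \<omega>
      \<le> nn_cond_exp M F (\<lambda>\<omega>. 2 * ennreal ((X \<omega>)\<^sup>2) + ennreal (2 * (c \<omega>)\<^sup>2)) \<omega>"
    using le by (intro nn_cond_exp_mono) auto
  have 2: "AE \<omega> in M. nn_cond_exp M F (\<lambda>\<omega>. 2 * ennreal ((X \<omega>)\<^sup>2)) \<omega> + nn_cond_exp M F (\<lambda>\<omega>. ennreal (2 * (c \<omega>)\<^sup>2)) \<omega>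
      = nn_cond_exp M F (\<lambda>\<omega>. 2 * ennreal ((X \<omega>)\<^sup>2) + ennreal (2 * (c \<omega>)\<^sup>2)) \<omega>"
    by (rule nn_cond_exp_sum) auto
  have 3: "AE \<omega> in M. 2 * nn_cond_exp M F (\<lambda>\<omega>. ennreal ((X \<omega>)\<^sup>2)) \<omega> = nn_cond_exp M F (\<lambda>\<omega>. 2 * ennreal ((X \<omega>)\<^sup>2)) \<omega>"
    by (rule nn_cond_exp_prod) auto
  have 4: "AE \<omega> in M. ennreal (2 * (c \<omega>)\<^sup>2) = nn_cond_exp M F (\<lambda>\<omega>. ennreal (2 * (c \<omega>)\<^sup>2)) \<omega>"
    by (rule nn_cond_exp_F_meas) auto
  show ?thesis
    using 1 2 3 4 fin
  proof eventually_elim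
    case (elim \<omega>)
    have lt: "2 * nn_cond_exp M F (\<lambda>\<omega>. ennreal ((X \<omega>)\<^sup>2)) \<omega> + ennreal (2 * (c \<omega>)\<^sup>2) < \<infinity>"
      using elim(5) by (simp add: ennreal_mult_less_top)
    show ?case
      by (rule order_le_less_trans[OF elim(1)]) (use lt elim(2-4) in simp)
  qed
qed

lemma cond_square_shift:
  assumes X[measurable]: "X \<in> borel_measurable M" and c[measurable]: "c \<in> borel_measurable F"
    and fin: "AE \<omega> in M. nn_cond_exp M F (\<lambda>\<omega>. ennreal ((X \<omega>)\<^sup>2)) \<omega> < \<infinity>"
  shows "AE \<omega> in M. real_cond_exp M F (\<lambda>\<omega>. (X \<omega> + c \<omega>)\<^sup>2) \<omega>
    = real_cond_exp M F (\<lambda>\<omega>. (X \<omega>)\<^sup>2) \<omega> + 2 * c \<omega> * real_cond_exp M F X \<omega> + (c \<omega>)\<^sup>2"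
proof -
  have cM[measurable]: "c \<in> borel_measurable M" by (rule measurable_F_M) measurable
  define N where "N = nn_cond_exp M F (\<lambda>\<omega>. ennreal ((X \<omega>)\<^sup>2))"
  have [measurable]: "N \<in> borel_measurable F" by (simp add: N_def)
  \<comment> \<open>Bounding \<open>c\<close> along with the conditional second moment makes the
    cross term integrable, too.\<close>
  define A where "A n = {\<omega>\<in>space F. N \<omega> \<le> of_nat n \<and> \<bar>c \<omega>\<bar> \<le> real n}" for n :: nat
  have AF[measurable]: "A n \<in> sets F" for n unfolding A_def by measurable
  have AM[measurable]: "A n \<in> sets M" for n using AF[of n] subalg by (auto simp: subalgebra_def)
  have *: "AE \<omega> in M. \<omega> \<in> A n \<longrightarrow> real_cond_exp M F (\<lambda>\<omega>. (X \<omega> + c \<omega>)\<^sup>2) \<omega>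
    = real_cond_exp M F (\<lambda>\<omega>. (X \<omega>)\<^sup>2) \<omega> + 2 * c \<omega> * real_cond_exp M F X \<omega> + (c \<omega>)\<^sup>2" for n
  proof -
    define Xn where "Xn \<omega> = indicator (A n) \<omega> * X \<omega>" for \<omega>
    define cn where "cn \<omega> = indicator (A n) \<omega> * c \<omega>" for \<omega>
    have [measurable]: "Xn \<in> borel_measurable M" "cn \<in> borel_measurable F" unfolding Xn_def cn_def by measurable
    have [measurable]: "cn \<in> borel_measurable M" by (rule measurable_F_M) measurable
    have cb: "\<bar>cn \<omega>\<bar> \<le> real n" for \<omega> by (auto simp: cn_def A_def split: split_indicator)
    have "(\<integral>\<^sup>+\<omega>. ennreal ((Xn \<omega>)\<^sup>2) \<partial>M) = (\<integral>\<^sup>+\<omega>. indicator (A n) \<omega> * ennreal ((X \<omega>)\<^sup>2) \<partial>M)"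
      by (intro nn_integral_cong) (auto simp: Xn_def split: split_indicator)
    also have "\<dots> = (\<integral>\<^sup>+\<omega>. indicator (A n) \<omega> * N \<omega> \<partial>M)"
      unfolding N_def by (rule nn_cond_exp_intg[symmetric]) measurable
    also have "\<dots> \<le> (\<integral>\<^sup>+\<omega>. of_nat n \<partial>M)"
      by (intro nn_integral_mono) (auto simp: A_def split: split_indicator)
    also have "\<dots> < \<infinity>"
    proof -
      have "emeasure M (space M) < top" using emeasure_finite[of "space M"] by (simp add: less_top[symmetric])
      then show ?thesis by (simp add: ennreal_mult_less_top of_nat_less_top)
    qed
    finally have sq: "integrable M (\<lambda>\<omega>. (Xn \<omega>)\<^sup>2)" by (intro integrableI_nonneg) auto
    have i1: "integrable M Xn" by (rule square_integrable_imp_integrable[OF _ sq]) measurable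
    have i2: "integrable M (\<lambda>\<omega>. cn \<omega> * Xn \<omega>)"
    proof (rule Bochner_Integration.integrable_bound)
      show "integrable M (\<lambda>\<omega>. real n * Xn \<omega>)" using i1 by simp
      show "AE \<omega> in M. norm (cn \<omega> * Xn \<omega>) \<le> norm (real n * Xn \<omega>)"
        using cb by (auto intro!: AE_I2 mult_right_mono simp: abs_mult)
    qed measurable
    have i3: "integrable M (\<lambda>\<omega>. (cn \<omega>)\<^sup>2)"
    proof (rule integrable_const_bound[where B="(real n)\<^sup>2"])
      show "AE \<omega> in M. norm ((cn \<omega>)\<^sup>2) \<le> (real n)\<^sup>2"
        using cb by (auto intro!: AE_I2 simp: abs_le_square_iff[symmetric])
    qed measurable
    have s: "(\<lambda>\<omega>. indicator (A n) \<omega> * (X \<omega> + c \<omega>)\<^sup>2) = (\<lambda>\<omega>. ((Xn \<omega>)\<^sup>2 + 2 * (cn \<omega> * Xn \<omega>)) + (cn \<omega>)\<^sup>2)"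
      by (auto simp: fun_eq_iff Xn_def cn_def power2_sum split: split_indicator)
    have s2: "(\<lambda>\<omega>. indicator (A n) \<omega> * (X \<omega>)\<^sup>2) = (\<lambda>\<omega>. (Xn \<omega>)\<^sup>2)"
      by (auto simp: fun_eq_iff Xn_def split: split_indicator)
    have a1: "AE \<omega> in M. real_cond_exp M F (\<lambda>\<omega>. ((Xn \<omega>)\<^sup>2 + 2 * (cn \<omega> * Xn \<omega>)) + (cn \<omega>)\<^sup>2) \<omega>
      = real_cond_exp M F (\<lambda>\<omega>. (Xn \<omega>)\<^sup>2 + 2 * (cn \<omega> * Xn \<omega>)) \<omega> + real_cond_exp M F (\<lambda>\<omega>. (cn \<omega>)\<^sup>2) \<omega>"
      using sq i2 i3 by (intro real_cond_exp_add) auto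
    have a2: "AE \<omega> in M. real_cond_exp M F (\<lambda>\<omega>. (Xn \<omega>)\<^sup>2 + 2 * (cn \<omega> * Xn \<omega>)) \<omega>
      = real_cond_exp M F (\<lambda>\<omega>. (Xn \<omega>)\<^sup>2) \<omega> + real_cond_exp M F (\<lambda>\<omega>. 2 * (cn \<omega> * Xn \<omega>)) \<omega>"
      using sq i2 by (intro real_cond_exp_add) auto
    have a3: "AE \<omega> in M. real_cond_exp M F (\<lambda>\<omega>. 2 * (cn \<omega> * Xn \<omega>)) \<omega> = 2 * real_cond_exp M F (\<lambda>\<omega>. cn \<omega> * Xn \<omega>) \<omega>"
      using i2 by (rule real_cond_exp_cmult)
    have a4: "AE \<omega> in M. real_cond_exp M F (\<lambda>\<omega>. cn \<omega> * Xn \<omega>) \<omega> = cn \<omega> * real_cond_exp M F Xn \<omega>"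
      using i2 by (intro real_cond_exp_mult) auto
    have a5: "AE \<omega> in M. real_cond_exp M F (\<lambda>\<omega>. (cn \<omega>)\<^sup>2) \<omega> = (cn \<omega>)\<^sup>2"
      using i3 by (intro real_cond_exp_F_meas) auto
    have r1: "AE \<omega> in M. real_cond_exp M F (\<lambda>\<omega>. indicator (A n) \<omega> * (X \<omega> + c \<omega>)\<^sup>2) \<omega> = indicator (A n) \<omega> * real_cond_exp M F (\<lambda>\<omega>. (X \<omega> + c \<omega>)\<^sup>2) \<omega>"
      by (rule real_cond_exp_restrict) measurable
    have r2: "AE \<omega> in M. real_cond_exp M F (\<lambda>\<omega>. indicator (A n) \<omega> * (X \<omega>)\<^sup>2) \<omega> = indicator (A n) \<omega> * real_cond_exp M F (\<lambda>\<omega>. (X \<omega>)\<^sup>2) \<omega>"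
      by (rule real_cond_exp_restrict) measurable
    have r3: "AE \<omega> in M. real_cond_exp M F Xn \<omega> = indicator (A n) \<omega> * real_cond_exp M F X \<omega>"
      unfolding Xn_def by (rule real_cond_exp_restrict) measurable
    show ?thesis
      using a1 a2 a3 a4 a5 r1[unfolded s] r2[unfolded s2] r3
      by eventually_elim (auto simp: cn_def)
  qed
  then have "AE \<omega> in M. \<forall>n. \<omega> \<in> A n \<longrightarrow> real_cond_exp M F (\<lambda>\<omega>. (X \<omega> + c \<omega>)\<^sup>2) \<omega>
    = real_cond_exp M F (\<lambda>\<omega>. (X \<omega>)\<^sup>2) \<omega> + 2 * c \<omega> * real_cond_exp M F X \<omega> + (c \<omega>)\<^sup>2"
    unfolding AE_all_countable by blast
  with fin AE_space show ?thesis
  proof eventually_elim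
    case (elim \<omega>)
    obtain b where b: "N \<omega> = ennreal b" "0 \<le> b" using elim(1) unfolding N_def[symmetric] by (cases "N \<omega>") auto
    obtain n :: nat where n: "max b \<bar>c \<omega>\<bar> \<le> real n" using real_arch_simple by blast
    have "N \<omega> \<le> of_nat n" unfolding b ennreal_of_nat_eq_real_of_nat using n by (intro ennreal_leI) simp
    then have "\<omega> \<in> A n" using n elim(2) subalg by (simp add: A_def subalgebra_def)
    with elim(3) show ?case by blast
  qed
qed

end

text \<open>Used with \<open>k = h0 \<omega> / (rho P 0)\<^sup>2\<close> and
  \<open>e = rho P 0 * x0 P - d\<close>: the centre of the square becomes \<open>mu_star\<close> and
  the constant term the frontier.\<close>

lemma concave_quadratic:
  fixes k e m :: real
  assumes "k < 1"
  shows "k * (e + m)\<^sup>2 - m\<^sup>2 = k * e\<^sup>2 / (1 - k) - (1 - k) * (m - k * e / (1 - k))\<^sup>2"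
proof -
  define \<mu> where "\<mu> = k * e / (1 - k)"
  have 1: "(1 - k) * \<mu> = k * e" using assms by (simp add: \<mu>_def)
  have "k * e\<^sup>2 / (1 - k) = e * \<mu>" by (simp add: \<mu>_def power2_eq_square)
  moreover have "(1 - k) * (m - \<mu>)\<^sup>2 = (1 - k) * m\<^sup>2 - 2 * m * ((1 - k) * \<mu>) + \<mu> * ((1 - k) * \<mu>)"
    by (simp add: power2_eq_square algebra_simps)
  moreover have "\<mu> * (k * e) = e * \<mu> - k * e\<^sup>2"
  proof -
    have "\<mu> * (k * e) = e * (\<mu> - (1 - k) * \<mu>)" by (simp add: algebra_simps)
    then show ?thesis unfolding 1 by (simp add: algebra_simps power2_eq_square)
  qed
  ultimately show ?thesis unfolding \<mu>_def[symmetric] 1 by (simp add: power2_eq_square algebra_simps)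
qed


section \<open>Verification\<close>

context mv_problem
begin

abbreviation Hedge where
  "Hedge t \<equiv> signal_step.hedge (law (Suc t)) (mat 1 - Phi P) (cvec P) (Dmat P) prec"

lemma h_measurable:
  assumes "t \<le> T" "L \<in> borel_measurable N" "y \<in> borel_measurable N"
  shows "(\<lambda>x. hc t (L x) (y x)) \<in> borel_measurable N"
proof -
  have "continuous_on UNIV (\<lambda>(L, x). hc t L x)" using h_regular[OF assms(1)] by (simp add: h_regular_def)
  from borel_measurable_continuous_on[OF this, of "\<lambda>x. (L x, y x)" N] assms(2,3)
  show ?thesis by (simp add: borel_measurable_Pair)
qed

lemma h_positive: "t \<le> T \<Longrightarrow> 0 < hc t L x"
  using h_regular[of t] by (simp add: h_regular_def)

lemma information:
  assumes lam: "admissible_attention P lam" and t: "t < T"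
  shows "mv_information P t (info P lam t) (lam t) (factor P t)"
proof -
  interpret mv_period P t by (rule period[OF t])
  show ?thesis
  proof unfold_locales
    show "sets (info P lam t) \<subseteq> sets (source_algebra (sources t))"
      using info_sources[OF lam, of t] t by simp
    show "lam t \<in> borel_measurable (info P lam t)" using lam t by (simp add: admissible_attention_def)
  qed (auto intro: factor_info attention_nonneg[OF lam t])
qed

lemma information_signal:
  assumes lam: "admissible_attention P lam" and t: "t < T"
  shows "mv_information.sig P t (lam t) (factor P t) = signal P lam t"
    "mv_information.Gplus P t (info P lam t) (lam t) (factor P t) = info_plus P lam t"
proof -
  interpret I: mv_information P t "info P lam t" "lam t" "factor P t" by (rule information[OF lam t])
  show s: "I.sig = signal P lam t"
    by (rule ext) (simp add: I.sig_def signal_def)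
  show "I.Gplus = info_plus P lam t"
    unfolding info_plus_def by (rule I.Gplus_sigma[OF info_def info_events_Pow s[symmetric]])
qed

lemma info_subalgebra:
  assumes lam: "admissible_attention P lam"
  shows "t \<le> T \<Longrightarrow> subalgebra M (info P lam t)" "t < T \<Longrightarrow> subalgebra M (info_plus P lam t)"
proof -
  show *: "subalgebra M (info P lam t)" if "t \<le> T" for t
    using info_sources[OF lam that] source_algebra_subset[OF sources_mono[OF that]] by (auto simp: subalgebra_def)
  assume "t < T"
  then show "subalgebra M (info_plus P lam t)"
    using *[of "Suc t"] info_plus_info_Suc[of P lam t] by (auto simp: subalgebra_def)
qed

lemma space_info0 [simp]: "space (info0 P) = space M"
  by (simp add: info0_def space_measure_of_conv)

lemma info0_subset: "sets (info0 P) \<subseteq> sets (info P lam t)"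
  using info_mono[of 0 t P lam] by (simp add: info_0)

lemma info0_info: "g \<in> borel_measurable (info0 P) \<Longrightarrow> g \<in> borel_measurable (info P lam t)"
  by (rule measurable_sub[OF _ info0_subset]) auto

lemma info_info_plus_measurable: "g \<in> borel_measurable (info P lam t) \<Longrightarrow> g \<in> borel_measurable (info_plus P lam t)"
  by (rule measurable_sub[OF _ info_info_plus]) auto

lemma f0_info0: "f0 P \<in> borel_measurable (info0 P)"
  using info_measurable(1)[of P undefined 0] by (simp add: info_0)

lemma subalgebra_info0: "subalgebra M (info0 P)"
  using info_subalgebra(1)[OF admissible_no_attention, of 0] by (simp add: info_0)

sublocale i0: finite_measure_subalgebra M "info0 P"
  by unfold_locales (rule subalgebra_info0)

lemma wealth_info:
  assumes "\<And>s. s < t \<Longrightarrow> u s \<in> borel_measurable (info_plus P lam s)"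
  shows "wealth P u t \<in> borel_measurable (info P lam t)"
  using assms
proof (induction t)
  case 0
  have "wealth P u 0 = (\<lambda>_. x0 P)" by (rule ext) simp
  then show ?case by simp
next
  case (Suc t)
  have [measurable]: "wealth P u t \<in> borel_measurable (info P lam (Suc t))"
    using Suc by (auto intro: measurable_sub[OF _ info_mono[of t "Suc t"]])
  have [measurable]: "u t \<in> borel_measurable (info P lam (Suc t))"
    using Suc.prems[of t] by (auto intro: measurable_sub[OF _ info_plus_info_Suc])
  note [measurable] = payoff_info[of P t lam]
  have "wealth P u (Suc t) = (\<lambda>\<omega>. ret P (Suc t) * wealth P u t \<omega> + payoff P (Suc t) \<omega> \<bullet> u t \<omega>)"
    by (rule ext) simp
  then show ?case by simp
qed

section \<open>The value process along a policy\<close>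

abbreviation shifted where "shifted \<equiv> shifted_wealth P"

text \<open>The shift is discounted by the riskless return, so shifted wealth follows the dynamics
  of wealth.\<close>

lemma shifted_Suc:
  assumes t: "t < T"
  shows "shifted d \<mu> u (Suc t) \<omega> = ret P (Suc t) * shifted d \<mu> u t \<omega> + u t \<omega> \<bullet> payoff P (Suc t) \<omega>"
proof -
  have "(d - \<mu> \<omega>) / rho P (Suc t) = ret P (Suc t) * ((d - \<mu> \<omega>) / rho P t)"
    using ret_gt_1[OF t] by (simp add: rho_Suc[OF t])
  then show ?thesis by (simp add: shifted_wealth_def algebra_simps inner_commute)
qed

lemma shifted_info:
  assumes "\<And>s. s < t \<Longrightarrow> u s \<in> borel_measurable (info_plus P lam s)" "\<mu> \<in> borel_measurable (info0 P)"
  shows "shifted d \<mu> u t \<in> borel_measurable (info P lam t)"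
proof -
  note [measurable] = wealth_info[OF assms(1)] info0_info[OF assms(2), of lam t]
  show ?thesis unfolding shifted_wealth_def[abs_def] by measurable
qed

text \<open>The process compared between consecutive dates: it starts at the claimed minimal cost
  and ends at the squared shifted terminal wealth.\<close>

definition candidate :: "real \<Rightarrow> ('w \<Rightarrow> real) \<Rightarrow> (nat \<Rightarrow> 'w \<Rightarrow> real^'k) \<Rightarrow> (nat \<Rightarrow> 'w \<Rightarrow> real^'n) \<Rightarrow> nat \<Rightarrow> 'w \<Rightarrow> real" where
  "candidate d \<mu> lam u t \<omega> = hc t (budget P lam t \<omega>) (factor P t \<omega>) * (shifted d \<mu> u t \<omega>)\<^sup>2"

definition hedging :: "(nat \<Rightarrow> 'w \<Rightarrow> real^'k) \<Rightarrow> nat \<Rightarrow> 'w \<Rightarrow> real^'n" where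
  "hedging lam t \<omega> = Hedge t (hc (Suc t)) (budget P lam (Suc t) \<omega>) (factor P t \<omega>) (lam t \<omega>)
     (\<chi> j. prec (lam t \<omega>) $ j * signal P lam t \<omega> $ j)"

text \<open>A submartingale property tested on events of \<open>info0\<close>. Losses arise from
  attention that does not attain \<open>h\<close>, by \<open>h_le_residual\<close>, and from a
  portfolio other than the hedge, by \<open>one_step_lower\<close>; if both are excluded, equality
  holds.\<close>

lemma candidate_step:
  assumes lam: "admissible_attention P lam" and t: "t < T"
    and u: "\<And>s. s \<le> t \<Longrightarrow> u s \<in> borel_measurable (info_plus P lam s)"
    and \<mu>: "\<mu> \<in> borel_measurable (info0 P)" and A: "A \<in> sets (info0 P)"
  shows "(\<integral>\<^sup>+\<omega>. indicator A \<omega> * ennreal (candidate d \<mu> lam u t \<omega>) \<partial>M)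
      \<le> (\<integral>\<^sup>+\<omega>. indicator A \<omega> * ennreal (candidate d \<mu> lam u (Suc t) \<omega>) \<partial>M)"
    and "\<lbrakk>\<And>\<omega>. \<omega> \<in> space M \<Longrightarrow> hc t (budget P lam t \<omega>) (factor P t \<omega>)
            = (ret P (Suc t))\<^sup>2 * Res t (hc (Suc t)) (budget P lam (Suc t) \<omega>) (factor P t \<omega>) (lam t \<omega>);
          AE \<omega> in M. u t \<omega> = - ((ret P (Suc t) * shifted d \<mu> u t \<omega>) *\<^sub>R hedging lam t \<omega>)\<rbrakk>
      \<Longrightarrow> (\<integral>\<^sup>+\<omega>. indicator A \<omega> * ennreal (candidate d \<mu> lam u t \<omega>) \<partial>M)
        = (\<integral>\<^sup>+\<omega>. indicator A \<omega> * ennreal (candidate d \<mu> lam u (Suc t) \<omega>) \<partial>M)"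
proof -
  let ?lower = "(\<integral>\<^sup>+\<omega>. indicator A \<omega> * ennreal (candidate d \<mu> lam u t \<omega>) \<partial>M)"
  let ?upper = "(\<integral>\<^sup>+\<omega>. indicator A \<omega> * ennreal (candidate d \<mu> lam u (Suc t) \<omega>) \<partial>M)"
  interpret I: mv_information P t "info P lam t" "lam t" "factor P t" by (rule information[OF lam t])
  note info = information_signal[OF lam t]
  have g: "I.good (hc (Suc t))" by (rule good_hc[OF t])
  have lm: "lam s \<in> borel_measurable (info P lam s)" if "s < Suc t" for s
    using lam that t by (simp add: admissible_attention_def)
  have b: "budget P lam (Suc t) \<in> borel_measurable (info P lam t)"
  proof -
    have [measurable]: "budget P lam t \<in> borel_measurable (info P lam t)" by (rule budget_info) (simp add: lm)
    have [measurable]: "lam t \<in> borel_measurable (info P lam t)" using lm[of t] by simp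
    have "budget P lam (Suc t) = (\<lambda>\<omega>. budget P lam t \<omega> - (\<Sum>j\<in>UNIV. lam t \<omega> $ j))" by (rule ext) simp
    then show ?thesis by simp
  qed
  have A': "A \<in> sets (info P lam t)" using A info0_subset by blast
  then have W: "(indicator A :: 'w \<Rightarrow> ennreal) \<in> borel_measurable (info P lam t)" by simp
  have [measurable]: "shifted d \<mu> u t \<in> borel_measurable (info P lam t)"
    using u by (intro shifted_info \<mu>) simp
  have \<alpha>: "(\<lambda>\<omega>. ret P (Suc t) * shifted d \<mu> u t \<omega>) \<in> borel_measurable (info P lam t)" by measurable
  have ut: "u t \<in> borel_measurable I.Gplus" unfolding info(2) by (rule u) simp
  have Y: "factor P (Suc t) \<omega> = I.fac (factor P t \<omega>) (I.Y \<omega>)" for \<omega>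
    using I.next_factor_eq by simp
  have pay: "payoff P (Suc t) \<omega> = I.pay (factor P t \<omega>) (I.Y \<omega>)" for \<omega>
    using I.payoff_eq by (simp add: payoff_def)
  have upper: "?upper = (\<integral>\<^sup>+\<omega>. indicator A \<omega> * ennreal (hc (Suc t) (budget P lam (Suc t) \<omega>) (I.fac (factor P t \<omega>) (I.Y \<omega>))
      * (ret P (Suc t) * shifted d \<mu> u t \<omega> + u t \<omega> \<bullet> I.pay (factor P t \<omega>) (I.Y \<omega>))\<^sup>2) \<partial>M)"
    unfolding candidate_def shifted_Suc[OF t] Y pay ..
  have hle: "hc t (budget P lam t \<omega>) (factor P t \<omega>)
      \<le> (ret P (Suc t))\<^sup>2 * Res t (hc (Suc t)) (budget P lam (Suc t) \<omega>) (factor P t \<omega>) (lam t \<omega>)" if "\<omega> \<in> space M" for \<omega>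
    using h_le_residual[OF t, of "budget P lam t \<omega>" "lam t \<omega>"] budget_nonneg[OF lam that, of t] lam t that
    by (simp add: admissible_attention_def)
  have "?lower \<le> (\<integral>\<^sup>+\<omega>. indicator A \<omega> * ennreal ((ret P (Suc t) * shifted d \<mu> u t \<omega>)\<^sup>2
      * I.residual (hc (Suc t)) (budget P lam (Suc t) \<omega>) (factor P t \<omega>) (lam t \<omega>)) \<partial>M)"
  proof (intro nn_integral_mono mult_left_mono ennreal_leI)
    fix \<omega> assume "\<omega> \<in> space M"
    from mult_right_mono[OF hle[OF this], of "(shifted d \<mu> u t \<omega>)\<^sup>2"]
    show "candidate d \<mu> lam u t \<omega> \<le> (ret P (Suc t) * shifted d \<mu> u t \<omega>)\<^sup>2
      * I.residual (hc (Suc t)) (budget P lam (Suc t) \<omega>) (factor P t \<omega>) (lam t \<omega>)"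
      by (simp add: candidate_def power_mult_distrib mult_ac)
  qed simp
  also have "\<dots> \<le> ?upper"
    unfolding upper by (rule I.one_step_lower[OF g b W \<alpha> ut])
  finally show "?lower \<le> ?upper" .
  assume eq: "\<And>\<omega>. \<omega> \<in> space M \<Longrightarrow> hc t (budget P lam t \<omega>) (factor P t \<omega>)
            = (ret P (Suc t))\<^sup>2 * Res t (hc (Suc t)) (budget P lam (Suc t) \<omega>) (factor P t \<omega>) (lam t \<omega>)"
    and opt: "AE \<omega> in M. u t \<omega> = - ((ret P (Suc t) * shifted d \<mu> u t \<omega>) *\<^sub>R hedging lam t \<omega>)"
  have "?lower = (\<integral>\<^sup>+\<omega>. indicator A \<omega> * ennreal ((ret P (Suc t) * shifted d \<mu> u t \<omega>)\<^sup>2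
      * I.residual (hc (Suc t)) (budget P lam (Suc t) \<omega>) (factor P t \<omega>) (lam t \<omega>)) \<partial>M)"
  proof (rule nn_integral_cong)
    fix \<omega> assume "\<omega> \<in> space M"
    then have "candidate d \<mu> lam u t \<omega> = (ret P (Suc t) * shifted d \<mu> u t \<omega>)\<^sup>2
      * I.residual (hc (Suc t)) (budget P lam (Suc t) \<omega>) (factor P t \<omega>) (lam t \<omega>)"
      unfolding candidate_def eq[OF \<open>\<omega> \<in> space M\<close>] by (simp only: power_mult_distrib mult_ac)
    then show "indicator A \<omega> * ennreal (candidate d \<mu> lam u t \<omega>) = indicator A \<omega> * ennreal ((ret P (Suc t) * shifted d \<mu> u t \<omega>)\<^sup>2
      * I.residual (hc (Suc t)) (budget P lam (Suc t) \<omega>) (factor P t \<omega>) (lam t \<omega>))" by simp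
  qed
  also have "\<dots> = ?upper"
    unfolding upper
    by (rule I.one_step_attained[OF g b W \<alpha> ut, symmetric]) (use opt in \<open>simp add: hedging_def I.score_def info(1)\<close>)
  finally show "?lower = ?upper" .
qed

text \<open>Chaining the periods compares integrals over every event of \<open>info0\<close>. As
  \<open>v\<close> is finite and known at time 0, this compares it with the conditional expectation
  itself.\<close>

lemma initial_value:
  fixes d :: real
  assumes lam: "admissible_attention P lam" and u: "\<And>s. s < T \<Longrightarrow> u s \<in> borel_measurable (info_plus P lam s)"
    and \<mu>: "\<mu> \<in> borel_measurable (info0 P)"
  defines "v \<equiv> \<lambda>\<omega>. hc 0 (Lambda0 P) (f0 P \<omega>) * (x0 P - (d - \<mu> \<omega>) / rho P 0)\<^sup>2"
  shows "AE \<omega> in M. ennreal (v \<omega>) \<le> nn_cond_exp M (info0 P) (\<lambda>\<omega>. ennreal ((shifted d \<mu> u T \<omega>)\<^sup>2)) \<omega>"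
    and "(\<And>t \<omega>. t < T \<Longrightarrow> \<omega> \<in> space M \<Longrightarrow> hc t (budget P lam t \<omega>) (factor P t \<omega>)
            = (ret P (Suc t))\<^sup>2 * Res t (hc (Suc t)) (budget P lam (Suc t) \<omega>) (factor P t \<omega>) (lam t \<omega>)) \<Longrightarrow>
         (\<And>t. t < T \<Longrightarrow> AE \<omega> in M. u t \<omega> = - ((ret P (Suc t) * shifted d \<mu> u t \<omega>) *\<^sub>R hedging lam t \<omega>)) \<Longrightarrow>
         AE \<omega> in M. ennreal (v \<omega>) = nn_cond_exp M (info0 P) (\<lambda>\<omega>. ennreal ((shifted d \<mu> u T \<omega>)\<^sup>2)) \<omega>"
proof -
  have v0: "candidate d \<mu> lam u 0 = v" by (rule ext) (simp add: candidate_def v_def shifted_wealth_def)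
  have vT: "candidate d \<mu> lam u T = (\<lambda>\<omega>. (shifted d \<mu> u T \<omega>)\<^sup>2)"
    by (rule ext) (simp add: candidate_def clamped_h_def h_terminal)
  have vm[measurable]: "v \<in> borel_measurable (info0 P)"
  proof -
    note [measurable] = \<mu> h_measurable[of 0 "\<lambda>_. Lambda0 P" "info0 P" "f0 P", OF _ _ f0_info0, simplified]
    show ?thesis unfolding v_def by measurable
  qed
  have ym[measurable]: "shifted d \<mu> u T \<in> borel_measurable M"
    using shifted_info[of T u lam \<mu> d] u \<mu> measurable_from_subalg[OF info_subalgebra(1)[OF lam order_refl]] by blast
  have int: "(\<integral>\<^sup>+\<omega>. nn_cond_exp M (info0 P) (\<lambda>\<omega>. ennreal ((shifted d \<mu> u T \<omega>)\<^sup>2)) \<omega> * indicator A \<omega> \<partial>M)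
      = (\<integral>\<^sup>+\<omega>. indicator A \<omega> * ennreal ((shifted d \<mu> u T \<omega>)\<^sup>2) \<partial>M)" if [measurable]: "A \<in> sets (info0 P)" for A
    using i0.nn_cond_exp_intg[of "indicator A" "\<lambda>\<omega>. ennreal ((shifted d \<mu> u T \<omega>)\<^sup>2)"] by (simp add: mult.commute)
  show "AE \<omega> in M. ennreal (v \<omega>) \<le> nn_cond_exp M (info0 P) (\<lambda>\<omega>. ennreal ((shifted d \<mu> u T \<omega>)\<^sup>2)) \<omega>"
  proof (rule subalgebra_AE_le[OF finite_measure_axioms subalgebra_info0])
    fix A assume A: "A \<in> sets (info0 P)"
    have "t \<le> T \<Longrightarrow> (\<integral>\<^sup>+\<omega>. indicator A \<omega> * ennreal (candidate d \<mu> lam u 0 \<omega>) \<partial>M)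
      \<le> (\<integral>\<^sup>+\<omega>. indicator A \<omega> * ennreal (candidate d \<mu> lam u t \<omega>) \<partial>M)" for t
    proof (induction t)
      case (Suc t)
      from Suc have t: "t < T" "t \<le> T" by simp_all
      have us: "u s \<in> borel_measurable (info_plus P lam s)" if "s \<le> t" for s using u that t by simp
      show ?case
        by (rule order_trans[OF Suc.IH[OF t(2)] candidate_step(1)[OF lam t(1) us \<mu> A]])
    qed simp
    from this[OF order_refl]
    show "(\<integral>\<^sup>+\<omega>. ennreal (v \<omega>) * indicator A \<omega> \<partial>M) \<le> (\<integral>\<^sup>+\<omega>. nn_cond_exp M (info0 P) (\<lambda>\<omega>. ennreal ((shifted d \<mu> u T \<omega>)\<^sup>2)) \<omega> * indicator A \<omega> \<partial>M)"
      unfolding int[OF A] v0 vT by (simp add: mult.commute)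
  qed auto
  assume eq: "\<And>t \<omega>. t < T \<Longrightarrow> \<omega> \<in> space M \<Longrightarrow> hc t (budget P lam t \<omega>) (factor P t \<omega>)
            = (ret P (Suc t))\<^sup>2 * Res t (hc (Suc t)) (budget P lam (Suc t) \<omega>) (factor P t \<omega>) (lam t \<omega>)"
    and opt: "\<And>t. t < T \<Longrightarrow> AE \<omega> in M. u t \<omega> = - ((ret P (Suc t) * shifted d \<mu> u t \<omega>) *\<^sub>R hedging lam t \<omega>)"
  show "AE \<omega> in M. ennreal (v \<omega>) = nn_cond_exp M (info0 P) (\<lambda>\<omega>. ennreal ((shifted d \<mu> u T \<omega>)\<^sup>2)) \<omega>"
  proof (rule i0.nn_cond_exp_charact)
    fix A assume A: "A \<in> sets (info0 P)"
    have "t \<le> T \<Longrightarrow> (\<integral>\<^sup>+\<omega>. indicator A \<omega> * ennreal (candidate d \<mu> lam u 0 \<omega>) \<partial>M)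
      = (\<integral>\<^sup>+\<omega>. indicator A \<omega> * ennreal (candidate d \<mu> lam u t \<omega>) \<partial>M)" for t
    proof (induction t)
      case (Suc t)
      from Suc have t: "t < T" "t \<le> T" by simp_all
      have us: "u s \<in> borel_measurable (info_plus P lam s)" if "s \<le> t" for s using u that t by simp
      show ?case
        by (rule trans[OF Suc.IH[OF t(2)] candidate_step(2)[OF lam t(1) us \<mu> A eq[OF t(1)] opt[OF t(1)]]])
    qed simp
    from this[OF order_refl]
    show "(\<integral>\<^sup>+\<omega>\<in>A. ennreal ((shifted d \<mu> u T \<omega>)\<^sup>2) \<partial>M) = (\<integral>\<^sup>+\<omega>\<in>A. ennreal (v \<omega>) \<partial>M)"
      unfolding v0 vT by (simp add: mult.commute)
  qed auto
qed

text \<open>The conditional expectations in the portfolio rule are determined only up to null sets.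
  Here they are identified with the explicit \<open>hedging\<close>, a function of budget, factor,
  attention and signal.\<close>

lemma weighted_moments:
  assumes lam: "admissible_attention P lam" and t: "t < T"
  shows "AE \<omega> in M. invertible (weighted_mat P lam t \<omega>)
    \<and> matrix_inv (weighted_mat P lam t \<omega>) *v weighted_vec P lam t \<omega> = hedging lam t \<omega>"
proof -
  interpret I: mv_information P t "info P lam t" "lam t" "factor P t" by (rule information[OF lam t])
  note info = information_signal[OF lam t]
  have g: "I.good (hc (Suc t))" by (rule good_hc[OF t])
  have lm: "lam s \<in> borel_measurable (info P lam s)" if "s < Suc t" for s
    using lam that t by (simp add: admissible_attention_def)
  have b: "budget P lam (Suc t) \<in> borel_measurable I.Gplus"
  proof -
    have [measurable]: "budget P lam t \<in> borel_measurable (info P lam t)" by (rule budget_info) (simp add: lm)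
    have [measurable]: "lam t \<in> borel_measurable (info P lam t)" using lm[of t] by simp
    have "budget P lam (Suc t) = (\<lambda>\<omega>. budget P lam t \<omega> - (\<Sum>j\<in>UNIV. lam t \<omega> $ j))" by (rule ext) simp
    then have "budget P lam (Suc t) \<in> borel_measurable (info P lam t)" by simp
    then show ?thesis by (rule I.measurable_G_Gplus)
  qed
  have nh: "next_h P lam t \<omega> = hc (Suc t) (budget P lam (Suc t) \<omega>) (I.fac (factor P t \<omega>) (I.Y \<omega>))" if "\<omega> \<in> space M" for \<omega>
  proof -
    have "0 \<le> budget P lam (Suc t) \<omega>" using budget_nonneg[OF lam that, of "Suc t"] t by simp
    moreover have "factor P (Suc t) \<omega> = I.fac (factor P t \<omega>) (I.Y \<omega>)" using I.next_factor_eq by simp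
    ultimately show ?thesis unfolding next_h_def clamped_h_def by (simp only: max_absorb1)
  qed
  have pay: "payoff P (Suc t) \<omega> = I.pay (factor P t \<omega>) (I.Y \<omega>)" for \<omega>
    using I.payoff_eq by (simp add: payoff_def)
  have wv: "weighted_vec P lam t = cond_vec M I.Gplus (\<lambda>\<omega>. hc (Suc t) (budget P lam (Suc t) \<omega>) (I.fac (factor P t \<omega>) (I.Y \<omega>)) *\<^sub>R I.pay (factor P t \<omega>) (I.Y \<omega>))"
    unfolding weighted_vec_def info(2) by (rule cond_vec_space_cong) (simp only: nh pay)
  have wm: "weighted_mat P lam t = cond_mat M I.Gplus (\<lambda>\<omega>. hc (Suc t) (budget P lam (Suc t) \<omega>) (I.fac (factor P t \<omega>) (I.Y \<omega>)) *\<^sub>R outer (I.pay (factor P t \<omega>) (I.Y \<omega>)))"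
    unfolding weighted_mat_def info(2) by (rule cond_mat_space_cong) (simp only: nh pay)
  have hd: "hedging lam t \<omega> = I.hedge (hc (Suc t)) (budget P lam (Suc t) \<omega>) (factor P t \<omega>) (lam t \<omega>) (I.score \<omega>)" for \<omega>
    by (simp add: hedging_def I.score_def info(1))
  show ?thesis
    using I.cond_vec_weighted[OF g b] I.cond_mat_weighted[OF g b]
  proof eventually_elim
    case (elim \<omega>)
    show ?case unfolding wv wm hd elim using I.weighted_hedge[OF g] by blast
  qed
qed

section \<open>Policies that follow the recursion\<close>

lemma follows_budget:
  assumes lstar: "attention_minimizer P lstar" and fol: "follows_attention P lstar lam" and \<omega>: "\<omega> \<in> space M"
  shows "t \<le> T \<Longrightarrow> budget P lam t \<omega> \<in> {0..Lambda0 P}"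
proof (induction t)
  case 0
  then show ?case using Lambda0_nonneg by simp
next
  case (Suc t)
  then have t: "t < T" and b: "budget P lam t \<omega> \<in> {0..Lambda0 P}" by auto
  have "lam t \<omega> \<in> attn_set (budget P lam t \<omega>)"
    using minimizer_attains(1)[OF lstar t b] fol t \<omega> by (simp add: follows_attention_def)
  moreover from this have "0 \<le> (\<Sum>j\<in>UNIV. lam t \<omega> $ j)"
    by (intro sum_nonneg) (simp add: attn_set_def nonneg_vecs_def)
  ultimately show ?case using b by (simp add: attn_set_def)
qed

text \<open>Attention and budget determine each other, so measurability is a strong induction over
  time. Membership in \<open>attn_set\<close> rests on the budget staying in the range where
  \<open>lstar\<close> minimizes.\<close>

lemma follows_admissible:
  assumes lstar: "attention_minimizer P lstar" and fol: "follows_attention P lstar lam"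
  shows "admissible_attention P lam"
proof -
  have m: "t < T \<Longrightarrow> lam t \<in> borel_measurable (info P lam t)" for t
  proof (induction t rule: less_induct)
    case (less t)
    have [measurable]: "budget P lam t \<in> borel_measurable (info P lam t)"
      by (rule budget_info) (use less in auto)
    note [measurable] = factor_info[of P t lam]
    have ls: "(\<lambda>(L, f). lstar t L f) \<in> borel_measurable borel"
      using lstar less.prems by (simp add: attention_minimizer_def)
    have "(\<lambda>\<omega>. (budget P lam t \<omega>, factor P t \<omega>)) \<in> borel_measurable (info P lam t)"
      by (intro borel_measurable_Pair) measurable
    from measurable_compose[OF this ls]
    have "(\<lambda>\<omega>. lstar t (budget P lam t \<omega>) (factor P t \<omega>)) \<in> borel_measurable (info P lam t)" by simp
    moreover have "lam t \<omega> = lstar t (budget P lam t \<omega>) (factor P t \<omega>)" if "\<omega> \<in> space (info P lam t)" for \<omega>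
      using fol less.prems that by (simp add: follows_attention_def)
    ultimately show ?case by (simp only: measurable_cong[of "info P lam t" "lam t"])
  qed
  show ?thesis
    unfolding admissible_attention_def
  proof (intro allI impI conjI ballI)
    fix t assume t: "t < T"
    then show "lam t \<in> borel_measurable (info P lam t)" by (rule m)
    fix \<omega> assume \<omega>: "\<omega> \<in> space M"
    show "lam t \<omega> \<in> attn_set (budget P lam t \<omega>)"
      using minimizer_attains(1)[OF lstar t follows_budget[OF lstar fol \<omega>, of t]] fol t \<omega>
      by (simp add: follows_attention_def)
  qed
qed

text \<open>The portfolio rule for an arbitrary multiplier: to identify the dual function, the
  auxiliary problem is solved at every measurable \<open>\<mu>\<close>, not only at
  \<open>mu_star\<close>.\<close>

definition follows_hedge :: "real \<Rightarrow> ('w \<Rightarrow> real) \<Rightarrow> (nat \<Rightarrow> 'w \<Rightarrow> real^'k) \<Rightarrow> (nat \<Rightarrow> 'w \<Rightarrow> real^'n) \<Rightarrow> bool" where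
  "follows_hedge d \<mu> lam u \<longleftrightarrow> (\<forall>t<T. \<forall>\<omega>\<in>space M.
     u t \<omega> = - ((ret P (Suc t) * shifted d \<mu> u t \<omega>) *\<^sub>R (matrix_inv (weighted_mat P lam t \<omega>) *v weighted_vec P lam t \<omega>)))"

lemma follows_portfolio_hedge: "follows_portfolio P d lam u \<longleftrightarrow> follows_hedge d (mu_star P d) lam u"
  by (simp add: follows_portfolio_def follows_hedge_def shifted_wealth_def)

lemma policy_exists: "\<exists>lam u. follows_attention P lstar lam \<and> follows_hedge d \<mu> lam u"
proof -
  \<comment> \<open>Budget and wealth are constructed by recursion first, as \<open>lam\<close> and
    \<open>u\<close> refer to them.\<close>
  define bud where "bud = rec_nat (\<lambda>_. Lambda0 P) (\<lambda>t b \<omega>. b \<omega> - (\<Sum>j\<in>UNIV. lstar t (b \<omega>) (factor P t \<omega>) $ j))"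
  define lam where "lam t \<omega> = lstar t (bud t \<omega>) (factor P t \<omega>)" for t \<omega>
  have bud: "budget P lam t \<omega> = bud t \<omega>" for t \<omega>
    by (induction t arbitrary: \<omega>) (simp_all add: bud_def lam_def)
  define U where "U t x \<omega> = - ((ret P (Suc t) * (x - (d - \<mu> \<omega>) / rho P t)) *\<^sub>R
     (matrix_inv (weighted_mat P lam t \<omega>) *v weighted_vec P lam t \<omega>))" for t x \<omega>
  define w where "w = rec_nat (\<lambda>_. x0 P) (\<lambda>t x \<omega>. ret P (Suc t) * x \<omega> + payoff P (Suc t) \<omega> \<bullet> U t (x \<omega>) \<omega>)"
  define u where "u t \<omega> = U t (w t \<omega>) \<omega>" for t \<omega>
  have w: "wealth P u t \<omega> = w t \<omega>" for t \<omega>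
    by (induction t arbitrary: \<omega>) (simp_all add: w_def u_def)
  have "follows_attention P lstar lam" by (simp add: follows_attention_def bud) (simp add: lam_def)
  moreover have "follows_hedge d \<mu> lam u"
    by (simp add: follows_hedge_def shifted_wealth_def w) (simp add: u_def U_def)
  ultimately show ?thesis by blast
qed

lemma follows_hedge_measurable:
  assumes fol: "follows_hedge d \<mu> lam u" and \<mu>: "\<mu> \<in> borel_measurable (info0 P)"
  shows "t < T \<Longrightarrow> u t \<in> borel_measurable (info_plus P lam t)"
proof (induction t rule: less_induct)
  case (less t)
  have "shifted d \<mu> u t \<in> borel_measurable (info P lam t)"
    using less by (intro shifted_info \<mu>) auto
  then have [measurable]: "shifted d \<mu> u t \<in> borel_measurable (info_plus P lam t)" by (rule info_info_plus_measurable)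
  have [measurable]: "weighted_mat P lam t \<in> borel_measurable (info_plus P lam t)"
    unfolding weighted_mat_def cond_mat_def by measurable
  have [measurable]: "weighted_vec P lam t \<in> borel_measurable (info_plus P lam t)"
    unfolding weighted_vec_def cond_vec_def by measurable
  have "(\<lambda>\<omega>. - ((ret P (Suc t) * shifted d \<mu> u t \<omega>) *\<^sub>R (matrix_inv (weighted_mat P lam t \<omega>) *v weighted_vec P lam t \<omega>)))
      \<in> borel_measurable (info_plus P lam t)" by measurable
  moreover have "u t \<omega> = - ((ret P (Suc t) * shifted d \<mu> u t \<omega>) *\<^sub>R (matrix_inv (weighted_mat P lam t \<omega>) *v weighted_vec P lam t \<omega>))"
    if "\<omega> \<in> space (info_plus P lam t)" for \<omega>
    using fol less.prems that unfolding follows_hedge_def by simp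
  ultimately show ?case by (simp only: measurable_cong[of "info_plus P lam t" "u t"])
qed

section \<open>Duality and the efficient frontier\<close>

abbreviation h0 where "h0 \<omega> \<equiv> hc 0 (Lambda0 P) (f0 P \<omega>)"

lemma h0_eq: "h0 \<omega> = h P 0 (Lambda0 P) (f0 P \<omega>)"
  unfolding clamped_h_def by (simp only: max_absorb1[OF Lambda0_nonneg])

lemma h0_measurable [measurable]: "h0 \<in> borel_measurable (info0 P)"
  by (rule h_measurable[of 0 "\<lambda>_. Lambda0 P" "info0 P" "f0 P", OF _ _ f0_info0]) auto

definition value_at :: "real \<Rightarrow> real \<Rightarrow> 'w \<Rightarrow> real" where
  "value_at d m \<omega> = h0 \<omega> * (x0 P - (d - m) / rho P 0)\<^sup>2 - m\<^sup>2"

lemma wealth_M: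
  assumes "(lam, u) \<in> admissible P" shows "wealth P u T \<in> borel_measurable M"
proof -
  have "admissible_attention P lam" "\<And>s. s < T \<Longrightarrow> u s \<in> borel_measurable (info_plus P lam s)"
    using assms by (auto simp: admissible_def)
  then show ?thesis
    using wealth_info[of T u lam] measurable_from_subalg[OF info_subalgebra(1)[of lam T]] by blast
qed

lemma shifted_T: "shifted d \<mu> u T \<omega> = wealth P u T \<omega> + (\<mu> \<omega> - d)"
  by (simp add: shifted_wealth_def rho_T)

lemma shifted_square:
  assumes adm: "(lam, u) \<in> admissible P" and \<mu>[measurable]: "\<mu> \<in> borel_measurable (info0 P)"
  shows "AE \<omega> in M. E0 P (\<lambda>\<omega>. (shifted d \<mu> u T \<omega>)\<^sup>2) \<omega>
      = E0 P (\<lambda>\<omega>. (wealth P u T \<omega>)\<^sup>2) \<omega> + 2 * (\<mu> \<omega> - d) * E0 P (wealth P u T) \<omega> + (\<mu> \<omega> - d)\<^sup>2"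
    "AE \<omega> in M. nn_cond_exp M (info0 P) (\<lambda>\<omega>. ennreal ((shifted d \<mu> u T \<omega>)\<^sup>2)) \<omega> < \<infinity>"
    "AE \<omega> in M. E0 P (\<lambda>\<omega>. (shifted d \<mu> u T \<omega>)\<^sup>2) \<omega> = enn2real (nn_cond_exp M (info0 P) (\<lambda>\<omega>. ennreal ((shifted d \<mu> u T \<omega>)\<^sup>2)) \<omega>)"
proof -
  note [measurable] = wealth_M[OF adm]
  have [measurable]: "\<mu> \<in> borel_measurable M" by (rule i0.measurable_F_M[OF \<mu>])
  have fin: "AE \<omega> in M. nn_cond_exp M (info0 P) (\<lambda>\<omega>. ennreal ((wealth P u T \<omega>)\<^sup>2)) \<omega> < \<infinity>"
    using adm by (simp add: admissible_def)
  show "AE \<omega> in M. E0 P (\<lambda>\<omega>. (shifted d \<mu> u T \<omega>)\<^sup>2) \<omega>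
      = E0 P (\<lambda>\<omega>. (wealth P u T \<omega>)\<^sup>2) \<omega> + 2 * (\<mu> \<omega> - d) * E0 P (wealth P u T) \<omega> + (\<mu> \<omega> - d)\<^sup>2"
    unfolding shifted_T E0_def by (rule i0.cond_square_shift[OF _ _ fin]) measurable
  show "AE \<omega> in M. nn_cond_exp M (info0 P) (\<lambda>\<omega>. ennreal ((shifted d \<mu> u T \<omega>)\<^sup>2)) \<omega> < \<infinity>"
    unfolding shifted_T by (rule i0.cond_second_moment_shift[OF _ _ fin]) measurable
  show "AE \<omega> in M. E0 P (\<lambda>\<omega>. (shifted d \<mu> u T \<omega>)\<^sup>2) \<omega> = enn2real (nn_cond_exp M (info0 P) (\<lambda>\<omega>. ennreal ((shifted d \<mu> u T \<omega>)\<^sup>2)) \<omega>)"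
    unfolding shifted_T E0_def by (rule i0.real_cond_exp_eq_enn2real) auto
qed

lemma aux_cost_lower:
  assumes adm: "(lam, u) \<in> admissible P" and \<mu>: "\<mu> \<in> borel_measurable (info0 P)"
  shows "AE \<omega> in M. value_at d (\<mu> \<omega>) \<omega> \<le> aux_cost P d \<mu> (lam, u) \<omega>"
proof -
  have lam: "admissible_attention P lam" and u: "\<And>s. s < T \<Longrightarrow> u s \<in> borel_measurable (info_plus P lam s)"
    using adm by (auto simp: admissible_def)
  have "AE \<omega> in M. ennreal (h0 \<omega> * (x0 P - (d - \<mu> \<omega>) / rho P 0)\<^sup>2)
      \<le> nn_cond_exp M (info0 P) (\<lambda>\<omega>. ennreal ((shifted d \<mu> u T \<omega>)\<^sup>2)) \<omega>"
    by (rule initial_value(1)[OF lam u \<mu>])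
  then show ?thesis
    using shifted_square(2,3)[OF adm \<mu>, of d]
  proof eventually_elim
    case (elim \<omega>)
    have "0 \<le> h0 \<omega> * (x0 P - (d - \<mu> \<omega>) / rho P 0)\<^sup>2" using h_positive[of 0 "Lambda0 P" "f0 P \<omega>"] by simp
    with enn2real_mono[OF elim(1)] elim(2)
    have "h0 \<omega> * (x0 P - (d - \<mu> \<omega>) / rho P 0)\<^sup>2 \<le> enn2real (nn_cond_exp M (info0 P) (\<lambda>\<omega>. ennreal ((shifted d \<mu> u T \<omega>)\<^sup>2)) \<omega>)"
      by simp
    then show ?case unfolding aux_cost_def value_at_def snd_conv elim(3)[symmetric] by simp
  qed
qed

lemma policy_optimal:
  assumes lstar: "attention_minimizer P lstar" and fol: "follows_attention P lstar lam" "follows_hedge d \<mu> lam u"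
    and \<mu>: "\<mu> \<in> borel_measurable (info0 P)"
  shows "(lam, u) \<in> admissible P" "AE \<omega> in M. aux_cost P d \<mu> (lam, u) \<omega> = value_at d (\<mu> \<omega>) \<omega>"
proof -
  have lam: "admissible_attention P lam" by (rule follows_admissible[OF lstar fol(1)])
  have u: "u s \<in> borel_measurable (info_plus P lam s)" if "s < T" for s
    by (rule follows_hedge_measurable[OF fol(2) \<mu> that])
  have eq: "hc t (budget P lam t \<omega>) (factor P t \<omega>)
            = (ret P (Suc t))\<^sup>2 * Res t (hc (Suc t)) (budget P lam (Suc t) \<omega>) (factor P t \<omega>) (lam t \<omega>)"
    if "t < T" "\<omega> \<in> space M" for t \<omega>
    using minimizer_attains(2)[OF lstar that(1) follows_budget[OF lstar fol(1) that(2)]] fol(1) that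
    by (simp add: follows_attention_def)
  have opt: "AE \<omega> in M. u t \<omega> = - ((ret P (Suc t) * shifted d \<mu> u t \<omega>) *\<^sub>R hedging lam t \<omega>)" if t: "t < T" for t
    using weighted_moments[OF lam t] AE_space
    by eventually_elim (use fol(2) t in \<open>simp add: follows_hedge_def\<close>)
  have val: "AE \<omega> in M. ennreal (h0 \<omega> * (x0 P - (d - \<mu> \<omega>) / rho P 0)\<^sup>2) = nn_cond_exp M (info0 P) (\<lambda>\<omega>. ennreal ((shifted d \<mu> u T \<omega>)\<^sup>2)) \<omega>"
    by (rule initial_value(2)[OF lam u \<mu> eq opt])
  have ym: "shifted d \<mu> u T \<in> borel_measurable M"
    using shifted_info[of T u lam \<mu> d] u \<mu> measurable_from_subalg[OF info_subalgebra(1)[OF lam order_refl]] by blast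
  \<comment> \<open>Admissibility comes out of the value: the conditional second moment of shifted
    wealth equals a real number, and undoing the shift keeps it finite.\<close>
  have fin: "AE \<omega> in M. nn_cond_exp M (info0 P) (\<lambda>\<omega>. ennreal ((shifted d \<mu> u T \<omega>)\<^sup>2)) \<omega> < \<infinity>"
    using val by eventually_elim (metis ennreal_less_top infinity_ennreal_def)
  have c: "(\<lambda>\<omega>. d - \<mu> \<omega>) \<in> borel_measurable (info0 P)" using \<mu> by simp
  have "AE \<omega> in M. nn_cond_exp M (info0 P) (\<lambda>\<omega>. ennreal ((wealth P u T \<omega>)\<^sup>2)) \<omega> < \<infinity>"
    using i0.cond_second_moment_shift[OF ym c fin] by (simp add: shifted_T)
  with lam u show adm: "(lam, u) \<in> admissible P" by (simp add: admissible_def)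
  show "AE \<omega> in M. aux_cost P d \<mu> (lam, u) \<omega> = value_at d (\<mu> \<omega>) \<omega>"
    using val shifted_square(3)[OF adm \<mu>, of d]
  proof eventually_elim
    case (elim \<omega>)
    have "0 \<le> h0 \<omega> * (x0 P - (d - \<mu> \<omega>) / rho P 0)\<^sup>2" using h_positive[of 0 "Lambda0 P" "f0 P \<omega>"] by simp
    then show ?case unfolding aux_cost_def value_at_def snd_conv elim(2) elim(1)[symmetric] by simp
  qed
qed

definition frontier :: "real \<Rightarrow> 'w \<Rightarrow> real" where
  "frontier d \<omega> = h P 0 (Lambda0 P) (f0 P \<omega>) * (d - rho P 0 * x0 P)\<^sup>2
     / ((rho P 0)\<^sup>2 - h P 0 (Lambda0 P) (f0 P \<omega>))"

lemma mu_star_measurable [measurable]: "mu_star P d \<in> borel_measurable (info0 P)"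
  unfolding mu_star_def[abs_def] h0_eq[symmetric] by measurable

lemma frontier_measurable [measurable]: "frontier d \<in> borel_measurable (info0 P)"
  unfolding frontier_def[abs_def] h0_eq[symmetric] by measurable

lemma value_at_square:
  assumes h0: "h0 \<omega> < (rho P 0)\<^sup>2"
  shows "value_at d m \<omega> = frontier d \<omega> - (1 - h0 \<omega> / (rho P 0)\<^sup>2) * (m - mu_star P d \<omega>)\<^sup>2"
proof -
  define r e k where "r = rho P 0" and "e = r * x0 P - d" and "k = h0 \<omega> / r\<^sup>2"
  have r: "0 < r" using rho_pos[of 0] by (simp add: r_def)
  have k: "k < 1" using h0 r by (simp add: k_def r_def)
  have h: "h0 \<omega> = k * r\<^sup>2" using r by (simp add: k_def)
  have "x0 P - (d - m) / r = (e + m) / r" using r by (simp add: e_def field_simps)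
  then have "value_at d m \<omega> = k * (e + m)\<^sup>2 - m\<^sup>2"
    unfolding value_at_def r_def[symmetric] h using r by (simp add: power_divide)
  also have "\<dots> = k * e\<^sup>2 / (1 - k) - (1 - k) * (m - k * e / (1 - k))\<^sup>2"
    by (rule concave_quadratic[OF k])
  also have "k * e\<^sup>2 / (1 - k) = frontier d \<omega>"
  proof -
    have "r\<^sup>2 - k * r\<^sup>2 = r\<^sup>2 * (1 - k)" by (simp add: algebra_simps)
    then show ?thesis
      unfolding frontier_def h0_eq[symmetric] r_def[symmetric] h using r
      by (simp add: e_def power2_commute)
  qed
  also have "k * e / (1 - k) = mu_star P d \<omega>"
  proof -
    have "r\<^sup>2 - k * r\<^sup>2 = r\<^sup>2 * (1 - k)" by (simp add: algebra_simps)
    then show ?thesis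
      unfolding mu_star_def h0_eq[symmetric] r_def[symmetric] h using r by (simp add: e_def)
  qed
  finally show ?thesis by (simp only: k_def r_def)
qed

lemma h0_less: "AE \<omega> in M. h0 \<omega> < (rho P 0)\<^sup>2"
  using h0_strict by (simp only: h0_eq)

text \<open>The witness \<open>value_at d\<close> is explicit in \<open>m\<close>, so for strict
  maximality a single null set, off which \<open>h0\<close> is below
  \<open>(rho P 0)\<^sup>2\<close>, serves all multipliers.\<close>

lemma optimal_multiplier_mu_star: "optimal_multiplier P d (mu_star P d)"
  unfolding optimal_multiplier_def
proof (intro conjI exI[of _ "value_at d"] ballI)
  show "mu_star P d \<in> borel_measurable (info0 P)" by measurable
  have [measurable]: "(\<lambda>x. h0 (snd x)) \<in> borel_measurable (borel \<Otimes>\<^sub>M info0 P)"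
    by (rule measurable_compose[OF measurable_snd h0_measurable])
  show "(\<lambda>(m, \<omega>). value_at d m \<omega>) \<in> borel_measurable (borel \<Otimes>\<^sub>M info0 P)"
    unfolding value_at_def split_beta by measurable
  show "AE \<omega> in M. \<forall>m. m \<noteq> mu_star P d \<omega> \<longrightarrow> value_at d m \<omega> < value_at d (mu_star P d \<omega>) \<omega>"
    using h0_less
  proof eventually_elim
    case (elim \<omega>)
    have "0 < (rho P 0)\<^sup>2" using rho_pos[of 0] by simp
    with elim have "0 < 1 - h0 \<omega> / (rho P 0)\<^sup>2" by simp
    then show ?case unfolding value_at_square[OF elim] by simp
  qed
  fix \<mu> :: "'w \<Rightarrow> real" assume \<mu>: "\<mu> \<in> borel_measurable (info0 P)"
  obtain lstar where lstar: "attention_minimizer P lstar" using minimizer_exists by blast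
  obtain lam u where fol: "follows_attention P lstar lam" "follows_hedge d \<mu> lam u"
    using policy_exists by blast
  show "is_cond_min P (admissible P) (aux_cost P d \<mu>) (\<lambda>\<omega>. value_at d (\<mu> \<omega>) \<omega>)"
    unfolding is_cond_min_def
  proof (intro conjI ballI bexI)
    note [measurable] = \<mu>
    show "(\<lambda>\<omega>. value_at d (\<mu> \<omega>) \<omega>) \<in> borel_measurable (info0 P)" unfolding value_at_def by measurable
    show "AE \<omega> in M. aux_cost P d \<mu> (lam, u) \<omega> = value_at d (\<mu> \<omega>) \<omega>" "(lam, u) \<in> admissible P"
      by (rule policy_optimal[OF lstar fol \<mu>])+
    fix p assume "p \<in> admissible P"
    then show "AE \<omega> in M. value_at d (\<mu> \<omega>) \<omega> \<le> aux_cost P d \<mu> p \<omega>"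
      using aux_cost_lower[of "fst p" "snd p" \<mu> d] \<mu> by simp
  qed
qed

text \<open>For a fixed policy the auxiliary cost is affine in the multiplier, with slope twice the
  violation of the target.\<close>

lemma aux_cost_expand:
  assumes adm: "(lam, u) \<in> admissible P" and \<mu>: "\<mu> \<in> borel_measurable (info0 P)"
  shows "AE \<omega> in M. aux_cost P d \<mu> (lam, u) \<omega> = E0 P (\<lambda>\<omega>. (wealth P u T \<omega>)\<^sup>2) \<omega>
     + 2 * \<mu> \<omega> * (E0 P (wealth P u T) \<omega> - d) - 2 * d * E0 P (wealth P u T) \<omega> + d\<^sup>2"
  using shifted_square(1)[OF adm \<mu>, of d]
  by eventually_elim (simp add: aux_cost_def power2_diff, simp add: algebra_simps)

text \<open>On feasible policies that slope vanishes, and what remains is the variance.\<close>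

lemma mv_cost_aux_cost:
  assumes feas: "(lam, u) \<in> mv_feasible P d" and \<mu>: "\<mu> \<in> borel_measurable (info0 P)"
  shows "AE \<omega> in M. mv_cost P (lam, u) \<omega> = aux_cost P d \<mu> (lam, u) \<omega>"
proof -
  have adm: "(lam, u) \<in> admissible P" and mean: "AE \<omega> in M. E0 P (wealth P u T) \<omega> = d"
    using feas by (auto simp: mv_feasible_def)
  note [measurable] = wealth_M[OF adm]
  have "AE \<omega> in M. mv_cost P (lam, u) \<omega> = E0 P (\<lambda>\<omega>. (wealth P u T \<omega> - d)\<^sup>2) \<omega>"
    unfolding mv_cost_def Var0_def snd_conv E0_def
    by (rule i0.real_cond_exp_cong) (use mean[unfolded E0_def] in auto)
  then show ?thesis
    using shifted_square(1)[OF adm borel_measurable_const[of "0::real"], of d] aux_cost_expand[OF adm \<mu>, of d] mean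
  proof eventually_elim
    case (elim \<omega>)
    have "E0 P (\<lambda>\<omega>. (wealth P u T \<omega> - d)\<^sup>2) \<omega> = E0 P (\<lambda>\<omega>. (wealth P u T \<omega>)\<^sup>2) \<omega> - d\<^sup>2"
      using elim(2,4) by (simp add: shifted_T power2_eq_square)
    then show ?case using elim(1,3,4) by (simp add: power2_eq_square)
  qed
qed

text \<open>Weak duality at \<open>mu_star\<close>, where the square in
  \<open>value_at_square\<close> vanishes.\<close>

lemma frontier_le_cost:
  assumes "(lam, u) \<in> mv_feasible P d"
  shows "AE \<omega> in M. frontier d \<omega> \<le> mv_cost P (lam, u) \<omega>"
proof -
  have "(lam, u) \<in> admissible P" using assms by (simp add: mv_feasible_def)
  from mv_cost_aux_cost[OF assms mu_star_measurable[of d]] aux_cost_lower[OF this mu_star_measurable[of d], of d] h0_less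
  show ?thesis by eventually_elim (simp add: value_at_square)
qed

text \<open>The dual function is differentiable at its maximizer and its derivative there is twice the
  constraint violation, so a minimizer of the auxiliary problem at \<open>\<mu>\<^sup>\<star>\<close> hits the target.\<close>

lemma optimal_policy_mean:
  assumes adm: "(lam, u) \<in> admissible P"
    and cost: "AE \<omega> in M. aux_cost P d (mu_star P d) (lam, u) \<omega> = value_at d (mu_star P d \<omega>) \<omega>"
  shows "AE \<omega> in M. E0 P (wealth P u T) \<omega> = d"
proof -
  \<comment> \<open>A sequence of perturbations of \<open>mu_star\<close>: the lower bound at each
    multiplier has its own null set, and only countably many can be united.\<close>
  define \<delta> where "\<delta> n = inverse (real (Suc n))" for n
  let ?up = "\<lambda>n \<omega>. mu_star P d \<omega> + \<delta> n" and ?dn = "\<lambda>n \<omega>. mu_star P d \<omega> - \<delta> n"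
  have up: "?up n \<in> borel_measurable (info0 P)" and dn: "?dn n \<in> borel_measurable (info0 P)" for n by measurable
  have "AE \<omega> in M. \<forall>n. value_at d (?up n \<omega>) \<omega> \<le> aux_cost P d (?up n) (lam, u) \<omega>
       \<and> value_at d (?dn n \<omega>) \<omega> \<le> aux_cost P d (?dn n) (lam, u) \<omega>"
    by (intro AE_all_countable[THEN iffD2] allI AE_conjI aux_cost_lower adm up dn)
  moreover have "AE \<omega> in M. \<forall>n. aux_cost P d (?up n) (lam, u) \<omega> = E0 P (\<lambda>\<omega>. (wealth P u T \<omega>)\<^sup>2) \<omega>
         + 2 * ?up n \<omega> * (E0 P (wealth P u T) \<omega> - d) - 2 * d * E0 P (wealth P u T) \<omega> + d\<^sup>2
       \<and> aux_cost P d (?dn n) (lam, u) \<omega> = E0 P (\<lambda>\<omega>. (wealth P u T \<omega>)\<^sup>2) \<omega>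
         + 2 * ?dn n \<omega> * (E0 P (wealth P u T) \<omega> - d) - 2 * d * E0 P (wealth P u T) \<omega> + d\<^sup>2"
    by (intro AE_all_countable[THEN iffD2] allI AE_conjI aux_cost_expand adm up dn)
  ultimately show ?thesis
    using aux_cost_expand[OF adm mu_star_measurable[of d], of d] cost h0_less
  proof eventually_elim
    case (elim \<omega>)
    define m where "m = E0 P (wealth P u T) \<omega>"
    let ?c = "1 - h0 \<omega> / (rho P 0)\<^sup>2"
    have c: "?c \<le> 1" using h_positive[of 0 "Lambda0 P" "f0 P \<omega>"] by simp
    \<comment> \<open>At \<open>mu_star\<close> the affine cost touches the concave value. At
      distance \<open>\<delta> n\<close> the value is lower by
      \<open>?c * (\<delta> n)\<^sup>2\<close> with \<open>?c \<le> 1\<close>, while the cost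
      changes by \<open>2 * \<delta> n * (m - d)\<close> with either sign; staying above the value
      bounds the slope.\<close>
    have bound: "\<bar>m - d\<bar> \<le> \<delta> n" for n
    proof -
      have \<delta>: "0 < \<delta> n" by (simp add: \<delta>_def)
      have "- (?c * (\<delta> n)\<^sup>2) \<le> 2 * \<delta> n * (m - d)" "- (?c * (\<delta> n)\<^sup>2) \<le> - (2 * \<delta> n * (m - d))"
        using elim(1)[rule_format, of n] elim(2)[rule_format, of n] elim(3,4)
        unfolding value_at_square[OF elim(5)] m_def[symmetric] by (simp_all add: algebra_simps)
      moreover have "?c * (\<delta> n)\<^sup>2 \<le> (\<delta> n)\<^sup>2" using mult_right_mono[OF c, of "(\<delta> n)\<^sup>2"] by simp
      ultimately have "2 * \<delta> n * \<bar>m - d\<bar> \<le> \<delta> n * \<delta> n"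
        by (simp add: abs_if power2_eq_square algebra_simps)
      then have "\<delta> n * (2 * \<bar>m - d\<bar>) \<le> \<delta> n * \<delta> n" by (simp add: mult_ac)
      then have "2 * \<bar>m - d\<bar> \<le> \<delta> n" using \<delta> by simp
      then show ?thesis using \<delta> by simp
    qed
    have "\<bar>m - d\<bar> \<le> 0"
    proof (rule LIMSEQ_le_const)
      show "\<delta> \<longlonglongrightarrow> 0" unfolding \<delta>_def by (rule LIMSEQ_inverse_real_of_nat)
    qed (use bound in blast)
    then show ?case by (simp add: m_def)
  qed
qed

lemma policy_attains_frontier:
  assumes lstar: "attention_minimizer P lstar"
    and fol: "follows_attention P lstar lam" "follows_portfolio P d lam u"
  shows "(lam, u) \<in> mv_feasible P d" "AE \<omega> in M. mv_cost P (lam, u) \<omega> = frontier d \<omega>"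
proof -
  note opt = policy_optimal[OF lstar fol(1) fol(2)[unfolded follows_portfolio_hedge] mu_star_measurable]
  show feas: "(lam, u) \<in> mv_feasible P d"
    using opt(1) optimal_policy_mean[OF opt] by (simp add: mv_feasible_def)
  show "AE \<omega> in M. mv_cost P (lam, u) \<omega> = frontier d \<omega>"
    using opt(2) mv_cost_aux_cost[OF feas mu_star_measurable[of d]] h0_less
    by eventually_elim (simp add: value_at_square)
qed

lemma policy_mv_optimal:
  assumes lstar: "attention_minimizer P lstar"
    and fol: "follows_attention P lstar lam" "follows_portfolio P d lam u"
  shows "mv_optimal P d (lam, u)"
  unfolding mv_optimal_def
proof (intro conjI ballI policy_attains_frontier(1)[OF assms])
  fix q assume "q \<in> mv_feasible P d"
  then have "AE \<omega> in M. frontier d \<omega> \<le> mv_cost P q \<omega>" using frontier_le_cost[of "fst q" "snd q" d] by simp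
  with policy_attains_frontier(2)[OF assms] show "AE \<omega> in M. mv_cost P (lam, u) \<omega> \<le> mv_cost P q \<omega>"
    by eventually_elim simp
qed

lemma frontier_minimum: "is_cond_min P (mv_feasible P d) (mv_cost P) (frontier d)"
proof -
  obtain lstar where lstar: "attention_minimizer P lstar" using minimizer_exists by blast
  obtain lam u where fol: "follows_attention P lstar lam" "follows_portfolio P d lam u"
    using policy_exists unfolding follows_portfolio_hedge by blast
  show ?thesis
    unfolding is_cond_min_def
  proof (intro conjI ballI bexI)
    show "AE \<omega> in M. mv_cost P (lam, u) \<omega> = frontier d \<omega>" "(lam, u) \<in> mv_feasible P d"
      by (rule policy_attains_frontier[OF lstar fol])+
    fix q assume "q \<in> mv_feasible P d"
    then show "AE \<omega> in M. frontier d \<omega> \<le> mv_cost P q \<omega>" using frontier_le_cost[of "fst q" "snd q" d] by simp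
  qed measurable
qed

text \<open>Conditional expectations given \<open>info_plus\<close> may depend on the whole history.
  By \<open>weighted_moments\<close> they reduce almost surely to \<open>Hedge\<close>, which is
  continuous in its arguments, so with the Borel rule \<open>lstar\<close> inserted a Borel function
  of current state and signal remains.\<close>

lemma portfolio_feedback:
  assumes lstar: "attention_minimizer P lstar"
    and fol: "follows_attention P lstar lam" "follows_portfolio P d lam u" and t: "t < T"
  shows "\<exists>U :: real \<times> (real ^ 'k) \<times> (real ^ 'k) \<Rightarrow> real ^ 'n. U \<in> borel_measurable borel \<and>
     (AE \<omega> in M. u t \<omega> = (wealth P u t \<omega> - (d - mu_star P d \<omega>) / rho P t) *\<^sub>R
        U (budget P lam t \<omega>, factor P t \<omega>, signal P lam t \<omega>))"
proof -
  interpret I: mv_period P t by (rule period[OF t])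
  define U where "U = (\<lambda>(L, f, s). - (ret P (Suc t) *\<^sub>R Hedge t (hc (Suc t)) (L - (\<Sum>j\<in>UNIV. lstar t L f $ j)) f (lstar t L f)
      (\<chi> j. prec (lstar t L f) $ j * s $ j)))"
  have ls: "(\<lambda>(L, f). lstar t L f) \<in> borel_measurable borel"
    using lstar t by (simp add: attention_minimizer_def)
  have "(\<lambda>x :: real \<times> (real ^ 'k) \<times> (real ^ 'k). (fst x, fst (snd x))) \<in> borel_measurable borel"
    by (intro borel_measurable_continuous_onI continuous_intros)
  from measurable_compose[OF this ls]
  have [measurable]: "(\<lambda>x :: real \<times> (real ^ 'k) \<times> (real ^ 'k). lstar t (fst x) (fst (snd x))) \<in> borel_measurable borel"
    by simp
  have [measurable]: "(\<lambda>x :: real \<times> (real ^ 'k) \<times> (real ^ 'k). fst x) \<in> borel_measurable borel"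
    "(\<lambda>x :: real \<times> (real ^ 'k) \<times> (real ^ 'k). fst (snd x)) \<in> borel_measurable borel"
    "(\<lambda>x :: real \<times> (real ^ 'k) \<times> (real ^ 'k). snd (snd x)) \<in> borel_measurable borel"
    by (intro borel_measurable_continuous_onI continuous_intros)+
  have "U \<in> borel_measurable borel"
    unfolding U_def split_beta
    by (intro borel_measurable_uminus borel_measurable_scaleR borel_measurable_const
        measurable_continuous4[of "Hedge t (hc (Suc t))"] I.continuous_on_hedge good_hc[OF t] continuous_intros) measurable
  moreover have "AE \<omega> in M. u t \<omega> = (wealth P u t \<omega> - (d - mu_star P d \<omega>) / rho P t) *\<^sub>R
        U (budget P lam t \<omega>, factor P t \<omega>, signal P lam t \<omega>)"
    using weighted_moments[OF follows_admissible[OF lstar fol(1)] t] AE_space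
  proof eventually_elim
    case (elim \<omega>)
    have lam: "lstar t (budget P lam t \<omega>) (factor P t \<omega>) = lam t \<omega>"
      using fol(1) t elim(2) by (simp add: follows_attention_def)
    have "U (budget P lam t \<omega>, factor P t \<omega>, signal P lam t \<omega>) = - (ret P (Suc t) *\<^sub>R hedging lam t \<omega>)"
      by (simp add: U_def hedging_def lam)
    moreover have "u t \<omega> = - ((ret P (Suc t) * (wealth P u t \<omega> - (d - mu_star P d \<omega>) / rho P t)) *\<^sub>R hedging lam t \<omega>)"
      using fol(2) t elim by (simp add: follows_portfolio_def)
    ultimately show ?case by (simp add: mult.commute)
  qed
  ultimately show ?thesis by blast
qed

end

theorem theorem4p1:
  fixes P :: "('w, 'n::finite, 'k::finite) market" and d :: real
  assumes market: "mv_market P"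
    and target: "rho P 0 * x0 P \<le> d"
    and cov_pos_def: "\<And>lam t. admissible_attention P lam \<Longrightarrow> t < horizon P \<Longrightarrow>
      AE \<omega> in pspace P.
        pos_def_matrix (cond_cov (pspace P) (info_plus P lam t) (payoff P (Suc t)) \<omega>)"
    and mean_nonzero: "\<And>lam. admissible_attention P lam \<Longrightarrow>
      AE \<omega> in pspace P.
        cond_vec (pspace P) (info_plus P lam (horizon P - 1)) (payoff P (horizon P)) \<omega> \<noteq> 0"
  shows
    \<comment> \<open>the inverses, the minima and the quotients below are well defined\<close>
    "(\<forall>t<horizon P. \<forall>L\<in>{0..Lambda0 P}. \<forall>f. \<forall>l\<in>attn_set L.
        AE \<omega> in pspace P. invertible (step_mat P t (h P (Suc t)) L f l \<omega>))
     \<and> (\<exists>lstar. attention_minimizer P lstar)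
     \<and> (AE \<omega> in pspace P. h P 0 (Lambda0 P) (f0 P \<omega>) < (rho P 0)\<^sup>2)
     \<and>
     \<comment> \<open>(i) and (ii)\<close>
     (\<forall>lstar. attention_minimizer P lstar \<longrightarrow>
        (\<exists>lam u. follows_attention P lstar lam \<and> follows_portfolio P d lam u) \<and>
        (\<forall>lam u. follows_attention P lstar lam \<and> follows_portfolio P d lam u \<longrightarrow>
           mv_optimal P d (lam, u) \<and>
           (\<forall>t<horizon P.
              (AE \<omega> in pspace P. invertible (weighted_mat P lam t \<omega>)) \<and>
              (\<exists>U :: real \<times> (real ^ 'k) \<times> (real ^ 'k) \<Rightarrow> real ^ 'n. U \<in> borel_measurable borel \<and>
                 (AE \<omega> in pspace P. u t \<omega> =
                    (wealth P u t \<omega> - (d - mu_star P d \<omega>) / rho P t) *\<^sub>R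
                      U (budget P lam t \<omega>, factor P t \<omega>, signal P lam t \<omega>))))))
     \<and> optimal_multiplier P d (mu_star P d)
     \<and>
     \<comment> \<open>(iii)\<close>
     (\<forall>e\<ge>rho P 0 * x0 P. is_cond_min P (mv_feasible P e) (mv_cost P)
        (\<lambda>\<omega>. h P 0 (Lambda0 P) (f0 P \<omega>) * (e - rho P 0 * x0 P)\<^sup>2
              / ((rho P 0)\<^sup>2 - h P 0 (Lambda0 P) (f0 P \<omega>))))"
proof -
  interpret B: mv_base P by unfold_locales (rule market)
  interpret mv_problem P
    using cov_pos_def[OF B.admissible_no_attention] mean_nonzero[OF B.admissible_no_attention]
    by unfold_locales
  show ?thesis
  proof (intro conjI allI impI ballI)
    fix t :: nat and L and f l :: "real^'k" assume t: "t < horizon P" and l: "l \<in> attn_set L"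
    show "AE \<omega> in pspace P. invertible (step_mat P t (h P (Suc t)) L f l \<omega>)"
      using t by (intro step_objective_residual(2)[OF t h_regular l]) simp
  next
    show "\<exists>lstar. attention_minimizer P lstar" by (rule minimizer_exists)
    show "AE \<omega> in pspace P. h P 0 (Lambda0 P) (f0 P \<omega>) < (rho P 0)\<^sup>2" by (rule h0_strict)
    show "optimal_multiplier P d (mu_star P d)" by (rule optimal_multiplier_mu_star)
  next
    fix lstar :: "nat \<Rightarrow> real \<Rightarrow> real^'k \<Rightarrow> real^'k" assume "attention_minimizer P lstar"
    show "\<exists>lam u. follows_attention P lstar lam \<and> follows_portfolio P d lam u"
      unfolding follows_portfolio_hedge by (rule policy_exists)
  next
    fix lstar lam and u :: "nat \<Rightarrow> 'w \<Rightarrow> real^'n" and t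
    assume lstar: "attention_minimizer P lstar"
      and "follows_attention P lstar lam \<and> follows_portfolio P d lam u"
    then have fol: "follows_attention P lstar lam" "follows_portfolio P d lam u" by simp_all
    show "mv_optimal P d (lam, u)" by (rule policy_mv_optimal[OF lstar fol])
    assume t: "t < horizon P"
    show "AE \<omega> in pspace P. invertible (weighted_mat P lam t \<omega>)"
      using weighted_moments[OF follows_admissible[OF lstar fol(1)] t] by eventually_elim simp
    show "\<exists>U :: real \<times> (real ^ 'k) \<times> (real ^ 'k) \<Rightarrow> real ^ 'n. U \<in> borel_measurable borel \<and>
       (AE \<omega> in pspace P. u t \<omega> = (wealth P u t \<omega> - (d - mu_star P d \<omega>) / rho P t) *\<^sub>R
          U (budget P lam t \<omega>, factor P t \<omega>, signal P lam t \<omega>))"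
      by (rule portfolio_feedback[OF lstar fol t])
  next
    fix e :: real assume "rho P 0 * x0 P \<le> e"
    show "is_cond_min P (mv_feasible P e) (mv_cost P) (\<lambda>\<omega>. h P 0 (Lambda0 P) (f0 P \<omega>) * (e - rho P 0 * x0 P)\<^sup>2
              / ((rho P 0)\<^sup>2 - h P 0 (Lambda0 P) (f0 P \<omega>)))"
      using frontier_minimum[of e] by (simp only: frontier_def[abs_def])
  qed
qed

end
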